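(* Let $U^{\tau}(\mathcal G)$ be the subalgebra of $wU_q^{\tau}(\mathcal G)$ generated by $K_i,\bar K_i,D_i,\bar D_i,E_i,F_i$ ($i\in I$) and $J^{m-1}$. Then $U^{\tau}(\mathcal G)$ is a noncommutative and noncocommutative weak Hopf algebra with the weak antipode $T$, but not a Hopf algebra. Moreover, $U^{\tau}(\mathcal G)J^{m-1}$ is isomorphic to $U_q'(\mathcal G)$ as Hopf algebras.
   Context: **Cartan datum.** $I=\{1,\dots,n\}$ or $I$ is the set of positive integers. $A=(a_{ij})_{i,j\in I}$ is a Borcherds-Cartan matrix: $a_{ij}\in\mathbf Z$; $a_{ii}=2$ or $a_{ii}\le0$; $a_{ij}\le0$ for $i\ne j$; $a_{ij}=0$ if and only if $a_{ji}=0$. It is symmetrizable: there is $D=\mathrm{diag}\{s_i>0\mid i\in I\}$ with $DA$ symmetric. $\mathcal G$ is the associated generalized Kac-Moody algebra. $\mathbf K$ is a field of characteristic $0$, $q\in\mathbf K$, $q_i=q^{s_i}$, and $q_i\ne\pm1,0$ for all $i\in I$. Put $[k]_\nu=\frac{\nu^k-\nu^{-k}}{\nu-\nu^{-1}}$, $[k]!_\nu=[k]_\nu\cdots[1]_\nu$, $[0]!_\nu=1$, $\left[{k\atop r}\right]_\nu=\frac{[k]!_\nu}{[r]!_\nu[k-r]!_\nu}$, and let $\left[{k\atop r}\right]_i$ be its value at $\nu=q_i$. **The algebra $wU_q^\tau(\mathcal G)$.** Fix a positive integer $m$ and $\tau=(\{\kappa_i\}_{i\in I}\,|\,\{\kappa_i'\}_{i\in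 I})$, where $\kappa_i,\kappa_i'\in\{0,1\}$ are the types (zero or one) of $E_i$ and $F_i$ respectively. $wU_q^\tau(\mathcal G)$ is the associative $\mathbf K$-algebra with unit $1$ generated by $J$, $E_i,F_i,K_i,\bar K_i,D_i,\bar D_i$ ($i\in I$) with the following defining relations, for all $i,j\in I$: - $1\ne J^{m-1}=K_i\bar K_i=D_i\bar D_i$ (so $m\ge2$), $J^m=J$; - $J,K_i,\bar K_i,D_i,\bar D_i$ ($i\in I$) commute pairwise, and $XJ^{m-1}=X$ for $X=K_i,\bar K_i,D_i,\bar D_i$; - $E_i,F_i$ are of type $\tau$, that is: if $E_i$ is of type one, $K_jE_i=q_i^{a_{ij}}E_iK_j$ and $\bar K_jE_i=q_i^{-a_{ij}}E_i\bar K_j$; if $E_i$ is of type zero, $K_jE_i\bar K_j=q_i^{a_{ij}}E_i$; if $F_i$ is of type one, $K_jF_i=q_i^{-a_{ij}}F_iK_j$ and $\bar K_jF_i=q_i^{a_{ij}}F_i\bar K_j$; if $F_i$ is of type zero, $K_jF_i\bar K_j=q_i^{-a_{ij}}F_i$; - $E_iF_j-F_jE_i=\delta_{ij}\frac{K_i-\bar K_i}{q_i-q_i^{-1}}$; - $\sum_{r=0}^{1-a_{ij}}(-1)^r\left[{1-a_{ij}\atop r}\right]_iX_i^{1-a_{ij}-r}X_jX_i^r=0$ for $X=E$ and for $X=F$, if $a_{ii}=2$, $i\ne j$; - $E_iE_j-E_jE_i=F_iF_j-F_jF_i=0$ if $a_{ij}=0$. **Bialgebra structure.** $wU_q^\tau(\mathcal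 G)$ is taken with the comultiplication $\Delta$ and counit $\varepsilon$, algebra morphisms given by $\Delta(X)=X\otimes X$, $\varepsilon(X)=1$ for $X=J,K_i,\bar K_i,D_i,\bar D_i$; $\varepsilon(E_i)=\varepsilon(F_i)=0$; $\Delta(E_i)=1\otimes E_i+E_i\otimes K_i$ if $E_i$ is of type one, $\Delta(E_i)=J^{m-1}\otimes E_i+E_i\otimes K_i$ if $E_i$ is of type zero; $\Delta(F_i)=F_i\otimes1+\bar K_i\otimes F_i$ if $F_i$ is of type one, $\Delta(F_i)=F_i\otimes J^{m-1}+\bar K_i\otimes F_i$ if $F_i$ is of type zero. $U^\tau(\mathcal G)$ is a sub-bialgebra. **The map $T$.** $T:wU_q^\tau(\mathcal G)\to wU_q^\tau(\mathcal G)$ is given on generators by $T(1)=1$, $T(J)=J$, $T(K_i)=\bar K_i$, $T(\bar K_i)=K_i$, $T(D_i)=\bar D_i$, $T(\bar D_i)=D_i$, $T(E_i)=-E_i\bar K_i$, $T(F_i)=-K_iF_i$, and extended as an anti-automorphism. **Weak Hopf algebra.** A bialgebra $H$ is called a weak Hopf algebra if there is an anti-automorphism $T$ of $H$ such that $\mathrm{id}_H*T*\mathrm{id}_H=\mathrm{id}_H$ and $T*\mathrm{id}_H*T=T$, where $*$ is the convolution product; such a $T$ is called a weak antipode. **$U_q(\mathcal G)$ and $U_q'(\mathcal G)$.** Let $P^\vee=(\oplus_{i\in I}\mathbf Zh_i)\oplus(\oplus_{i\in I}\mathbf Zd_i)$ be the free abelian group on $\{h_i,d_i\}$, and let $\alpha_i$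 be the linear functionals with $\alpha_i(h_j)=a_{ji}$, $\alpha_i(d_j)=\delta_{ij}$. $U_q(\mathcal G)$ is the associative $\mathbf K$-algebra with $1$ generated by $e_i,f_i$ ($i\in I$) and $q^h$ ($h\in P^\vee$) with relations $q^0=1$, $q^hq^{h'}=q^{h+h'}$; $q^he_iq^{-h}=q^{\alpha_i(h)}e_i$, $q^hf_iq^{-h}=q^{-\alpha_i(h)}f_i$; $e_if_j-f_je_i=\delta_{ij}\frac{k_i-k_i^{-1}}{q_i-q_i^{-1}}$ where $k_i=q^{s_ih_i}$; $\sum_{r=0}^{1-a_{ij}}(-1)^r\left[{1-a_{ij}\atop r}\right]_ix_i^{1-a_{ij}-r}x_jx_i^r=0$ for $x=e$ and for $x=f$ if $a_{ii}=2$, $i\ne j$; $e_ie_j-e_je_i=f_if_j-f_jf_i=0$ if $a_{ij}=0$. It is a Hopf algebra with $\Delta(q^h)=q^h\otimes q^h$, $\Delta(e_i)=e_i\otimes k_i^{-1}+1\otimes e_i$, $\Delta(f_i)=k_i\otimes f_i+f_i\otimes1$, $\varepsilon(q^h)=1$, $\varepsilon(e_i)=\varepsilon(f_i)=0$, $S(q^h)=q^{-h}$, $S(e_i)=-e_ik_i$, $S(f_i)=-k_i^{-1}f_i$. $U_q'(\mathcal G)$ is the Hopf subalgebra generated by $e_i,f_i$ ($i\in I$) and $q^h$ with $h\in\oplus_{i\in I}\mathbf Zs_ih_i\oplus\oplus_{i\in I}\mathbf Zd_i$.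
   Formalization: Relations D_jE_i=q^{δ_ij}E_iD_j (type zero: D_jE_iD̄_j=q^{δ_ij}E_i; inverse for F_i) are added, else the isomorphism fails; T is only an anti-endomorphism, proved bijective on U^τ if all types are zero, since T kills E_i(1-J^{m-1}) or F_i(1-J^{m-1}) ≠ 0 for type one. *)

theory Defs
  imports
    "HOL-Algebra.Algebra"
    "HOL-Algebra.Algebraic_Closure_Type"
    "HOL-Algebra.Free_Abelian_Groups"
    "HOL-Library.Poly_Mapping"
    "HOL-Computational_Algebra.Formal_Laurent_Series"
begin

section \<open>Associative unital algebras over a field\<close>

text \<open>Scalars form a field type \<open>'k\<close>; algebras are HOL-Algebra records with a carrier.  The library locale
  \<open>algebra\<close> is restricted to commutative rings, so the noncommutative notion is introduced here.\<close>

definition kalgebra :: "('k::field, 'a, 'e) module_scheme \<Rightarrow> bool" where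
  "kalgebra A \<longleftrightarrow>
     ring A \<and> module (ring_of_type_algebra :: 'k ring) A \<and>
     (\<forall>c. \<forall>x\<in>carrier A. \<forall>y\<in>carrier A.
        (c \<odot>\<^bsub>A\<^esub> x) \<otimes>\<^bsub>A\<^esub> y = c \<odot>\<^bsub>A\<^esub> (x \<otimes>\<^bsub>A\<^esub> y) \<and>
        x \<otimes>\<^bsub>A\<^esub> (c \<odot>\<^bsub>A\<^esub> y) = c \<odot>\<^bsub>A\<^esub> (x \<otimes>\<^bsub>A\<^esub> y))"

definition linear_map ::
    "('k, 'a, 'e) module_scheme \<Rightarrow> ('k, 'b, 'f) module_scheme \<Rightarrow> ('a \<Rightarrow> 'b) \<Rightarrow> bool" where
  "linear_map A B f \<longleftrightarrow>
     f \<in> carrier A \<rightarrow> carrier B \<and>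
     (\<forall>x\<in>carrier A. \<forall>y\<in>carrier A. f (x \<oplus>\<^bsub>A\<^esub> y) = f x \<oplus>\<^bsub>B\<^esub> f y) \<and>
     (\<forall>c. \<forall>x\<in>carrier A. f (c \<odot>\<^bsub>A\<^esub> x) = c \<odot>\<^bsub>B\<^esub> f x)"

definition algebra_hom ::
    "('k, 'a, 'e) module_scheme \<Rightarrow> ('k, 'b, 'f) module_scheme \<Rightarrow> ('a \<Rightarrow> 'b) \<Rightarrow> bool" where
  "algebra_hom A B f \<longleftrightarrow> linear_map A B f \<and> f \<in> ring_hom A B"

definition opposite :: "('k, 'a, 'e) module_scheme \<Rightarrow> ('k, 'a, 'e) module_scheme" where
  "opposite A = A\<lparr>monoid.mult := \<lambda>x y. y \<otimes>\<^bsub>A\<^esub> x\<rparr>"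

abbreviation algebra_antihom ::
    "('k, 'a, 'e) module_scheme \<Rightarrow> ('k, 'b, 'f) module_scheme \<Rightarrow> ('a \<Rightarrow> 'b) \<Rightarrow> bool" where
  "algebra_antihom A B f \<equiv> algebra_hom A (opposite B) f"

definition generated_subalgebra :: "('k, 'a, 'e) module_scheme \<Rightarrow> 'a set \<Rightarrow> 'a set" where
  "generated_subalgebra A S =
     \<Inter>{C. subring C A \<and> (\<forall>c. \<forall>x\<in>C. c \<odot>\<^bsub>A\<^esub> x \<in> C) \<and> S \<subseteq> C}"

definition base_field :: "('k::field, 'k) module" where
  "base_field = ring.extend ring_of_type_algebra (module.fields (*))"

section \<open>Monoid algebras, quotients, presentations, tensor products\<close>

definition monoid_algebra ::
    "('m, 'e) monoid_scheme \<Rightarrow> ('k::field, 'm \<Rightarrow>\<^sub>0 'k) module" where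
  "monoid_algebra G =
     \<lparr>carrier = {p. Poly_Mapping.keys p \<subseteq> carrier G},
      monoid.mult = (\<lambda>p p'. \<Sum>g\<in>Poly_Mapping.keys p. \<Sum>h\<in>Poly_Mapping.keys p'.
        Poly_Mapping.single (g \<otimes>\<^bsub>G\<^esub> h) (Poly_Mapping.lookup p g * Poly_Mapping.lookup p' h)),
      one = Poly_Mapping.single \<one>\<^bsub>G\<^esub> 1,
      ring.zero = 0,
      ring.add = (+),
      module.smult = (\<lambda>c. Poly_Mapping.map ((*) c))\<rparr>"

definition quotient_algebra ::
    "('k, 'a, 'e) module_scheme \<Rightarrow> 'a set \<Rightarrow> ('k, 'a set) module" where
  "quotient_algebra A N =
     ring.extend (A Quot N) (module.fields (\<lambda>c Y. \<Union>x\<in>Y. N +>\<^bsub>A\<^esub> (c \<odot>\<^bsub>A\<^esub> x)))"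

definition word_monoid :: "'g set \<Rightarrow> 'g list monoid" where
  "word_monoid gs = \<lparr>carrier = lists gs, monoid.mult = (@), one = []\<rparr>"

abbreviation free_algebra :: "'g set \<Rightarrow> ('k::field, 'g list \<Rightarrow>\<^sub>0 'k) module" where
  "free_algebra gs \<equiv> monoid_algebra (word_monoid gs)"

definition presented_algebra ::
    "'g set \<Rightarrow> ('g list \<Rightarrow>\<^sub>0 'k::field) set \<Rightarrow> ('k, ('g list \<Rightarrow>\<^sub>0 'k) set) module" where
  "presented_algebra gs R = quotient_algebra (free_algebra gs) (Idl\<^bsub>free_algebra gs\<^esub> R)"

definition pclass ::
    "'g set \<Rightarrow> ('g list \<Rightarrow>\<^sub>0 'k::field) set \<Rightarrow> ('g list \<Rightarrow>\<^sub>0 'k) \<Rightarrow> ('g list \<Rightarrow>\<^sub>0 'k) set" where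
  "pclass gs R p = (Idl\<^bsub>free_algebra gs\<^esub> R) +>\<^bsub>free_algebra gs\<^esub> p"

text \<open>The tensor product is the vector space on the symbols \<open>a \<otimes> b\<close> modulo bilinearity.  A product of a
  symbol with a bilinearity relator is again such a relator, so their linear span is already a
  two-sided ideal of the monoid algebra of \<open>A \<times>\<times> B\<close>; this yields the usual product
  \<open>(a \<otimes> b) (a' \<otimes> b') = a a' \<otimes> b b'\<close>.\<close>

definition bilinear_rels ::
    "('k::field, 'a, 'e) module_scheme \<Rightarrow> ('k, 'b, 'f) module_scheme \<Rightarrow> ('a \<times> 'b \<Rightarrow>\<^sub>0 'k) set" where
  "bilinear_rels A B =
     {Poly_Mapping.single (x \<oplus>\<^bsub>A\<^esub> x', y) 1 - Poly_Mapping.single (x, y) 1 - Poly_Mapping.single (x', y) 1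
       | x x' y. x \<in> carrier A \<and> x' \<in> carrier A \<and> y \<in> carrier B} \<union>
     {Poly_Mapping.single (x, y \<oplus>\<^bsub>B\<^esub> y') 1 - Poly_Mapping.single (x, y) 1 - Poly_Mapping.single (x, y') 1
       | x y y'. x \<in> carrier A \<and> y \<in> carrier B \<and> y' \<in> carrier B} \<union>
     {Poly_Mapping.single (c \<odot>\<^bsub>A\<^esub> x, y) 1 - Poly_Mapping.single (x, y) c
       | c x y. x \<in> carrier A \<and> y \<in> carrier B} \<union>
     {Poly_Mapping.single (x, c \<odot>\<^bsub>B\<^esub> y) 1 - Poly_Mapping.single (x, y) c
       | c x y. x \<in> carrier A \<and> y \<in> carrier B}"

definition tensor_algebra ::
    "('k::field, 'a, 'e) module_scheme \<Rightarrow> ('k, 'b, 'f) module_scheme \<Rightarrow>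
      ('k, ('a \<times> 'b \<Rightarrow>\<^sub>0 'k) set) module" where
  "tensor_algebra A B =
     quotient_algebra (monoid_algebra (A \<times>\<times> B)) (Idl\<^bsub>monoid_algebra (A \<times>\<times> B)\<^esub> (bilinear_rels A B))"

definition tensor ::
    "('k::field, 'a, 'e) module_scheme \<Rightarrow> ('k, 'b, 'f) module_scheme \<Rightarrow> 'a \<Rightarrow> 'b \<Rightarrow>
      ('a \<times> 'b \<Rightarrow>\<^sub>0 'k) set" where
  "tensor A B x y =
     (Idl\<^bsub>monoid_algebra (A \<times>\<times> B)\<^esub> (bilinear_rels A B)) +>\<^bsub>monoid_algebra (A \<times>\<times> B)\<^esub>
       Poly_Mapping.single (x, y) 1"

text \<open>The linear map to \<open>M\<close> with prescribed values \<open>f\<close> on a basis, evaluated on a coset through a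
  representative.  It is only meaningful if the value does not depend on the representative, i.e.
  for bilinear \<open>f\<close> on tensors, and for assignments compatible with the relations on presented
  algebras.\<close>

definition coset_extend ::
    "('k::field, 'b, 'e) module_scheme \<Rightarrow> ('m \<Rightarrow> 'b) \<Rightarrow> ('m \<Rightarrow>\<^sub>0 'k) set \<Rightarrow> 'b" where
  "coset_extend M f Y = (let p = (SOME p. p \<in> Y) in
     \<Oplus>\<^bsub>M\<^esub>g\<in>Poly_Mapping.keys p. Poly_Mapping.lookup p g \<odot>\<^bsub>M\<^esub> f g)"

definition tensor_extend ::
    "('k::field, 'c, 'e) module_scheme \<Rightarrow> ('a \<Rightarrow> 'b \<Rightarrow> 'c) \<Rightarrow> ('a \<times> 'b \<Rightarrow>\<^sub>0 'k) set \<Rightarrow> 'c" where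
  "tensor_extend M f = coset_extend M (\<lambda>(x, y). f x y)"

definition generator_extend ::
    "('k::field, 'b, 'e) module_scheme \<Rightarrow> ('g \<Rightarrow> 'b) \<Rightarrow> ('g list \<Rightarrow>\<^sub>0 'k) set \<Rightarrow> 'b" where
  "generator_extend B f = coset_extend B (\<lambda>w. foldr (\<lambda>x y. f x \<otimes>\<^bsub>B\<^esub> y) w \<one>\<^bsub>B\<^esub>)"

section \<open>Bialgebras, Hopf algebras and weak Hopf algebras\<close>

record (overloaded) ('k, 'a) bialgebra = "('k::field, 'a) module" +
  comult :: "'a \<Rightarrow> ('a \<times> 'a \<Rightarrow>\<^sub>0 'k) set"
  counit :: "'a \<Rightarrow> 'k"

definition is_bialgebra :: "('k::field, 'a) bialgebra \<Rightarrow> bool" where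
  "is_bialgebra H \<longleftrightarrow>
     kalgebra H \<and>
     algebra_hom H (tensor_algebra H H) (comult H) \<and>
     algebra_hom H base_field (counit H) \<and>
     (\<forall>x\<in>carrier H.
        tensor_extend (tensor_algebra H (tensor_algebra H H))
          (\<lambda>x1 x2. tensor H (tensor_algebra H H) x1 (comult H x2)) (comult H x) =
        tensor_extend (tensor_algebra H (tensor_algebra H H))
          (\<lambda>x1 x2. tensor_extend (tensor_algebra H (tensor_algebra H H))
             (\<lambda>x11 x12. tensor H (tensor_algebra H H) x11 (tensor H H x12 x2)) (comult H x1))
          (comult H x)) \<and>
     (\<forall>x\<in>carrier H. tensor_extend H (\<lambda>x1 x2. counit H x1 \<odot>\<^bsub>H\<^esub> x2) (comult H x) = x) \<and>
     (\<forall>x\<in>carrier H. tensor_extend H (\<lambda>x1 x2. counit H x2 \<odot>\<^bsub>H\<^esub> x1) (comult H x) = x)"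

definition convolution ::
    "('k::field, 'a) bialgebra \<Rightarrow> ('a \<Rightarrow> 'a) \<Rightarrow> ('a \<Rightarrow> 'a) \<Rightarrow> 'a \<Rightarrow> 'a" where
  "convolution H f g x = tensor_extend H (\<lambda>x1 x2. f x1 \<otimes>\<^bsub>H\<^esub> g x2) (comult H x)"

definition is_hopf_algebra :: "('k::field, 'a) bialgebra \<Rightarrow> ('a \<Rightarrow> 'a) \<Rightarrow> bool" where
  "is_hopf_algebra H S \<longleftrightarrow>
     is_bialgebra H \<and> linear_map H H S \<and>
     (\<forall>x\<in>carrier H. convolution H S id x = counit H x \<odot>\<^bsub>H\<^esub> \<one>\<^bsub>H\<^esub> \<and>
                    convolution H id S x = counit H x \<odot>\<^bsub>H\<^esub> \<one>\<^bsub>H\<^esub>)"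

text \<open>A weak antipode is required to be an anti-endomorphism; bijectivity is not part of this
  notion, as the weak antipode \<open>T\<close> of interest annihilates the nonzero element \<open>E\<^sub>i (1 - J^(m-1))\<close>
  whenever \<open>E\<^sub>i\<close> is of type one (and similarly for \<open>F\<^sub>i\<close>).\<close>

definition is_weak_hopf_algebra :: "('k::field, 'a) bialgebra \<Rightarrow> ('a \<Rightarrow> 'a) \<Rightarrow> bool" where
  "is_weak_hopf_algebra H T \<longleftrightarrow>
     is_bialgebra H \<and> algebra_antihom H H T \<and>
     (\<forall>x\<in>carrier H. convolution H (convolution H id T) id x = x \<and>
                    convolution H (convolution H T id) T x = T x)"

definition noncommutative :: "('k::field, 'a) bialgebra \<Rightarrow> bool" where
  "noncommutative H \<longleftrightarrow> (\<exists>x\<in>carrier H. \<exists>y\<in>carrier H. x \<otimes>\<^bsub>H\<^esub> y \<noteq> y \<otimes>\<^bsub>H\<^esub> x)"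

definition noncocommutative :: "('k::field, 'a) bialgebra \<Rightarrow> bool" where
  "noncocommutative H \<longleftrightarrow>
     (\<exists>x\<in>carrier H. tensor_extend (tensor_algebra H H) (\<lambda>x1 x2. tensor H H x2 x1) (comult H x)
        \<noteq> comult H x)"

definition hopf_isomorphic ::
    "('k::field, 'a) bialgebra \<Rightarrow> ('a \<Rightarrow> 'a) \<Rightarrow> ('k, 'b) bialgebra \<Rightarrow> ('b \<Rightarrow> 'b) \<Rightarrow> bool" where
  "hopf_isomorphic H S H' S' \<longleftrightarrow>
     is_hopf_algebra H S \<and> is_hopf_algebra H' S' \<and>
     (\<exists>\<phi>. algebra_hom H H' \<phi> \<and> bij_betw \<phi> (carrier H) (carrier H') \<and>
        (\<forall>x\<in>carrier H.
           tensor_extend (tensor_algebra H' H') (\<lambda>x1 x2. tensor H' H' (\<phi> x1) (\<phi> x2)) (comult H x)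
             = comult H' (\<phi> x) \<and>
           counit H' (\<phi> x) = counit H x \<and>
           \<phi> (S x) = S' (\<phi> x)))"

text \<open>The bialgebra structure that \<open>H\<close> induces on a subspace \<open>C\<close> with unit element \<open>u\<close> (possibly
  different from the unit of \<open>H\<close>).  Over a field \<open>C \<otimes> C \<rightarrow> H \<otimes> H\<close> is injective, so the restricted
  comultiplication is determined by its image in \<open>H \<otimes> H\<close>.\<close>

definition sub_bialgebra :: "('k::field, 'a) bialgebra \<Rightarrow> 'a set \<Rightarrow> 'a \<Rightarrow> ('k, 'a) bialgebra" where
  "sub_bialgebra H C u = (let B = H\<lparr>carrier := C, one := u\<rparr> in
     B\<lparr>comult := \<lambda>x. THE t. t \<in> carrier (tensor_algebra B B) \<and>
        tensor_extend (tensor_algebra H H) (tensor H H) t = comult H x\<rparr>)"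

section \<open>Quantum integers and Borcherds-Cartan matrices\<close>

text \<open>Quantum integers live in the field of formal Laurent series in \<open>\<nu>\<close>, where the quotients below
  make sense.  Gaussian binomials are Laurent polynomials, and are evaluated only afterwards, so
  that roots of unity are allowed.\<close>

definition qint :: "nat \<Rightarrow> 'k::field fls" where
  "qint k = (fls_X ^ k - fls_X_inv ^ k) / (fls_X - fls_X_inv)"

definition qfact :: "nat \<Rightarrow> 'k::field fls" where
  "qfact k = (\<Prod>l=1..k. qint l)"

definition qbinom :: "nat \<Rightarrow> nat \<Rightarrow> 'k::field fls" where
  "qbinom k r = qfact k / (qfact r * qfact (k - r))"

definition qbinom_at :: "'k::field \<Rightarrow> nat \<Rightarrow> nat \<Rightarrow> 'k" where
  "qbinom_at z k r = (\<Sum>n | fls_nth (qbinom k r :: 'k fls) n \<noteq> 0. fls_nth (qbinom k r) n * z powi n)"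

definition borcherds_cartan :: "nat set \<Rightarrow> (nat \<Rightarrow> nat \<Rightarrow> int) \<Rightarrow> bool" where
  "borcherds_cartan I a \<longleftrightarrow>
     (\<forall>i\<in>I. a i i = 2 \<or> a i i \<le> 0) \<and>
     (\<forall>i\<in>I. \<forall>j\<in>I. i \<noteq> j \<longrightarrow> a i j \<le> 0) \<and>
     (\<forall>i\<in>I. \<forall>j\<in>I. a i j = 0 \<longleftrightarrow> a j i = 0)"

text \<open>The symmetrizer takes integer values, since \<open>q\<^sub>i = q^s\<^sub>i\<close> and \<open>k\<^sub>i = q^(s\<^sub>i h\<^sub>i)\<close> with
  \<open>s\<^sub>i h\<^sub>i \<in> P\<^sup>\<or>\<close>.\<close>

definition symmetrizes :: "nat set \<Rightarrow> (nat \<Rightarrow> nat \<Rightarrow> int) \<Rightarrow> (nat \<Rightarrow> nat) \<Rightarrow> bool" where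
  "symmetrizes I a s \<longleftrightarrow>
     (\<forall>i\<in>I. s i > 0) \<and> (\<forall>i\<in>I. \<forall>j\<in>I. int (s i) * a i j = int (s j) * a j i)"

definition serre_rel :: "'k::field \<Rightarrow> nat \<Rightarrow> 'g \<Rightarrow> 'g \<Rightarrow> ('g list \<Rightarrow>\<^sub>0 'k)" where
  "serre_rel z n x y = (\<Sum>r\<le>n. Poly_Mapping.single (replicate (n - r) x @ [y] @ replicate r x)
     ((-1) ^ r * qbinom_at z n r))"

definition commutator_rel :: "'g \<Rightarrow> 'g \<Rightarrow> ('g list \<Rightarrow>\<^sub>0 'k::field)" where
  "commutator_rel x y = Poly_Mapping.single [x, y] 1 - Poly_Mapping.single [y, x] 1"

text \<open>\<open>u v = c v u\<close> and \<open>u x v = c x\<close>, respectively.\<close>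

definition type_one_rel :: "'g \<Rightarrow> 'g \<Rightarrow> 'k \<Rightarrow> ('g list \<Rightarrow>\<^sub>0 'k::field)" where
  "type_one_rel u x c = Poly_Mapping.single [u, x] 1 - Poly_Mapping.single [x, u] c"

definition conjugation_rel :: "'g \<Rightarrow> 'g \<Rightarrow> 'g \<Rightarrow> 'k \<Rightarrow> ('g list \<Rightarrow>\<^sub>0 'k::field)" where
  "conjugation_rel u x v c = Poly_Mapping.single [u, x, v] 1 - Poly_Mapping.single [x] c"

section \<open>The weak quantum algebra\<close>

datatype wgen = GJ | GE nat | GF nat | GK nat | GKb nat | GD nat | GDb nat

definition w_toral :: "nat set \<Rightarrow> wgen set" where
  "w_toral I = GK ` I \<union> GKb ` I \<union> GD ` I \<union> GDb ` I"

definition w_gens :: "nat set \<Rightarrow> wgen set" where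
  "w_gens I = {GJ} \<union> GE ` I \<union> GF ` I \<union> w_toral I"

text \<open>The relations saying that \<open>x\<close>, of type \<open>t\<close>, has weight \<open>c\<close> under \<open>u\<close> with weak inverse \<open>v\<close>.\<close>

definition typed_weight_rels :: "nat \<Rightarrow> wgen \<Rightarrow> wgen \<Rightarrow> wgen \<Rightarrow> 'k::field \<Rightarrow> (wgen list \<Rightarrow>\<^sub>0 'k) set" where
  "typed_weight_rels t u v x c =
     (if t = 1 then {type_one_rel u x c, type_one_rel v x (inverse c)}
      else {conjugation_rel u x v c})"

text \<open>The type conditions are imposed with respect to both families \<open>K\<close> and \<open>D\<close>, the weights
  under \<open>D\<^sub>j\<close> being those of \<open>q^d\<^sub>j\<close>; without the latter the \<open>D\<^sub>j\<close> would be free over the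
  \<open>E\<^sub>i\<close>, \<open>F\<^sub>i\<close> and the comparison with the usual quantum algebra would fail.\<close>

definition w_type_rels ::
    "nat set \<Rightarrow> (nat \<Rightarrow> nat \<Rightarrow> int) \<Rightarrow> (nat \<Rightarrow> nat) \<Rightarrow> 'k::field \<Rightarrow> (nat \<Rightarrow> nat) \<Rightarrow> (nat \<Rightarrow> nat) \<Rightarrow>
      (wgen list \<Rightarrow>\<^sub>0 'k) set" where
  "w_type_rels I a s q \<kappa> \<kappa>' = (\<Union>i\<in>I. \<Union>j\<in>I.
     typed_weight_rels (\<kappa> i) (GK j) (GKb j) (GE i) ((q ^ s i) powi a i j) \<union>
     typed_weight_rels (\<kappa>' i) (GK j) (GKb j) (GF i) ((q ^ s i) powi (- a i j)) \<union>
     typed_weight_rels (\<kappa> i) (GD j) (GDb j) (GE i) (if i = j then q else 1) \<union>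
     typed_weight_rels (\<kappa>' i) (GD j) (GDb j) (GF i) (if i = j then inverse q else 1))"

text \<open>The condition \<open>1 \<noteq> J^(m-1)\<close> is not a relation: it holds in the presented algebra as soon as
  \<open>m \<ge> 2\<close> (consider \<open>J \<mapsto> 0\<close>).\<close>

definition w_rels ::
    "nat set \<Rightarrow> (nat \<Rightarrow> nat \<Rightarrow> int) \<Rightarrow> (nat \<Rightarrow> nat) \<Rightarrow> 'k::field \<Rightarrow> nat \<Rightarrow> (nat \<Rightarrow> nat) \<Rightarrow> (nat \<Rightarrow> nat) \<Rightarrow>
      (wgen list \<Rightarrow>\<^sub>0 'k) set" where
  "w_rels I a s q m \<kappa> \<kappa>' =
     {Poly_Mapping.single [GK i, GKb i] 1 - Poly_Mapping.single (replicate (m - 1) GJ) 1 | i. i \<in> I} \<union>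
     {Poly_Mapping.single [GD i, GDb i] 1 - Poly_Mapping.single (replicate (m - 1) GJ) 1 | i. i \<in> I} \<union>
     {Poly_Mapping.single (replicate m GJ) 1 - Poly_Mapping.single [GJ] 1} \<union>
     {commutator_rel x y | x y. x \<in> insert GJ (w_toral I) \<and> y \<in> insert GJ (w_toral I)} \<union>
     {Poly_Mapping.single (x # replicate (m - 1) GJ) 1 - Poly_Mapping.single [x] 1 | x. x \<in> w_toral I} \<union>
     w_type_rels I a s q \<kappa> \<kappa>' \<union>
     {commutator_rel (GE i) (GF j) -
        (if i = j then Poly_Mapping.single [GK i] (1 / (q ^ s i - inverse (q ^ s i))) -
                       Poly_Mapping.single [GKb i] (1 / (q ^ s i - inverse (q ^ s i)))
         else 0) | i j. i \<in> I \<and> j \<in> I} \<union>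
     {serre_rel (q ^ s i) (nat (1 - a i j)) (Z i) (Z j)
        | i j Z. i \<in> I \<and> j \<in> I \<and> i \<noteq> j \<and> a i i = 2 \<and> Z \<in> {GE, GF}} \<union>
     {commutator_rel (Z i) (Z j) | i j Z. i \<in> I \<and> j \<in> I \<and> a i j = 0 \<and> Z \<in> {GE, GF}}"

context
  fixes I :: "nat set" and a :: "nat \<Rightarrow> nat \<Rightarrow> int" and s :: "nat \<Rightarrow> nat"
    and q :: "'k::field" and m :: nat and \<kappa> \<kappa>' :: "nat \<Rightarrow> nat"
begin

definition w_class :: "wgen list \<Rightarrow> 'k \<Rightarrow> (wgen list \<Rightarrow>\<^sub>0 'k) set" where
  "w_class w c = pclass (w_gens I) (w_rels I a s q m \<kappa> \<kappa>') (Poly_Mapping.single w c)"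

definition w_algebra :: "('k, (wgen list \<Rightarrow>\<^sub>0 'k) set) module" where
  "w_algebra = presented_algebra (w_gens I) (w_rels I a s q m \<kappa> \<kappa>')"

fun w_comult_gen :: "wgen \<Rightarrow> ((wgen list \<Rightarrow>\<^sub>0 'k) set \<times> (wgen list \<Rightarrow>\<^sub>0 'k) set \<Rightarrow>\<^sub>0 'k) set" where
  "w_comult_gen (GE i) =
     tensor w_algebra w_algebra (w_class (if \<kappa> i = 1 then [] else replicate (m - 1) GJ) 1) (w_class [GE i] 1)
     \<oplus>\<^bsub>tensor_algebra w_algebra w_algebra\<^esub>
     tensor w_algebra w_algebra (w_class [GE i] 1) (w_class [GK i] 1)"
| "w_comult_gen (GF i) =
     tensor w_algebra w_algebra (w_class [GF i] 1) (w_class (if \<kappa>' i = 1 then [] else replicate (m - 1) GJ) 1)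
     \<oplus>\<^bsub>tensor_algebra w_algebra w_algebra\<^esub>
     tensor w_algebra w_algebra (w_class [GKb i] 1) (w_class [GF i] 1)"
| "w_comult_gen x = tensor w_algebra w_algebra (w_class [x] 1) (w_class [x] 1)"

fun w_counit_gen :: "wgen \<Rightarrow> 'k" where
  "w_counit_gen (GE i) = 0"
| "w_counit_gen (GF i) = 0"
| "w_counit_gen x = 1"

definition wU :: "('k, (wgen list \<Rightarrow>\<^sub>0 'k) set) bialgebra" where
  "wU = module.extend w_algebra (bialgebra.fields
     (generator_extend (tensor_algebra w_algebra w_algebra) w_comult_gen)
     (generator_extend base_field w_counit_gen))"

fun w_T_gen :: "wgen \<Rightarrow> (wgen list \<Rightarrow>\<^sub>0 'k) set" where
  "w_T_gen GJ = w_class [GJ] 1"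
| "w_T_gen (GK i) = w_class [GKb i] 1"
| "w_T_gen (GKb i) = w_class [GK i] 1"
| "w_T_gen (GD i) = w_class [GDb i] 1"
| "w_T_gen (GDb i) = w_class [GD i] 1"
| "w_T_gen (GE i) = w_class [GE i, GKb i] (-1)"
| "w_T_gen (GF i) = w_class [GK i, GF i] (-1)"

definition wT :: "(wgen list \<Rightarrow>\<^sub>0 'k) set \<Rightarrow> (wgen list \<Rightarrow>\<^sub>0 'k) set" where
  "wT = generator_extend (opposite w_algebra) w_T_gen"

text \<open>\<open>wP = J^(m-1)\<close>.\<close>

definition wP :: "(wgen list \<Rightarrow>\<^sub>0 'k) set" where
  "wP = w_class (replicate (m - 1) GJ) 1"

text \<open>\<open>U\<close> is a unital subalgebra, i.e. contains the unit of \<open>wU\<close>, as needed for \<open>\<Delta>(E\<^sub>i) \<in> U \<otimes> U\<close>.\<close>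

definition Utau :: "('k, (wgen list \<Rightarrow>\<^sub>0 'k) set) bialgebra" where
  "Utau = sub_bialgebra wU
     (generated_subalgebra wU (insert wP ((\<lambda>x. w_class [x] 1) ` (w_toral I \<union> GE ` I \<union> GF ` I)))) \<one>\<^bsub>wU\<^esub>"

definition UtauP :: "('k, (wgen list \<Rightarrow>\<^sub>0 'k) set) bialgebra" where
  "UtauP = sub_bialgebra Utau ((\<lambda>x. x \<otimes>\<^bsub>Utau\<^esub> wP) ` carrier Utau) wP"

end

section \<open>The usual quantum algebra\<close>

datatype coweight = CH nat | CD nat

definition coweight_lattice :: "nat set \<Rightarrow> (coweight \<Rightarrow>\<^sub>0 int) set" where
  "coweight_lattice I = carrier (free_Abelian_group (CH ` I \<union> CD ` I))"

definition scaled_coweight_lattice :: "nat set \<Rightarrow> (nat \<Rightarrow> nat) \<Rightarrow> (coweight \<Rightarrow>\<^sub>0 int) set" where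
  "scaled_coweight_lattice I s =
     {h \<in> coweight_lattice I. \<forall>i\<in>I. int (s i) dvd Poly_Mapping.lookup h (CH i)}"

definition simple_root :: "(nat \<Rightarrow> nat \<Rightarrow> int) \<Rightarrow> nat \<Rightarrow> (coweight \<Rightarrow>\<^sub>0 int) \<Rightarrow> int" where
  "simple_root a i h = (\<Sum>x\<in>Poly_Mapping.keys h. Poly_Mapping.lookup h x *
     (case x of CH j \<Rightarrow> a j i | CD j \<Rightarrow> if i = j then 1 else 0))"

datatype qgen = QE nat | QF nat | QH "coweight \<Rightarrow>\<^sub>0 int"

definition q_gens :: "nat set \<Rightarrow> qgen set" where
  "q_gens I = QE ` I \<union> QF ` I \<union> QH ` coweight_lattice I"

definition q_k :: "(nat \<Rightarrow> nat) \<Rightarrow> nat \<Rightarrow> qgen" where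
  "q_k s i = QH (Poly_Mapping.single (CH i) (int (s i)))"

definition q_k_inv :: "(nat \<Rightarrow> nat) \<Rightarrow> nat \<Rightarrow> qgen" where
  "q_k_inv s i = QH (Poly_Mapping.single (CH i) (- int (s i)))"

definition q_rels ::
    "nat set \<Rightarrow> (nat \<Rightarrow> nat \<Rightarrow> int) \<Rightarrow> (nat \<Rightarrow> nat) \<Rightarrow> 'k::field \<Rightarrow> (qgen list \<Rightarrow>\<^sub>0 'k) set" where
  "q_rels I a s q =
     {Poly_Mapping.single [QH 0] 1 - Poly_Mapping.single [] 1} \<union>
     {Poly_Mapping.single [QH h, QH h'] 1 - Poly_Mapping.single [QH (h + h')] 1
        | h h'. h \<in> coweight_lattice I \<and> h' \<in> coweight_lattice I} \<union>
     {conjugation_rel (QH h) (QE i) (QH (- h)) (q powi simple_root a i h)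
        | h i. h \<in> coweight_lattice I \<and> i \<in> I} \<union>
     {conjugation_rel (QH h) (QF i) (QH (- h)) (q powi (- simple_root a i h))
        | h i. h \<in> coweight_lattice I \<and> i \<in> I} \<union>
     {commutator_rel (QE i) (QF j) -
        (if i = j then Poly_Mapping.single [q_k s i] (1 / (q ^ s i - inverse (q ^ s i))) -
                       Poly_Mapping.single [q_k_inv s i] (1 / (q ^ s i - inverse (q ^ s i)))
         else 0) | i j. i \<in> I \<and> j \<in> I} \<union>
     {serre_rel (q ^ s i) (nat (1 - a i j)) (Z i) (Z j)
        | i j Z. i \<in> I \<and> j \<in> I \<and> i \<noteq> j \<and> a i i = 2 \<and> Z \<in> {QE, QF}} \<union>
     {commutator_rel (Z i) (Z j) | i j Z. i \<in> I \<and> j \<in> I \<and> a i j = 0 \<and> Z \<in> {QE, QF}}"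

context
  fixes I :: "nat set" and a :: "nat \<Rightarrow> nat \<Rightarrow> int" and s :: "nat \<Rightarrow> nat" and q :: "'k::field"
begin

definition q_class :: "qgen list \<Rightarrow> 'k \<Rightarrow> (qgen list \<Rightarrow>\<^sub>0 'k) set" where
  "q_class w c = pclass (q_gens I) (q_rels I a s q) (Poly_Mapping.single w c)"

definition q_algebra :: "('k, (qgen list \<Rightarrow>\<^sub>0 'k) set) module" where
  "q_algebra = presented_algebra (q_gens I) (q_rels I a s q)"

fun q_comult_gen :: "qgen \<Rightarrow> ((qgen list \<Rightarrow>\<^sub>0 'k) set \<times> (qgen list \<Rightarrow>\<^sub>0 'k) set \<Rightarrow>\<^sub>0 'k) set" where
  "q_comult_gen (QE i) =
     tensor q_algebra q_algebra (q_class [QE i] 1) (q_class [q_k_inv s i] 1)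
     \<oplus>\<^bsub>tensor_algebra q_algebra q_algebra\<^esub>
     tensor q_algebra q_algebra (q_class [] 1) (q_class [QE i] 1)"
| "q_comult_gen (QF i) =
     tensor q_algebra q_algebra (q_class [q_k s i] 1) (q_class [QF i] 1)
     \<oplus>\<^bsub>tensor_algebra q_algebra q_algebra\<^esub>
     tensor q_algebra q_algebra (q_class [QF i] 1) (q_class [] 1)"
| "q_comult_gen (QH h) = tensor q_algebra q_algebra (q_class [QH h] 1) (q_class [QH h] 1)"

fun q_counit_gen :: "qgen \<Rightarrow> 'k" where
  "q_counit_gen (QE i) = 0"
| "q_counit_gen (QF i) = 0"
| "q_counit_gen (QH h) = 1"

definition Uq :: "('k, (qgen list \<Rightarrow>\<^sub>0 'k) set) bialgebra" where
  "Uq = module.extend q_algebra (bialgebra.fields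
     (generator_extend (tensor_algebra q_algebra q_algebra) q_comult_gen)
     (generator_extend base_field q_counit_gen))"

fun q_S_gen :: "qgen \<Rightarrow> (qgen list \<Rightarrow>\<^sub>0 'k) set" where
  "q_S_gen (QH h) = q_class [QH (- h)] 1"
| "q_S_gen (QE i) = q_class [QE i, q_k s i] (-1)"
| "q_S_gen (QF i) = q_class [q_k_inv s i, QF i] (-1)"

definition qS :: "(qgen list \<Rightarrow>\<^sub>0 'k) set \<Rightarrow> (qgen list \<Rightarrow>\<^sub>0 'k) set" where
  "qS = generator_extend (opposite q_algebra) q_S_gen"

definition Uq' :: "('k, (qgen list \<Rightarrow>\<^sub>0 'k) set) bialgebra" where
  "Uq' = sub_bialgebra Uq
     (generated_subalgebra Uq
       ((\<lambda>x. q_class [x] 1) ` (QE ` I \<union> QF ` I \<union> QH ` scaled_coweight_lattice I s))) \<one>\<^bsub>Uq\<^esub>"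

end

end

theory Submission
  imports Defs
begin

text \<open>All structure maps are built from universal properties, so identities between homomorphisms are checked on
  generators.  Write \<open>P = J\<^sup>m\<^sup>-\<^sup>1\<close>, a central idempotent on \<open>U\<^sup>\<tau>\<close>, and \<open>Q = 1 - P\<close>.  After multiplication by \<open>P\<close> the
  map \<open>T\<close> is an ordinary antipode, while \<open>Q T(x) = th(x) Q\<close> for the character \<open>th\<close> that annihilates all generators;
  this gives the weak antipode axioms, and \<open>th(P) = 0\<close> excludes an antipode because \<open>P\<close> is group-like.  A dual
  highest weight module shows that \<open>E\<^sub>1\<close>, \<open>F\<^sub>1\<close> do not commute and that \<open>\<Delta>(E\<^sub>1)\<close> is not symmetric.  The isomorphism
  sends \<open>K\<^sub>i\<close> to \<open>k\<^sub>i\<^sup>-\<^sup>1\<close>, \<open>E\<^sub>i\<close> to \<open>k\<^sub>i\<^sup>-\<^sup>1 f\<^sub>i\<close> and \<open>F\<^sub>i\<close> to \<open>e\<^sub>i k\<^sub>i\<close>; it is injective because \<open>U\<^sub>q\<close> acts on functions from the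
  coweight lattice to \<open>wU P\<close> in such a way that \<open>x \<in> U\<^sup>\<tau>\<close> can be recovered from the action of its image.\<close>

text \<open>No PBW basis or triangular decomposition is used, so every inequality is detected in a
  representation built by hand. Injectivity cannot be shown by prescribing an inverse on generators:
  \<open>Uq'\<close> is a subalgebra of a presented algebra, not a presented one, and q^h with h
  outside the scaled lattice has no counterpart in wU P. Passing to functions on the whole lattice
  lets all of U_q act. The exchange of E and F comes from the coproducts: k_i^-1 f_i has coproduct 1
  \<otimes> k_i^-1 f_i + k_i^-1 f_i \<otimes> k_i^-1, the shape of \<Delta>(E_i) with K_i = k_i^-1.
  Two definitions shape the groundwork: linear extensions are evaluated on an arbitrary
  representative, and the coproduct of a subspace C is a definite description, which requires C
  \<otimes> C -> H \<otimes> H to be injective. The quantum Serre relations must survive coproduct,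
  reversal and twisting by toral elements; a Serre element is therefore written as a product of
  operators L_x - c R_x (left and right multiplication), so that each of these is a computation with
  a single factor, valid also at roots of unity.\<close>

abbreviation "keys \<equiv> Poly_Mapping.keys"
abbreviation "lookup \<equiv> Poly_Mapping.lookup"
abbreviation "single \<equiv> Poly_Mapping.single"

section \<open>Modules and algebras over a field type\<close>

lemma ring_of_type_algebra_simps [simp]:
  "carrier ring_of_type_algebra = UNIV"
  "x \<oplus>\<^bsub>ring_of_type_algebra\<^esub> y = x + y"
  "x \<otimes>\<^bsub>ring_of_type_algebra\<^esub> y = x * y"
  "\<zero>\<^bsub>ring_of_type_algebra\<^esub> = 0"
  "\<one>\<^bsub>ring_of_type_algebra\<^esub> = 1"
  by (simp_all add: ring_of_type_algebra_def)

locale kmod =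
  fixes M :: "('k::field, 'b, 'e) module_scheme" (structure)
  assumes is_kmod: "module (ring_of_type_algebra :: 'k ring) M"

sublocale kmod \<subseteq> abelian_group M
  using is_kmod by (rule module.axioms(2))

context kmod
begin

lemma smult_closed [simp, intro]: "x : carrier M ==> c \<odot> x : carrier M"
  using module.smult_closed [OF is_kmod, of c x] by simp

lemma smult_add_left: "x : carrier M ==> (c + d) \<odot> x = c \<odot> x \<oplus> d \<odot> x"
  using module.smult_l_distr [OF is_kmod, of c d x] by simp

lemma smult_add_right:
  "x : carrier M ==> y : carrier M ==> c \<odot> (x \<oplus> y) = c \<odot> x \<oplus> c \<odot> y"
  using module.smult_r_distr [OF is_kmod, of c x y] by simp

lemma smult_smult [simp]: "x : carrier M ==> c \<odot> (d \<odot> x) = (c * d) \<odot> x"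
  using module.smult_assoc1 [OF is_kmod, of c d x] by simp

lemma smult_1 [simp]: "x : carrier M ==> 1 \<odot> x = x"
  using module.smult_one [OF is_kmod, of x] by simp

lemma smult_0 [simp]: "x : carrier M ==> 0 \<odot> x = \<zero>"
  using module.smult_l_null [OF is_kmod, of x] by simp

lemma smult_zero [simp]: "c \<odot> \<zero> = \<zero>"
  using module.smult_r_null [OF is_kmod, of c] by simp

lemma smult_minus_left: "x : carrier M ==> (- c) \<odot> x = \<ominus> (c \<odot> x)"
  by (rule minus_equality [symmetric]) (simp_all flip: smult_add_left)

lemma minus_eq_smult: "x : carrier M ==> \<ominus> x = (- 1) \<odot> x"
  by (simp add: smult_minus_left)

lemma finsum_smult:
  "finite S ==> f : S \<rightarrow> carrier M ==> c \<odot> (\<Oplus>i\<in>S. f i) = (\<Oplus>i\<in>S. c \<odot> f i)"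
  using module.finsum_smult_ldistr [OF is_kmod, of S c f] by simp

lemma diff_zero_iff: "x : carrier M ==> y : carrier M ==> x \<oplus> (- 1) \<odot> y = \<zero> \<longleftrightarrow> x = y"
  by (metis minus_eq_smult minus_equality minus_minus r_neg smult_closed)

lemma smult_cancel: "c ~= 0 ==> x : carrier M ==> y : carrier M ==> c \<odot> x = c \<odot> y \<longleftrightarrow> x = y"
  by (metis left_inverse smult_1 smult_smult)

end

locale kalg =
  fixes A :: "('k::field, 'a, 'e) module_scheme" (structure)
  assumes is_kalgebra: "kalgebra A"

sublocale kalg \<subseteq> kmod A
  using is_kalgebra by (intro kmod.intro) (simp add: kalgebra_def)

sublocale kalg \<subseteq> ring A
  using is_kalgebra by (simp add: kalgebra_def)

context kalg
begin

lemma smult_mult_left [simp]: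
  "x : carrier A ==> y : carrier A ==> (c \<odot> x) \<otimes> y = c \<odot> (x \<otimes> y)"
  using is_kalgebra by (simp add: kalgebra_def)

lemma smult_mult_right [simp]:
  "x : carrier A ==> y : carrier A ==> x \<otimes> (c \<odot> y) = c \<odot> (x \<otimes> y)"
  using is_kalgebra by (simp add: kalgebra_def)

end

text \<open>Additive inverses come from scaling by \<open>- 1\<close>; the condition
  \<open>0 \<odot> x = \<zero>\<close> therefore stands in place of an inverse law.\<close>

lemma kmodI:
  fixes M :: "('k::field, 'b, 'e) module_scheme" (structure)
  assumes "!!x y. x : carrier M ==> y : carrier M ==> x \<oplus> y : carrier M"
    and "\<zero> : carrier M"
    and "!!x y z. x : carrier M ==> y : carrier M ==> z : carrier M ==> (x \<oplus> y) \<oplus> z = x \<oplus> (y \<oplus> z)"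
    and "!!x y. x : carrier M ==> y : carrier M ==> x \<oplus> y = y \<oplus> x"
    and "!!x. x : carrier M ==> \<zero> \<oplus> x = x"
    and "!!c x. x : carrier M ==> c \<odot> x : carrier M"
    and "!!c d x. x : carrier M ==> (c + d) \<odot> x = c \<odot> x \<oplus> d \<odot> x"
    and "!!c x y. x : carrier M ==> y : carrier M ==> c \<odot> (x \<oplus> y) = c \<odot> x \<oplus> c \<odot> y"
    and "!!c d x. x : carrier M ==> (c * d) \<odot> x = c \<odot> (d \<odot> x)"
    and "!!x. x : carrier M ==> 1 \<odot> x = x"
    and "!!x. x : carrier M ==> (0::'k) \<odot> x = \<zero>"
  shows "kmod M"
proof -
  have inv: "EX y:carrier M. y \<oplus> x = \<zero>" if "x : carrier M" for x
    using assms(6)[of x "-1"] assms(7)[of x "-1" 1] assms(10,11)[of x] that by auto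
  have "abelian_group M"
    by (rule abelian_groupI) (use assms inv in auto)
  then show ?thesis
    unfolding kmod_def using assms
    by (intro moduleI) (auto intro: cring_from_type_algebra)
qed

lemma kalgebraI:
  fixes A :: "('k::field, 'a, 'e) module_scheme" (structure)
  assumes "kmod A"
    and "!!x y. x : carrier A ==> y : carrier A ==> x \<otimes> y : carrier A"
    and "\<one> : carrier A"
    and "!!x y z. x : carrier A ==> y : carrier A ==> z : carrier A ==> (x \<otimes> y) \<otimes> z = x \<otimes> (y \<otimes> z)"
    and "!!x. x : carrier A ==> \<one> \<otimes> x = x"
    and "!!x. x : carrier A ==> x \<otimes> \<one> = x"
    and "!!x y z. x : carrier A ==> y : carrier A ==> z : carrier A ==> (x \<oplus> y) \<otimes> z = x \<otimes> z \<oplus> y \<otimes> z"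
    and "!!x y z. x : carrier A ==> y : carrier A ==> z : carrier A ==> z \<otimes> (x \<oplus> y) = z \<otimes> x \<oplus> z \<otimes> y"
    and "!!c x y. x : carrier A ==> y : carrier A ==> (c \<odot> x) \<otimes> y = c \<odot> (x \<otimes> y)"
    and "!!c x y. x : carrier A ==> y : carrier A ==> x \<otimes> (c \<odot> y) = c \<odot> (x \<otimes> y)"
  shows "kalgebra A"
proof -
  interpret kmod A by fact
  have "Group.monoid A" by (rule monoidI) (use assms in auto)
  then have "ring A" by (intro ringI) (use assms abelian_group_axioms in auto)
  then show ?thesis using assms is_kmod by (simp add: kalgebra_def)
qed

lemma kmod_cong:
  assumes "kmod A" "carrier B = carrier A" "\<zero>\<^bsub>B\<^esub> = \<zero>\<^bsub>A\<^esub>"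
    "!!x y. x : carrier A ==> y : carrier A ==> x \<oplus>\<^bsub>B\<^esub> y = x \<oplus>\<^bsub>A\<^esub> y"
    "!!c x. x : carrier A ==> c \<odot>\<^bsub>B\<^esub> x = c \<odot>\<^bsub>A\<^esub> x"
  shows "kmod B"
proof -
  interpret kmod A by fact
  show ?thesis
    by (rule kmodI) (use assms in "simp_all add: a_ac smult_add_left smult_add_right")
qed

lemma kalgebra_cong:
  assumes "kalgebra A" "carrier B = carrier A" "\<zero>\<^bsub>B\<^esub> = \<zero>\<^bsub>A\<^esub>" "\<one>\<^bsub>B\<^esub> = \<one>\<^bsub>A\<^esub>"
    "!!x y. x : carrier A ==> y : carrier A ==> x \<oplus>\<^bsub>B\<^esub> y = x \<oplus>\<^bsub>A\<^esub> y"
    "!!x y. x : carrier A ==> y : carrier A ==> x \<otimes>\<^bsub>B\<^esub> y = x \<otimes>\<^bsub>A\<^esub> y"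
    "!!c x. x : carrier A ==> c \<odot>\<^bsub>B\<^esub> x = c \<odot>\<^bsub>A\<^esub> x"
  shows "kalgebra B"
proof -
  interpret kalg A by (rule kalg.intro) fact
  have "kmod B" by (rule kmod_cong [OF kmod_axioms]) (use assms in auto)
  then show ?thesis
    by (rule kalgebraI) (use assms in "simp_all add: m_assoc l_distr r_distr")
qed

lemma opposite_simps [simp]:
  "carrier (opposite A) = carrier A" "\<zero>\<^bsub>opposite A\<^esub> = \<zero>\<^bsub>A\<^esub>" "\<one>\<^bsub>opposite A\<^esub> = \<one>\<^bsub>A\<^esub>"
  "x \<oplus>\<^bsub>opposite A\<^esub> y = x \<oplus>\<^bsub>A\<^esub> y" "c \<odot>\<^bsub>opposite A\<^esub> x = c \<odot>\<^bsub>A\<^esub> x"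
  "x \<otimes>\<^bsub>opposite A\<^esub> y = y \<otimes>\<^bsub>A\<^esub> x"
  by (simp_all add: opposite_def)

lemma (in kalg) kalgebra_opposite: "kalgebra (opposite A)"
proof -
  have "kmod (opposite A)" by (rule kmod_cong [OF kmod_axioms]) auto
  then show ?thesis
    by (rule kalgebraI) (simp_all add: m_assoc l_distr r_distr)
qed

lemma base_field_simps [simp]:
  "carrier base_field = UNIV" "\<zero>\<^bsub>base_field\<^esub> = 0" "\<one>\<^bsub>base_field\<^esub> = 1"
  "x \<oplus>\<^bsub>base_field\<^esub> y = x + y" "x \<otimes>\<^bsub>base_field\<^esub> y = x * y" "c \<odot>\<^bsub>base_field\<^esub> x = c * x"
  by (simp_all add: base_field_def ring.extend_def module.fields_def ring_of_type_algebra_def)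

lemma kalgebra_base_field: "kalgebra base_field"
proof -
  have "kmod base_field" by (rule kmodI) (simp_all add: algebra_simps)
  then show ?thesis by (rule kalgebraI) (simp_all add: algebra_simps)
qed

subsection \<open>Linear maps\<close>

lemma linear_mapI:
  assumes "!!x. x : carrier A ==> f x : carrier B"
    "!!x y. x : carrier A ==> y : carrier A ==> f (x \<oplus>\<^bsub>A\<^esub> y) = f x \<oplus>\<^bsub>B\<^esub> f y"
    "!!c x. x : carrier A ==> f (c \<odot>\<^bsub>A\<^esub> x) = c \<odot>\<^bsub>B\<^esub> f x"
  shows "linear_map A B f"
  using assms by (simp add: linear_map_def)

lemma linear_mapD:
  assumes "linear_map A B f"
  shows "x : carrier A ==> f x : carrier B"
    "x : carrier A ==> y : carrier A ==> f (x \<oplus>\<^bsub>A\<^esub> y) = f x \<oplus>\<^bsub>B\<^esub> f y"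
    "x : carrier A ==> f (c \<odot>\<^bsub>A\<^esub> x) = c \<odot>\<^bsub>B\<^esub> f x"
  using assms by (auto simp: linear_map_def)

lemma linear_map_zero: "kmod A ==> kmod B ==> linear_map A B f ==> f \<zero>\<^bsub>A\<^esub> = \<zero>\<^bsub>B\<^esub>"
  using linear_mapD(3)[of A B f "\<zero>\<^bsub>A\<^esub>" 0] linear_mapD(1)[of A B f "\<zero>\<^bsub>A\<^esub>"]
  by (simp add: kmod.smult_0 kmod.smult_zero abelian_group.axioms kmod_def module_def
      abelian_monoid.zero_closed kmod.smult_closed)

lemma linear_map_id: "linear_map A A (%x. x)"
  by (rule linear_mapI) auto

lemma linear_map_comp: "linear_map A B f ==> linear_map B C g ==> linear_map A C (%x. g (f x))"
  by (auto simp: linear_map_def Pi_iff)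

lemma algebra_homI:
  assumes "linear_map A B f" "f \<one>\<^bsub>A\<^esub> = \<one>\<^bsub>B\<^esub>"
    "!!x y. x : carrier A ==> y : carrier A ==> f (x \<otimes>\<^bsub>A\<^esub> y) = f x \<otimes>\<^bsub>B\<^esub> f y"
  shows "algebra_hom A B f"
  using assms by (auto simp: algebra_hom_def linear_map_def ring_hom_def)

lemma algebra_homD:
  assumes "algebra_hom A B f"
  shows "linear_map A B f" "f \<one>\<^bsub>A\<^esub> = \<one>\<^bsub>B\<^esub>"
    "x : carrier A ==> f x : carrier B"
    "x : carrier A ==> y : carrier A ==> f (x \<otimes>\<^bsub>A\<^esub> y) = f x \<otimes>\<^bsub>B\<^esub> f y"
    "x : carrier A ==> y : carrier A ==> f (x \<oplus>\<^bsub>A\<^esub> y) = f x \<oplus>\<^bsub>B\<^esub> f y"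
    "x : carrier A ==> f (c \<odot>\<^bsub>A\<^esub> x) = c \<odot>\<^bsub>B\<^esub> f x"
  using assms by (auto simp: algebra_hom_def linear_map_def ring_hom_def)

lemma algebra_hom_comp: "algebra_hom A B f ==> algebra_hom B C g ==> algebra_hom A C (%x. g (f x))"
  by (auto simp: algebra_hom_def linear_map_def ring_hom_def Pi_iff)

subsection \<open>Linear extension of functions on a basis\<close>

text \<open>Splitting off one monomial leaves a smaller support. Linear statements about free
  algebras and about tensors are reduced to basis elements by this rule; \<open>S\<close> keeps the
  monomials inside a carrier.\<close>

lemma poly_mapping_induct [consumes 1, case_names zero single add]:
  assumes "keys p <= S" "P 0"
    "!!g c. g : S ==> P (single g c)"
    "!!p q. keys p <= S ==> keys q <= S ==> P p ==> P q ==> P (p + q)"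
  shows "P (p :: 'm \<Rightarrow>\<^sub>0 'k::ab_group_add)"
  using assms(1)
proof (induction "card (keys p)" arbitrary: p rule: less_induct)
  case less
  show ?case
  proof (cases "keys p = {}")
    case True
    then have "p = 0" by (intro poly_mapping_eqI) (simp add: in_keys_iff)
    then show ?thesis using assms(2) by simp
  next
    case False
    then obtain g where g: "g : keys p" by blast
    define s where "s = single g (lookup p g)"
    have k: "keys (p - s) = keys p - {g}"
      by (auto simp: s_def in_keys_iff lookup_minus lookup_single when_def split: if_splits)
    have "P (p - s)"
      using less.prems g k by (intro less.hyps psubset_card_mono) auto
    moreover have "P s" using assms(3) g less.prems unfolding s_def by blast
    moreover have "keys s <= S" "keys (p - s) <= S"
      using less.prems g k by (auto simp: s_def split: if_splits)
    ultimately have "P ((p - s) + s)" by (intro assms(4))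
    then show ?thesis by simp
  qed
qed

definition lin :: "('k::field, 'b, 'e) module_scheme => ('m => 'b) => ('m \<Rightarrow>\<^sub>0 'k) => 'b" where
  "lin M f p = (\<Oplus>\<^bsub>M\<^esub>g\<in>keys p. lookup p g \<odot>\<^bsub>M\<^esub> f g)"

lemma coset_extend_eq_lin: "coset_extend M f Y = lin M f (SOME p. p : Y)"
  by (simp add: coset_extend_def lin_def Let_def)

lemma lookup_map_times [simp]:
  "lookup (Poly_Mapping.map ((*) c) p) x = (c::'k::field) * lookup p x"
  by (simp add: Poly_Mapping.map.rep_eq when_def)

lemma keys_map_times: "keys (Poly_Mapping.map ((*) (c::'k::field)) p) <= keys p"
  by (auto simp: in_keys_iff)

lemma keys_add_subset:
  "keys p <= S ==> keys q <= S ==> keys (p + q) <= S"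
  using keys_add[of p q] by blast

lemma keys_diff_subset:
  "keys p <= S ==> keys q <= S ==> keys (p - q) <= S"
  using keys_diff[of p q] by blast

lemma keys_sum_subset:
  "(!!i. i : J ==> keys (p i) <= S) ==> keys (sum p J) <= S"
  by (induction J rule: infinite_finite_induct) (simp_all add: keys_add_subset)

context kmod
begin

text \<open>Coefficients outside the support are zero, so different combinations can be summed over
  one common index set. This turns additivity into a termwise computation.\<close>

lemma lin_superset:
  assumes "finite T" "keys p <= T" "f : T \<rightarrow> carrier M"
  shows "lin M f p = (\<Oplus>g\<in>T. lookup p g \<odot> f g)"
  unfolding lin_def
  by (rule add.finprod_mono_neutral_cong_left) (use assms in "auto simp: in_keys_iff Pi_iff")

lemma lin_closed [intro]: "f : keys p \<rightarrow> carrier M ==> lin M f p : carrier M"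
  unfolding lin_def by (rule finsum_closed) auto

lemma lin_closed': "f : S \<rightarrow> carrier M ==> keys p <= S ==> lin M f p : carrier M"
  by (rule lin_closed) auto

lemma lin_0 [simp]: "lin M f 0 = \<zero>"
  by (simp add: lin_def)

lemma lin_single [simp]: "f g : carrier M ==> lin M f (single g c) = c \<odot> f g"
  by (cases "c = 0") (simp_all add: lin_def)

lemma lin_add:
  assumes "f : S \<rightarrow> carrier M" "keys p <= S" "keys q <= S"
  shows "lin M f (p + q) = lin M f p \<oplus> lin M f q"
proof -
  let ?T = "keys p Un keys q"
  have f: "f : ?T \<rightarrow> carrier M" using assms by auto
  have "lin M f (p + q) = (\<Oplus>g\<in>?T. lookup (p + q) g \<odot> f g)"
    by (rule lin_superset) (use keys_add[of p q] f in auto)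
  also have "... = (\<Oplus>g\<in>?T. lookup p g \<odot> f g \<oplus> lookup q g \<odot> f g)"
    by (rule finsum_cong') (use f in "auto simp: lookup_add Pi_iff intro!: smult_add_left")
  also have "... = (\<Oplus>g\<in>?T. lookup p g \<odot> f g) \<oplus> (\<Oplus>g\<in>?T. lookup q g \<odot> f g)"
    by (rule finsum_addf) (use f in auto)
  also have "... = lin M f p \<oplus> lin M f q"
    using lin_superset[of ?T p f] lin_superset[of ?T q f] f by simp
  finally show ?thesis .
qed

lemma lin_smult:
  assumes "f : S \<rightarrow> carrier M" "keys p <= S"
  shows "lin M f (Poly_Mapping.map ((*) c) p) = c \<odot> lin M f p"
proof -
  have f: "f : keys p \<rightarrow> carrier M" using assms by auto
  have "lin M f (Poly_Mapping.map ((*) c) p) = (\<Oplus>g\<in>keys p. (c * lookup p g) \<odot> f g)"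
    using lin_superset[of "keys p" "Poly_Mapping.map ((*) c) p" f] f keys_map_times[of c p]
    by simp
  also have "... = c \<odot> lin M f p"
    unfolding lin_def
    by (subst finsum_smult) (use f in "auto intro!: finsum_cong' simp: Pi_iff")
  finally show ?thesis .
qed

lemma lin_diff:
  assumes "f : S \<rightarrow> carrier M" "keys p <= S" "keys q <= S"
  shows "lin M f (p - q) = lin M f p \<oplus> (- 1) \<odot> lin M f q"
proof -
  have "p - q = p + Poly_Mapping.map ((*) (- 1)) q"
    by (rule poly_mapping_eqI) (simp add: lookup_add lookup_minus)
  moreover have "keys (Poly_Mapping.map ((*) (- 1)) q) <= S"
    by (rule order_trans [OF keys_map_times assms(3)])
  ultimately show ?thesis
    using lin_add[OF assms(1,2)] lin_smult[OF assms(1,3)] by metis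
qed

lemma lin_sum:
  assumes "f : S \<rightarrow> carrier M" "finite J" "!!i. i : J ==> keys (p i) <= S"
  shows "lin M f (sum p J) = (\<Oplus>i\<in>J. lin M f (p i))"
  using assms(2,3)
proof (induction J)
  case (insert x J)
  then have "keys (sum p J) <= S" by (intro keys_sum_subset) auto
  then have "lin M f (sum p (insert x J)) = lin M f (p x) \<oplus> lin M f (sum p J)"
    using insert assms(1) by (simp add: lin_add)
  also have "... = (\<Oplus>i\<in>insert x J. lin M f (p i))"
    by (subst finsum_insert) (use insert in "auto intro!: lin_closed'[OF assms(1)]")
  finally show ?case .
qed auto

lemma lin_cong:
  assumes "!!g. g : keys p ==> f g = f' g" "f' : keys p \<rightarrow> carrier M"
  shows "lin M f p = lin M f' p"
  unfolding lin_def by (rule finsum_cong') (use assms in auto)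

lemma linear_map_lin:
  assumes "kmod N" "linear_map M N h" "f : keys p \<rightarrow> carrier M"
  shows "h (lin M f p) = lin N (%g. h (f g)) p"
proof -
  interpret N: kmod N by fact
  let ?S = "keys p"
  note h = linear_mapD[OF assms(2)]
  have hf: "(%g. h (f g)) : ?S \<rightarrow> carrier N" using assms(3) h(1) by auto
  have "keys p <= ?S" by simp
  then show ?thesis
  proof (induction p rule: poly_mapping_induct)
    case zero
    show ?case using linear_map_zero[OF kmod_axioms assms(1,2)] by simp
  next
    case (single g c)
    then have "f g : carrier M" using assms(3) by auto
    then show ?case using h by simp
  next
    case (add p q)
    then show ?case
      using assms(3) hf by (simp add: lin_add[of _ ?S] N.lin_add[of _ ?S] h lin_closed'[of _ ?S])
  qed
qed

end

section \<open>Monoid algebras, quotients and presented algebras\<close>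

lemma monoid_algebra_simps [simp]:
  "carrier (monoid_algebra G) = {p. keys p <= carrier G}"
  "\<one>\<^bsub>monoid_algebra G\<^esub> = single \<one>\<^bsub>G\<^esub> 1"
  "\<zero>\<^bsub>monoid_algebra G\<^esub> = 0"
  "p \<oplus>\<^bsub>monoid_algebra G\<^esub> q = p + q"
  "c \<odot>\<^bsub>monoid_algebra G\<^esub> p = Poly_Mapping.map ((*) c) p"
  by (simp_all add: monoid_algebra_def)

lemma monoid_algebra_mult_superset:
  assumes "finite S" "finite T" "keys p <= S" "keys q <= T"
  shows "p \<otimes>\<^bsub>monoid_algebra G\<^esub> q = (\<Sum>g\<in>S. \<Sum>h\<in>T.
    single (g \<otimes>\<^bsub>G\<^esub> h) (lookup p g * lookup q h))"
proof -
  have "p \<otimes>\<^bsub>monoid_algebra G\<^esub> q = (\<Sum>g\<in>keys p. \<Sum>h\<in>keys q.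
    single (g \<otimes>\<^bsub>G\<^esub> h) (lookup p g * lookup q h))"
    by (simp add: monoid_algebra_def)
  also have "... = (\<Sum>g\<in>S. \<Sum>h\<in>keys q.
    single (g \<otimes>\<^bsub>G\<^esub> h) (lookup p g * lookup q h))"
    by (rule sum.mono_neutral_left) (use assms in "auto simp: in_keys_iff")
  also have "... = (\<Sum>g\<in>S. \<Sum>h\<in>T.
    single (g \<otimes>\<^bsub>G\<^esub> h) (lookup p g * lookup q h))"
    by (intro sum.cong refl sum.mono_neutral_left) (use assms in "auto simp: in_keys_iff")
  finally show ?thesis .
qed

lemma monoid_algebra_mult_single [simp]:
  "single g c \<otimes>\<^bsub>monoid_algebra G\<^esub> single h d =
    single (g \<otimes>\<^bsub>G\<^esub> h) (c * d)"
  by (subst monoid_algebra_mult_superset[of "{g}" "{h}"]) auto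

lemma monoid_algebra_mult_zero [simp]:
  "0 \<otimes>\<^bsub>monoid_algebra G\<^esub> q = 0" "q \<otimes>\<^bsub>monoid_algebra G\<^esub> 0 = 0"
  by (simp_all add: monoid_algebra_def)

lemma monoid_algebra_add_mult:
  "(p + p') \<otimes>\<^bsub>monoid_algebra G\<^esub> q = p \<otimes>\<^bsub>monoid_algebra G\<^esub> q + p' \<otimes>\<^bsub>monoid_algebra G\<^esub> q"
  using keys_add[of p p']
  by (simp add: monoid_algebra_mult_superset[of "keys p Un keys p'" "keys q"]
      lookup_add distrib_right single_add sum.distrib)

lemma monoid_algebra_mult_add:
  "q \<otimes>\<^bsub>monoid_algebra G\<^esub> (p + p') = q \<otimes>\<^bsub>monoid_algebra G\<^esub> p + q \<otimes>\<^bsub>monoid_algebra G\<^esub> p'"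
  using keys_add[of p p']
  by (simp add: monoid_algebra_mult_superset[of "keys q" "keys p Un keys p'"]
      lookup_add distrib_left single_add sum.distrib)

lemma map_times_add:
  "Poly_Mapping.map ((*) (c::'k::field)) (p + q) = Poly_Mapping.map ((*) c) p + Poly_Mapping.map ((*) c) q"
  by (rule poly_mapping_eqI) (simp add: lookup_add distrib_left)

lemma map_times_single:
  "Poly_Mapping.map ((*) (c::'k::field)) (single g d) = single g (c * d)"
  by (rule poly_mapping_eqI) (simp add: lookup_single when_def)

lemma map_times_0 [simp]: "Poly_Mapping.map ((*) (c::'k::field)) 0 = 0"
  by (rule poly_mapping_eqI) simp

lemma kmod_monoid_algebra: "kmod (monoid_algebra G :: ('k::field, 'm \<Rightarrow>\<^sub>0 'k) module)"
  by (rule kmodI)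
    (auto intro!: poly_mapping_eqI simp: lookup_add algebra_simps intro: keys_add_subset
      dest: subsetD[OF keys_map_times] subsetD[OF keys_add])

lemma (in Group.monoid) kalgebra_monoid_algebra:
  "kalgebra (monoid_algebra G :: ('k::field, 'a \<Rightarrow>\<^sub>0 'k) module)"
proof (rule kalgebraI)
  let ?A = "monoid_algebra G :: ('k, 'a \<Rightarrow>\<^sub>0 'k) module"
  note distr = monoid_algebra_add_mult monoid_algebra_mult_add map_times_add map_times_single
  show "kmod ?A" by (rule kmod_monoid_algebra)
  show "\<one>\<^bsub>?A\<^esub> : carrier ?A" by auto
  show "p \<otimes>\<^bsub>?A\<^esub> q : carrier ?A" if "p : carrier ?A" "q : carrier ?A" for p q
  proof -
    have "keys p <= carrier G" "keys q <= carrier G" using that by auto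
    then show ?thesis
      by (subst monoid_algebra_mult_superset[of "keys p" "keys q"])
        (auto intro!: keys_sum_subset dest!: subsetD split: if_splits)
  qed
  show "(p \<otimes>\<^bsub>?A\<^esub> q) \<otimes>\<^bsub>?A\<^esub> r = p \<otimes>\<^bsub>?A\<^esub> (q \<otimes>\<^bsub>?A\<^esub> r)"
    if "p : carrier ?A" "q : carrier ?A" "r : carrier ?A" for p q r
  proof -
    have p: "keys p <= carrier G" and q: "keys q <= carrier G"
      and r: "keys r <= carrier G" using that by auto
    \<comment> \<open>Associativity is trilinear: the arguments are reduced to monomials one at a
      time, from the rightmost to the leftmost.\<close>
    have 1: "(single g c \<otimes>\<^bsub>?A\<^esub> single h d) \<otimes>\<^bsub>?A\<^esub> r =
      single g c \<otimes>\<^bsub>?A\<^esub> (single h d \<otimes>\<^bsub>?A\<^esub> r)"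
      if "g : carrier G" "h : carrier G" for g h c d
      using r by (induction r rule: poly_mapping_induct) (use that in "simp_all add: distr m_assoc mult.assoc")
    have 2: "(single g c \<otimes>\<^bsub>?A\<^esub> q) \<otimes>\<^bsub>?A\<^esub> r = single g c \<otimes>\<^bsub>?A\<^esub> (q \<otimes>\<^bsub>?A\<^esub> r)"
      if "g : carrier G" for g c
      using q by (induction q rule: poly_mapping_induct)
        (use that 1 in "simp_all add: distr del: monoid_algebra_mult_single")
    show ?thesis
      using p by (induction p rule: poly_mapping_induct) (use 2 in "simp_all add: distr")
  qed
  show "\<one>\<^bsub>?A\<^esub> \<otimes>\<^bsub>?A\<^esub> p = p" if "p : carrier ?A" for p
  proof -
    have "keys p <= carrier G" using that by simp
    then show ?thesis by (induction p rule: poly_mapping_induct) (simp_all add: distr)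
  qed
  show "p \<otimes>\<^bsub>?A\<^esub> \<one>\<^bsub>?A\<^esub> = p" if "p : carrier ?A" for p
  proof -
    have "keys p <= carrier G" using that by simp
    then show ?thesis by (induction p rule: poly_mapping_induct) (simp_all add: distr)
  qed
  have 3: "(c \<odot>\<^bsub>?A\<^esub> single g d) \<otimes>\<^bsub>?A\<^esub> q = c \<odot>\<^bsub>?A\<^esub> (single g d \<otimes>\<^bsub>?A\<^esub> q)
      & single g d \<otimes>\<^bsub>?A\<^esub> (c \<odot>\<^bsub>?A\<^esub> q) = c \<odot>\<^bsub>?A\<^esub> (single g d \<otimes>\<^bsub>?A\<^esub> q)"
    if q: "keys q <= UNIV" for c g d q
    using q by (induction q rule: poly_mapping_induct) (simp_all add: distr mult.assoc mult.left_commute)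
  show "(c \<odot>\<^bsub>?A\<^esub> p) \<otimes>\<^bsub>?A\<^esub> q = c \<odot>\<^bsub>?A\<^esub> (p \<otimes>\<^bsub>?A\<^esub> q)" for c p q
  proof -
    have "keys p <= UNIV" by simp
    then show ?thesis by (induction p rule: poly_mapping_induct) (use 3 in "simp_all add: distr")
  qed
  show "p \<otimes>\<^bsub>?A\<^esub> (c \<odot>\<^bsub>?A\<^esub> q) = c \<odot>\<^bsub>?A\<^esub> (p \<otimes>\<^bsub>?A\<^esub> q)" for c p q
  proof -
    have "keys p <= UNIV" by simp
    then show ?thesis by (induction p rule: poly_mapping_induct) (use 3 in "simp_all add: distr")
  qed
qed (auto simp: monoid_algebra_add_mult monoid_algebra_mult_add)

lemma (in kmod) lin_mult:
  assumes "Group.monoid G" "f : carrier G \<rightarrow> carrier M"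
    "keys p <= carrier G" "keys q <= carrier G"
  shows "lin M f (p \<otimes>\<^bsub>monoid_algebra G\<^esub> q) = lin M (%g. lin M (%h. f (g \<otimes>\<^bsub>G\<^esub> h)) q) p"
proof -
  interpret G: Group.monoid G by fact
  interpret MA: kalg "monoid_algebra G :: ('k, _) module"
    by (rule kalg.intro) (rule G.kalgebra_monoid_algebra)
  have f1: "(%h. f (g \<otimes>\<^bsub>G\<^esub> h)) : carrier G \<rightarrow> carrier M" if "g : carrier G" for g
    using that assms(2) by auto
  have c: "keys (p \<otimes>\<^bsub>monoid_algebra G\<^esub> q) <= carrier G"
    if "keys p <= carrier G" "keys q <= carrier G" for p q :: "_ \<Rightarrow>\<^sub>0 'k"
    using MA.m_closed[of p q] that by simp
  have cl: "lin M (%h. f (g \<otimes>\<^bsub>G\<^esub> h)) q : carrier M"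
    if "g : carrier G" "keys q <= carrier G" for g q
    using f1[OF that(1)] that(2) by (rule lin_closed')
  have 1: "lin M f (single g c \<otimes>\<^bsub>monoid_algebra G\<^esub> q) = c \<odot> lin M (%h. f (g \<otimes>\<^bsub>G\<^esub> h)) q"
    if g: "g : carrier G" for g c
    using assms(4)
  proof (induction q rule: poly_mapping_induct)
    case zero then show ?case by simp
  next
    case (single h d)
    then have "f (g \<otimes>\<^bsub>G\<^esub> h) : carrier M" using f1[OF g] by auto
    then show ?case by simp
  next
    case (add r s)
    moreover have "keys (single g c) <= carrier G" using g by auto
    ultimately show ?case
      by (simp add: monoid_algebra_mult_add lin_add[OF assms(2)] lin_add[OF f1[OF g]] c
          smult_add_right cl[OF g])
  qed
  have 2: "(%g. lin M (%h. f (g \<otimes>\<^bsub>G\<^esub> h)) q) : carrier G \<rightarrow> carrier M"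
    using cl assms(4) by auto
  show ?thesis
    using assms(3)
  proof (induction p rule: poly_mapping_induct)
    case zero then show ?case by simp
  next
    case (single g d)
    then show ?case using 1 2 cl assms(4) by simp
  next
    case (add r s)
    then show ?case
      by (simp add: monoid_algebra_add_mult lin_add[OF assms(2)] lin_add[OF 2] c assms(4))
  qed
qed

text \<open>The algebra axioms are identities, and additive inverses come from scaling, so
  everything passes to a surjective image. The case of interest is the projection onto
  cosets.\<close>

lemma kalgebra_image:
  fixes A :: "('k::field, 'a, 'e) module_scheme" (structure)
  assumes "kalgebra A" "carrier B = h ` carrier A" "\<one>\<^bsub>B\<^esub> = h \<one>" "\<zero>\<^bsub>B\<^esub> = h \<zero>"
    "!!x y. x : carrier A ==> y : carrier A ==> h x \<oplus>\<^bsub>B\<^esub> h y = h (x \<oplus> y)"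
    "!!x y. x : carrier A ==> y : carrier A ==> h x \<otimes>\<^bsub>B\<^esub> h y = h (x \<otimes> y)"
    "!!c x. x : carrier A ==> c \<odot>\<^bsub>B\<^esub> h x = h (c \<odot> x)"
  shows "kalgebra B"
proof -
  interpret kalg A by (rule kalg.intro) fact
  note ops = assms(5-7)
  have "kmod B"
  proof (rule kmodI, unfold assms(2), goal_cases)
    case 3 then show ?case by (auto simp: ops a_assoc)
  next
    case 4 then show ?case by (auto simp: ops a_comm)
  next
    case 7 then show ?case by (auto simp: ops smult_add_left)
  next
    case 8 then show ?case by (auto simp: ops smult_add_right)
  qed (auto simp: assms(3,4) ops)
  then show ?thesis
  proof (rule kalgebraI, unfold assms(2), goal_cases)
    case 3 then show ?case by (auto simp: ops m_assoc)
  next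
    case 6 then show ?case by (auto simp: ops l_distr)
  next
    case 7 then show ?case by (auto simp: ops r_distr)
  qed (auto simp: assms(3,4) ops)
qed

locale kideal = kalg A + ideal N A for A :: "('k::field, 'a, 'e) module_scheme" (structure) and N
begin

abbreviation Q where "Q == quotient_algebra A N"

text \<open>Scaling is multiplication by \<open>c \<odot> \<one>\<close>, so a ring ideal of an
  algebra is a subspace.\<close>

lemma smult_in_ideal: "x : N ==> c \<odot> x : N"
  using I_l_closed[of x "c \<odot> \<one>"] by simp

lemma quotient_simps:
  "carrier Q = {N +> x | x. x : carrier A}" "\<one>\<^bsub>Q\<^esub> = N +> \<one>" "\<zero>\<^bsub>Q\<^esub> = N +> \<zero>"
  by (auto simp: quotient_algebra_def ring.extend_def module.fields_def FactRing_simps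
      a_coset_add_zero[OF a_subset])

lemma quotient_ops:
  assumes "x : carrier A" "y : carrier A"
  shows "(N +> x) \<oplus>\<^bsub>Q\<^esub> (N +> y) = N +> (x \<oplus> y)" (is ?t2) "(N +> x) \<otimes>\<^bsub>Q\<^esub> (N +> y) = N +> (x \<otimes> y)" (is ?t1)
    "c \<odot>\<^bsub>Q\<^esub> (N +> x) = N +> (c \<odot> x)"
proof -
  show ?t2
    using assms by (simp add: quotient_algebra_def ring.extend_def module.fields_def FactRing_simps a_rcos_sum)
  show ?t1
    using assms by (simp add: quotient_algebra_def ring.extend_def module.fields_def FactRing_simps rcoset_mult_add)
  \<comment> \<open>Every representative yields the same coset, so the union that defines scalar
    multiplication in the quotient is a single coset.\<close>
  have "N +> (c \<odot> y') = N +> (c \<odot> x)" if y: "y' : N +> x" for y'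
  proof -
    obtain n where n: "n : N" "y' = n \<oplus> x"
      using y by (auto simp: a_r_coset_def')
    then have "c \<odot> y' = c \<odot> n \<oplus> c \<odot> x" using assms by (simp add: smult_add_right)
    then have "c \<odot> y' : N +> (c \<odot> x)"
      using n smult_in_ideal by (auto simp: a_r_coset_def')
    then show ?thesis
      using a_repr_independence' assms(1) smult_closed by metis
  qed
  moreover have "x : N +> x" using assms by (simp add: a_rcos_self)
  ultimately have "(\<Union>y'\<in>N +> x. N +> (c \<odot> y')) = N +> (c \<odot> x)"
    by blast
  then show "c \<odot>\<^bsub>Q\<^esub> (N +> x) = N +> (c \<odot> x)"
    by (simp add: quotient_algebra_def ring.extend_def module.fields_def)
qed

lemma quotient_eq_iff:
  "x : carrier A ==> y : carrier A ==> N +> x = N +> y \<longleftrightarrow> x \<ominus> y : N"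
  using quotient_eq_iff_same_a_r_cos[OF is_ideal] by blast

lemma quotient_zero_iff: "x : carrier A ==> N +> x = \<zero>\<^bsub>Q\<^esub> \<longleftrightarrow> x : N"
  using quotient_eq_iff[of x \<zero>] by (simp add: quotient_simps minus_eq)

lemma kalgebra_quotient: "kalgebra Q"
  by (rule kalgebra_image [OF is_kalgebra, of _ "(+>) N"]) (auto simp: quotient_simps quotient_ops)

lemma algebra_hom_quotient: "algebra_hom A Q ((+>) N)"
  by (intro algebra_homI linear_mapI) (auto simp: quotient_simps quotient_ops)

end

text \<open>The elements killed by \<open>f\<close> when surrounded by any two monomials form a
  two-sided ideal, the set \<open>Z\<close> of the proof. Once \<open>Z\<close> contains
  \<open>R\<close> it contains the ideal generated by \<open>R\<close>; surrounding by units shows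
  that \<open>Z\<close> lies in the kernel of \<open>lin M f\<close>.\<close>

lemma (in kmod) lin_vanishes_on_ideal:
  assumes "Group.monoid G" "R <= carrier (monoid_algebra G)" "f : carrier G \<rightarrow> carrier M"
    and van: "!!r a b. r : R ==> a : carrier G ==> b : carrier G ==>
      lin M (%g. f (a \<otimes>\<^bsub>G\<^esub> g \<otimes>\<^bsub>G\<^esub> b)) r = \<zero>"
    and "p : Idl\<^bsub>monoid_algebra G\<^esub> R"
  shows "lin M f p = \<zero>"
proof -
  interpret G: Group.monoid G by fact
  interpret MA: kalg "monoid_algebra G :: ('k, _) module"
    by (rule kalg.intro) (rule G.kalgebra_monoid_algebra)
  define Z where "Z = {p : carrier (monoid_algebra G).
    ALL a:carrier G. ALL b:carrier G. lin M (%g. f (a \<otimes>\<^bsub>G\<^esub> g \<otimes>\<^bsub>G\<^esub> b)) p = \<zero>}"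
  have F: "(%g. f (a \<otimes>\<^bsub>G\<^esub> g \<otimes>\<^bsub>G\<^esub> b)) : carrier G \<rightarrow> carrier M"
    if "a : carrier G" "b : carrier G" for a b using that assms(3) by auto
  have "ideal Z (monoid_algebra G)"
  proof (rule idealI)
    show "ring (monoid_algebra G :: ('k, _) module)" by (rule MA.ring_axioms)
    show "subgroup Z (add_monoid (monoid_algebra G))"
    proof (rule MA.add.subgroupI)
      have "0 : Z" by (simp add: Z_def)
      then show "Z ~= {}" by blast
      fix p assume p: "p : Z"
      then have e: "\<ominus>\<^bsub>monoid_algebra G\<^esub> p = 0 - p"
        using MA.minus_equality[of "0 - p" p] by (simp add: Z_def)
      have "keys (0 - p) <= carrier G"
        using p by (intro keys_diff_subset) (auto simp: Z_def)
      then show "\<ominus>\<^bsub>monoid_algebra G\<^esub> p : Z"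
        unfolding e using p by (simp add: Z_def lin_diff[OF F] del: diff_0)
    next
      fix p q assume "p : Z" "q : Z"
      then show "p \<oplus>\<^bsub>monoid_algebra G\<^esub> q : Z"
        by (auto simp: Z_def lin_add[OF F] dest: subsetD[OF keys_add])
    qed (auto simp: Z_def)
    fix p x :: "_ \<Rightarrow>\<^sub>0 'k" assume p: "p : Z" and x: "x : carrier (monoid_algebra G)"
    show "x \<otimes>\<^bsub>monoid_algebra G\<^esub> p : Z"
    proof -
      have "lin M (%g. f (a \<otimes>\<^bsub>G\<^esub> g \<otimes>\<^bsub>G\<^esub> b)) (x \<otimes>\<^bsub>monoid_algebra G\<^esub> p) = \<zero>"
        if ab: "a : carrier G" "b : carrier G" for a b
      proof -
        have "lin M (%g. f (a \<otimes>\<^bsub>G\<^esub> g \<otimes>\<^bsub>G\<^esub> b)) (x \<otimes>\<^bsub>monoid_algebra G\<^esub> p)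
          = lin M (%g. lin M (%h. f (a \<otimes>\<^bsub>G\<^esub> (g \<otimes>\<^bsub>G\<^esub> h) \<otimes>\<^bsub>G\<^esub> b)) p) x"
          by (rule lin_mult[OF assms(1) F[OF ab]]) (use p x in "auto simp: Z_def")
        also have "... = lin M (%g. \<zero>) x"
        proof (rule lin_cong)
          fix g assume "g : keys x"
          then have g: "g : carrier G" using x by auto
          have "lin M (%h. f (a \<otimes>\<^bsub>G\<^esub> (g \<otimes>\<^bsub>G\<^esub> h) \<otimes>\<^bsub>G\<^esub> b)) p = lin M (%h. f ((a \<otimes>\<^bsub>G\<^esub> g) \<otimes>\<^bsub>G\<^esub> h \<otimes>\<^bsub>G\<^esub> b)) p"
            by (rule lin_cong) (use p g ab assms(3) in "auto simp: Z_def G.m_assoc subset_iff")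
          then show "lin M (%h. f (a \<otimes>\<^bsub>G\<^esub> (g \<otimes>\<^bsub>G\<^esub> h) \<otimes>\<^bsub>G\<^esub> b)) p = \<zero>"
            using p g ab by (simp add: Z_def)
        qed auto
        also have "... = \<zero>" by (simp add: lin_def)
        finally show ?thesis .
      qed
      then show ?thesis using MA.m_closed[OF x, of p] p unfolding Z_def by blast
    qed
    show "p \<otimes>\<^bsub>monoid_algebra G\<^esub> x : Z"
    proof -
      have "lin M (%g. f (a \<otimes>\<^bsub>G\<^esub> g \<otimes>\<^bsub>G\<^esub> b)) (p \<otimes>\<^bsub>monoid_algebra G\<^esub> x) = \<zero>"
        if ab: "a : carrier G" "b : carrier G" for a b
        using x[unfolded monoid_algebra_simps mem_Collect_eq]
      proof (induction x rule: poly_mapping_induct)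
        case zero then show ?case by simp
      next
        case (single h c)
        have "lin M (%g. f (a \<otimes>\<^bsub>G\<^esub> g \<otimes>\<^bsub>G\<^esub> b)) (p \<otimes>\<^bsub>monoid_algebra G\<^esub> single h c)
          = lin M (%g. lin M (%h. f (a \<otimes>\<^bsub>G\<^esub> (g \<otimes>\<^bsub>G\<^esub> h) \<otimes>\<^bsub>G\<^esub> b)) (single h c)) p"
          by (rule lin_mult[OF assms(1) F[OF ab]]) (use p single in "auto simp: Z_def")
        also have "... = lin M (%g. c \<odot> f (a \<otimes>\<^bsub>G\<^esub> g \<otimes>\<^bsub>G\<^esub> (h \<otimes>\<^bsub>G\<^esub> b))) p"
        proof (rule lin_cong)
          fix g assume "g : keys p"
          then have g: "g : carrier G" using p by (auto simp: Z_def)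
          have "f (a \<otimes>\<^bsub>G\<^esub> (g \<otimes>\<^bsub>G\<^esub> h) \<otimes>\<^bsub>G\<^esub> b) : carrier M" using g ab single assms(3) by auto
          then show "lin M (%h. f (a \<otimes>\<^bsub>G\<^esub> (g \<otimes>\<^bsub>G\<^esub> h) \<otimes>\<^bsub>G\<^esub> b)) (single h c) =
              c \<odot> f (a \<otimes>\<^bsub>G\<^esub> g \<otimes>\<^bsub>G\<^esub> (h \<otimes>\<^bsub>G\<^esub> b))"
            using g ab single by (simp add: G.m_assoc)
        next
          show "(%g. c \<odot> f (a \<otimes>\<^bsub>G\<^esub> g \<otimes>\<^bsub>G\<^esub> (h \<otimes>\<^bsub>G\<^esub> b))) : keys p \<rightarrow> carrier M"
            using ab single assms(3) p by (auto simp: Z_def subset_iff intro!: smult_closed)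
        qed
        also have "... = c \<odot> lin M (%g. f (a \<otimes>\<^bsub>G\<^esub> g \<otimes>\<^bsub>G\<^esub> (h \<otimes>\<^bsub>G\<^esub> b))) p"
          by (rule linear_map_lin [OF kmod_axioms, of "%y. c \<odot> y", symmetric])
            (use ab single assms(3) p in "auto simp: Z_def subset_iff smult_add_right mult.commute intro!: linear_mapI")
        also have "... = \<zero>" using p ab single by (simp add: Z_def)
        finally show ?case .
      next
        case (add r s)
        then show ?case
          using MA.m_closed[of p r] MA.m_closed[of p s] p ab
          by (simp add: monoid_algebra_mult_add lin_add[OF F[OF ab]] Z_def)
      qed
      then show ?thesis using MA.m_closed[of p x] p x unfolding Z_def by blast
    qed
  qed
  moreover have "R <= Z" using van assms(2) by (auto simp: Z_def)
  ultimately have "Idl\<^bsub>monoid_algebra G\<^esub> R <= Z" by (rule MA.genideal_minimal)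
  then have p: "p : Z" using assms(5) by auto
  have "lin M f p = lin M (%g. f (\<one>\<^bsub>G\<^esub> \<otimes>\<^bsub>G\<^esub> g \<otimes>\<^bsub>G\<^esub> \<one>\<^bsub>G\<^esub>)) p"
    by (rule lin_cong) (use p assms(3) in "auto simp: Z_def subset_iff")
  then show ?thesis using p by (simp add: Z_def)
qed

text \<open>The choice of representative hidden in \<open>coset_extend\<close> is harmless once the
  linear extension kills the ideal.\<close>

lemma (in kmod) coset_extend_coset:
  assumes "Group.monoid G" "ideal N (monoid_algebra G)" "f : carrier G \<rightarrow> carrier M"
    and "!!p. p : N ==> lin M f p = \<zero>"
    and p: "keys p <= carrier G"
  shows "coset_extend M f (N +>\<^bsub>monoid_algebra G\<^esub> p) = lin M f p"
proof -
  interpret N: ideal N "monoid_algebra G" by fact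
  have "lin M f q = lin M f p" if q: "q : N +>\<^bsub>monoid_algebra G\<^esub> p" for q
  proof -
    obtain n where n: "n : N" "q = n + p"
      using q by (auto simp: a_r_coset_def')
    moreover have "keys n <= carrier G" using N.a_subset n by auto
    ultimately show ?thesis
      using p assms(3,4) by (simp add: lin_add[OF assms(3)] lin_closed'[OF assms(3)])
  qed
  moreover have "p : N +>\<^bsub>monoid_algebra G\<^esub> p" using p N.a_rcos_self[of p] by simp
  ultimately show ?thesis
    unfolding coset_extend_eq_lin by (metis someI_ex)
qed

subsection \<open>Presented algebras\<close>

lemma monoid_word_monoid: "Group.monoid (word_monoid gs)"
  by (rule monoidI) (auto simp: word_monoid_def)

lemma word_monoid_simps [simp]:
  "carrier (word_monoid gs) = lists gs" "u \<otimes>\<^bsub>word_monoid gs\<^esub> v = u @ v" "\<one>\<^bsub>word_monoid gs\<^esub> = []"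
  by (simp_all add: word_monoid_def)

definition word_value :: "('k, 'b, 'e) module_scheme => ('g => 'b) => 'g list => 'b" where
  "word_value B f w = foldr (%x y. f x \<otimes>\<^bsub>B\<^esub> y) w \<one>\<^bsub>B\<^esub>"

lemma word_value_simps [simp]:
  "word_value B f [] = \<one>\<^bsub>B\<^esub>" "word_value B f (x # w) = f x \<otimes>\<^bsub>B\<^esub> word_value B f w"
  by (simp_all add: word_value_def)

lemma generator_extend_eq: "generator_extend B f = coset_extend B (word_value B f)"
  by (rule ext) (simp add: generator_extend_def word_value_def[abs_def])

context kalg
begin

lemma word_value_closed: "f : gs \<rightarrow> carrier A ==> w : lists gs ==> word_value A f w : carrier A"
  by (induction w) auto

lemma word_value_append:
  "f : gs \<rightarrow> carrier A ==> u : lists gs ==> v : lists gs ==>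
    word_value A f (u @ v) = word_value A f u \<otimes> word_value A f v"
  by (induction u) (auto simp: word_value_closed m_assoc Pi_iff)

lemma word_value_replicate: "f x : carrier A ==> word_value A f (replicate n x) = f x [^] n"
  by (induction n) (simp_all, metis nat_pow_Suc nat_pow_Suc2)

end

locale presented =
  fixes gs :: "'g set" and R :: "('g list \<Rightarrow>\<^sub>0 'k::field) set"
  assumes rels_closed: "R <= carrier (free_algebra gs)"
begin

abbreviation F where "F == (free_algebra gs :: ('k, 'g list \<Rightarrow>\<^sub>0 'k) module)"
abbreviation W where "W == presented_algebra gs R"
abbreviation cls where "cls == pclass gs R"

interpretation F: kideal F "Idl\<^bsub>F\<^esub> R"
proof -
  interpret kalg F by (rule kalg.intro) (rule monoid.kalgebra_monoid_algebra[OF monoid_word_monoid])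
  show "kideal F (Idl\<^bsub>F\<^esub> R)"
    using genideal_ideal[OF rels_closed] kalg_axioms by (intro kideal.intro)
qed

lemma W_def: "W = quotient_algebra F (Idl\<^bsub>F\<^esub> R)" by (simp add: presented_algebra_def)

lemma kalgebra_presented: "kalgebra W"
  unfolding W_def by (rule F.kalgebra_quotient)

sublocale W: kalg W by (rule kalg.intro) (rule kalgebra_presented)

lemma algebra_hom_cls: "algebra_hom F W cls"
  unfolding W_def pclass_def using F.algebra_hom_quotient by simp

lemma carrier_presented: "carrier W = cls ` {p. keys p <= lists gs}"
  by (auto simp: W_def pclass_def F.quotient_simps)

lemma presented_cases:
  assumes "x : carrier W" obtains p where "keys p <= lists gs" "x = cls p"
  using assms carrier_presented by auto

definition gen where "gen g = cls (single [g] 1)"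

lemma gen_closed [simp, intro]: "g : gs ==> gen g : carrier W"
  by (auto simp: gen_def carrier_presented)

lemma gen_funcset: "gen : gs \<rightarrow> carrier W" by auto

lemma cls_eq_zero_iff: "keys p <= lists gs ==> cls p = \<zero>\<^bsub>W\<^esub> \<longleftrightarrow> p : Idl\<^bsub>F\<^esub> R"
  using F.quotient_zero_iff[of p] by (simp add: W_def pclass_def)

lemma cls_single_one: "w : lists gs ==> cls (single w 1) = word_value W gen w"
proof (induction w)
  case Nil
  show ?case using algebra_homD(2)[OF algebra_hom_cls] by simp
next
  case (Cons g w)
  have "cls (single [g] 1 \<otimes>\<^bsub>F\<^esub> single w 1) =
      cls (single [g] 1) \<otimes>\<^bsub>W\<^esub> cls (single w 1)"
    by (rule algebra_homD(4)[OF algebra_hom_cls]) (use Cons in auto)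
  then show ?case using Cons by (simp add: gen_def)
qed

lemma cls_eq_lin:
  assumes "keys p <= lists gs"
  shows "cls p = lin W (word_value W gen) p"
  using assms
proof (induction p rule: poly_mapping_induct)
  case zero
  show ?case using linear_map_zero[OF F.kmod_axioms W.kmod_axioms] algebra_homD(1)[OF algebra_hom_cls] by simp
next
  case (single w c)
  have "cls (c \<odot>\<^bsub>F\<^esub> single w 1) = c \<odot>\<^bsub>W\<^esub> cls (single w 1)"
    by (rule algebra_homD(6)[OF algebra_hom_cls]) (use single in auto)
  then show ?case
    using single by (simp add: map_times_single cls_single_one W.word_value_closed[OF gen_funcset])
next
  case (add p q)
  have wf: "word_value W gen : lists gs \<rightarrow> carrier W" by (auto simp: W.word_value_closed[OF gen_funcset])
  have "cls (p \<oplus>\<^bsub>F\<^esub> q) = cls p \<oplus>\<^bsub>W\<^esub> cls q"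
    by (rule algebra_homD(5)[OF algebra_hom_cls]) (use add in auto)
  then show ?case using add W.lin_add[OF wf] by simp
qed

lemma cls_single: "w : lists gs ==> cls (single w c) = c \<odot>\<^bsub>W\<^esub> word_value W gen w"
  using cls_eq_lin[of "single w c"] by (simp add: W.word_value_closed[OF gen_funcset])

lemma relation_holds: "r : R ==> lin W (word_value W gen) r = \<zero>\<^bsub>W\<^esub>"
  using cls_eq_lin[of r] cls_eq_zero_iff[of r] rels_closed F.genideal_self[OF rels_closed]
  by (metis mem_Collect_eq monoid_algebra_simps(1) subsetD word_monoid_simps(1))

context
  fixes B :: "('k, 'b, 'e) module_scheme" and f
  assumes B: "kalgebra B" and f: "f : gs \<rightarrow> carrier B"
    and rels: "!!r. r : R ==> lin B (word_value B f) r = \<zero>\<^bsub>B\<^esub>"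
begin

interpretation B: kalg B by (rule kalg.intro) (rule B)

lemma word_value_funcset: "word_value B f : lists gs \<rightarrow> carrier B"
  by (auto simp: B.word_value_closed[OF f])

text \<open>Evaluation of words is multiplicative: a relator with value zero keeps value zero
  between two words, which is what \<open>lin_vanishes_on_ideal\<close> asks for. This is the
  existence half of the universal property.\<close>

lemma generator_extend_cls:
  assumes "keys p <= lists gs"
  shows "generator_extend B f (cls p) = lin B (word_value B f) p"
proof -
  have "lin B (word_value B f) p = \<zero>\<^bsub>B\<^esub>" if "p : Idl\<^bsub>F\<^esub> R" for p
  proof (rule B.lin_vanishes_on_ideal[OF monoid_word_monoid rels_closed _ _ that])
    fix r a b assume r: "r : R" and "a : carrier (word_monoid gs)" "b : carrier (word_monoid gs)"
    then have ab: "a : lists gs" "b : lists gs" by auto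
    note v = B.word_value_closed[OF f]
    have va: "word_value B f a : carrier B" and vb: "word_value B f b : carrier B" using v ab by auto
    have k: "keys r <= lists gs" using r rels_closed by auto
    have "lin B (%g. word_value B f (a @ g @ b)) r =
      lin B (%g. word_value B f a \<otimes>\<^bsub>B\<^esub> word_value B f g \<otimes>\<^bsub>B\<^esub> word_value B f b) r"
      by (rule B.lin_cong) (use k ab v in "auto simp: B.word_value_append[OF f] B.m_assoc subset_iff")
    also have "... = word_value B f a \<otimes>\<^bsub>B\<^esub> lin B (word_value B f) r \<otimes>\<^bsub>B\<^esub> word_value B f b"
      by (rule B.linear_map_lin[OF B.kmod_axioms, where h = "%y. word_value B f a \<otimes>\<^bsub>B\<^esub> y \<otimes>\<^bsub>B\<^esub> word_value B f b", symmetric])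
        (use va vb v k in "auto simp: B.l_distr B.r_distr subset_iff simp del: in_lists_conv_set intro!: linear_mapI")
    also have "... = \<zero>\<^bsub>B\<^esub>" using rels[OF r] va vb by simp
    finally show "lin B (%g. word_value B f (a \<otimes>\<^bsub>word_monoid gs\<^esub> g \<otimes>\<^bsub>word_monoid gs\<^esub> b)) r = \<zero>\<^bsub>B\<^esub>"
      by simp
  qed (use word_value_funcset in auto)
  then show ?thesis
    unfolding generator_extend_eq pclass_def
    by (intro B.coset_extend_coset[OF monoid_word_monoid F.is_ideal])
      (use word_value_funcset assms in auto)
qed

lemma generator_extend_gen: "g : gs ==> generator_extend B f (gen g) = f g"
  unfolding gen_def using f by (subst generator_extend_cls) (auto simp: Pi_iff)

lemma generator_extend_hom: "algebra_hom W B (generator_extend B f)"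
proof (intro algebra_homI linear_mapI)
  note hom = algebra_homD[OF algebra_hom_cls]
  note wf = word_value_funcset
  fix x y assume xy: "x : carrier W" "y : carrier W"
  obtain p where p: "keys p <= lists gs" "x = cls p" using presented_cases xy by metis
  obtain q where q: "keys q <= lists gs" "y = cls q" using presented_cases xy by metis
  have c: "lin B (word_value B f) p : carrier B" "lin B (word_value B f) q : carrier B"
    using p q B.lin_closed'[OF wf] by auto
  show "generator_extend B f x : carrier B"
    using p c by (simp add: generator_extend_cls)
  have "x \<oplus>\<^bsub>W\<^esub> y = cls (p + q)" using hom(5)[of p q] p q by simp
  then show "generator_extend B f (x \<oplus>\<^bsub>W\<^esub> y) = generator_extend B f x \<oplus>\<^bsub>B\<^esub> generator_extend B f y"
    using p q by (simp add: generator_extend_cls keys_add_subset B.lin_add[OF wf])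
  fix c
  have "c \<odot>\<^bsub>W\<^esub> x = cls (Poly_Mapping.map ((*) c) p)" using hom(6)[of p c] p by simp
  moreover have "keys (Poly_Mapping.map ((*) c) p) <= lists gs"
    by (rule order_trans[OF keys_map_times p(1)])
  ultimately show "generator_extend B f (c \<odot>\<^bsub>W\<^esub> x) = c \<odot>\<^bsub>B\<^esub> generator_extend B f x"
    using p by (simp add: generator_extend_cls B.lin_smult[OF wf])
  have "x \<otimes>\<^bsub>W\<^esub> y = cls (p \<otimes>\<^bsub>F\<^esub> q)" using hom(4)[of p q] p q by simp
  note m1 = this
  have m2: "keys (p \<otimes>\<^bsub>F\<^esub> q) <= lists gs"
    using F.m_closed[of p q] p q by simp
  have "lin B (word_value B f) (p \<otimes>\<^bsub>F\<^esub> q) =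
      lin B (%g. lin B (%h. word_value B f (g @ h)) q) p"
    using B.lin_mult[OF monoid_word_monoid, of "word_value B f" gs p q] wf p q by simp
  also have "... = lin B (%g. word_value B f g \<otimes>\<^bsub>B\<^esub> lin B (word_value B f) q) p"
  proof (rule B.lin_cong)
    fix g assume "g : keys p"
    then have g: "g : lists gs" using p by auto
    have wg: "word_value B f g : carrier B" using g wf by blast
    have "lin B (%h. word_value B f (g @ h)) q = lin B (%h. word_value B f g \<otimes>\<^bsub>B\<^esub> word_value B f h) q"
      by (rule B.lin_cong) (use g q wf in "auto simp: B.word_value_append[OF f] subset_iff Pi_iff")
    also have "... = word_value B f g \<otimes>\<^bsub>B\<^esub> lin B (word_value B f) q"
      by (rule B.linear_map_lin[OF B.kmod_axioms, symmetric])
        (use wg q wf in "auto simp: B.r_distr subset_iff Pi_iff simp del: in_lists_conv_set intro!: linear_mapI")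
    finally show "lin B (%h. word_value B f (g @ h)) q = word_value B f g \<otimes>\<^bsub>B\<^esub> lin B (word_value B f) q" .
  qed (use p c wf in "auto simp: subset_iff Pi_iff")
  also have "... = lin B (word_value B f) p \<otimes>\<^bsub>B\<^esub> lin B (word_value B f) q"
    by (rule B.linear_map_lin[OF B.kmod_axioms, where h = "%y. y \<otimes>\<^bsub>B\<^esub> lin B (word_value B f) q", symmetric])
      (use p c wf in "auto simp: B.l_distr subset_iff Pi_iff intro!: linear_mapI")
  finally show "generator_extend B f (x \<otimes>\<^bsub>W\<^esub> y) = generator_extend B f x \<otimes>\<^bsub>B\<^esub> generator_extend B f y"
    using p q m1 m2 by (simp add: generator_extend_cls)
next
  have "generator_extend B f (cls (single [] 1)) = \<one>\<^bsub>B\<^esub>"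
    by (subst generator_extend_cls) auto
  then show "generator_extend B f \<one>\<^bsub>W\<^esub> = \<one>\<^bsub>B\<^esub>"
    by (simp add: cls_single_one)
qed

end

text \<open>Linearity and multiplicativity determine a homomorphism by its values on single letters:
  the uniqueness half of the universal property.\<close>

lemma presented_hom_eqI:
  assumes "kalgebra B" "algebra_hom W B h" "algebra_hom W B h'"
    "!!g. g : gs ==> h (gen g) = h' (gen g)" and x: "x : carrier W"
  shows "h x = h' x"
proof -
  interpret B: kalg B by (rule kalg.intro) fact
  obtain p where p: "keys p <= lists gs" "x = cls p" using presented_cases[OF x] .
  have w: "word_value W gen w : carrier W" if "w : lists gs" for w
    using that W.word_value_closed[OF gen_funcset] by simp
  have eq: "h (word_value W gen w) = h' (word_value W gen w)" if "w : lists gs" for w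
    using that
  proof (induction w)
    case Nil then show ?case using assms(2,3) by (simp add: algebra_homD(2))
  next
    case (Cons g w)
    then show ?case using assms(4) w[of w] algebra_homD(4)[OF assms(2)] algebra_homD(4)[OF assms(3)] by auto
  qed
  have "h x = lin B (%w. h (word_value W gen w)) p"
    unfolding p(2) cls_eq_lin[OF p(1)]
    by (rule W.linear_map_lin[OF B.kmod_axioms algebra_homD(1)[OF assms(2)]]) (use p w in "auto simp: subset_iff simp del: in_lists_conv_set")
  also have "... = lin B (%w. h' (word_value W gen w)) p"
    by (rule B.lin_cong) (use eq p w algebra_homD(3)[OF assms(3)] in "auto simp: subset_iff")
  also have "... = h' x"
    unfolding p(2) cls_eq_lin[OF p(1)]
    by (rule W.linear_map_lin[OF B.kmod_axioms algebra_homD(1)[OF assms(3)], symmetric]) (use p w in "auto simp: subset_iff simp del: in_lists_conv_set")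
  finally show ?thesis .
qed

end

section \<open>Tensor products\<close>

definition bilinear_map ::
    "('k::field, 'a, 'e) module_scheme => ('k, 'b, 'f) module_scheme => ('k, 'c, 'g) module_scheme =>
      ('a => 'b => 'c) => bool" where
  "bilinear_map A B M f \<longleftrightarrow>
     (ALL y:carrier B. linear_map A M (%x. f x y)) & (ALL x:carrier A. linear_map B M (f x))"

lemma bilinear_mapI:
  assumes "!!y. y : carrier B ==> linear_map A M (%x. f x y)" "!!x. x : carrier A ==> linear_map B M (f x)"
  shows "bilinear_map A B M f"
  using assms by (simp add: bilinear_map_def)

lemma bilinear_mapD:
  assumes "bilinear_map A B M f"
  shows "y : carrier B ==> linear_map A M (%x. f x y)" "x : carrier A ==> linear_map B M (f x)"
    "x : carrier A ==> y : carrier B ==> f x y : carrier M"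
    "x : carrier A ==> x' : carrier A ==> y : carrier B ==> f (x \<oplus>\<^bsub>A\<^esub> x') y = f x y \<oplus>\<^bsub>M\<^esub> f x' y"
    "x : carrier A ==> y : carrier B ==> y' : carrier B ==> f x (y \<oplus>\<^bsub>B\<^esub> y') = f x y \<oplus>\<^bsub>M\<^esub> f x y'"
    "x : carrier A ==> y : carrier B ==> f (c \<odot>\<^bsub>A\<^esub> x) y = c \<odot>\<^bsub>M\<^esub> f x y"
    "x : carrier A ==> y : carrier B ==> f x (c \<odot>\<^bsub>B\<^esub> y) = c \<odot>\<^bsub>M\<^esub> f x y"
  using assms by (auto simp: bilinear_map_def linear_map_def)

lemma bilinear_map_compose:
  assumes "bilinear_map A B M f" "linear_map A' A g" "linear_map B' B h" "linear_map M N l"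
  shows "bilinear_map A' B' N (%x y. l (f (g x) (h y)))"
  by (intro bilinear_mapI linear_mapI)
    (simp_all add: bilinear_mapD[OF assms(1)] linear_mapD[OF assms(2)] linear_mapD[OF assms(3)] linear_mapD[OF assms(4)])

lemma bilinear_map_post:
  "bilinear_map A B M f ==> linear_map M N l ==> bilinear_map A B N (%x y. l (f x y))"
  by (rule bilinear_map_compose[OF _ linear_map_id linear_map_id])

locale tens = A: kalg A + B: kalg B
  for A :: "('k::field, 'a, 'e) module_scheme" and B :: "('k, 'b, 'f) module_scheme"
begin

abbreviation G where "G == A \<times>\<times> B"
abbreviation MA where "MA == (monoid_algebra G :: ('k, 'a \<times> 'b \<Rightarrow>\<^sub>0 'k) module)"
abbreviation T where "T == tensor_algebra A B"
abbreviation tn where "tn == tensor A B"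

lemma monoid_G: "Group.monoid G"
  by (rule DirProd_monoid) (rule A.monoid_axioms B.monoid_axioms)+

lemma carrier_G [simp]: "carrier G = carrier A \<times> carrier B"
  by (simp add: DirProd_def)

lemma rels_closed: "bilinear_rels A B <= carrier MA"
  by (auto simp: bilinear_rels_def dest!: subsetD[OF keys_diff] split: if_splits)

interpretation I: kideal MA "Idl\<^bsub>MA\<^esub> (bilinear_rels A B)"
proof -
  interpret kalg MA by (rule kalg.intro) (rule monoid.kalgebra_monoid_algebra[OF monoid_G])
  show "kideal MA (Idl\<^bsub>MA\<^esub> (bilinear_rels A B))"
    using genideal_ideal[OF rels_closed] kalg_axioms by (intro kideal.intro)
qed

lemma T_def: "T = quotient_algebra MA (Idl\<^bsub>MA\<^esub> (bilinear_rels A B))"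
  by (simp add: tensor_algebra_def)

lemma kalgebra_tensor: "kalgebra T"
  unfolding T_def by (rule I.kalgebra_quotient)

sublocale T: kalg T by (rule kalg.intro) (rule kalgebra_tensor)

abbreviation cls where "cls p == Idl\<^bsub>MA\<^esub> (bilinear_rels A B) +>\<^bsub>MA\<^esub> p"

lemma cls_hom: "algebra_hom MA T cls"
  unfolding T_def by (rule I.algebra_hom_quotient)

lemma tn_cls: "tn x y = cls (single (x, y) 1)"
  by (simp add: tensor_def)

lemma tn_closed [simp, intro]: "x : carrier A ==> y : carrier B ==> tn x y : carrier T"
  unfolding tn_cls by (rule algebra_homD(3)[OF cls_hom]) auto

lemma cls_single:
  assumes "x : carrier A" "y : carrier B"
  shows "cls (single (x, y) c) = c \<odot>\<^bsub>T\<^esub> tn x y"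
proof -
  have "cls (c \<odot>\<^bsub>MA\<^esub> single (x, y) 1) = c \<odot>\<^bsub>T\<^esub> tn x y"
    unfolding tn_cls by (rule algebra_homD(6)[OF cls_hom]) (use assms in auto)
  then show ?thesis by (simp add: map_times_single)
qed

lemma cls_add: "keys p <= carrier G ==> keys q <= carrier G ==>
    cls (p + q) = cls p \<oplus>\<^bsub>T\<^esub> cls q"
  using algebra_homD(5)[OF cls_hom, of p q] by simp

lemma rel_zero: "r : bilinear_rels A B ==> cls r = \<zero>\<^bsub>T\<^esub>"
  using I.quotient_zero_iff[of r] rels_closed I.genideal_self[OF rels_closed] by (auto simp: T_def)

lemma tn_add_left:
  assumes "x : carrier A" "x' : carrier A" "y : carrier B"
  shows "tn (x \<oplus>\<^bsub>A\<^esub> x') y = tn x y \<oplus>\<^bsub>T\<^esub> tn x' y"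
proof -
  define r where "r = single (x \<oplus>\<^bsub>A\<^esub> x', y) (1::'k) - single (x, y) 1 - single (x', y) 1"
  have "r : bilinear_rels A B" using assms by (auto simp: bilinear_rels_def r_def)
  then have "cls r = \<zero>\<^bsub>T\<^esub>" and k: "keys r <= carrier G"
    using rel_zero rels_closed by auto
  moreover have "single (x \<oplus>\<^bsub>A\<^esub> x', y) (1::'k) = r + (single (x, y) 1 + single (x', y) 1)"
    by (simp add: r_def)
  moreover have "keys (single (x, y) (1::'k) + single (x', y) 1) <= carrier G"
    by (rule keys_add_subset) (use assms in auto)
  ultimately show ?thesis
    using assms by (simp add: tn_cls[of "x \<oplus>\<^bsub>A\<^esub> x'"] cls_add cls_single)
qed

lemma tn_add_right:
  assumes "x : carrier A" "y : carrier B" "y' : carrier B"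
  shows "tn x (y \<oplus>\<^bsub>B\<^esub> y') = tn x y \<oplus>\<^bsub>T\<^esub> tn x y'"
proof -
  define r where "r = single (x, y \<oplus>\<^bsub>B\<^esub> y') (1::'k) - single (x, y) 1 - single (x, y') 1"
  have "r : bilinear_rels A B" using assms unfolding bilinear_rels_def r_def by blast
  then have "cls r = \<zero>\<^bsub>T\<^esub>" and k: "keys r <= carrier G"
    using rel_zero rels_closed by auto
  moreover have "single (x, y \<oplus>\<^bsub>B\<^esub> y') (1::'k) = r + (single (x, y) 1 + single (x, y') 1)"
    by (simp add: r_def)
  moreover have "keys (single (x, y) (1::'k) + single (x, y') 1) <= carrier G"
    by (rule keys_add_subset) (use assms in auto)
  ultimately show ?thesis
    using assms by (simp add: tn_cls[of x "y \<oplus>\<^bsub>B\<^esub> y'"] cls_add cls_single)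
qed

lemma tn_smult_left:
  assumes "x : carrier A" "y : carrier B"
  shows "tn (c \<odot>\<^bsub>A\<^esub> x) y = c \<odot>\<^bsub>T\<^esub> tn x y"
proof -
  define r where "r = single (c \<odot>\<^bsub>A\<^esub> x, y) (1::'k) - single (x, y) c"
  have "r : bilinear_rels A B" using assms unfolding bilinear_rels_def r_def by blast
  then have "cls r = \<zero>\<^bsub>T\<^esub>" and k: "keys r <= carrier G"
    using rel_zero rels_closed by auto
  moreover have "single (c \<odot>\<^bsub>A\<^esub> x, y) (1::'k) = r + single (x, y) c"
    by (simp add: r_def)
  ultimately show ?thesis
    using assms by (simp add: tn_cls[of "c \<odot>\<^bsub>A\<^esub> x"] cls_add cls_single)
qed

lemma tn_smult_right:
  assumes "x : carrier A" "y : carrier B"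
  shows "tn x (c \<odot>\<^bsub>B\<^esub> y) = c \<odot>\<^bsub>T\<^esub> tn x y"
proof -
  define r where "r = single (x, c \<odot>\<^bsub>B\<^esub> y) (1::'k) - single (x, y) c"
  have "r : bilinear_rels A B" using assms unfolding bilinear_rels_def r_def by blast
  then have "cls r = \<zero>\<^bsub>T\<^esub>" and k: "keys r <= carrier G"
    using rel_zero rels_closed by auto
  moreover have "single (x, c \<odot>\<^bsub>B\<^esub> y) (1::'k) = r + single (x, y) c"
    by (simp add: r_def)
  ultimately show ?thesis
    using assms by (simp add: tn_cls[of x "c \<odot>\<^bsub>B\<^esub> y"] cls_add cls_single)
qed

lemma bilinear_tn: "bilinear_map A B T tn"
  by (auto intro!: bilinear_mapI linear_mapI simp: tn_add_left tn_add_right tn_smult_left tn_smult_right)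

lemma tn_mult [simp]:
  assumes "x : carrier A" "y : carrier B" "x' : carrier A" "y' : carrier B"
  shows "tn x y \<otimes>\<^bsub>T\<^esub> tn x' y' = tn (x \<otimes>\<^bsub>A\<^esub> x') (y \<otimes>\<^bsub>B\<^esub> y')"
proof -
  have "cls (single (x, y) 1 \<otimes>\<^bsub>MA\<^esub> single (x', y') 1) = tn x y \<otimes>\<^bsub>T\<^esub> tn x' y'"
    unfolding tn_cls by (rule algebra_homD(4)[OF cls_hom]) (use assms in auto)
  then show ?thesis by (simp add: tn_cls)
qed

lemma one_T: "\<one>\<^bsub>T\<^esub> = tn \<one>\<^bsub>A\<^esub> \<one>\<^bsub>B\<^esub>"
  using algebra_homD(2)[OF cls_hom] by (simp add: tn_cls)

lemma zero_T: "\<zero>\<^bsub>T\<^esub> = tn \<zero>\<^bsub>A\<^esub> \<zero>\<^bsub>B\<^esub>"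
  using tn_smult_left[of "\<zero>\<^bsub>A\<^esub>" "\<zero>\<^bsub>B\<^esub>" 0] by simp

lemma carrier_T: "carrier T = cls ` {p. keys p <= carrier G}"
  by (auto simp: T_def I.quotient_simps)

lemma tensor_induct [consumes 1, case_names tensor add]:
  assumes "t : carrier T"
    and tensor: "!!x y. x : carrier A ==> y : carrier B ==> P (tn x y)"
    and add: "!!t t'. t : carrier T ==> t' : carrier T ==> P t ==> P t' ==> P (t \<oplus>\<^bsub>T\<^esub> t')"
  shows "P t"
proof -
  obtain p where p: "keys p <= carrier G" "t = cls p" using assms(1) carrier_T by auto
  have "P (cls p)" using p(1)
  proof (induction p rule: poly_mapping_induct)
    case zero
    have "cls 0 = \<zero>\<^bsub>T\<^esub>"
      using linear_map_zero[OF I.kmod_axioms T.kmod_axioms algebra_homD(1)[OF cls_hom]] by simp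
    then show ?case using tensor[of "\<zero>\<^bsub>A\<^esub>" "\<zero>\<^bsub>B\<^esub>"] zero_T by simp
  next
    case (single g c)
    then show ?case using tensor by (cases g) (auto simp: cls_single simp flip: tn_smult_left)
  next
    case (add p q)
    moreover have "cls p : carrier T" "cls q : carrier T" using add carrier_T by auto
    ultimately show ?case by (simp add: cls_add assms(3))
  qed
  then show ?thesis using p by simp
qed

lemma tensor_linear_eqI:
  assumes "linear_map T M h" "linear_map T M h'"
    "!!x y. x : carrier A ==> y : carrier B ==> h (tn x y) = h' (tn x y)" "t : carrier T"
  shows "h t = h' t"
  using assms(4)
  by (induction rule: tensor_induct) (use assms in "auto simp: linear_mapD(2)")

context
  fixes M :: "('k, 'c, 'g) module_scheme" and f
  assumes M: "kmod M" and bil: "bilinear_map A B M f"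
begin

interpretation M: kmod M by (rule M)

lemma case_prod_funcset: "(%(x, y). f x y) : carrier G \<rightarrow> carrier M"
  using bilinear_mapD(3)[OF bil] by auto

lemma lin_bilinear_rel:
  assumes bil': "bilinear_map A B M f'" and r: "r : bilinear_rels A B"
  shows "lin M (%(x, y). f' x y) r = \<zero>\<^bsub>M\<^esub>"
proof -
  note D = bilinear_mapD[OF bil']
  have F: "(%(x, y). f' x y) : carrier G \<rightarrow> carrier M" using D by auto
  have ks: "keys (single g c) <= carrier A \<times> carrier B"
    if "g : carrier A \<times> carrier B" for g and c :: 'k
    using that by auto
  have kd: "keys (p - q) <= carrier A \<times> carrier B"
    if "keys p <= carrier A \<times> carrier B" "keys q <= carrier A \<times> carrier B"
    for p q :: "_ \<Rightarrow>\<^sub>0 'k"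
    using that by (rule keys_diff_subset)
  note lind = M.lin_diff[OF F[unfolded carrier_G]]
  have zc: "c \<odot>\<^bsub>M\<^esub> x \<oplus>\<^bsub>M\<^esub> (- c) \<odot>\<^bsub>M\<^esub> x = \<zero>\<^bsub>M\<^esub>" if "x : carrier M" for c x
    using that by (simp add: M.smult_minus_left M.r_neg)
  have z: "x \<oplus>\<^bsub>M\<^esub> (- 1) \<odot>\<^bsub>M\<^esub> x = \<zero>\<^bsub>M\<^esub>" if "x : carrier M" for x
    using that by (simp add: M.smult_minus_left M.r_neg)
  have z2: "x \<oplus>\<^bsub>M\<^esub> y \<oplus>\<^bsub>M\<^esub> (- 1) \<odot>\<^bsub>M\<^esub> x \<oplus>\<^bsub>M\<^esub> (- 1) \<odot>\<^bsub>M\<^esub> y = \<zero>\<^bsub>M\<^esub>"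
    if "x : carrier M" "y : carrier M" for x y
    using z[of "x \<oplus>\<^bsub>M\<^esub> y"] that by (simp add: M.smult_add_right M.a_assoc)
  from r consider
    (1) x x' y where "r = single (x \<oplus>\<^bsub>A\<^esub> x', y) 1 - single (x, y) 1 - single (x', y) 1"
       "x : carrier A" "x' : carrier A" "y : carrier B"
  | (2) x y y' where "r = single (x, y \<oplus>\<^bsub>B\<^esub> y') 1 - single (x, y) 1 - single (x, y') 1"
       "x : carrier A" "y : carrier B" "y' : carrier B"
  | (3) c x y where "r = single (c \<odot>\<^bsub>A\<^esub> x, y) 1 - single (x, y) c" "x : carrier A" "y : carrier B"
  | (4) c x y where "r = single (x, c \<odot>\<^bsub>B\<^esub> y) 1 - single (x, y) c" "x : carrier A" "y : carrier B"
    unfolding bilinear_rels_def by blast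
  then show ?thesis
    by cases (simp_all add: lind kd ks D z z2 zc del: keys_single)
qed

text \<open>Surrounding a bilinearity relator by symbols (a1, a2) and (b1, b2) amounts to evaluating
  the relator itself with another bilinear map, (x, y) -> f (a1 x b1) (a2 y b2). Hence the whole
  ideal is killed.\<close>

lemma tensor_extend_cls:
  assumes "keys p <= carrier G"
  shows "tensor_extend M f (cls p) = lin M (%(x, y). f x y) p"
  unfolding tensor_extend_def
proof (rule M.coset_extend_coset[OF monoid_G I.is_ideal case_prod_funcset _ assms])
  fix p assume "p : Idl\<^bsub>MA\<^esub> (bilinear_rels A B)"
  then show "lin M (%(x, y). f x y) p = \<zero>\<^bsub>M\<^esub>"
  proof (rule M.lin_vanishes_on_ideal[OF monoid_G rels_closed case_prod_funcset, rotated])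
    fix r a b assume r: "r : bilinear_rels A B" and ab: "a : carrier G" "b : carrier G"
    obtain a1 a2 b1 b2 where [simp]: "a = (a1, a2)" "b = (b1, b2)" by (cases a, cases b)
    have "bilinear_map A B M (%x y. f (a1 \<otimes>\<^bsub>A\<^esub> x \<otimes>\<^bsub>A\<^esub> b1) (a2 \<otimes>\<^bsub>B\<^esub> y \<otimes>\<^bsub>B\<^esub> b2))"
      by (rule bilinear_map_compose[OF bil _ _ linear_map_id])
        (use ab in "auto intro!: linear_mapI simp: A.r_distr A.l_distr B.r_distr B.l_distr")
    moreover have "(%g. (%(x, y). f x y) (a \<otimes>\<^bsub>G\<^esub> g \<otimes>\<^bsub>G\<^esub> b)) =
        (%(x, y). f (a1 \<otimes>\<^bsub>A\<^esub> x \<otimes>\<^bsub>A\<^esub> b1) (a2 \<otimes>\<^bsub>B\<^esub> y \<otimes>\<^bsub>B\<^esub> b2))"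
      by (auto simp: fun_eq_iff)
    ultimately show "lin M (%g. (%(x, y). f x y) (a \<otimes>\<^bsub>G\<^esub> g \<otimes>\<^bsub>G\<^esub> b)) r = \<zero>\<^bsub>M\<^esub>"
      using r by (simp add: lin_bilinear_rel)
  qed
qed

lemma tensor_extend_tensor: "x : carrier A ==> y : carrier B ==> tensor_extend M f (tn x y) = f x y"
  unfolding tn_cls by (subst tensor_extend_cls) (use bilinear_mapD(3)[OF bil] in auto)

lemma tensor_extend_linear: "linear_map T M (tensor_extend M f)"
proof (rule linear_mapI)
  note F = case_prod_funcset
  fix t t' c assume t: "t : carrier T" "t' : carrier T"
  then obtain p p' where p: "keys p <= carrier G" "t = cls p"
    "keys p' <= carrier G" "t' = cls p'" using carrier_T by auto
  show "tensor_extend M f t : carrier M"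
    using p M.lin_closed'[OF F] by (simp add: tensor_extend_cls)
  show "tensor_extend M f (t \<oplus>\<^bsub>T\<^esub> t') = tensor_extend M f t \<oplus>\<^bsub>M\<^esub> tensor_extend M f t'"
    using p M.lin_add[OF F] by (simp add: tensor_extend_cls keys_add_subset flip: cls_add)
  have "c \<odot>\<^bsub>T\<^esub> t = cls (Poly_Mapping.map ((*) c) p)"
    using algebra_homD(6)[OF cls_hom, of p c] p by simp
  moreover have "keys (Poly_Mapping.map ((*) c) p) <= carrier G"
    by (rule order_trans[OF keys_map_times p(1)])
  ultimately show "tensor_extend M f (c \<odot>\<^bsub>T\<^esub> t) = c \<odot>\<^bsub>M\<^esub> tensor_extend M f t"
    using p M.lin_smult[OF F] by (simp add: tensor_extend_cls)
qed

lemmas tensor_extend_closed = linear_mapD(1)[OF tensor_extend_linear]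
lemmas tensor_extend_add = linear_mapD(2)[OF tensor_extend_linear]
lemmas tensor_extend_smult = linear_mapD(3)[OF tensor_extend_linear]

lemma tensor_extend_unique:
  assumes "linear_map T M h" "!!x y. x : carrier A ==> y : carrier B ==> h (tn x y) = f x y" "t : carrier T"
  shows "tensor_extend M f t = h t"
  by (rule tensor_linear_eqI[OF tensor_extend_linear assms(1) _ assms(3)])
    (simp add: tensor_extend_tensor assms(2))

text \<open>Representatives of a tensor are supported on pairs from the carriers, so only the values
  there count. In particular \<open>f'\<close> may be an expression that is bilinear on the carriers
  alone.\<close>

lemma tensor_extend_cong:
  assumes "!!x y. x : carrier A ==> y : carrier B ==> f' x y = f x y" "t : carrier T"
  shows "tensor_extend M f' t = tensor_extend M f t"
proof -
  obtain p where p: "keys p <= carrier G" "t = cls p" using assms(2) carrier_T by auto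
  have "lin M (%(x, y). f' x y) q = lin M (%(x, y). f x y) q" if "q : t" for q
  proof (rule M.lin_cong)
    have "t <= carrier MA" using p I.a_r_coset_subset_G[OF I.a_subset, of p] by auto
    then have "keys q <= carrier G" using that by auto
    then show "!!g. g : keys q ==> (%(x, y). f' x y) g = (%(x, y). f x y) g"
      and "(%(x, y). f x y) : keys q \<rightarrow> carrier M"
      using assms(1) bilinear_mapD(3)[OF bil] by auto
  qed
  moreover have "p : t" using p I.a_rcos_self[of p] by simp
  ultimately show ?thesis
    unfolding tensor_extend_def coset_extend_eq_lin by (metis someI_ex)
qed

lemma tensor_extend_compose:
  assumes "kmod N" "linear_map M N h" "t : carrier T"
  shows "h (tensor_extend M f t) = tensor_extend N (%x y. h (f x y)) t"
proof -
  have b: "bilinear_map A B N (%x y. h (f x y))"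
    by (rule bilinear_map_post[OF bil assms(2)])
  interpret N: kmod N by fact
  show ?thesis
    using assms(3)
  proof (induction rule: tensor_induct)
    case (tensor x y)
    then show ?case using tens.tensor_extend_tensor[OF tens_axioms assms(1) b] by (simp add: tensor_extend_tensor)
  next
    case (add t t')
    then show ?case
      using linear_mapD(2)[OF tens.tensor_extend_linear[OF tens_axioms assms(1) b]]
        linear_mapD(2)[OF assms(2)] by (simp add: tensor_extend_add tensor_extend_closed)
  qed
qed

text \<open>Multiplicativity extends from pure tensors by additivity in each factor. The equation
  \<open>C = M\<close> says that the target of the surrounding context is the algebra
  \<open>C\<close>.\<close>

lemma tensor_extend_hom:
  fixes C :: "('k, 'c, 'g) module_scheme"
  assumes "kalgebra C" "C = M" "f \<one>\<^bsub>A\<^esub> \<one>\<^bsub>B\<^esub> = \<one>\<^bsub>C\<^esub>"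
    "!!x y x' y'. x : carrier A ==> y : carrier B ==> x' : carrier A ==> y' : carrier B ==>
      f (x \<otimes>\<^bsub>A\<^esub> x') (y \<otimes>\<^bsub>B\<^esub> y') = f x y \<otimes>\<^bsub>C\<^esub> f x' y'"
  shows "algebra_hom T C (tensor_extend C f)"
proof -
  interpret C: kalg C by (rule kalg.intro) fact
  note [simp] = assms(2)
  have 1: "tensor_extend M f (tn x y \<otimes>\<^bsub>T\<^esub> t') = f x y \<otimes>\<^bsub>C\<^esub> tensor_extend M f t'"
    if "x : carrier A" "y : carrier B" "t' : carrier T" for x y t'
    using that(3)
  proof (induction rule: tensor_induct)
    case (tensor x y)
    then show ?case using that assms(4) by (simp add: tensor_extend_tensor)
  next
    case (add t t')
    have "tensor_extend M f t : carrier C" "tensor_extend M f t' : carrier C" "f x y : carrier C"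
      using add that tensor_extend_closed bilinear_mapD(3)[OF bil] by auto
    then show ?case
      using add that C.r_distr by (simp add: T.r_distr tensor_extend_add)
  qed
  show ?thesis
  proof (rule algebra_homI)
    show "tensor_extend C f \<one>\<^bsub>T\<^esub> = \<one>\<^bsub>C\<^esub>" using assms(3) by (simp add: one_T tensor_extend_tensor)
    fix t t' assume t: "t : carrier T" "t' : carrier T"
    show "tensor_extend C f (t \<otimes>\<^bsub>T\<^esub> t') = tensor_extend C f t \<otimes>\<^bsub>C\<^esub> tensor_extend C f t'"
      using t(1)
    proof (induction rule: tensor_induct)
      case (tensor x y)
      then show ?case using t 1 by (simp add: tensor_extend_tensor)
    next
      case (add s s')
      have "tensor_extend M f s : carrier C" "tensor_extend M f s' : carrier C" "tensor_extend M f t' : carrier C"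
        using add t tensor_extend_closed by auto
      then show ?case
        using add t C.l_distr by (simp add: T.l_distr tensor_extend_add)
    qed
  qed (use tensor_extend_linear in simp)
qed

text \<open>Supports inductions in which generators are multiplied on from the left: the coproduct
  of a generator is a sum of pure tensors, and each of them is absorbed into the bilinear
  map.\<close>

lemma tensor_extend_mult_tensor:
  assumes ab: "a : carrier A" "b : carrier B" and t: "t : carrier T"
  shows "tensor_extend M f (tn a b \<otimes>\<^bsub>T\<^esub> t) = tensor_extend M (%x y. f (a \<otimes>\<^bsub>A\<^esub> x) (b \<otimes>\<^bsub>B\<^esub> y)) t"
proof -
  have b: "bilinear_map A B M (%x y. f (a \<otimes>\<^bsub>A\<^esub> x) (b \<otimes>\<^bsub>B\<^esub> y))"
    by (rule bilinear_map_compose[OF bil _ _ linear_map_id])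
      (use ab in "auto intro!: linear_mapI simp: A.r_distr B.r_distr")
  have l: "linear_map T T ((\<otimes>\<^bsub>T\<^esub>) (tn a b))"
    using ab by (auto intro!: linear_mapI simp: T.r_distr)
  show ?thesis
    by (rule tens.tensor_extend_unique[OF tens_axioms M b _ _ t, symmetric])
      (use linear_map_comp[OF l tensor_extend_linear] ab in "auto simp: tensor_extend_tensor")
qed

end

end

text \<open>Linear dependence on a parameter is inherited from pure tensors. The associator uses it
  with the third tensor factor as the parameter.\<close>

lemma (in tens) tensor_extend_param:
  assumes M: "kmod M" and bil: "!!z. z : carrier D ==> bilinear_map A B M (f z)"
    and lin: "!!x y. x : carrier A ==> y : carrier B ==> linear_map D M (%z. f z x y)"
    and D: "kmod D" and t: "t : carrier T"
  shows "linear_map D M (%z. tensor_extend M (f z) t)"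
  using t
proof (induction rule: tensor_induct)
  case (tensor x y)
  note L = linear_mapD[OF lin[OF tensor]]
  interpret D: kmod D by fact
  show ?case
    by (rule linear_mapI) (use tensor L in "simp_all add: tensor_extend_tensor[OF M bil]")
next
  case (add t t')
  interpret M: kmod M by fact
  interpret D: kmod D by fact
  note L = linear_mapD[OF add(3)] linear_mapD[OF add(4)]
  show ?case
    by (rule linear_mapI)
      (use add L in "simp_all add: tensor_extend_add[OF M bil] M.a_ac M.smult_add_right")
qed

text \<open>If r and r' are left inverses of i and j, then r \<otimes> r' is one of i \<otimes> j.
  Injectivity of C \<otimes> C -> H \<otimes> H is obtained in this way.\<close>

lemma tensor_map_left_inverse:
  fixes A :: "('k::field, 'a, 'e) module_scheme"
  assumes "tens A B" "tens A' B'"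
    and i: "linear_map A A' i" "linear_map A' A r" "!!x. x : carrier A ==> r (i x) = x"
    and j: "linear_map B B' j" "linear_map B' B r'" "!!x. x : carrier B ==> r' (j x) = x"
  shows "\<exists>\<rho>. linear_map (tensor_algebra A' B') (tensor_algebra A B) \<rho> &
    (ALL t:carrier (tensor_algebra A B).
      \<rho> (tensor_extend (tensor_algebra A' B') (%x y. tensor A' B' (i x) (j y)) t) = t)"
proof -
  interpret S: tens A B by fact
  interpret H: tens A' B' by fact
  let ?i = "tensor_extend H.T (%x y. H.tn (i x) (j y))"
  let ?r = "tensor_extend S.T (%x y. S.tn (r x) (r' y))"
  have b1: "bilinear_map A B H.T (%x y. H.tn (i x) (j y))"
    by (rule bilinear_map_compose[OF H.bilinear_tn i(1) j(1) linear_map_id])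
  have b2: "bilinear_map A' B' S.T (%x y. S.tn (r x) (r' y))"
    by (rule bilinear_map_compose[OF S.bilinear_tn i(2) j(2) linear_map_id])
  have l1: "linear_map S.T H.T ?i" by (rule S.tensor_extend_linear[OF H.T.kmod_axioms b1])
  have l2: "linear_map H.T S.T ?r" by (rule H.tensor_extend_linear[OF S.T.kmod_axioms b2])
  have "?r (?i t) = t" if "t : carrier S.T" for t
    by (rule S.tensor_linear_eqI[OF linear_map_comp[OF l1 l2] linear_map_id _ that])
      (use linear_mapD(1)[OF i(1)] linear_mapD(1)[OF j(1)] in
       \<open>simp add: S.tensor_extend_tensor[OF H.T.kmod_axioms b1] H.tensor_extend_tensor[OF S.T.kmod_axioms b2] i(3) j(3)\<close>)
  then show ?thesis using l2 by blast
qed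

text \<open>A linear projection of the free vector space on the carrier onto the preimage of the subspace
  descends, because that preimage contains the kernel.\<close>

lemma (in kmod) subspace_retraction:
  assumes C: "C <= carrier M" "\<zero> : C" "!!x y. x : C ==> y : C ==> x \<oplus> y : C"
    "!!c x. x : C ==> c \<odot> x : C"
  obtains r where "linear_map M M r" "!!x. x : carrier M ==> r x : C" "!!x. x : C ==> r x = x"
proof -
  let ?s = "%c. Poly_Mapping.map ((*) (c::'k)) :: ('b \<Rightarrow>\<^sub>0 'k) => _"
  interpret V: vector_space ?s
    by unfold_locales (auto intro!: poly_mapping_eqI simp: lookup_add algebra_simps)
  interpret VV: vector_space_pair ?s ?s ..
  let ?L = "lin M (%x. x)"
  have F: "(%x. x) : carrier M \<rightarrow> carrier M" by auto
  define C' where "C' = {p. keys p <= carrier M & ?L p : C}"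
  have keys_s: "keys (?s c p) <= carrier M" if "keys p <= carrier M" for c p
    by (rule order_trans[OF keys_map_times that])
  have sub: "V.subspace C'"
    by (rule V.subspaceI)
      (use C in "auto simp: C'_def lin_add[OF F] lin_smult[OF F] dest!: subsetD[OF keys_add] subsetD[OF keys_map_times]")
  obtain g where g: "g ` UNIV <= C'" "Vector_Spaces.linear ?s ?s g" "!!v. v : C' ==> g v = v"
    using VV.linear_exists_left_inverse_on[OF V.linear_id sub] by (auto simp: id_def)
  interpret g: Vector_Spaces.linear ?s ?s g by (rule g)
  have gC: "keys (g p) <= carrier M" "?L (g p) : C" for p
    using g(1) by (auto simp: C'_def)
  define r where "r x = ?L (g (single x 1))" for x
  have ks: "keys (single x (c::'k)) <= carrier M" if "x : carrier M" for x c
    using that by auto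
  have eq: "?L (g p) = ?L (g q)" if pq: "keys p <= carrier M" "keys q <= carrier M" "?L p = ?L q" for p q
  proof -
    have n: "p - q : C'"
      using pq C(2) lin_closed'[OF F pq(2)]
      by (auto simp: C'_def lin_diff[OF F] smult_minus_left r_neg dest: subsetD[OF keys_diff])
    have "g p = g q + (p - q)" using g(3)[OF n] g.diff[of p q] by (simp add: algebra_simps)
    moreover have "?L (p - q) = \<zero>"
      using pq lin_closed'[OF F pq(2)] by (simp add: lin_diff[OF F] smult_minus_left r_neg)
    moreover have "keys (p - q) <= carrier M" using n by (simp add: C'_def)
    ultimately show ?thesis using gC C(1) by (simp add: lin_add[OF F] lin_closed'[OF F])
  qed
  have "linear_map M M r"
  proof (rule linear_mapI)
    fix x y c assume x: "x : carrier M"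
    show "r x : carrier M" using gC(2) C(1) by (auto simp: r_def)
    have "r (c \<odot> x) = ?L (g (?s c (single x 1)))"
      unfolding r_def by (rule eq) (use x keys_s ks in "simp_all add: lin_smult[OF F] del: keys_single")
    then show "r (c \<odot> x) = c \<odot> r x" unfolding g.scale by (simp add: lin_smult[OF F] gC r_def)
    assume y: "y : carrier M"
    have "r (x \<oplus> y) = ?L (g (single x 1 + single y 1))"
      unfolding r_def by (rule eq) (use x y ks in "simp_all add: lin_add[OF F] keys_add_subset del: keys_single")
    then show "r (x \<oplus> y) = r x \<oplus> r y" by (simp add: g.add lin_add[OF F] gC r_def)
  qed
  moreover have "r x = x" if "x : C" for x
  proof -
    have "single x 1 : C'" using that C(1) by (auto simp: C'_def)
    then show ?thesis using that C(1) by (auto simp: r_def g(3) subset_iff)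
  qed
  ultimately show ?thesis using that gC(2) by (auto simp: r_def)
qed

section \<open>Bialgebras\<close>

lemma sub_bialgebra_simps [simp]:
  "carrier (sub_bialgebra H C u) = C" "\<one>\<^bsub>sub_bialgebra H C u\<^esub> = u" "\<zero>\<^bsub>sub_bialgebra H C u\<^esub> = \<zero>\<^bsub>H\<^esub>"
  "x \<oplus>\<^bsub>sub_bialgebra H C u\<^esub> y = x \<oplus>\<^bsub>H\<^esub> y" "x \<otimes>\<^bsub>sub_bialgebra H C u\<^esub> y = x \<otimes>\<^bsub>H\<^esub> y"
  "c \<odot>\<^bsub>sub_bialgebra H C u\<^esub> x = c \<odot>\<^bsub>H\<^esub> x" "counit (sub_bialgebra H C u) = counit H"
  by (simp_all add: sub_bialgebra_def Let_def)

text \<open>A tensor product depends only on the algebra fields of the two records. It is thus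
  insensitive to adding or replacing a coproduct, as happens in \<open>sub_bialgebra\<close> and
  when \<open>module.extend\<close> builds a bialgebra.\<close>

lemma tensor_algebra_cong:
  assumes "carrier A = carrier A'" "\<one>\<^bsub>A\<^esub> = \<one>\<^bsub>A'\<^esub>" "add A = add A'" "monoid.mult A = monoid.mult A'"
    "module.smult A = module.smult A'"
    "carrier B = carrier B'" "\<one>\<^bsub>B\<^esub> = \<one>\<^bsub>B'\<^esub>" "add B = add B'" "monoid.mult B = monoid.mult B'"
    "module.smult B = module.smult B'"
  shows "tensor_algebra A B = tensor_algebra A' B'" "tensor A B = tensor A' B'"
proof -
  have "bilinear_rels A B = bilinear_rels A' B'"
    unfolding bilinear_rels_def assms ..
  moreover have "A \<times>\<times> B = A' \<times>\<times> B'"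
    by (simp add: DirProd_def assms)
  ultimately show "tensor_algebra A B = tensor_algebra A' B'" "tensor A B = tensor A' B'"
    by (simp_all add: tensor_algebra_def tensor_def fun_eq_iff)
qed

lemma comult_sub_bialgebra:
  "comult (sub_bialgebra H C u) x =
    (THE t. t : carrier (tensor_algebra (sub_bialgebra H C u) (sub_bialgebra H C u)) &
      tensor_extend (tensor_algebra H H) (tensor H H) t = comult H x)"
proof -
  let ?S = "sub_bialgebra H C u" and ?B = "H\<lparr>carrier := C, one := u\<rparr>"
  have "tensor_algebra ?B ?B = tensor_algebra ?S ?S"
    by (rule tensor_algebra_cong) (simp_all add: sub_bialgebra_def Let_def)
  then show ?thesis
    by (simp add: sub_bialgebra_def Let_def)
qed

locale bialg =
  fixes H :: "('k::field, 'a) bialgebra" (structure)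
  assumes is_bialg: "is_bialgebra H"

sublocale bialg \<subseteq> kalg H
  using is_bialg by (intro kalg.intro) (simp add: is_bialgebra_def)

sublocale bialg \<subseteq> HH: tens H H ..

context bialg
begin

lemma comult_hom: "algebra_hom H HH.T (comult H)"
  and counit_hom: "algebra_hom H base_field (counit H)"
  using is_bialg by (simp_all add: is_bialgebra_def)

lemma comult_closed [simp, intro]: "x : carrier H ==> comult H x : carrier HH.T"
  by (rule algebra_homD(3)[OF comult_hom])

lemma comult_linear: "linear_map H HH.T (comult H)"
  by (rule algebra_homD(1)[OF comult_hom])

lemma counit_simps [simp]:
  "counit H \<one> = 1"
  "x : carrier H ==> y : carrier H ==> counit H (x \<oplus> y) = counit H x + counit H y"
  "x : carrier H ==> y : carrier H ==> counit H (x \<otimes> y) = counit H x * counit H y"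
  "x : carrier H ==> counit H (c \<odot> x) = c * counit H x"
  using algebra_homD[OF counit_hom] by auto

lemma coassoc: "x : carrier H ==>
    tensor_extend (tensor_algebra H HH.T) (%x1 x2. tensor H HH.T x1 (comult H x2)) (comult H x) =
    tensor_extend (tensor_algebra H HH.T) (%x1 x2. tensor_extend (tensor_algebra H HH.T)
      (%x11 x12. tensor H HH.T x11 (HH.tn x12 x2)) (comult H x1)) (comult H x)"
  using is_bialg by (simp add: is_bialgebra_def)

lemma counit_left: "x : carrier H ==> tensor_extend H (%x1 x2. counit H x1 \<odot> x2) (comult H x) = x"
  and counit_right: "x : carrier H ==> tensor_extend H (%x1 x2. counit H x2 \<odot> x1) (comult H x) = x"
  using is_bialg by (simp_all add: is_bialgebra_def)

end

text \<open>The two ways of comultiplying twice are compared through the associator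
  \<open>(x \<otimes> y, z) \<mapsto> x \<otimes> (y \<otimes> z)\<close>.\<close>

context kalg
begin

interpretation HH: tens A A ..
interpretation HHH: tens A HH.T ..

definition associator where
  "associator t z = tensor_extend HHH.T (%x y. HHH.tn x (HH.tn y z)) t"

lemma bilinear_assoc: "z : carrier A ==> bilinear_map A A HHH.T (%x y. HHH.tn x (HH.tn y z))"
  by (rule bilinear_map_compose[OF HHH.bilinear_tn linear_map_id _ linear_map_id])
    (auto intro: bilinear_mapD(1)[OF HH.bilinear_tn])

lemma bilinear_associator: "bilinear_map HH.T A HHH.T associator"
  unfolding associator_def
proof (rule bilinear_mapI)
  show "linear_map HH.T HHH.T (%t. tensor_extend HHH.T (%x y. HHH.tn x (HH.tn y z)) t)" if "z : carrier A" for z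
    by (rule HH.tensor_extend_linear[OF HHH.T.kmod_axioms bilinear_assoc[OF that]])
  show "linear_map A HHH.T (%z. tensor_extend HHH.T (%x y. HHH.tn x (HH.tn y z)) t)" if "t : carrier HH.T" for t
    by (rule HH.tensor_extend_param[OF HHH.T.kmod_axioms bilinear_assoc _ kmod_axioms that])
      (auto intro!: linear_map_comp[OF bilinear_mapD(2)[OF HH.bilinear_tn] bilinear_mapD(2)[OF HHH.bilinear_tn]])
qed

lemma associator_tensor [simp]:
  "x : carrier A ==> y : carrier A ==> z : carrier A ==> associator (HH.tn x y) z = HHH.tn x (HH.tn y z)"
  unfolding associator_def by (simp add: HH.tensor_extend_tensor[OF HHH.T.kmod_axioms bilinear_assoc])

lemmas associator_add = bilinear_mapD(4)[OF bilinear_associator]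
lemmas associator_closed = bilinear_mapD(3)[OF bilinear_associator]

lemma associator_mult:
  assumes "t : carrier HH.T" "t' : carrier HH.T" "z : carrier A" "z' : carrier A"
  shows "associator (t \<otimes>\<^bsub>HH.T\<^esub> t') (z \<otimes> z') = associator t z \<otimes>\<^bsub>HHH.T\<^esub> associator t' z'"
  using assms(1)
proof (induction rule: HH.tensor_induct)
  case (tensor x y)
  show ?case using assms(2)
  proof (induction rule: HH.tensor_induct)
    case (add t t')
    then show ?case using tensor assms by (simp add: HH.T.r_distr HHH.T.r_distr associator_add associator_closed)
  qed (use tensor assms in simp)
next
  case (add s s')
  then show ?case using assms by (simp add: HH.T.l_distr HHH.T.l_distr associator_add associator_closed)
qed

text \<open>Stated for an arbitrary homomorphism \<open>D\<close>, so that the two sides of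
  coassociativity are known to be homomorphisms before a bialgebra structure exists.\<close>

lemma comult_left_hom:
  assumes D: "algebra_hom A HH.T D"
  shows "algebra_hom A HHH.T (%x. tensor_extend HHH.T (%x1 x2. tensor_extend HHH.T
    (%x11 x12. HHH.tn x11 (HH.tn x12 x2)) (D x1)) (D x))"
proof -
  have "bilinear_map A A HHH.T (%x1 x2. associator (D x1) x2)"
    by (rule bilinear_map_compose[OF bilinear_associator algebra_homD(1)[OF D] linear_map_id linear_map_id])
  then have "algebra_hom HH.T HHH.T (tensor_extend HHH.T (%x1 x2. associator (D x1) x2))"
    by (rule HH.tensor_extend_hom[OF HHH.T.kmod_axioms _ HHH.kalgebra_tensor refl])
      (use algebra_homD[OF D] in "simp_all add: associator_mult HH.one_T HHH.one_T")
  then show ?thesis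
    using algebra_hom_comp[OF D] unfolding associator_def by fast
qed

lemma comult_right_hom:
  assumes D: "algebra_hom A HH.T D"
  shows "algebra_hom A HHH.T (%x. tensor_extend HHH.T (%x1 x2. HHH.tn x1 (D x2)) (D x))"
proof -
  have "bilinear_map A A HHH.T (%x1 x2. HHH.tn x1 (D x2))"
    by (rule bilinear_map_compose[OF HHH.bilinear_tn linear_map_id algebra_homD(1)[OF D] linear_map_id])
  then have "algebra_hom HH.T HHH.T (tensor_extend HHH.T (%x1 x2. HHH.tn x1 (D x2)))"
    by (rule HH.tensor_extend_hom[OF HHH.T.kmod_axioms _ HHH.kalgebra_tensor refl])
      (use algebra_homD[OF D] in "simp_all add: HHH.one_T")
  then show ?thesis
    using algebra_hom_comp[OF D] by fast
qed

lemma counit_hom_left: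
  assumes D: "algebra_hom A HH.T D" and e: "algebra_hom A base_field e"
  shows "algebra_hom A A (%x. tensor_extend A (%x1 x2. e x1 \<odot> x2) (D x))" (is ?t1)
    "algebra_hom A A (%x. tensor_extend A (%x1 x2. e x2 \<odot> x1) (D x))" (is ?t2)
proof -
  note E = algebra_homD[OF e, simplified]
  have 1: "bilinear_map A A A (%x1 x2. e x1 \<odot> x2)"
    by (auto intro!: bilinear_mapI linear_mapI simp: E smult_add_left smult_add_right mult.commute)
  have 2: "bilinear_map A A A (%x1 x2. e x2 \<odot> x1)"
    by (auto intro!: bilinear_mapI linear_mapI simp: E smult_add_left smult_add_right mult.commute)
  have "algebra_hom HH.T A (tensor_extend A (%x1 x2. e x1 \<odot> x2))"
    by (rule HH.tensor_extend_hom[OF kmod_axioms 1 is_kalgebra refl]) (simp_all add: E mult.commute)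
  then show ?t1
    using algebra_hom_comp[OF D] by fast
  have "algebra_hom HH.T A (tensor_extend A (%x1 x2. e x2 \<odot> x1))"
    by (rule HH.tensor_extend_hom[OF kmod_axioms 2 is_kalgebra refl]) (simp_all add: E mult.commute)
  then show ?t2
    using algebra_hom_comp[OF D] by fast
qed

end

subsection \<open>Sub-bialgebras\<close>

lemma (in kalg) bilinear_mult:
  "linear_map A A f ==> linear_map A A g ==> bilinear_map A A A (%x y. f x \<otimes> g y)"
  by (auto intro!: bilinear_mapI linear_mapI simp: linear_mapD l_distr r_distr)

text \<open>The unit \<open>u\<close> may differ from that of \<open>H\<close>, as in the corner cut
  out by J^(m-1). That \<open>u\<close> is group-like is therefore assumed instead of following from
  \<open>H\<close>.\<close>

locale sub_bialg = bialg H for H :: "('k::field, 'a) bialgebra" (structure) +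
  fixes C u
  assumes C_sub: "C <= carrier H" and C_zero: "\<zero> : C" and u_in: "u : C"
    and C_add: "!!x y. x : C ==> y : C ==> x \<oplus> y : C"
    and C_mult: "!!x y. x : C ==> y : C ==> x \<otimes> y : C"
    and C_smult: "!!c x. x : C ==> c \<odot> x : C"
    and u_unit: "!!x. x : C ==> u \<otimes> x = x" "!!x. x : C ==> x \<otimes> u = x"
    and counit_u: "counit H u = 1" and comult_u: "comult H u = tensor H H u u"
begin

abbreviation S where "S == sub_bialgebra H C u"

lemma C_carrier [simp, intro]: "x : C ==> x : carrier H" using C_sub by auto

lemma kalgebra_sub: "kalgebra S"
proof -
  have "kmod S"
    by (rule kmodI) (simp_all add: C_zero C_add C_smult a_ac smult_add_left smult_add_right)
  then show ?thesis
    by (rule kalgebraI) (simp_all add: C_mult u_in u_unit m_assoc l_distr r_distr)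
qed

interpretation S: kalg S
  by (rule kalg.intro, rule kalgebra_sub)

interpretation S.HH: tens S S ..

interpretation S.HHH: tens S S.HH.T ..

interpretation HHH: tens H HH.T ..

definition emb where "emb = tensor_extend HH.T HH.tn"

lemma bilinear_restrict: "bilinear_map H H M f ==> bilinear_map S S M f"
  by (auto simp: bilinear_map_def linear_map_def Pi_iff)

lemma bilinear_tn_S: "bilinear_map S S HH.T HH.tn"
  by (rule bilinear_restrict[OF HH.bilinear_tn])

lemma emb_linear: "linear_map S.HH.T HH.T emb"
  unfolding emb_def by (rule S.HH.tensor_extend_linear[OF HH.T.kmod_axioms bilinear_tn_S])

lemma emb_hom:
  "t : carrier S.HH.T ==> t' : carrier S.HH.T ==> emb (t \<otimes>\<^bsub>S.HH.T\<^esub> t') = emb t \<otimes>\<^bsub>HH.T\<^esub> emb t'"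
proof (induction t rule: S.HH.tensor_induct)
  case (tensor x y)
  show ?case using tensor(3)
  proof (induction t' rule: S.HH.tensor_induct)
    case (tensor x' y')
    then show ?case using \<open>x : carrier S\<close> \<open>y : carrier S\<close>
      unfolding emb_def by (simp add: S.HH.tensor_extend_tensor[OF HH.T.kmod_axioms bilinear_tn_S] C_mult)
  next
    case (add s s')
    then show ?case using tensor linear_mapD[OF emb_linear] by (simp add: S.HH.T.r_distr HH.T.r_distr)
  qed
next
  case (add s s')
  then show ?case using linear_mapD[OF emb_linear] by (simp add: S.HH.T.l_distr HH.T.l_distr)
qed

lemma emb_tensor: "x : C ==> y : C ==> emb (S.HH.tn x y) = HH.tn x y"
  unfolding emb_def by (simp add: S.HH.tensor_extend_tensor[OF HH.T.kmod_axioms bilinear_tn_S])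

lemma inclusion_linear: "linear_map S H (%x. x)"
  by (rule linear_mapI) auto

lemma retraction:
  obtains r where "linear_map H S r" "!!x. x : C ==> r x = x"
proof -
  obtain r where "linear_map H H r" "!!x. x : carrier H ==> r x : C" "!!x. x : C ==> r x = x"
    using subspace_retraction[OF C_sub C_zero C_add C_smult] by blast
  moreover from this have "linear_map H S r"
    by (intro linear_mapI) (simp_all add: linear_mapD)
  ultimately show ?thesis using that by blast
qed

text \<open>Scalars in a field enter here: a subspace has a linear retraction, and retracting both
  tensor factors inverts \<open>emb\<close> on its image.\<close>

lemma emb_left_inverse:
  "\<exists>\<rho>. linear_map HH.T S.HH.T \<rho> & (ALL t:carrier S.HH.T. \<rho> (emb t) = t)"
proof -
  obtain r where r: "linear_map H S r" "!!x. x : C ==> r x = x" using retraction by metis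
  show ?thesis
    using tensor_map_left_inverse[OF S.HH.tens_axioms HH.tens_axioms inclusion_linear r(1) _ inclusion_linear r(1)] r(2)
    unfolding emb_def by (simp add: eta_contract_eq)
qed

lemma emb_inj: "t : carrier S.HH.T ==> t' : carrier S.HH.T ==> emb t = emb t' ==> t = t'"
  using emb_left_inverse by metis

lemma bilinear_emb3: "bilinear_map S S.HH.T HHH.T (%x t. HHH.tn x (emb t))"
  by (rule bilinear_map_compose[OF HHH.bilinear_tn inclusion_linear emb_linear linear_map_id])

text \<open>The inclusion of C \<otimes> (C \<otimes> C) into H \<otimes> (H \<otimes> H), along
  which coassociativity is pulled back.\<close>

definition emb3 where "emb3 = tensor_extend HHH.T (%x t. HHH.tn x (emb t))"

lemma emb3_linear: "linear_map S.HHH.T HHH.T emb3"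
  unfolding emb3_def by (rule S.HHH.tensor_extend_linear[OF HHH.T.kmod_axioms bilinear_emb3])

lemma emb3_tensor: "x : C ==> t : carrier S.HH.T ==> emb3 (S.HHH.tn x t) = HHH.tn x (emb t)"
  unfolding emb3_def by (simp add: S.HHH.tensor_extend_tensor[OF HHH.T.kmod_axioms bilinear_emb3])

lemma emb3_inj: "t : carrier S.HHH.T ==> t' : carrier S.HHH.T ==> emb3 t = emb3 t' ==> t = t'"
proof -
  obtain r where r: "linear_map H S r" "!!x. x : C ==> r x = x" using retraction by metis
  obtain \<rho> where \<rho>: "linear_map HH.T S.HH.T \<rho>" "!!t. t\<in>carrier S.HH.T ==> \<rho> (emb t) = t"
    using emb_left_inverse by blast
  have "\<exists>\<rho>. linear_map HHH.T S.HHH.T \<rho> & (ALL t:carrier S.HHH.T. \<rho> (emb3 t) = t)"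
    using tensor_map_left_inverse[OF S.HHH.tens_axioms HHH.tens_axioms inclusion_linear r(1) _ emb_linear \<rho>] r(2)
    unfolding emb3_def by simp
  then show "t : carrier S.HHH.T ==> t' : carrier S.HHH.T ==> emb3 t = emb3 t' ==> t = t'" by metis
qed

lemma tensor_extend_emb:
  assumes "kmod M" "bilinear_map H H M f" "t : carrier S.HH.T"
  shows "tensor_extend M f (emb t) = tensor_extend M f t"
  by (rule S.HH.tensor_extend_unique[OF assms(1) bilinear_restrict[OF assms(2)]
        linear_map_comp[OF emb_linear HH.tensor_extend_linear[OF assms(1,2)]] _ assms(3), symmetric])
    (simp add: emb_tensor HH.tensor_extend_tensor[OF assms(1,2)])

lemma tensor_extend_S:
  assumes "bilinear_map H H H f" "!!x y. x : C ==> y : C ==> f x y : C" "t : carrier S.HH.T"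
  shows "tensor_extend S f t = tensor_extend H f (emb t)"
proof -
  have b: "bilinear_map S S S f"
    by (intro bilinear_mapI linear_mapI) (simp_all add: assms(2) bilinear_mapD[OF assms(1)])
  show ?thesis
    unfolding tensor_extend_emb[OF kmod_axioms assms(1,3)]
    using S.HH.tensor_extend_compose[OF S.kmod_axioms b kmod_axioms inclusion_linear assms(3)] .
qed

text \<open>The image of \<open>emb\<close> is a subalgebra that contains the pure tensors over
  \<open>C\<close>. Whether coproducts stay in C \<otimes> C can therefore be tested on
  generators.\<close>

lemma emb_image_closed:
  "EX t:carrier S.HH.T. emb t = z ==> EX t:carrier S.HH.T. emb t = z' ==> EX t:carrier S.HH.T. emb t = z \<oplus>\<^bsub>HH.T\<^esub> z'"
  "EX t:carrier S.HH.T. emb t = z ==> EX t:carrier S.HH.T. emb t = z' ==> EX t:carrier S.HH.T. emb t = z \<otimes>\<^bsub>HH.T\<^esub> z'"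
  "EX t:carrier S.HH.T. emb t = z ==> EX t:carrier S.HH.T. emb t = c \<odot>\<^bsub>HH.T\<^esub> z"
  "x : C ==> y : C ==> EX t:carrier S.HH.T. emb t = HH.tn x y"
proof -
  assume z: "EX t:carrier S.HH.T. emb t = z"
  then show "EX t:carrier S.HH.T. emb t = c \<odot>\<^bsub>HH.T\<^esub> z"
    by (metis S.HH.T.smult_closed linear_mapD(3)[OF emb_linear])
  assume "EX t:carrier S.HH.T. emb t = z'"
  with z show "EX t:carrier S.HH.T. emb t = z \<oplus>\<^bsub>HH.T\<^esub> z'" "EX t:carrier S.HH.T. emb t = z \<otimes>\<^bsub>HH.T\<^esub> z'"
    by (metis S.HH.T.a_closed linear_mapD(2)[OF emb_linear], metis S.HH.T.m_closed emb_hom)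
next
  assume "x : C" "y : C"
  then show "EX t:carrier S.HH.T. emb t = HH.tn x y"
    by (intro bexI[of _ "S.HH.tn x y"]) (auto simp: emb_tensor)
qed

context
  assumes comult_im: "!!x. x : C ==> EX t:carrier S.HH.T. emb t = comult H x"
begin

text \<open>Existence is the standing assumption and uniqueness is injectivity of
  \<open>emb\<close>; together they make the definite description in \<open>sub_bialgebra\<close>
  meaningful.\<close>

lemma comult_S: "x : C ==> comult S x : carrier S.HH.T" "x : C ==> emb (comult S x) = comult H x"
proof -
  assume x: "x : C"
  have "\<exists>!t. t : carrier S.HH.T & emb t = comult H x"
    using comult_im[OF x] emb_inj by metis
  from theI'[OF this] show "comult S x : carrier S.HH.T" "emb (comult S x) = comult H x"
    unfolding comult_sub_bialgebra emb_def by auto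
qed

lemma comult_S_eqI: "x : C ==> t : carrier S.HH.T ==> emb t = comult H x ==> comult S x = t"
  using comult_S emb_inj by metis

lemma comult_S_hom: "algebra_hom S S.HH.T (comult S)"
proof (intro algebra_homI linear_mapI)
  note C = algebra_homD[OF comult_hom] and I = linear_mapD[OF emb_linear]
  show "comult S \<one>\<^bsub>S\<^esub> = \<one>\<^bsub>S.HH.T\<^esub>"
    by (rule comult_S_eqI) (use u_in comult_u in "auto simp: S.HH.one_T emb_tensor")
  fix x y c assume x: "x : carrier S"
  then show "comult S x : carrier S.HH.T" using comult_S by simp
  show "comult S (c \<odot>\<^bsub>S\<^esub> x) = c \<odot>\<^bsub>S.HH.T\<^esub> comult S x"
    by (rule comult_S_eqI) (use x comult_S C I C_smult in auto)
  assume y: "y : carrier S"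
  show "comult S (x \<oplus>\<^bsub>S\<^esub> y) = comult S x \<oplus>\<^bsub>S.HH.T\<^esub> comult S y"
    by (rule comult_S_eqI) (use x y comult_S C I C_add in auto)
  show "comult S (x \<otimes>\<^bsub>S\<^esub> y) = comult S x \<otimes>\<^bsub>S.HH.T\<^esub> comult S y"
    by (rule comult_S_eqI) (use x y comult_S C emb_hom C_mult in auto)
qed

lemma convolution_S:
  assumes "linear_map H H f" "linear_map H H g" "!!x. x : C ==> f x : C" "!!x. x : C ==> g x : C" "x : C"
  shows "convolution S f g x = convolution H f g x"
  using tensor_extend_S[OF bilinear_mult[OF assms(1,2)], of "comult S x"] assms comult_S[of x]
  by (simp add: convolution_def C_mult)

text \<open>Both sides have the same image under the injective map \<open>emb3\<close>. There the
  associator of \<open>C\<close> becomes that of \<open>H\<close>, and coassociativity of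
  \<open>H\<close> applies.\<close>

lemma coassoc_S:
  assumes x: "x : C"
  shows "tensor_extend S.HHH.T (%x1 x2. S.HHH.tn x1 (comult S x2)) (comult S x) =
    tensor_extend S.HHH.T (%x1 x2. tensor_extend S.HHH.T (%x11 x12. S.HHH.tn x11 (S.HH.tn x12 x2)) (comult S x1)) (comult S x)"
    (is "?l = ?r")
proof -
  note L = algebra_homD(1)[OF comult_S_hom]
  have b1: "bilinear_map S S S.HHH.T (%x1 x2. S.HHH.tn x1 (comult S x2))"
    by (rule bilinear_map_compose[OF S.HHH.bilinear_tn linear_map_id L linear_map_id])
  have b2: "bilinear_map S S S.HHH.T (%x1 x2. S.associator (comult S x1) x2)"
    by (rule bilinear_map_compose[OF S.bilinear_associator L linear_map_id linear_map_id])
  have b1': "bilinear_map H H HHH.T (%x1 x2. HHH.tn x1 (comult H x2))"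
    by (rule bilinear_map_compose[OF HHH.bilinear_tn linear_map_id comult_linear linear_map_id])
  have b2': "bilinear_map H H HHH.T (%x1 x2. associator (comult H x1) x2)"
    by (rule bilinear_map_compose[OF bilinear_associator comult_linear linear_map_id linear_map_id])
  have d: "comult S x : carrier S.HH.T" using comult_S x by simp
  have r: "?r = tensor_extend S.HHH.T (%x1 x2. S.associator (comult S x1) x2) (comult S x)"
    by (simp add: S.associator_def)
  have a: "emb3 (S.associator t z) = associator (emb t) z" if "t : carrier S.HH.T" "z : C" for t z
    using that(1)
  proof (induction rule: S.HH.tensor_induct)
    case (add s s')
    then show ?case
      using that linear_mapD[OF emb_linear] linear_mapD[OF emb3_linear]
      by (simp add: S.associator_add S.associator_closed associator_add)
  qed (use that in "simp add: emb3_tensor emb_tensor")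
  have "emb3 ?l = tensor_extend HHH.T (%x1 x2. emb3 (S.HHH.tn x1 (comult S x2))) (comult S x)"
    by (rule S.HH.tensor_extend_compose[OF S.HHH.T.kmod_axioms b1 HHH.T.kmod_axioms emb3_linear d])
  also have "... = tensor_extend HHH.T (%x1 x2. HHH.tn x1 (comult H x2)) (comult S x)"
    by (rule S.HH.tensor_extend_cong[OF HHH.T.kmod_axioms bilinear_restrict[OF b1'] _ d])
      (simp add: emb3_tensor comult_S)
  also have "... = tensor_extend HHH.T (%x1 x2. HHH.tn x1 (comult H x2)) (comult H x)"
    using tensor_extend_emb[OF HHH.T.kmod_axioms b1' d] comult_S(2)[OF x] by simp
  also have "... = tensor_extend HHH.T (%x1 x2. associator (comult H x1) x2) (comult H x)"
    using coassoc[of x] x by (simp add: associator_def)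
  also have "... = tensor_extend HHH.T (%x1 x2. associator (comult H x1) x2) (comult S x)"
    using tensor_extend_emb[OF HHH.T.kmod_axioms b2' d] comult_S(2)[OF x] by simp
  also have "... = tensor_extend HHH.T (%x1 x2. emb3 (S.associator (comult S x1) x2)) (comult S x)"
    by (rule S.HH.tensor_extend_cong[OF HHH.T.kmod_axioms bilinear_restrict[OF b2'] _ d, symmetric])
      (simp add: a comult_S)
  also have "... = emb3 ?r"
    unfolding r
    by (rule S.HH.tensor_extend_compose[OF S.HHH.T.kmod_axioms b2 HHH.T.kmod_axioms emb3_linear d, symmetric])
  finally have eq: "emb3 ?l = emb3 ?r" .
  have "?l : carrier S.HHH.T"
    by (rule S.HH.tensor_extend_closed[OF S.HHH.T.kmod_axioms b1 d])
  moreover have "?r : carrier S.HHH.T"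
    unfolding r by (rule S.HH.tensor_extend_closed[OF S.HHH.T.kmod_axioms b2 d])
  ultimately show ?thesis using eq by (rule emb3_inj)
qed

lemma is_bialgebra_S: "is_bialgebra S"
proof -
  have e: "algebra_hom S base_field (counit H)"
    by (intro algebra_homI linear_mapI) (auto simp: counit_u)
  have 1: "bilinear_map H H H (%x1 x2. counit H x1 \<odot> x2)"
    by (auto intro!: bilinear_mapI linear_mapI simp: smult_add_left smult_add_right mult.commute)
  have 2: "bilinear_map H H H (%x1 x2. counit H x2 \<odot> x1)"
    by (auto intro!: bilinear_mapI linear_mapI simp: smult_add_left smult_add_right mult.commute)
  have "tensor_extend S (%x1 x2. counit H x1 \<odot> x2) (comult S x) = x" if "x : C" for x
    using tensor_extend_S[OF 1, of "comult S x"] comult_S that counit_left C_smult by simp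
  moreover have "tensor_extend S (%x1 x2. counit H x2 \<odot> x1) (comult S x) = x" if "x : C" for x
    using tensor_extend_S[OF 2, of "comult S x"] comult_S that counit_right C_smult by simp
  ultimately show ?thesis
    using e comult_S_hom kalgebra_sub coassoc_S by (simp add: is_bialgebra_def)
qed

end

end

section \<open>Gaussian binomials and quantum Serre elements\<close>

lemma qint_conv: "(qint k :: 'k::field fls) = (fls_X ^ k - fls_X_inv ^ k) / (fls_X - fls_X_inv)"
  by (simp add: qint_def)

lemma fls_X_power_conv: "(fls_X :: 'k::field fls) ^ k = fls_X_intpow (int k)"
  by (simp add: fls_X_power_conv_shift_1)

lemma fls_X_inv_power_conv: "(fls_X_inv :: 'k::field fls) ^ k = fls_X_intpow (- int k)"
  by (simp add: fls_X_inv_power_conv_shift_1)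

lemma qint_nonzero: "k > 0 ==> (qint k :: 'k::field fls) ~= 0"
proof -
  have nz: "fls_X_intpow (int k) - fls_X_intpow (- int k) ~= (0 :: 'k fls)" if "k > 0" for k
  proof
    assume "fls_X_intpow (int k) - fls_X_intpow (- int k) = (0 :: 'k fls)"
    then have "fls_nth (fls_X_intpow (int k) - fls_X_intpow (- int k) :: 'k fls) (int k) = 0" by simp
    then show False using that by (simp add: fls_shift_nth)
  qed
  assume "k > 0"
  moreover have "fls_X ^ 1 - fls_X_inv ^ 1 ~= (0 :: 'k fls)"
    unfolding fls_X_power_conv fls_X_inv_power_conv by (rule nz) simp
  ultimately show ?thesis using nz[of k]
    unfolding qint_conv fls_X_power_conv[symmetric] fls_X_inv_power_conv[symmetric] by simp
qed

lemma qfact_Suc: "qfact (Suc k) = qint (Suc k) * qfact k"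
  by (simp add: qfact_def mult.commute)

lemma qfact_nonzero: "(qfact k :: 'k::field fls) ~= 0"
  by (induction k) (simp_all add: qfact_Suc qint_nonzero, simp add: qfact_def)

text \<open>Expanding X^(a+b) - X^-(a+b) in two ways. The two versions are exchanged by X -> X^-1
  and give the two forms of the Pascal rule.\<close>

lemma qint_split:
  "(qint (a + b) :: 'k::field fls) = fls_X ^ a * qint b + fls_X_inv ^ b * qint a"
  "(qint (a + b) :: 'k::field fls) = fls_X_inv ^ a * qint b + fls_X ^ b * qint a"
  by (simp_all add: qint_conv power_add add_divide_distrib[symmetric] algebra_simps)

lemma qbinom_0 [simp]: "qbinom n 0 = 1"
  by (simp add: qbinom_def qfact_nonzero qfact_def[of 0])

lemma qbinom_self [simp]: "qbinom n n = 1"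
  by (simp add: qbinom_def qfact_nonzero qfact_def[of 0])

text \<open>With t + 1 = n - r, all three binomials are [n]! / ([r+1]! [t+1]!) times one quantum
  integer, so the rule is \<open>qint_split\<close> for r + 1 and t + 1.\<close>

lemma qbinom_pascal:
  assumes "r < n"
  shows "(qbinom (Suc n) (Suc r) :: 'k::field fls) = fls_X ^ (Suc r) * qbinom n (Suc r) + fls_X_inv ^ (n - r) * qbinom n r" (is ?t2)
    "(qbinom (Suc n) (Suc r) :: 'k::field fls) = fls_X_inv ^ (Suc r) * qbinom n (Suc r) + fls_X ^ (n - r) * qbinom n r" (is ?t1)
proof -
  obtain t where t: "n - r = Suc t" using assms by (metis Suc_diff_Suc)
  have t': "n - Suc r = t" using t by simp
  have n: "Suc n = Suc r + Suc t" using t assms by simp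
  have 1: "(qbinom n (Suc r) :: 'k fls) = qfact n / (qfact (Suc r) * qfact (Suc t)) * qint (Suc t)"
    using qfact_nonzero[where 'k = 'k] qint_nonzero[where 'k = 'k]
    by (simp add: qbinom_def t' qfact_Suc[of t])
  have 2: "(qbinom n r :: 'k fls) = qfact n / (qfact (Suc r) * qfact (Suc t)) * qint (Suc r)"
    using qfact_nonzero[where 'k = 'k] qint_nonzero[where 'k = 'k]
    by (simp add: qbinom_def t qfact_Suc[of r])
  have 3: "(qbinom (Suc n) (Suc r) :: 'k fls) = qfact n / (qfact (Suc r) * qfact (Suc t)) * qint (Suc r + Suc t)"
    unfolding n[symmetric] by (simp add: qbinom_def t qfact_Suc[of n] mult.commute)
  show ?t2
    unfolding 1 2 3 t qint_split(1)[of "Suc r" "Suc t"] by (simp only: distrib_left ac_simps)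
  show ?t1
    unfolding 1 2 3 t qint_split(2)[of "Suc r" "Suc t"] by (simp only: distrib_left ac_simps)
qed

text \<open>Finite support is what makes \<open>laurent_eval\<close> additive: a sum over an
  infinite index set is zero by convention.\<close>

definition laurent_polynomial :: "'k::field fls => bool" where
  "laurent_polynomial f \<longleftrightarrow> finite {n. fls_nth f n ~= 0}"

definition laurent_eval :: "'k::field => 'k fls => 'k" where
  "laurent_eval z f = (\<Sum>n | fls_nth f n ~= 0. fls_nth f n * z powi n)"

lemma laurent_add:
  assumes "laurent_polynomial f" "laurent_polynomial g"
  shows "laurent_polynomial (f + g)" "laurent_eval z (f + g) = laurent_eval z f + laurent_eval z g" (is ?t1)
proof -
  let ?N = "{n. fls_nth f n ~= 0} Un {n. fls_nth g n ~= 0}"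
  have fin: "finite ?N" using assms by (simp add: laurent_polynomial_def)
  show "laurent_polynomial (f + g)"
    unfolding laurent_polynomial_def by (rule finite_subset[OF _ fin]) auto
  have e: "laurent_eval z h = (\<Sum>n\<in>?N. fls_nth h n * z powi n)" if "{n. fls_nth h n ~= 0} <= ?N" for h
    unfolding laurent_eval_def by (rule sum.mono_neutral_left) (use fin that in auto)
  have "laurent_eval z (f + g) = (\<Sum>n\<in>?N. fls_nth (f + g) n * z powi n)" by (rule e) auto
  also have "... = (\<Sum>n\<in>?N. fls_nth f n * z powi n) + (\<Sum>n\<in>?N. fls_nth g n * z powi n)"
    by (simp add: distrib_right sum.distrib)
  also have "... = laurent_eval z f + laurent_eval z g" using e[of f] e[of g] by auto
  finally show ?t1 .
qed

lemma laurent_shift: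
  assumes "z ~= 0"
  shows "laurent_polynomial f ==> laurent_polynomial (fls_shift k f)"
    "laurent_eval z (fls_shift k f) = z powi (- k) * laurent_eval z f" (is ?t1)
proof -
  have S: "{n. fls_nth (fls_shift k f) n ~= 0} = (%n. n - k) ` {n. fls_nth f n ~= 0}" for k :: int and f :: "'a fls"
  proof (intro Set.set_eqI iffI)
    fix n assume "n : {n. fls_nth (fls_shift k f) n ~= 0}"
    then show "n : (%n. n - k) ` {n. fls_nth f n ~= 0}" by (intro image_eqI[of _ _ "n + k"]) auto
  qed auto
  show "laurent_polynomial f ==> laurent_polynomial (fls_shift k f)"
    unfolding laurent_polynomial_def S by simp
  show ?t1
    unfolding laurent_eval_def S
    by (subst sum.reindex)
      (auto simp: inj_on_def sum_distrib_left power_int_diff power_int_minus assms divide_inverse intro!: sum.cong)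
qed

lemma laurent_mult_powers:
  assumes "z ~= 0" "laurent_polynomial f"
  shows "laurent_polynomial (fls_X ^ k * f)" "laurent_eval z (fls_X ^ k * f) = z ^ k * laurent_eval z f"
    "laurent_polynomial (fls_X_inv ^ k * f)" "laurent_eval z (fls_X_inv ^ k * f) = inverse z ^ k * laurent_eval z f"
proof -
  have 1: "fls_X ^ k * f = fls_shift (- int k) f"
    by (simp add: fls_X_power_times_conv_shift)
  have 2: "fls_X_inv ^ k * f = fls_shift (int k) f"
    by (simp add: fls_X_inv_power_times_conv_shift)
  show "laurent_polynomial (fls_X ^ k * f)" "laurent_eval z (fls_X ^ k * f) = z ^ k * laurent_eval z f"
    "laurent_polynomial (fls_X_inv ^ k * f)" "laurent_eval z (fls_X_inv ^ k * f) = inverse z ^ k * laurent_eval z f"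
    unfolding 1 2 using laurent_shift[OF assms(1)] assms
    by (simp_all add: power_int_minus power_inverse)
qed

lemma laurent_one: "laurent_polynomial 1" "laurent_eval z 1 = 1"
proof -
  have "{n. fls_nth (1::'a fls) n ~= 0} = {0}" by auto
  then show "laurent_polynomial (1::'a fls)" "laurent_eval z 1 = 1"
    by (simp_all add: laurent_polynomial_def laurent_eval_def)
qed

text \<open>A quotient of quantum factorials is not visibly a Laurent polynomial; the Pascal rule
  shows it by induction.\<close>

lemma laurent_qbinom: "r \<le> n ==> laurent_polynomial (qbinom n r :: 'k::field fls)"
proof (induction n arbitrary: r)
  case 0 then show ?case by (simp add: laurent_one)
next
  case (Suc n)
  show ?case
  proof (cases "r = 0 | r = Suc n")
    case False
    then obtain r' where r': "r = Suc r'" "r' < n" using Suc.prems by (cases r) auto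
    show ?thesis
      unfolding r'(1) qbinom_pascal(1)[OF r'(2)]
      by (intro laurent_add laurent_mult_powers[of 1] Suc.IH) (use r' in auto)
  qed (auto simp: laurent_one)
qed

lemma qbinom_at_eval: "qbinom_at z n r = laurent_eval z (qbinom n r)"
  by (simp add: qbinom_at_def laurent_eval_def)

lemma qbinom_at_ends [simp]: "qbinom_at z n 0 = 1" "qbinom_at z n n = 1"
  by (simp_all add: qbinom_at_eval laurent_one)

text \<open>Evaluating the rule after the division keeps it valid at roots of unity, where quantum
  factorials may vanish.\<close>

lemma qbinom_at_pascal:
  assumes "z ~= 0" "r < n"
  shows "qbinom_at z (Suc n) (Suc r) = z ^ Suc r * qbinom_at z n (Suc r) + inverse z ^ (n - r) * qbinom_at z n r"
    "qbinom_at z (Suc n) (Suc r) = inverse z ^ Suc r * qbinom_at z n (Suc r) + z ^ (n - r) * qbinom_at z n r"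
  using assms
  by (simp add: qbinom_at_eval qbinom_pascal(1)[OF assms(2)] laurent_add laurent_mult_powers laurent_qbinom del: power_Suc)
    (use assms in "simp add: qbinom_at_eval qbinom_pascal(2)[OF assms(2)] laurent_add laurent_mult_powers laurent_qbinom del: power_Suc")

section \<open>Iterated q-commutators and the factored form of quantum Serre elements\<close>

context kalg
begin

lemma nat_pow_Suc_left: "x : carrier A ==> x [^] Suc n = x \<otimes> x [^] (n::nat)"
  by (metis nat_pow_Suc2)

text \<open>The product of the commuting operators L_x - c_d R_x for d < n, applied to
  \<open>y\<close>, where L_x and R_x are left and right multiplication by \<open>x\<close>. Serre
  elements arise when the c_d form a geometric progression.\<close>

primrec qad :: "'a => (nat => 'k) => nat => 'a => 'a" where
  "qad x c 0 y = y"
| "qad x c (Suc d) y = x \<otimes> qad x c d y \<oplus> (- c d) \<odot> (qad x c d y \<otimes> x)"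

lemma qad_closed [simp, intro]: "x : carrier A ==> y : carrier A ==> qad x c n y : carrier A"
  by (induction n) auto

lemma qad_add:
  "x : carrier A ==> y : carrier A ==> y' : carrier A ==> qad x c n (y \<oplus> y') = qad x c n y \<oplus> qad x c n y'"
  by (induction n) (simp_all add: l_distr r_distr smult_add_right a_ac)

lemma qad_smult:
  "x : carrier A ==> y : carrier A ==> qad x c n (b \<odot> y) = b \<odot> qad x c n y"
  by (induction n) (simp_all add: smult_add_right mult.commute)

lemma qad_zero [simp]: "x : carrier A ==> qad x c n \<zero> = \<zero>"
  by (induction n) simp_all

lemma qad_cong: "(!!d. d < n ==> c d = c' d) ==> qad x c n y = qad x c' n y"
  by (induction n) auto

text \<open>The quantum binomial theorem for the commuting operators of left and right multiplication
  by \<open>x\<close>.\<close>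

lemma qad_eq_sum:
  assumes x: "x : carrier A" and y: "y : carrier A"
    and ends: "!!n. b n 0 = 1" "!!n. b n n = 1"
    and pascal: "!!n r. r < n ==> b (Suc n) (Suc r) = inverse z ^ Suc r * b n (Suc r) + z ^ (n - r) * b n r"
    and z: "z ~= 0"
  shows "qad x (%d. t * z ^ (2 * d)) n y =
    (\<Oplus>r\<in>{..n}. ((- 1) ^ r * t ^ r * z powi (int r * (int n - 1)) * b n r) \<odot> (x [^] (n - r) \<otimes> y \<otimes> x [^] r))"
proof (induction n)
  case 0
  then show ?case using x y ends by simp
next
  case (Suc n)
  define k where "k n r = (- 1) ^ r * t ^ r * z powi (int r * (int n - 1)) * b n r" for n r :: nat
  define w where "w i j = x [^] i \<otimes> y \<otimes> x [^] j" for i j :: nat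
  have w [simp]: "w i j : carrier A" for i j using x y by (simp add: w_def)
  have xw: "x \<otimes> w i j = w (Suc i) j" for i j
    unfolding w_def nat_pow_Suc_left[OF x] using x y by (simp add: m_assoc)
  have wx: "w i j \<otimes> x = w i (Suc j)" for i j
    using x y by (simp add: w_def m_assoc)
  have L: "x \<otimes> qad x (%d. t * z ^ (2 * d)) n y = (\<Oplus>r\<in>{..n}. k n r \<odot> w (Suc (n - r)) r)"
    unfolding Suc.IH k_def[symmetric] w_def[symmetric]
    by (subst finsum_rdistr) (use x xw in "auto intro!: finsum_cong'")
  have R: "qad x (%d. t * z ^ (2 * d)) n y \<otimes> x = (\<Oplus>r\<in>{..n}. k n r \<odot> w (n - r) (Suc r))"
    unfolding Suc.IH k_def[symmetric] w_def[symmetric]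
    by (subst finsum_ldistr) (use x wx in "auto intro!: finsum_cong'")
  \<comment> \<open>The term without a power of x on the right is split off and the others are
    shifted. A zero coefficient at r = n lets the shifted sum run over the same range as the one
    from right multiplication.\<close>
  have L1: "(\<Oplus>r\<in>{..n}. k n r \<odot> w (Suc (n - r)) r) =
      (\<Oplus>r\<in>{..n}. (if r < n then k n (Suc r) else 0) \<odot> w (n - r) (Suc r)) \<oplus> w (Suc n) 0"
  proof (cases n)
    case 0
    then show ?thesis by (simp add: k_def ends)
  next
    case (Suc n')
    have "(\<Oplus>r\<in>{..n}. k n r \<odot> w (Suc (n - r)) r) =
        (\<Oplus>r\<in>{..n'}. k n (Suc r) \<odot> w (Suc (n - Suc r)) (Suc r)) \<oplus> k n 0 \<odot> w (Suc (n - 0)) 0"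
      unfolding Suc by (rule finsum_Suc2) auto
    also have "(\<Oplus>r\<in>{..n'}. k n (Suc r) \<odot> w (Suc (n - Suc r)) (Suc r)) =
       (\<Oplus>r\<in>{..n'}. (if r < n then k n (Suc r) else 0) \<odot> w (n - r) (Suc r))"
      by (rule finsum_cong') (auto simp: Suc Suc_diff_le)
    also have "... = (\<Oplus>r\<in>{..n}. (if r < n then k n (Suc r) else 0) \<odot> w (n - r) (Suc r))"
      unfolding Suc by (subst finsum_Suc) auto
    finally show ?thesis by (simp add: k_def ends)
  qed
  \<comment> \<open>After the powers of z are collected by \<open>e1\<close> and \<open>e2\<close>,
    comparing coefficients is exactly the Pascal rule for \<open>b\<close>; at r = n the boundary
    value 1 takes its place.\<close>
  have coeff: "(if r < n then k n (Suc r) else 0) + (- (t * z ^ (2 * n))) * k n r = k (Suc n) (Suc r)" if "r \<le> n" for r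
  proof -
    have e1: "z ^ (2 * n) * z powi (int r * (int n - 1)) = z powi (int (Suc r) * int n) * z powi (int n - int r)"
    proof -
      have "z ^ (2 * n) * z powi (int r * (int n - 1)) = z powi (2 * int n + int r * (int n - 1))"
        using z by (simp add: power_int_add flip: power_int_of_nat)
      also have "2 * int n + int r * (int n - 1) = int (Suc r) * int n + (int n - int r)"
        by (simp add: algebra_simps)
      finally show ?thesis using z by (simp add: power_int_add)
    qed
    have zr: "z powi (int n - int r) = z ^ (n - r)"
      using that by (simp flip: power_int_of_nat)
    have e2: "z powi (int (Suc r) * (int n - 1)) = z powi (int (Suc r) * int n) * inverse z ^ Suc r"
    proof -
      have "z powi (int (Suc r) * (int n - 1)) = z powi (int (Suc r) * int n + - int (Suc r))"
        by (rule arg_cong) (simp add: algebra_simps)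
      also have "... = z powi (int (Suc r) * int n) * z powi (- int (Suc r))"
        by (rule power_int_add) (use z in simp)
      finally show ?thesis by (simp only: power_int_minus power_int_of_nat power_inverse)
    qed
    show ?thesis
    proof (cases "r < n")
      case True
      have "k n (Suc r) + (- (t * z ^ (2 * n))) * k n r =
        (- 1) ^ Suc r * t ^ Suc r * (z powi (int (Suc r) * (int n - 1)) * b n (Suc r) + (z ^ (2 * n) * z powi (int r * (int n - 1))) * b n r)"
        by (simp add: k_def algebra_simps)
      also have "... = k (Suc n) (Suc r)"
        unfolding e1 e2 zr k_def pascal[OF True] by (simp add: algebra_simps)
      finally show ?thesis using True by simp
    next
      case False
      then have [simp]: "r = n" using that by simp
      have "(- (t * z ^ (2 * n))) * k n n = (- 1) ^ Suc n * t ^ Suc n * (z ^ (2 * n) * z powi (int n * (int n - 1)))"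
        by (simp add: k_def ends)
      also have "... = k (Suc n) (Suc n)"
        using e1 by (simp add: k_def ends)
      finally show ?thesis by simp
    qed
  qed
  have "qad x (%d. t * z ^ (2 * d)) (Suc n) y =
     ((\<Oplus>r\<in>{..n}. (if r < n then k n (Suc r) else 0) \<odot> w (n - r) (Suc r)) \<oplus> w (Suc n) 0) \<oplus>
     (- (t * z ^ (2 * n))) \<odot> (\<Oplus>r\<in>{..n}. k n r \<odot> w (n - r) (Suc r))"
    by (simp add: L R L1)
  also have "(- (t * z ^ (2 * n))) \<odot> (\<Oplus>r\<in>{..n}. k n r \<odot> w (n - r) (Suc r)) =
      (\<Oplus>r\<in>{..n}. ((- (t * z ^ (2 * n))) * k n r) \<odot> w (n - r) (Suc r))"
    by (subst finsum_smult) (auto intro!: finsum_cong')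
  also have "((\<Oplus>r\<in>{..n}. (if r < n then k n (Suc r) else 0) \<odot> w (n - r) (Suc r)) \<oplus> w (Suc n) 0) \<oplus>
      (\<Oplus>r\<in>{..n}. ((- (t * z ^ (2 * n))) * k n r) \<odot> w (n - r) (Suc r)) =
      ((\<Oplus>r\<in>{..n}. (if r < n then k n (Suc r) else 0) \<odot> w (n - r) (Suc r)) \<oplus>
      (\<Oplus>r\<in>{..n}. ((- (t * z ^ (2 * n))) * k n r) \<odot> w (n - r) (Suc r))) \<oplus> w (Suc n) 0"
    by (simp add: a_ac finsum_closed Pi_iff)
  also have "(\<Oplus>r\<in>{..n}. (if r < n then k n (Suc r) else 0) \<odot> w (n - r) (Suc r)) \<oplus>
      (\<Oplus>r\<in>{..n}. ((- (t * z ^ (2 * n))) * k n r) \<odot> w (n - r) (Suc r)) =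
      (\<Oplus>r\<in>{..n}. k (Suc n) (Suc r) \<odot> w (n - r) (Suc r))"
    by (subst finsum_addf[symmetric], blast intro: w, blast intro: w, rule finsum_cong')
      (auto simp only: smult_add_left[OF w, symmetric] coeff atMost_iff Pi_iff intro: w)
  also have "... \<oplus> w (Suc n) 0 = (\<Oplus>r\<in>{..Suc n}. k (Suc n) r \<odot> w (Suc n - r) r)"
    by (subst finsum_Suc2) (simp_all add: k_def ends Pi_iff)
  finally show ?case unfolding k_def w_def by simp
qed

text \<open>The constants run through z^(n-1), z^(n-3), ..., z^(1-n), a progression closed under
  inversion. Expanded, it is the usual alternating sum of Gaussian binomials, see
  \<open>serre_eq_sum\<close>.\<close>

definition serre where
  "serre z n x y = qad x (%d. z powi (int n - 1 - 2 * int d)) n y"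

text \<open>The progression of constants may be run through in either direction: the two orders are
  the quantum binomial theorem at z and at z^-1, for which the two forms of the Pascal rule are
  used. Having both orders available lets later arguments choose which constant comes first.\<close>

lemma serre_eq_sum:
  assumes x: "x : carrier A" and y: "y : carrier A" and z: "z ~= 0"
  shows "serre z n x y = (\<Oplus>r\<in>{..n}. ((- 1) ^ r * qbinom_at z n r) \<odot> (x [^] (n - r) \<otimes> y \<otimes> x [^] r))" (is ?t2)
    "qad x (%d. z powi (1 - int n + 2 * int d)) n y =
      (\<Oplus>r\<in>{..n}. ((- 1) ^ r * qbinom_at z n r) \<odot> (x [^] (n - r) \<otimes> y \<otimes> x [^] r))" (is ?t1)
proof -
  \<comment> \<open>For t = z^(1-n) the powers of t and of z in the coefficients of
    \<open>qad_eq_sum\<close> cancel, leaving the sign and the binomial.\<close>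
  have aux: "t ^ r * z powi (int r * (int n - 1)) = 1" if "z ~= 0" "t = z powi (1 - int n)" for z t :: 'k and r
  proof -
    have "t ^ r = z powi ((1 - int n) * int r)" using that by (simp add: power_int_mult)
    then have "t ^ r * z powi (int r * (int n - 1)) = z powi ((1 - int n) * int r + int r * (int n - 1))"
      using that by (simp add: power_int_add)
    also have "(1 - int n) * int r + int r * (int n - 1) = 0" by (simp add: algebra_simps)
    finally show ?thesis by simp
  qed
  have main: "qad x (%d. t * z ^ (2 * d)) n y =
     (\<Oplus>r\<in>{..n}. ((- 1) ^ r * b n r) \<odot> (x [^] (n - r) \<otimes> y \<otimes> x [^] r))"
    if "t = z powi (1 - int n)" "!!n. b n 0 = 1" "!!n. b n n = 1"
      "!!n r. r < n ==> b (Suc n) (Suc r) = inverse z ^ Suc r * b n (Suc r) + z ^ (n - r) * b n r" "z ~= 0" for t z b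
  proof -
    have "(- 1) ^ r * t ^ r * z powi (int r * (int n - 1)) * b n r = (- 1) ^ r * b n r" for r
      using aux[OF that(5,1), of r] by (simp add: mult.assoc)
    moreover have "qad x (%d. t * z ^ (2 * d)) n y =
        (\<Oplus>r\<in>{..n}. ((- 1) ^ r * t ^ r * z powi (int r * (int n - 1)) * b n r) \<odot> (x [^] (n - r) \<otimes> y \<otimes> x [^] r))"
      by (rule qad_eq_sum[OF x y]) (use that in auto)
    ultimately show ?thesis by (simp only:)
  qed
  have s1: "qad x (%d. z powi (1 - int n + 2 * int d)) n y = qad x (%d. z powi (1 - int n) * z ^ (2 * d)) n y"
    by (rule qad_cong) (use z in "simp add: power_int_add flip: power_int_of_nat")
  show ?t1
    unfolding s1 by (rule main) (use z qbinom_at_pascal(2) in auto)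
  have s2: "serre z n x y = qad x (%d. inverse z powi (1 - int n) * inverse z ^ (2 * d)) n y"
    unfolding serre_def
  proof (rule qad_cong)
    fix d
    have "z powi (int n - 1 - 2 * int d) = z powi (- (1 - int n) + - int (2 * d))"
      by (rule arg_cong) simp
    also have "... = z powi (- (1 - int n)) * z powi (- int (2 * d))"
      by (rule power_int_add) (use z in simp)
    finally show "z powi (int n - 1 - 2 * int d) = inverse z powi (1 - int n) * inverse z ^ (2 * d)"
      by (simp only: power_int_minus power_int_inverse power_int_of_nat power_inverse)
  qed
  show ?t2
    unfolding s2 by (rule main) (use z qbinom_at_pascal(1) in auto)
qed

lemma serre_alt:
  "x : carrier A ==> y : carrier A ==> z ~= 0 ==>
    serre z n x y = qad x (%d. z powi (1 - int n + 2 * int d)) n y"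
  by (simp add: serre_eq_sum)

lemma serre_closed [simp, intro]: "x : carrier A ==> y : carrier A ==> serre z n x y : carrier A"
  by (simp add: serre_def)

lemma word_value_serre_rel:
  assumes "f x : carrier A" "f y : carrier A" "z ~= 0"
  shows "lin A (word_value A f) (serre_rel z n x y) = serre z n (f x) (f y)"
proof -
  have f: "f : {x, y} \<rightarrow> carrier A" using assms by auto
  have wc: "word_value A f : lists {x, y} \<rightarrow> carrier A" using word_value_closed[OF f] by auto
  have "lin A (word_value A f) (serre_rel z n x y) =
    (\<Oplus>r\<in>{..n}. lin A (word_value A f) (single (replicate (n - r) x @ [y] @ replicate r x) ((-1) ^ r * qbinom_at z n r)))"
    unfolding serre_rel_def by (rule lin_sum[OF wc]) auto
  also have "... = (\<Oplus>r\<in>{..n}. ((- 1) ^ r * qbinom_at z n r) \<odot> (f x [^] (n - r) \<otimes> f y \<otimes> f x [^] r))"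
  proof (rule finsum_cong')
    fix r assume "r : {..n}"
    have l: "replicate (n - r) x : lists {x, y}" "[y] : lists {x, y}" "replicate r x : lists {x, y}" "[y] @ replicate r x : lists {x, y}" by auto
    have "word_value A f (replicate (n - r) x @ [y] @ replicate r x) = f x [^] (n - r) \<otimes> (f y \<otimes> f x [^] r)"
      unfolding word_value_append[OF f l(1,4)] word_value_append[OF f l(2,3)]
      using assms by (simp add: word_value_replicate)
    then show "lin A (word_value A f) (single (replicate (n - r) x @ [y] @ replicate r x) ((-1) ^ r * qbinom_at z n r)) =
      ((- 1) ^ r * qbinom_at z n r) \<odot> (f x [^] (n - r) \<otimes> f y \<otimes> f x [^] r)"
      using assms by (simp add: m_assoc del: append_Cons)
  qed (use assms in auto)
  finally show ?thesis using assms by (simp add: serre_eq_sum)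
qed

end

section \<open>Serre elements under coproducts, toral twists, reversal of products, and commutation
  with a dual generator\<close>

context kalg
begin

lemma smult_swap: "x \<otimes> y = b \<odot> (y \<otimes> x) ==> b ~= 0 ==> x : carrier A ==> y : carrier A ==>
    y \<otimes> x = inverse b \<odot> (x \<otimes> y)"
  by simp

lemma mult_swap3:
  assumes "x \<otimes> y = b \<odot> (y \<otimes> x)" "x : carrier A" "y : carrier A" "z : carrier A"
  shows "x \<otimes> (y \<otimes> z) = b \<odot> (y \<otimes> (x \<otimes> z))"
  using assms by (simp add: m_assoc[symmetric])

text \<open>If v passes the d-th partial product Y with the factor c_d, then v Y - c_d Y v = 0, so v
  contributes nothing to the next factor. Passing that factor multiplies the constant by b, in step
  with the progression.\<close>

lemma qad_absorb:
  assumes [simp]: "u : carrier A" "v : carrier A" "w : carrier A"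
    and vu: "v \<otimes> u = b \<odot> (u \<otimes> v)" and vw: "v \<otimes> w = c 0 \<odot> (w \<otimes> v)" and c: "!!d. c (Suc d) = b * c d"
  shows "v \<otimes> qad u c d w = c d \<odot> (qad u c d w \<otimes> v)" (is ?t1) "qad (u \<oplus> v) c d w = qad u c d w"
proof -
  have 1: "v \<otimes> qad u c d w = c d \<odot> (qad u c d w \<otimes> v)" for d
  proof (induction d)
    case 0 then show ?case using vw by simp
  next
    case (Suc d)
    define Y where "Y = qad u c d w"
    have [simp]: "Y : carrier A" by (simp add: Y_def)
    have vY: "v \<otimes> Y = c d \<odot> (Y \<otimes> v)" using Suc.IH by (simp add: Y_def)
    have "v \<otimes> (u \<otimes> Y) = (b * c d) \<odot> ((u \<otimes> Y) \<otimes> v)"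
      using mult_swap3[OF vu, of Y] by (simp add: vY m_assoc)
    moreover have "v \<otimes> (Y \<otimes> u) = (b * c d) \<odot> ((Y \<otimes> u) \<otimes> v)"
      using mult_swap3[OF vY, of u] by (simp add: vu m_assoc mult.commute)
    ultimately show ?case
      by (simp add: c l_distr r_distr smult_add_right mult_ac flip: Y_def)
  qed
  show ?t1 by (rule 1)
  show "qad (u \<oplus> v) c d w = qad u c d w"
  proof (induction d)
    case (Suc d)
    define Y where "Y = qad u c d w"
    have [simp]: "Y : carrier A" by (simp add: Y_def)
    have vY: "v \<otimes> Y = c d \<odot> (Y \<otimes> v)" using 1 by (simp add: Y_def)
    have "qad (u \<oplus> v) c (Suc d) w = (u \<otimes> Y \<oplus> (- c d) \<odot> (Y \<otimes> u)) \<oplus> (c d \<odot> (Y \<otimes> v) \<oplus> (- c d) \<odot> (Y \<otimes> v))"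
      by (simp add: Suc.IH l_distr r_distr smult_add_right vY a_ac flip: Y_def)
    also have "c d \<odot> (Y \<otimes> v) \<oplus> (- c d) \<odot> (Y \<otimes> v) = \<zero>"
      by (simp flip: smult_add_left)
    finally show ?case by (simp flip: Y_def)
  qed simp
qed

text \<open>Here u + v and w + y stand for the coproducts of two generators. The mixed terms are
  absorbed by \<open>qad_absorb\<close>: v acting on w with the progression that starts at z^(1-n),
  and u acting on y with the one that starts at z^(n-1). Only the two pure Serre elements
  remain.\<close>

lemma serre_coproduct:
  assumes [simp]: "u : carrier A" "v : carrier A" "w : carrier A" "y : carrier A" and z: "z ~= 0"
    and vu: "v \<otimes> u = z powi 2 \<odot> (u \<otimes> v)" and vw: "v \<otimes> w = z powi (1 - int n) \<odot> (w \<otimes> v)"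
    and yu: "y \<otimes> u = z powi (1 - int n) \<odot> (u \<otimes> y)"
  shows "serre z n (u \<oplus> v) (w \<oplus> y) = serre z n u w \<oplus> serre z n v y"
proof -
  have "serre z n (u \<oplus> v) w = serre z n u w"
    unfolding serre_alt[OF _ _ z, of "u \<oplus> v" w, simplified] serre_alt[OF _ _ z, of u w, simplified]
  proof (rule qad_absorb(2)[OF _ _ _ vu])
    fix d
    have "z powi (1 - int n + 2 * int (Suc d)) = z powi (2 + (1 - int n + 2 * int d))"
      by (rule arg_cong) simp
    also have "... = z powi 2 * z powi (1 - int n + 2 * int d)"
      by (rule power_int_add) (use z in simp)
    finally show "z powi (1 - int n + 2 * int (Suc d)) = z powi 2 * z powi (1 - int n + 2 * int d)" .
  qed (use vw in auto)
  moreover have "serre z n (v \<oplus> u) y = serre z n v y"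
    unfolding serre_def
  proof (rule qad_absorb(2))
    show "u \<otimes> v = inverse (z powi 2) \<odot> (v \<otimes> u)"
      by (rule smult_swap[OF vu]) (use z in auto)
    have "u \<otimes> y = inverse (z powi (1 - int n)) \<odot> (y \<otimes> u)"
      by (rule smult_swap[OF yu]) (use z in auto)
    moreover have "inverse (z powi (1 - int n)) = z powi (int n - 1 - 2 * int 0)"
      by (simp flip: power_int_minus)
    ultimately show "u \<otimes> y = z powi (int n - 1 - 2 * int 0) \<odot> (y \<otimes> u)" by simp
    fix d
    have "z powi (int n - 1 - 2 * int (Suc d)) = z powi (- 2 + (int n - 1 - 2 * int d))"
      by (rule arg_cong) simp
    also have "... = z powi (- 2) * z powi (int n - 1 - 2 * int d)"
      by (rule power_int_add) (use z in simp)
    finally show "z powi (int n - 1 - 2 * int (Suc d)) = inverse (z powi 2) * z powi (int n - 1 - 2 * int d)"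
      by (simp add: power_int_minus)
  qed auto
  ultimately show ?thesis
    by (simp add: serre_def qad_add a_comm[of u v])
qed

text \<open>Collecting the twists on the right multiplies both terms of each factor by the same
  scalar b^d e, because k passes y and k' passes x with the same constant e. So twisting changes an
  iterated q-commutator only by a scalar and a right factor.\<close>

lemma qad_twisted:
  assumes [simp]: "x : carrier A" "y : carrier A" "k : carrier A" "k' : carrier A"
    and kx: "k \<otimes> x = b \<odot> (x \<otimes> k)" and ky: "k \<otimes> y = e \<odot> (y \<otimes> k)" and k'x: "k' \<otimes> x = e \<odot> (x \<otimes> k')"
    and kk': "k \<otimes> k' = k' \<otimes> k"
  shows "\<exists>g. qad (l \<odot> (x \<otimes> k)) c n (l' \<odot> (y \<otimes> k')) = g \<odot> (qad x c n y \<otimes> (k [^] n \<otimes> k'))"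
proof (induction n)
  case 0 then show ?case by auto
next
  case (Suc d)
  define Y where "Y = qad x c d y"
  define J where "J = k [^] d \<otimes> k'"
  have [simp]: "Y : carrier A" "J : carrier A" by (simp_all add: Y_def J_def)
  have kY: "k \<otimes> Y = (b ^ d * e) \<odot> (Y \<otimes> k)" unfolding Y_def
  proof (induction d)
    case (Suc d)
    define Y where "Y = qad x c d y"
    have [simp]: "Y : carrier A" by (simp add: Y_def)
    have kY: "k \<otimes> Y = (b ^ d * e) \<odot> (Y \<otimes> k)" using Suc.IH by (simp add: Y_def)
    show ?case
      using mult_swap3[OF kx, of Y] mult_swap3[OF kY, of x]
      by (simp add: kY kx l_distr r_distr smult_add_right m_assoc mult_ac flip: Y_def)
  qed (use ky in simp)
  have kpx: "k [^] d \<otimes> x = b ^ d \<odot> (x \<otimes> k [^] d)"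
  proof (induction d)
    case (Suc d)
    have "k [^] Suc d \<otimes> x = b \<odot> (k [^] d \<otimes> x \<otimes> k)" by (simp add: m_assoc kx)
    then show ?case by (simp add: Suc.IH m_assoc)
  qed simp
  have Jx: "J \<otimes> x = (b ^ d * e) \<odot> (x \<otimes> J)"
  proof -
    have "J \<otimes> x = e \<odot> (k [^] d \<otimes> x \<otimes> k')" by (simp add: J_def m_assoc k'x)
    then show ?thesis by (simp add: kpx J_def m_assoc mult.commute)
  qed
  have Jk: "J \<otimes> k = k \<otimes> J"
  proof -
    have "k [^] d \<otimes> k = k \<otimes> k [^] d" by (metis nat_pow_Suc nat_pow_Suc2 \<open>k : carrier A\<close>)
    then show ?thesis by (simp add: J_def m_assoc kk'[symmetric]) (simp add: m_assoc[symmetric])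
  qed
  have kJ: "k [^] Suc d \<otimes> k' = k \<otimes> J"
    unfolding J_def nat_pow_Suc_left[OF \<open>k : carrier A\<close>] by (simp add: m_assoc)
  obtain g where g: "qad (l \<odot> (x \<otimes> k)) c d (l' \<odot> (y \<otimes> k')) = g \<odot> (Y \<otimes> J)"
    using Suc.IH unfolding Y_def J_def by blast
  have 1: "(l \<odot> (x \<otimes> k)) \<otimes> (g \<odot> (Y \<otimes> J)) = (l * g * (b ^ d * e)) \<odot> ((x \<otimes> Y) \<otimes> (k \<otimes> J))"
    using mult_swap3[OF kY, of J] by (simp add: m_assoc mult_ac)
  have 2: "(g \<odot> (Y \<otimes> J)) \<otimes> (l \<odot> (x \<otimes> k)) = (l * g * (b ^ d * e)) \<odot> ((Y \<otimes> x) \<otimes> (k \<otimes> J))"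
    using mult_swap3[OF Jx, of k] by (simp add: m_assoc Jk mult_ac)
  have "qad (l \<odot> (x \<otimes> k)) c (Suc d) (l' \<odot> (y \<otimes> k')) =
      (l * g * (b ^ d * e)) \<odot> (qad x c (Suc d) y \<otimes> (k [^] Suc d \<otimes> k'))"
    unfolding kJ qad.simps g 1 2
    by (simp add: l_distr smult_add_right mult_ac flip: Y_def)
  then show ?case by blast
qed

lemma serre_twisted:
  assumes "x : carrier A" "y : carrier A" "k : carrier A" "k' : carrier A"
    "k \<otimes> x = b \<odot> (x \<otimes> k)" "k \<otimes> y = e \<odot> (y \<otimes> k)" "k' \<otimes> x = e \<odot> (x \<otimes> k')" "k \<otimes> k' = k' \<otimes> k"
    "serre z n x y = \<zero>"
  shows "serre z n (l \<odot> (x \<otimes> k)) (l' \<odot> (y \<otimes> k')) = \<zero>"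
  using qad_twisted[OF assms(1-8), of l "%d. z powi (int n - 1 - 2 * int d)" n l'] assms
  unfolding serre_def by auto

text \<open>Reversing products exchanges left and right multiplication; dividing the factor R_x -
  c_d L_x by - c_d inverts its constant.\<close>

lemma qad_opposite:
  assumes [simp]: "x : carrier A" "y : carrier A" and c: "!!d. c d ~= 0"
  shows "\<exists>g. kalg.qad (opposite A) x c n y = g \<odot> qad x (%d. inverse (c d)) n y"
proof -
  interpret O: kalg "opposite A" by (rule kalg.intro) (rule kalgebra_opposite)
  show ?thesis
  proof (induction n)
    case 0
    then show ?case by (intro exI[of _ 1]) simp
  next
    case (Suc d)
    then obtain g where g: "O.qad x c d y = g \<odot> qad x (%d. inverse (c d)) d y" by blast
    let ?Q = "qad x (%d. inverse (c d)) d y"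
    have "O.qad x c (Suc d) y = g \<odot> (?Q \<otimes> x) \<oplus> (- (c d * g)) \<odot> (x \<otimes> ?Q)"
      by (simp add: g)
    also have "g \<odot> (?Q \<otimes> x) = (c d * g * inverse (c d)) \<odot> (?Q \<otimes> x)"
      using c[of d] by (intro arg_cong2[where f = "%a b. a \<odot> b"]) auto
    finally have "O.qad x c (Suc d) y = (- c d * g) \<odot> qad x (%d. inverse (c d)) (Suc d) y"
      by (simp add: smult_add_right a_comm)
    then show ?case by blast
  qed
qed

text \<open>Inverting the constants runs the symmetric progression backwards, and
  \<open>serre_alt\<close> identifies the result with the original Serre element.\<close>

lemma serre_opposite:
  assumes "x : carrier A" "y : carrier A" "z ~= 0" "serre z n x y = \<zero>"
  shows "kalg.serre (opposite A) z n x y = \<zero>"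
proof -
  interpret O: kalg "opposite A" by (rule kalg.intro) (rule kalgebra_opposite)
  obtain g where "O.serre z n x y = g \<odot> qad x (%d. inverse (z powi (int n - 1 - 2 * int d))) n y"
    unfolding O.serre_def using qad_opposite[of x y "%d. z powi (int n - 1 - 2 * int d)" n] assms by auto
  also have "qad x (%d. inverse (z powi (int n - 1 - 2 * int d))) n y = qad x (%d. z powi (1 - int n + 2 * int d)) n y"
    by (rule qad_cong) (simp flip: power_int_minus add: algebra_simps)
  also have "... = \<zero>" using serre_alt[OF assms(1-3), of n] assms(4) by simp
  finally show ?thesis by simp
qed

lemma qad_mult_commuting:
  assumes "x : carrier A" "y : carrier A" "e : carrier A" "e \<otimes> x = x \<otimes> e"
  shows "qad x c n (e \<otimes> y) = e \<otimes> qad x c n y" "qad x c n (y \<otimes> e) = qad x c n y \<otimes> e"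
proof -
  have x: "x \<otimes> (e \<otimes> t) = e \<otimes> (x \<otimes> t)" if "t : carrier A" for t
    using assms that by (simp add: m_assoc[symmetric])
  show "qad x c n (e \<otimes> y) = e \<otimes> qad x c n y"
    by (induction n) (use assms in "simp_all add: r_distr m_assoc x")
  show "qad x c n (y \<otimes> e) = qad x c n y \<otimes> e"
    by (induction n) (use assms in "simp_all add: l_distr m_assoc")
qed

lemma serre_commute_trivial:
  assumes "x : carrier A" "y : carrier A" "e : carrier A" "e \<otimes> x = x \<otimes> e" "e \<otimes> y = y \<otimes> e"
  shows "e \<otimes> serre z n x y = serre z n x y \<otimes> e"
  using qad_mult_commuting[OF assms(1-4)] assms(5) unfolding serre_def by metis

text \<open>The case of e dual to the second argument. Moving e across leaves Serre elements applied
  to k and to l, and each is killed by a first factor: k by the one with constant z^(1-n), l by the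
  one with constant z^(n-1).\<close>

lemma serre_commute_second:
  assumes [simp]: "x : carrier A" "y : carrier A" "e : carrier A" "k : carrier A" "l : carrier A"
    and z: "z ~= 0" and n: "n > 0" and ex: "e \<otimes> x = x \<otimes> e"
    and ey: "e \<otimes> y = y \<otimes> e \<oplus> c0 \<odot> (k \<oplus> (- 1) \<odot> l)"
    and kx: "k \<otimes> x = z powi (int n - 1) \<odot> (x \<otimes> k)" and lx: "l \<otimes> x = z powi (1 - int n) \<odot> (x \<otimes> l)"
  shows "e \<otimes> serre z n x y = serre z n x y \<otimes> e"
proof -
  have vanish: "qad x c n t = \<zero>" if "t : carrier A" "t \<otimes> x = b \<odot> (x \<otimes> t)" "c 0 * b = 1" for c t b
  proof -
    have 1: "qad x c 1 t = \<zero>"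
      using that by (simp flip: smult_add_left add: smult_minus_left r_neg)
    have "qad x c (Suc d) t = \<zero>" for d
      by (induction d) (use 1 in simp_all)
    then show ?thesis using n by (metis Suc_pred)
  qed
  have k: "serre z n x k = \<zero>"
    unfolding serre_alt[OF \<open>x : carrier A\<close> \<open>k : carrier A\<close> z]
    by (rule vanish[OF _ kx]) (use z in "simp_all flip: power_int_add")
  have l: "serre z n x l = \<zero>"
    unfolding serre_def
    by (rule vanish[OF _ lx]) (use z in "simp_all flip: power_int_add")
  have "e \<otimes> serre z n x y = serre z n x (e \<otimes> y)"
    unfolding serre_def using qad_mult_commuting(1)[OF _ _ _ ex] by simp
  also have "... = serre z n x (y \<otimes> e) \<oplus> c0 \<odot> (serre z n x k \<oplus> (- 1) \<odot> serre z n x l)"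
    unfolding ey serre_def by (simp add: qad_add qad_smult)
  also have "... = serre z n x y \<otimes> e"
    unfolding k l by (simp add: serre_def qad_mult_commuting(2)[OF _ _ _ ex])
  finally show ?thesis .
qed

text \<open>The case of e dual to the first argument. Moving e past the first d factors leaves a
  multiple \<gamma>_d of the previous partial product times l; since the constants c_0, ..., c_(n-1)
  pair off with their inverses, \<gamma>_n = 0.\<close>

lemma serre_commute_first:
  assumes [simp]: "x : carrier A" "y : carrier A" "e : carrier A" "k : carrier A" "l : carrier A"
    and z: "z ~= 0" and ey: "e \<otimes> y = y \<otimes> e"
    and ex: "e \<otimes> x = x \<otimes> e \<oplus> c0 \<odot> (k \<oplus> (- 1) \<odot> l)"
    and kx: "k \<otimes> x = z powi (- 2) \<odot> (x \<otimes> k)" and lx: "l \<otimes> x = z powi 2 \<odot> (x \<otimes> l)"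
    and ky: "k \<otimes> y = z powi (int n - 1) \<odot> (y \<otimes> k)" and ly: "l \<otimes> y = z powi (1 - int n) \<odot> (y \<otimes> l)"
  shows "e \<otimes> serre z n x y = serre z n x y \<otimes> e"
proof -
  define c where "c d = z powi (int n - 1 - 2 * int d)" for d
  define Y where "Y d = qad x c d y" for d
  have [simp]: "Y d : carrier A" for d by (simp add: Y_def)
  have Y_Suc: "Y (Suc d) = x \<otimes> Y d \<oplus> (- c d) \<odot> (Y d \<otimes> x)" for d by (simp add: Y_def)
  have cS: "c (Suc d) = z powi (- 2) * c d" for d
  proof -
    have "c (Suc d) = z powi (- 2 + (int n - 1 - 2 * int d))" unfolding c_def by (rule arg_cong) simp
    also have "... = z powi (- 2) * c d" unfolding c_def by (rule power_int_add) (use z in simp)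
    finally show ?thesis .
  qed
  have c0: "c 0 = z powi (int n - 1)" by (simp add: c_def)
  have [simp]: "c d ~= 0" for d using z by (simp add: c_def)
  have kY: "k \<otimes> Y d = c d \<odot> (Y d \<otimes> k)" for d
    unfolding Y_def by (rule qad_absorb(1)[OF _ _ _ kx]) (use ky cS c0 in auto)
  have lY: "l \<otimes> Y d = inverse (c d) \<odot> (Y d \<otimes> l)" for d
  proof (induction d)
    case 0
    show ?case using ly by (simp add: Y_def c0 flip: power_int_minus)
  next
    case (Suc d)
    have cS': "inverse (c (Suc d)) = z powi 2 * inverse (c d)"
      by (simp add: cS power_int_minus)
    show ?case
      using mult_swap3[OF lx, of "Y d"] mult_swap3[OF Suc.IH, of x]
      by (simp add: Y_Suc Suc.IH lx cS' l_distr r_distr smult_add_right m_assoc mult_ac)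
  qed
  \<comment> \<open>In each factor the terms with k cancel, while the terms with l leave c_d from
    right multiplication by x and - 1/c_d from left multiplication.\<close>
  define \<gamma> where "\<gamma> d = c0 * (\<Sum>i<d. c i - inverse (c i))" for d
  have main: "e \<otimes> Y d = Y d \<otimes> e \<oplus> \<gamma> d \<odot> (Y (d - 1) \<otimes> l)" for d
  proof (induction d)
    case 0
    show ?case using ey by (simp add: \<gamma>_def Y_def)
  next
    case (Suc d)
    define V where "V = Y (d - 1)"
    have [simp]: "V : carrier A" by (simp add: V_def)
    have IH: "e \<otimes> Y d = Y d \<otimes> e \<oplus> \<gamma> d \<odot> (V \<otimes> l)" using Suc.IH by (simp add: V_def)
    \<comment> \<open>The constant c_d z^2 is that of the preceding factor, so the bracket rebuilds
      \<open>Y d\<close>. For d = 0 the truncated index d - 1 is harmless because \<gamma>_0 =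
      0.\<close>
    have VY: "\<gamma> d \<odot> (x \<otimes> V \<oplus> (- (c d * z powi 2)) \<odot> (V \<otimes> x)) = \<gamma> d \<odot> Y d"
    proof (cases d)
      case 0 then show ?thesis by (simp add: \<gamma>_def)
    next
      case (Suc d')
      have "c d * z powi 2 = c d'" unfolding Suc cS using z by (simp add: power_int_minus)
      then show ?thesis by (simp add: V_def Suc Y_Suc)
    qed
    have a1: "e \<otimes> (x \<otimes> Y d) = (x \<otimes> Y d) \<otimes> e \<oplus> \<gamma> d \<odot> ((x \<otimes> V) \<otimes> l) \<oplus>
        (c0 * c d) \<odot> (Y d \<otimes> k) \<oplus> (- (c0 * inverse (c d))) \<odot> (Y d \<otimes> l)"
    proof -
      have "e \<otimes> (x \<otimes> Y d) = (e \<otimes> x) \<otimes> Y d" by (simp add: m_assoc)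
      also have "... = x \<otimes> (e \<otimes> Y d) \<oplus> c0 \<odot> (k \<otimes> Y d) \<oplus> (- c0) \<odot> (l \<otimes> Y d)"
        by (simp add: ex l_distr m_assoc smult_add_right a_assoc)
      finally show ?thesis by (simp add: IH kY lY r_distr m_assoc)
    qed
    have a2: "e \<otimes> (Y d \<otimes> x) = (Y d \<otimes> x) \<otimes> e \<oplus> (\<gamma> d * z powi 2) \<odot> ((V \<otimes> x) \<otimes> l) \<oplus>
        c0 \<odot> (Y d \<otimes> k) \<oplus> (- c0) \<odot> (Y d \<otimes> l)"
    proof -
      have "e \<otimes> (Y d \<otimes> x) = (e \<otimes> Y d) \<otimes> x" by (simp add: m_assoc)
      also have "... = Y d \<otimes> (e \<otimes> x) \<oplus> \<gamma> d \<odot> (V \<otimes> (l \<otimes> x))"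
        by (simp add: IH l_distr m_assoc)
      also have "... = ((Y d \<otimes> x) \<otimes> e \<oplus> c0 \<odot> (Y d \<otimes> k) \<oplus> (- c0) \<odot> (Y d \<otimes> l)) \<oplus> (\<gamma> d * z powi 2) \<odot> ((V \<otimes> x) \<otimes> l)"
        by (simp add: ex lx r_distr m_assoc smult_add_right a_assoc)
      finally show ?thesis by (simp add: a_ac)
    qed
    have "e \<otimes> Y (Suc d) = e \<otimes> (x \<otimes> Y d) \<oplus> (- c d) \<odot> (e \<otimes> (Y d \<otimes> x))"
      by (simp add: Y_Suc r_distr)
    also have "... = Y (Suc d) \<otimes> e \<oplus> (\<gamma> d \<odot> (x \<otimes> V \<oplus> (- (c d * z powi 2)) \<odot> (V \<otimes> x))) \<otimes> l \<oplus>
        ((c0 * c d) \<odot> (Y d \<otimes> k) \<oplus> (- (c0 * c d)) \<odot> (Y d \<otimes> k)) \<oplus>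
        ((c0 * c d) \<odot> (Y d \<otimes> l) \<oplus> (- (c0 * inverse (c d))) \<odot> (Y d \<otimes> l))"
      unfolding a1 a2
      by (simp add: Y_Suc l_distr smult_add_right a_ac mult_ac)
    also have "(c0 * c d) \<odot> (Y d \<otimes> k) \<oplus> (- (c0 * c d)) \<odot> (Y d \<otimes> k) = \<zero>"
      by (simp add: smult_minus_left r_neg)
    also have "(c0 * c d) \<odot> (Y d \<otimes> l) \<oplus> (- (c0 * inverse (c d))) \<odot> (Y d \<otimes> l) =
        (c0 * (c d - inverse (c d))) \<odot> (Y d \<otimes> l)"
      by (simp add: algebra_simps flip: smult_add_left)
    also have "(\<gamma> d \<odot> (x \<otimes> V \<oplus> (- (c d * z powi 2)) \<odot> (V \<otimes> x))) \<otimes> l = \<gamma> d \<odot> (Y d \<otimes> l)"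
      unfolding VY by simp
    finally have "e \<otimes> Y (Suc d) = Y (Suc d) \<otimes> e \<oplus> (\<gamma> d \<odot> (Y d \<otimes> l) \<oplus> (c0 * (c d - inverse (c d))) \<odot> (Y d \<otimes> l))"
      by (simp add: a_assoc)
    also have "\<gamma> d \<odot> (Y d \<otimes> l) \<oplus> (c0 * (c d - inverse (c d))) \<odot> (Y d \<otimes> l) = \<gamma> (Suc d) \<odot> (Y d \<otimes> l)"
      by (simp add: \<gamma>_def distrib_left flip: smult_add_left)
    finally show ?case by simp
  qed
  \<comment> \<open>Reflection of the index uses c_(n-1-i) = 1/c_i.\<close>
  have "(\<Sum>i<n. inverse (c i)) = (\<Sum>i<n. inverse (c (n - Suc i)))"
    by (rule sum.nat_diff_reindex[symmetric])
  also have "... = (\<Sum>i<n. c i)"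
  proof (rule sum.cong)
    fix i assume "i : {..<n}"
    then have "int (n - Suc i) = int n - 1 - int i" by simp
    then show "inverse (c (n - Suc i)) = c i"
      by (simp add: c_def algebra_simps flip: power_int_minus)
  qed simp
  finally have "\<gamma> n = 0" by (simp add: \<gamma>_def sum_subtractf)
  then show ?thesis using main[of n] by (simp add: serre_def Y_def c_def[abs_def])
qed

end

context tens
begin

text \<open>The commuting legs a and b merely accumulate to a^d b in both terms of a factor, so the
  q-commutators take place in the other leg.\<close>

lemma serre_tensor_right:
  assumes "a : carrier A" "b : carrier A" "a \<otimes>\<^bsub>A\<^esub> b = b \<otimes>\<^bsub>A\<^esub> a" "x : carrier B" "y : carrier B"
    "B.serre z n x y = \<zero>\<^bsub>B\<^esub>"
  shows "T.serre z n (tn a x) (tn b y) = \<zero>\<^bsub>T\<^esub>"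
proof -
  have comm: "a [^]\<^bsub>A\<^esub> d \<otimes>\<^bsub>A\<^esub> b \<otimes>\<^bsub>A\<^esub> a = a [^]\<^bsub>A\<^esub> Suc d \<otimes>\<^bsub>A\<^esub> b" for d :: nat
    using assms by (simp add: A.m_assoc)
  have comm': "a \<otimes>\<^bsub>A\<^esub> (a [^]\<^bsub>A\<^esub> d \<otimes>\<^bsub>A\<^esub> b) = a [^]\<^bsub>A\<^esub> Suc d \<otimes>\<^bsub>A\<^esub> b" for d :: nat
    unfolding A.nat_pow_Suc_left[OF assms(1)] using assms by (simp add: A.m_assoc)
  have "T.qad (tn a x) c d (tn b y) = tn (a [^]\<^bsub>A\<^esub> d \<otimes>\<^bsub>A\<^esub> b) (B.qad x c d y)" for c d
  proof (induction d)
    case (Suc d)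
    then show ?case
      using assms by (simp add: tn_add_right tn_smult_right comm comm' del: nat_pow_Suc A.nat_pow_Suc)
  qed (use assms in simp)
  then show ?thesis
    using assms(1,2,6) tn_smult_right[of "a [^]\<^bsub>A\<^esub> n \<otimes>\<^bsub>A\<^esub> b" "\<zero>\<^bsub>B\<^esub>" 0]
    unfolding T.serre_def B.serre_def by simp
qed

lemma serre_tensor_left:
  assumes "a : carrier B" "b : carrier B" "a \<otimes>\<^bsub>B\<^esub> b = b \<otimes>\<^bsub>B\<^esub> a" "x : carrier A" "y : carrier A"
    "A.serre z n x y = \<zero>\<^bsub>A\<^esub>"
  shows "T.serre z n (tn x a) (tn y b) = \<zero>\<^bsub>T\<^esub>"
proof -
  have comm: "a [^]\<^bsub>B\<^esub> d \<otimes>\<^bsub>B\<^esub> b \<otimes>\<^bsub>B\<^esub> a = a [^]\<^bsub>B\<^esub> Suc d \<otimes>\<^bsub>B\<^esub> b" for d :: nat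
    using assms by (simp add: B.m_assoc)
  have comm': "a \<otimes>\<^bsub>B\<^esub> (a [^]\<^bsub>B\<^esub> d \<otimes>\<^bsub>B\<^esub> b) = a [^]\<^bsub>B\<^esub> Suc d \<otimes>\<^bsub>B\<^esub> b" for d :: nat
    unfolding B.nat_pow_Suc_left[OF assms(1)] using assms by (simp add: B.m_assoc)
  have "T.qad (tn x a) c d (tn y b) = tn (A.qad x c d y) (a [^]\<^bsub>B\<^esub> d \<otimes>\<^bsub>B\<^esub> b)" for c d
  proof (induction d)
    case (Suc d)
    then show ?case
      using assms by (simp add: tn_add_left tn_smult_left comm comm' del: nat_pow_Suc B.nat_pow_Suc)
  qed (use assms in simp)
  then show ?thesis
    using assms(1,2,6) tn_smult_left[of "\<zero>\<^bsub>A\<^esub>" "a [^]\<^bsub>B\<^esub> n \<otimes>\<^bsub>B\<^esub> b" 0]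
    unfolding T.serre_def A.serre_def by simp
qed

end

section \<open>The relations of the weak quantum algebra in an arbitrary algebra\<close>

lemma ball_setcompr1: "(ALL x:{f i | i. P i}. Q x) \<longleftrightarrow> (\<forall>i. P i --> Q (f i))"
  by blast

lemma ball_setcompr2: "(ALL x:{f i j | i j. P i j}. Q x) \<longleftrightarrow> (\<forall>i j. P i j --> Q (f i j))"
  by blast

lemma ball_setcompr3: "(ALL x:{f i j k | i j k. P i j k}. Q x) \<longleftrightarrow> (\<forall>i j k. P i j k --> Q (f i j k))"
  by blast

definition typed_weight :: "('k::field, 'b, 'e) module_scheme => nat => 'b => 'b => 'b => 'k => bool" where
  "typed_weight B t u v x c \<longleftrightarrow>
    (if t = 1 then u \<otimes>\<^bsub>B\<^esub> x = c \<odot>\<^bsub>B\<^esub> (x \<otimes>\<^bsub>B\<^esub> u) & v \<otimes>\<^bsub>B\<^esub> x = inverse c \<odot>\<^bsub>B\<^esub> (x \<otimes>\<^bsub>B\<^esub> v)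
     else u \<otimes>\<^bsub>B\<^esub> x \<otimes>\<^bsub>B\<^esub> v = c \<odot>\<^bsub>B\<^esub> x)"

definition ef_rel :: "('k::field, 'b, 'e) module_scheme => 'k => bool => 'b => 'b => 'b => 'b => bool" where
  "ef_rel B z b x y k l \<longleftrightarrow> x \<otimes>\<^bsub>B\<^esub> y = y \<otimes>\<^bsub>B\<^esub> x \<oplus>\<^bsub>B\<^esub>
     (if b then (1 / (z - inverse z)) \<odot>\<^bsub>B\<^esub> (k \<oplus>\<^bsub>B\<^esub> (- 1) \<odot>\<^bsub>B\<^esub> l) else \<zero>\<^bsub>B\<^esub>)"

locale rel_eval = B: kalg B for B :: "('k::field, 'b, 'e) module_scheme" (structure) +
  fixes gs :: "'g set" and f :: "'g => 'b"
  assumes f_closed: "f : gs \<rightarrow> carrier B"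
begin

abbreviation ev where "ev == word_value B f"

lemma f_carrier [simp]: "g : gs ==> f g : carrier B" using f_closed by auto

lemma ev_closed [simp]: "w : lists gs ==> ev w : carrier B"
  by (rule B.word_value_closed[OF f_closed])

lemma ev_funcset: "ev : lists gs \<rightarrow> carrier B" by auto

lemma eval_binomial:
  assumes "u : lists gs" "v : lists gs"
  shows "lin B ev (single u 1 - single v c) = \<zero> \<longleftrightarrow> ev u = c \<odot> ev v"
proof -
  have "ev u \<oplus> (- 1) \<odot> (c \<odot> ev v) = \<zero> \<longleftrightarrow> ev u = c \<odot> ev v"
    by (rule B.diff_zero_iff) (use assms in simp_all)
  moreover have "lin B ev (single u 1 - single v c) = ev u \<oplus> (- 1) \<odot> (c \<odot> ev v)"
    using assms by (subst B.lin_diff[OF ev_funcset]) auto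
  ultimately show ?thesis by simp
qed

lemma eval_commutator:
  "x : gs ==> y : gs ==> lin B ev (commutator_rel x y) = \<zero> \<longleftrightarrow> f x \<otimes> f y = f y \<otimes> f x"
  unfolding commutator_rel_def by (subst eval_binomial) auto

lemma eval_type_one:
  "x : gs ==> u : gs ==> lin B ev (type_one_rel u x c) = \<zero> \<longleftrightarrow> f u \<otimes> f x = c \<odot> (f x \<otimes> f u)"
  unfolding type_one_rel_def by (subst eval_binomial) auto

lemma eval_conjugation:
  "x : gs ==> u : gs ==> v : gs ==>
    lin B ev (conjugation_rel u x v c) = \<zero> \<longleftrightarrow> f u \<otimes> f x \<otimes> f v = c \<odot> f x"
  unfolding conjugation_rel_def by (subst eval_binomial) (auto simp: B.m_assoc)

lemma eval_serre:
  "x : gs ==> y : gs ==> z ~= 0 ==> lin B ev (serre_rel z n x y) = B.serre z n (f x) (f y)"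
  by (simp add: B.word_value_serre_rel)

lemma eval_ef:
  assumes g: "x : gs" "y : gs" "b ==> k : gs" "b ==> l : gs"
  shows "lin B ev (commutator_rel x y - (if b then single [k] (1 / (z - inverse z)) -
       single [l] (1 / (z - inverse z)) else 0)) = \<zero> \<longleftrightarrow> ef_rel B z b (f x) (f y) (f k) (f l)"
proof -
  let ?r = "if b then single [k] (1 / (z - inverse z)) - single [l] (1 / (z - inverse z)) else 0"
  let ?h = "if b then (1 / (z - inverse z)) \<odot> (f k \<oplus> (- 1) \<odot> f l) else \<zero>"
  have h: "?h : carrier B" using g by auto
  have k1: "keys (commutator_rel x y :: _ \<Rightarrow>\<^sub>0 'k) <= lists gs"
    unfolding commutator_rel_def by (rule keys_diff_subset) (use g in auto)
  have k2: "keys ?r <= lists gs"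
    using g by (auto dest!: subsetD[OF keys_diff] split: if_splits)
  have r: "lin B ev ?r = ?h"
    using g by (auto simp: B.lin_diff[OF ev_funcset] B.smult_add_right)
  have "lin B ev (commutator_rel x y) = f x \<otimes> f y \<oplus> (- 1) \<odot> (f y \<otimes> f x)"
    unfolding commutator_rel_def using g by (subst B.lin_diff[OF ev_funcset]) auto
  then have "lin B ev (commutator_rel x y - ?r) = f x \<otimes> f y \<oplus> (- 1) \<odot> (f y \<otimes> f x) \<oplus> (- 1) \<odot> ?h"
    unfolding B.lin_diff[OF ev_funcset k1 k2] r by simp
  also have "... = f x \<otimes> f y \<oplus> (- 1) \<odot> (f y \<otimes> f x \<oplus> ?h)"
    unfolding B.smult_add_right[OF B.m_closed[OF f_carrier f_carrier] h, OF g(2,1)]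
    by (rule B.a_assoc) (use g h in auto)
  also have "... = \<zero> \<longleftrightarrow> f x \<otimes> f y = f y \<otimes> f x \<oplus> ?h"
    by (rule B.diff_zero_iff) (use g h in auto)
  finally show ?thesis unfolding ef_rel_def .
qed

end

section \<open>The Cartan datum, and the defining relations as a property of an assignment of
  generators\<close>

locale cartan =
  fixes I :: "nat set" and a :: "nat => nat => int" and s :: "nat => nat"
    and q :: "'k::field" and m :: nat and \<kappa> \<kappa>' :: "nat => nat"
  assumes I_nonempty: "1 : I"
    and bc: "borcherds_cartan I a" and sym: "symmetrizes I a s"
    and q_cond: "ALL i:I. q ^ s i ~: {0, 1, -1}" and m_ge_2: "m \<ge> 2"
    and types: "ALL i:I. \<kappa> i : {0, 1} & \<kappa>' i : {0, 1}"
begin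

abbreviation qi where "qi i == q ^ s i"
abbreviation n_ij where "n_ij i j == nat (1 - a i j)"

lemma s_pos: "i : I ==> s i > 0" using sym by (simp add: symmetrizes_def)

lemma q_nonzero [simp]: "q ~= 0"
proof
  assume "q = 0"
  then have "q ^ s 1 = 0" using s_pos[OF I_nonempty] by simp
  then show False using q_cond I_nonempty by auto
qed

lemma qi_diff: "i : I ==> qi i - inverse (qi i) ~= 0"
proof
  assume i: "i : I" and "qi i - inverse (qi i) = 0"
  then have "qi i * qi i = 1" by (metis eq_iff_diff_eq_0 power_not_zero q_nonzero right_inverse)
  then show False using q_cond i by (auto simp: square_eq_1_iff)
qed

lemma qi_powi: "qi i powi b = q powi (int (s i) * b)"
  by (simp add: power_int_mult)

text \<open>Symmetry of DA says that both sides are the same power of q. It is used wherever a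
  relation for (i, j) has to be matched with one for (j, i).\<close>

lemma weight_sym: "i : I ==> j : I ==> qi i powi a i j = qi j powi a j i"
  using sym by (simp add: symmetrizes_def qi_powi)

lemma a_nonpos: "i : I ==> j : I ==> i ~= j ==> a i j \<le> 0"
  using bc by (simp add: borcherds_cartan_def)

lemma int_n_ij: "i : I ==> j : I ==> i ~= j ==> int (n_ij i j) = 1 - a i j"
  using a_nonpos[of i j] by simp

lemma w_gens_mem [simp]:
  "GJ : w_gens I" "i : I ==> GE i : w_gens I" "i : I ==> GF i : w_gens I"
  "i : I ==> GK i : w_gens I" "i : I ==> GKb i : w_gens I"
  "i : I ==> GD i : w_gens I" "i : I ==> GDb i : w_gens I"
  "x : w_toral I ==> x : w_gens I" "x : insert GJ (w_toral I) ==> x : w_gens I"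
  by (auto simp: w_gens_def w_toral_def)

lemma w_toral_mem [simp]:
  "i : I ==> GK i : w_toral I" "i : I ==> GKb i : w_toral I"
  "i : I ==> GD i : w_toral I" "i : I ==> GDb i : w_toral I"
  by (auto simp: w_toral_def)

lemma w_gens_cases:
  assumes "g : w_gens I"
  obtains "g = GJ" | i where "i : I" "g = GE i" | i where "i : I" "g = GF i" | "g : w_toral I"
  using assms by (auto simp: w_gens_def)

lemma w_toral_cases:
  assumes "g : w_toral I"
  obtains i where "i : I" "g = GK i" | i where "i : I" "g = GKb i"
    | i where "i : I" "g = GD i" | i where "i : I" "g = GDb i"
  using assms by (auto simp: w_toral_def)

abbreviation wrels where "wrels == w_rels I a s q m \<kappa> \<kappa>'"

text \<open>The conjuncts follow the order of the union in \<open>w_rels\<close>, so that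
  \<open>w_sat_iff\<close> can compare the two piece by piece.\<close>

definition w_sat where
  "w_sat B f \<longleftrightarrow>
    (\<forall>i. i : I --> f (GK i) \<otimes>\<^bsub>B\<^esub> f (GKb i) = f GJ [^]\<^bsub>B\<^esub> (m - 1)) &
    (\<forall>i. i : I --> f (GD i) \<otimes>\<^bsub>B\<^esub> f (GDb i) = f GJ [^]\<^bsub>B\<^esub> (m - 1)) &
    f GJ [^]\<^bsub>B\<^esub> m = f GJ &
    (\<forall>x y. x : insert GJ (w_toral I) & y : insert GJ (w_toral I) --> f x \<otimes>\<^bsub>B\<^esub> f y = f y \<otimes>\<^bsub>B\<^esub> f x) &
    (\<forall>x. x : w_toral I --> f x \<otimes>\<^bsub>B\<^esub> f GJ [^]\<^bsub>B\<^esub> (m - 1) = f x) &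
    (ALL i:I. ALL j:I.
      typed_weight B (\<kappa> i) (f (GK j)) (f (GKb j)) (f (GE i)) (qi i powi a i j) &
      typed_weight B (\<kappa>' i) (f (GK j)) (f (GKb j)) (f (GF i)) (qi i powi (- a i j)) &
      typed_weight B (\<kappa> i) (f (GD j)) (f (GDb j)) (f (GE i)) (if i = j then q else 1) &
      typed_weight B (\<kappa>' i) (f (GD j)) (f (GDb j)) (f (GF i)) (if i = j then inverse q else 1)) &
    (\<forall>i j. i : I & j : I --> ef_rel B (qi i) (i = j) (f (GE i)) (f (GF j)) (f (GK i)) (f (GKb i))) &
    (\<forall>i j Z. i : I & j : I & i ~= j & a i i = 2 & Z : {GE, GF} -->
      kalg.serre B (qi i) (n_ij i j) (f (Z i)) (f (Z j)) = \<zero>\<^bsub>B\<^esub>) &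
    (\<forall>i j Z. i : I & j : I & a i j = 0 & Z : {GE, GF} -->
      f (Z i) \<otimes>\<^bsub>B\<^esub> f (Z j) = f (Z j) \<otimes>\<^bsub>B\<^esub> f (Z i))"

lemma w_sat_iff:
  fixes B (structure)
  assumes "kalgebra B" "f : w_gens I \<rightarrow> carrier B"
  shows "(ALL r:wrels. lin B (word_value B f) r = \<zero>) \<longleftrightarrow> w_sat B f"
proof -
  interpret R: rel_eval B "w_gens I" f
    by (intro rel_eval.intro kalg.intro assms rel_eval_axioms.intro)
  have pow: "word_value B f (replicate k GJ) = f GJ [^] k" for k
    by (rule R.B.word_value_replicate) simp
  have tw: "(ALL r:typed_weight_rels t u v x c. lin B R.ev r = \<zero>) \<longleftrightarrow> typed_weight B t (f u) (f v) (f x) c"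
    if "u : w_gens I" "v : w_gens I" "x : w_gens I" for t u v x c
    unfolding typed_weight_rels_def typed_weight_def
    using that by (simp add: R.eval_type_one R.eval_conjugation)
  show ?thesis
    unfolding w_rels_def w_sat_def ball_Un ball_setcompr1 ball_setcompr2 ball_setcompr3 conj_assoc
  proof (intro arg_cong2[where f = "(&)"], goal_cases)
    case 1
    show ?case by (intro iff_allI imp_cong refl, subst R.eval_binomial) (auto simp: pow)
  next
    case 2
    show ?case by (intro iff_allI imp_cong refl, subst R.eval_binomial) (auto simp: pow)
  next
    case 3
    have "lin B R.ev (single (replicate m GJ) 1 - single [GJ] 1) = \<zero> \<longleftrightarrow>
        f GJ [^] m = f GJ"
      by (subst R.eval_binomial) (auto simp: pow)
    then show ?case by simp
  next
    case 4
    show ?case by (intro iff_allI imp_cong refl, subst R.eval_commutator) auto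
  next
    case 5
    show ?case by (intro iff_allI imp_cong refl, subst R.eval_binomial) (auto simp: pow)
  next
    case 6
    show ?case
      unfolding w_type_rels_def ball_UN ball_Un conj_assoc
      by (intro ball_cong refl) (simp add: tw)
  next
    case 7
    show ?case by (intro iff_allI imp_cong refl, subst R.eval_ef) auto
  next
    case 8
    show ?case by (intro iff_allI imp_cong refl, subst R.eval_serre) auto
  next
    case 9
    show ?case by (intro iff_allI imp_cong refl, subst R.eval_commutator) auto
  qed
qed

lemma wrels_closed: "wrels <= carrier (free_algebra (w_gens I))"
proof -
  note [simp] = keys_diff_subset keys_sum_subset
  have c: "keys (commutator_rel x y :: _ \<Rightarrow>\<^sub>0 'k) <= lists (w_gens I)"
    if "x : w_gens I" "y : w_gens I" for x y
    unfolding commutator_rel_def by (rule keys_diff_subset) (use that in auto)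
  have t: "keys r <= lists (w_gens I)"
    if "r : typed_weight_rels t u v x (d :: 'k)" "u : w_gens I" "v : w_gens I" "x : w_gens I" for t u v x d r
    using that unfolding typed_weight_rels_def type_one_rel_def conjugation_rel_def
    by (auto split: if_splits dest!: subsetD[OF keys_diff])
  have z: "keys (serre_rel (d :: 'k) n x y) <= lists (w_gens I)"
    if "x : w_gens I" "y : w_gens I" for d n x y
    unfolding serre_rel_def by (rule keys_sum_subset) (use that in auto)
  have "ALL r:wrels. keys r <= lists (w_gens I)"
    unfolding w_rels_def ball_Un ball_setcompr1 ball_setcompr2 ball_setcompr3 conj_assoc
  proof (intro conjI, goal_cases)
    case 4
    show ?case by (intro allI impI c) auto
  next
    case 6
    show ?case unfolding w_type_rels_def ball_UN ball_Un by (intro ballI conjI; erule t; simp)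
  next
    case 7
    show ?case
      by (intro allI impI keys_diff_subset c) (auto split: if_splits dest!: subsetD[OF keys_diff])
  next
    case 8
    show ?case by (intro allI impI z) auto
  next
    case 9
    show ?case by (intro allI impI c) auto
  qed (auto dest!: subsetD[OF keys_diff] split: if_splits)
  then show ?thesis by auto
qed

end

context kalg
begin

lemma typed_weightI:
  assumes "u : carrier A" "v : carrier A" "x : carrier A"
    and "u \<otimes> x = c \<odot> (x \<otimes> u)" "v \<otimes> x = inverse c \<odot> (x \<otimes> v)" "x \<otimes> (u \<otimes> v) = x"
  shows "typed_weight A t u v x c"
  using assms unfolding typed_weight_def by (simp add: m_assoc)

text \<open>Both types yield the same commutation rules. In type zero, x is a multiple of u x v and
  hence fixed by P on either side, so v can be cancelled against u; this also explains the extra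
  conclusion \<open>x \<otimes> P = x\<close>.\<close>

lemma typed_weightD:
  assumes tw: "typed_weight A t u v x c" and c: "c ~= 0"
    and [simp]: "u : carrier A" "v : carrier A" "x : carrier A" "P : carrier A"
    and uv: "u \<otimes> v = P" "v \<otimes> u = P" and P: "u \<otimes> P = u" "P \<otimes> u = u" "v \<otimes> P = v" "P \<otimes> v = v"
  shows "u \<otimes> x = c \<odot> (x \<otimes> u)" "v \<otimes> x = inverse c \<odot> (x \<otimes> v)" "P \<otimes> x = x \<otimes> P"
    "t ~= 1 ==> x \<otimes> P = x"
proof -
  consider (one) "t = 1" | (other) "t ~= 1" by blast
  then have "u \<otimes> x = c \<odot> (x \<otimes> u) & v \<otimes> x = inverse c \<odot> (x \<otimes> v) & P \<otimes> x = x \<otimes> P & (t ~= 1 --> x \<otimes> P = x)"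
  proof cases
    case one
    then have w: "u \<otimes> x = c \<odot> (x \<otimes> u)" "v \<otimes> x = inverse c \<odot> (x \<otimes> v)"
      using tw by (simp_all add: typed_weight_def)
    have "P \<otimes> x = u \<otimes> (v \<otimes> x)" by (simp add: uv m_assoc[symmetric])
    also have "... = inverse c \<odot> ((u \<otimes> x) \<otimes> v)" by (simp add: w(2) m_assoc)
    also have "... = x \<otimes> P" using c by (simp add: w(1) m_assoc uv)
    finally show ?thesis using w one by simp
  next
    case other
    then have w: "u \<otimes> x \<otimes> v = c \<odot> x" using tw by (simp add: typed_weight_def)
    have x: "x = inverse c \<odot> (u \<otimes> x \<otimes> v)" using c by (simp add: w)
    have xP: "x \<otimes> P = x" by (subst (1 2) x) (simp add: m_assoc P)
    have Px: "P \<otimes> x = x" by (subst (1 2) x) (simp add: P flip: m_assoc)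
    have "c \<odot> (x \<otimes> u) = u \<otimes> x \<otimes> v \<otimes> u" by (simp add: w)
    also have "... = u \<otimes> x" using xP by (simp add: m_assoc uv)
    finally have ux: "u \<otimes> x = c \<odot> (x \<otimes> u)" ..
    have "c \<odot> (v \<otimes> x) = v \<otimes> (u \<otimes> x \<otimes> v)" by (simp add: w)
    also have "... = (v \<otimes> u) \<otimes> x \<otimes> v" by (simp add: m_assoc)
    also have "... = x \<otimes> v" by (simp add: uv Px)
    finally have "inverse c \<odot> (c \<odot> (v \<otimes> x)) = inverse c \<odot> (x \<otimes> v)" by simp
    then have "v \<otimes> x = inverse c \<odot> (x \<otimes> v)" using c by simp
    then show ?thesis using ux xP Px by simp
  qed
  then show "u \<otimes> x = c \<odot> (x \<otimes> u)" "v \<otimes> x = inverse c \<odot> (x \<otimes> v)" "P \<otimes> x = x \<otimes> P"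
    "t ~= 1 ==> x \<otimes> P = x" by auto
qed

lemma nat_pow_opposite: "x : carrier A ==> x [^]\<^bsub>opposite A\<^esub> n = x [^] (n::nat)"
proof (induction n)
  case (Suc n)
  interpret O: kalg "opposite A" by (rule kalg.intro) (rule kalgebra_opposite)
  have "x [^]\<^bsub>opposite A\<^esub> Suc n = x \<otimes> x [^]\<^bsub>opposite A\<^esub> n" by simp
  then show ?case using Suc nat_pow_Suc_left by simp
qed (simp add: nat_pow_def)

end

lemma (in tens) tn_pow:
  "x : carrier A ==> y : carrier B ==> tn x y [^]\<^bsub>T\<^esub> n = tn (x [^]\<^bsub>A\<^esub> n) (y [^]\<^bsub>B\<^esub> (n::nat))"
  by (induction n) (simp_all add: one_T)

text \<open>An arbitrary algebra with elements satisfying the relations. Working here and not only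
  in wU itself makes the coproduct and antipode computations reusable for U_q, which is a model with
  J = 1.\<close>

locale w_model = cartan I a s q m \<kappa> \<kappa>' + B: kalg B
  for I a s and q :: "'k::field" and m \<kappa> \<kappa>' and B :: "('k, 'b, 'e) module_scheme" (structure) +
  fixes f :: "wgen => 'b"
  assumes f_closed: "f : w_gens I \<rightarrow> carrier B" and sat: "w_sat B f"
begin

lemma f_carrier [simp]: "g : w_gens I ==> f g : carrier B" using f_closed by auto

definition P where "P = f GJ [^] (m - 1)"

lemma P_closed [simp]: "P : carrier B" by (simp add: P_def)

lemma toral_comm: "x : insert GJ (w_toral I) ==> y : insert GJ (w_toral I) ==> f x \<otimes> f y = f y \<otimes> f x"
  using sat unfolding w_sat_def by blast

lemma J_pow: "f GJ [^] m = f GJ"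
  using sat unfolding w_sat_def by blast

lemma P_J: "P \<otimes> f GJ = f GJ" "f GJ \<otimes> P = f GJ"
proof -
  have "P \<otimes> f GJ = f GJ [^] Suc (m - 1)" by (simp add: P_def)
  then show "P \<otimes> f GJ = f GJ" using J_pow m_ge_2 by simp
  have "f GJ \<otimes> P = f GJ [^] Suc (m - 1)" unfolding P_def by (rule B.nat_pow_Suc_left[symmetric]) simp
  then show "f GJ \<otimes> P = f GJ" using J_pow m_ge_2 by simp
qed

lemma P_idem [simp]: "P \<otimes> P = P"
proof -
  define k where "k = m - 2"
  have k: "m - 1 = Suc k" using m_ge_2 by (simp add: k_def)
  have P: "P = f GJ [^] k \<otimes> f GJ" unfolding P_def k by simp
  then have "P \<otimes> P = f GJ [^] k \<otimes> (f GJ \<otimes> P)" by (metis B.m_assoc B.nat_pow_closed P_closed f_carrier w_gens_mem(1))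
  then show ?thesis by (simp add: P_J P[symmetric])
qed

lemma toral_P: "x : w_toral I ==> f x \<otimes> P = f x"
  using sat unfolding w_sat_def P_def by blast

lemma P_toral_comm: "x : w_toral I ==> P \<otimes> f x = f x \<otimes> P"
proof -
  assume x: "x : w_toral I"
  have "f GJ [^] n \<otimes> f x = f x \<otimes> f GJ [^] n" for n :: nat
  proof (induction n)
    case (Suc n)
    have "f GJ [^] Suc n \<otimes> f x = f GJ [^] n \<otimes> (f x \<otimes> f GJ)"
      using x toral_comm[of GJ x] by (simp add: B.m_assoc)
    also have "... = (f GJ [^] n \<otimes> f x) \<otimes> f GJ" using x by (simp add: B.m_assoc)
    finally show ?case using Suc x by (simp add: B.m_assoc)
  qed (use x in simp)
  then show ?thesis by (simp add: P_def)
qed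

lemma P_toral: "x : w_toral I ==> P \<otimes> f x = f x"
  by (simp add: P_toral_comm toral_P)

lemma KKb: "i : I ==> f (GK i) \<otimes> f (GKb i) = P" "i : I ==> f (GKb i) \<otimes> f (GK i) = P"
  "i : I ==> f (GD i) \<otimes> f (GDb i) = P" "i : I ==> f (GDb i) \<otimes> f (GD i) = P"
proof -
  assume i: "i : I"
  show "f (GK i) \<otimes> f (GKb i) = P" "f (GD i) \<otimes> f (GDb i) = P"
    using sat i unfolding w_sat_def P_def by blast+
  then show "f (GKb i) \<otimes> f (GK i) = P" "f (GDb i) \<otimes> f (GD i) = P"
    using i toral_comm[of "GKb i" "GK i"] toral_comm[of "GDb i" "GD i"] by auto
qed

definition dwt :: "nat => nat => 'k" where "dwt i j = (if i = j then q else 1)"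

lemma dwt_nonzero [simp]: "dwt i j ~= 0" by (simp add: dwt_def)

lemma tw:
  assumes "i : I" "j : I"
  shows "typed_weight B (\<kappa> i) (f (GK j)) (f (GKb j)) (f (GE i)) (qi i powi a i j)" (is ?t1)
    "typed_weight B (\<kappa>' i) (f (GK j)) (f (GKb j)) (f (GF i)) (qi i powi (- a i j))"
    "typed_weight B (\<kappa> i) (f (GD j)) (f (GDb j)) (f (GE i)) (dwt i j)"
    "typed_weight B (\<kappa>' i) (f (GD j)) (f (GDb j)) (f (GF i)) (inverse (dwt i j))"
proof -
  have "inverse (dwt i j) = (if i = j then inverse q else 1)" by (simp add: dwt_def)
  then show ?t1
    "typed_weight B (\<kappa>' i) (f (GK j)) (f (GKb j)) (f (GF i)) (qi i powi (- a i j))"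
    "typed_weight B (\<kappa> i) (f (GD j)) (f (GDb j)) (f (GE i)) (dwt i j)"
    "typed_weight B (\<kappa>' i) (f (GD j)) (f (GDb j)) (f (GF i)) (inverse (dwt i j))"
    using sat assms unfolding w_sat_def dwt_def by auto
qed

context
  fixes i j assumes ij: "i : I" "j : I"
begin

lemmas twK = B.typed_weightD[OF _ _ f_carrier f_carrier f_carrier P_closed KKb(1)[OF ij(2)] KKb(2)[OF ij(2)]
  toral_P P_toral toral_P P_toral]
lemmas twD = B.typed_weightD[OF _ _ f_carrier f_carrier f_carrier P_closed KKb(3)[OF ij(2)] KKb(4)[OF ij(2)]
  toral_P P_toral toral_P P_toral]

lemma KE: "f (GK j) \<otimes> f (GE i) = qi i powi a i j \<odot> (f (GE i) \<otimes> f (GK j))"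
  "f (GKb j) \<otimes> f (GE i) = qi i powi (- a i j) \<odot> (f (GE i) \<otimes> f (GKb j))"
  "P \<otimes> f (GE i) = f (GE i) \<otimes> P" "\<kappa> i ~= 1 ==> f (GE i) \<otimes> P = f (GE i)"
  unfolding power_int_minus
  by (rule twK[OF tw(1)[OF ij]]; simp add: ij)+

lemma KF: "f (GK j) \<otimes> f (GF i) = qi i powi (- a i j) \<odot> (f (GF i) \<otimes> f (GK j))"
  "f (GKb j) \<otimes> f (GF i) = qi i powi a i j \<odot> (f (GF i) \<otimes> f (GKb j))"
  "P \<otimes> f (GF i) = f (GF i) \<otimes> P" "\<kappa>' i ~= 1 ==> f (GF i) \<otimes> P = f (GF i)"
proof -
  have inv: "inverse (qi i powi (- a i j)) = qi i powi a i j" by (simp add: power_int_minus)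
  show "f (GKb j) \<otimes> f (GF i) = qi i powi a i j \<odot> (f (GF i) \<otimes> f (GKb j))"
    by (rule twK(2)[OF tw(2)[OF ij], unfolded inv]; simp add: ij)
qed (rule twK[OF tw(2)[OF ij]]; simp add: ij)+

lemma DE: "f (GD j) \<otimes> f (GE i) = dwt i j \<odot> (f (GE i) \<otimes> f (GD j))"
  "f (GDb j) \<otimes> f (GE i) = inverse (dwt i j) \<odot> (f (GE i) \<otimes> f (GDb j))"
  by (rule twD[OF tw(3)[OF ij]]; simp add: ij)+

lemma DF: "f (GD j) \<otimes> f (GF i) = inverse (dwt i j) \<odot> (f (GF i) \<otimes> f (GD j))"
  "f (GDb j) \<otimes> f (GF i) = dwt i j \<odot> (f (GF i) \<otimes> f (GDb j))"
  using twD(1,2)[OF tw(4)[OF ij]] by (simp_all add: ij)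

lemma EF: "f (GE i) \<otimes> f (GF j) = f (GF j) \<otimes> f (GE i) \<oplus>
    (if i = j then (1 / (qi i - inverse (qi i))) \<odot> (f (GK i) \<oplus> (- 1) \<odot> f (GKb i)) else \<zero>)"
  using sat ij unfolding w_sat_def ef_rel_def by blast

lemma SE: "i ~= j ==> a i i = 2 ==> B.serre (qi i) (n_ij i j) (f (GE i)) (f (GE j)) = \<zero>"
  and SF: "i ~= j ==> a i i = 2 ==> B.serre (qi i) (n_ij i j) (f (GF i)) (f (GF j)) = \<zero>"
  using sat ij unfolding w_sat_def by blast+

lemma CE: "a i j = 0 ==> f (GE i) \<otimes> f (GE j) = f (GE j) \<otimes> f (GE i)"
  and CF: "a i j = 0 ==> f (GF i) \<otimes> f (GF j) = f (GF j) \<otimes> f (GF i)"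
  using sat ij unfolding w_sat_def by blast+

end

lemma P_central: "g : w_gens I ==> P \<otimes> f g = f g \<otimes> P"
proof (erule w_gens_cases)
  show "P \<otimes> f g = f g \<otimes> P" if "i : I" "g = GE i" for i
    unfolding that(2) by (rule KE(3)[OF that(1,1)])
  show "P \<otimes> f g = f g \<otimes> P" if "i : I" "g = GF i" for i
    unfolding that(2) by (rule KF(3)[OF that(1,1)])
qed (simp_all add: P_J P_toral P_toral_comm[symmetric])

end

context cartan
begin

text \<open>When J is the unit, the toral elements are invertible and both types reduce to one
  commutation rule; the rule for the inverse follows by multiplying with it from both sides.\<close>

lemma w_satI_unit:
  fixes B (structure)
  assumes B: "kalgebra B" and cl: "f : w_gens I \<rightarrow> carrier B" and J: "f GJ = \<one>"
    and KKb: "!!i. i : I ==> f (GK i) \<otimes> f (GKb i) = \<one>" "!!i. i : I ==> f (GD i) \<otimes> f (GDb i) = \<one>"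
    and comm: "!!x y. x : w_toral I ==> y : w_toral I ==> f x \<otimes> f y = f y \<otimes> f x"
    and wt: "!!i j. i : I ==> j : I ==> f (GK j) \<otimes> f (GE i) = qi i powi a i j \<odot> (f (GE i) \<otimes> f (GK j))"
     "!!i j. i : I ==> j : I ==> f (GK j) \<otimes> f (GF i) = qi i powi (- a i j) \<odot> (f (GF i) \<otimes> f (GK j))"
     "!!i j. i : I ==> j : I ==> f (GD j) \<otimes> f (GE i) = (if i = j then q else 1) \<odot> (f (GE i) \<otimes> f (GD j))"
     "!!i j. i : I ==> j : I ==> f (GD j) \<otimes> f (GF i) = (if i = j then inverse q else 1) \<odot> (f (GF i) \<otimes> f (GD j))"
    and ef: "!!i j. i : I ==> j : I ==> ef_rel B (qi i) (i = j) (f (GE i)) (f (GF j)) (f (GK i)) (f (GKb i))"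
    and serre: "!!i j Z. i : I ==> j : I ==> i ~= j ==> a i i = 2 ==> Z : {GE, GF} ==>
      kalg.serre B (qi i) (n_ij i j) (f (Z i)) (f (Z j)) = \<zero>"
    and ab: "!!i j Z. i : I ==> j : I ==> a i j = 0 ==> Z : {GE, GF} ==>
      f (Z i) \<otimes> f (Z j) = f (Z j) \<otimes> f (Z i)"
  shows "w_sat B f"
proof -
  interpret B: kalg B by (rule kalg.intro) fact
  have [simp]: "g : w_gens I ==> f g : carrier B" for g using cl by auto
  have tw: "typed_weight B t u v x c"
    if "u : carrier B" "v : carrier B" "x : carrier B" "u \<otimes> x = c \<odot> (x \<otimes> u)" "c ~= 0"
      "u \<otimes> v = \<one>" "u \<otimes> v = v \<otimes> u" for t u v x c
  proof (rule B.typed_weightI)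
    have "v \<otimes> (u \<otimes> x) \<otimes> v = (v \<otimes> u) \<otimes> x \<otimes> v"
      using that(1-3) by (simp add: B.m_assoc)
    then have "x \<otimes> v = v \<otimes> (u \<otimes> x) \<otimes> v"
      using that(1-3) that(6) that(7) by simp
    also have "... = c \<odot> (v \<otimes> x)"
      unfolding that(4) using that(1-3,6) by (simp add: B.m_assoc)
    finally show "v \<otimes> x = inverse c \<odot> (x \<otimes> v)"
      using that by simp
  qed (use that in auto)
  have "typed_weight B (\<kappa> i) (f (GK j)) (f (GKb j)) (f (GE i)) (qi i powi a i j) &
      typed_weight B (\<kappa>' i) (f (GK j)) (f (GKb j)) (f (GF i)) (qi i powi (- a i j)) &
      typed_weight B (\<kappa> i) (f (GD j)) (f (GDb j)) (f (GE i)) (if i = j then q else 1) &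
      typed_weight B (\<kappa>' i) (f (GD j)) (f (GDb j)) (f (GF i)) (if i = j then inverse q else 1)"
    if "i : I" "j : I" for i j
    by (intro conjI tw wt KKb comm) (use that in auto)
  then show ?thesis
    unfolding w_sat_def
    by (intro conjI) (use KKb comm ef serre[of _ _ GE] serre[of _ _ GF] ab[of _ _ GE] ab[of _ _ GF] J in auto)
qed

end

section \<open>Comultiplication and antipode of the weak quantum algebra\<close>

context w_model
begin

interpretation BB: tens B B ..

abbreviation E where "E i == f (GE i)"
abbreviation F where "F i == f (GF i)"
abbreviation K where "K i == f (GK i)"
abbreviation Kb where "Kb i == f (GKb i)"

lemma KK: "i : I ==> j : I ==> K i \<otimes> K j = K j \<otimes> K i" "i : I ==> j : I ==> Kb i \<otimes> Kb j = Kb j \<otimes> Kb i"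
  "i : I ==> j : I ==> K i \<otimes> Kb j = Kb j \<otimes> K i"
  by (rule toral_comm; simp)+

text \<open>The group-like leg in the coproduct of E_i: the unit for type one and J^(m-1) for type
  zero.\<close>

definition e0 where "e0 i = (if \<kappa> i = 1 then \<one> else P)"
definition f0 where "f0 i = (if \<kappa>' i = 1 then \<one> else P)"

lemma e0_f0_closed [simp]: "e0 i : carrier B" "f0 i : carrier B"
  by (simp_all add: e0_def f0_def)

lemma e0_central: "g : w_gens I ==> e0 i \<otimes> f g = f g \<otimes> e0 i" "g : w_gens I ==> f0 i \<otimes> f g = f g \<otimes> f0 i"
  "e0 i \<otimes> e0 j = e0 j \<otimes> e0 i" "f0 i \<otimes> f0 j = f0 j \<otimes> f0 i"
  using P_central by (simp_all add: e0_def f0_def)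

lemma e0_toral: "x : w_toral I ==> e0 i \<otimes> f x = f x" "x : w_toral I ==> f x \<otimes> e0 i = f x"
  "x : w_toral I ==> f0 i \<otimes> f x = f x" "x : w_toral I ==> f x \<otimes> f0 i = f x"
  by (simp_all add: e0_def f0_def P_toral toral_P)

fun cop where
  "cop (GE i) = BB.tn (e0 i) (E i) \<oplus>\<^bsub>BB.T\<^esub> BB.tn (E i) (K i)"
| "cop (GF i) = BB.tn (F i) (f0 i) \<oplus>\<^bsub>BB.T\<^esub> BB.tn (Kb i) (F i)"
| "cop x = BB.tn (f x) (f x)"

lemma cop_closed: "cop : w_gens I \<rightarrow> carrier BB.T"
proof
  fix x assume "x : w_gens I"
  then show "cop x : carrier BB.T" by (cases x) (auto simp: w_gens_def w_toral_def)
qed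

lemma cop_toral: "x : insert GJ (w_toral I) ==> cop x = BB.tn (f x) (f x)"
  by (cases x) (auto simp: w_toral_def)

lemma cop_J_pow: "cop GJ [^]\<^bsub>BB.T\<^esub> (n::nat) = BB.tn (f GJ [^] n) (f GJ [^] n)"
  by (simp add: BB.tn_pow)

text \<open>In type one the legs e and k commute with u and v. In type zero conjugation has to fix
  the legs e = P and k, which it does because u v = P and k P = k.\<close>

lemma cop_typed_weight_aux:
  assumes [simp]: "u : carrier B" "v : carrier B" "x : carrier B" "k : carrier B" "e : carrier B"
    and tw: "typed_weight B t u v x c" and uk: "u \<otimes> k = k \<otimes> u" "v \<otimes> k = k \<otimes> v"
    and eu: "e \<otimes> u = u \<otimes> e" "e \<otimes> v = v \<otimes> e" and uv: "u \<otimes> v = P" and kP: "k \<otimes> P = k"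
    and e: "t ~= 1 ==> e = P" and vP: "v \<otimes> P = v"
  shows "typed_weight BB.T t (BB.tn u u) (BB.tn v v) (BB.tn e x \<oplus>\<^bsub>BB.T\<^esub> BB.tn x k) c" (is ?t1)
    "typed_weight BB.T t (BB.tn u u) (BB.tn v v) (BB.tn x e \<oplus>\<^bsub>BB.T\<^esub> BB.tn k x) c"
proof -
  have uev: "u \<otimes> e \<otimes> v = P" if "t ~= 1"
  proof -
    have "u \<otimes> e \<otimes> v = u \<otimes> (v \<otimes> e)" by (simp add: B.m_assoc eu)
    then show ?thesis using e[OF that] vP uv by simp
  qed
  have ukv: "u \<otimes> k \<otimes> v = k"
  proof -
    have "u \<otimes> k \<otimes> v = k \<otimes> (u \<otimes> v)" by (simp add: B.m_assoc uk)
    then show ?thesis using uv kP by simp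
  qed
  have kuv: "k \<otimes> u \<otimes> v = k" using ukv uk by simp
  have uPv: "u \<otimes> P \<otimes> v = P" if "t ~= 1" using uev[OF that] e[OF that] by simp
  show ?t1
    "typed_weight BB.T t (BB.tn u u) (BB.tn v v) (BB.tn x e \<oplus>\<^bsub>BB.T\<^esub> BB.tn k x) c"
    using tw e unfolding typed_weight_def
    by (auto simp: BB.T.r_distr BB.T.l_distr uk eu BB.tn_smult_left BB.tn_smult_right kuv uPv
        BB.T.smult_add_right split: if_splits)
qed

lemma cop_typed_weight:
  assumes "i : I" "u : w_toral I" "v : w_toral I" "f u \<otimes> f v = P"
  shows "typed_weight B (\<kappa> i) (f u) (f v) (E i) c ==> typed_weight BB.T (\<kappa> i) (cop u) (cop v) (cop (GE i)) c"
    "typed_weight B (\<kappa>' i) (f u) (f v) (F i) c ==> typed_weight BB.T (\<kappa>' i) (cop u) (cop v) (cop (GF i)) c"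
proof -
  assume t: "typed_weight B (\<kappa> i) (f u) (f v) (E i) c"
  show "typed_weight BB.T (\<kappa> i) (cop u) (cop v) (cop (GE i)) c"
    using assms unfolding cop.simps(1)
    by (simp only: cop_toral insertI2)
      (rule cop_typed_weight_aux(1)[OF _ _ _ _ _ t]; simp add: e0_def P_toral toral_P toral_comm)
next
  assume t: "typed_weight B (\<kappa>' i) (f u) (f v) (F i) c"
  show "typed_weight BB.T (\<kappa>' i) (cop u) (cop v) (cop (GF i)) c"
    using assms unfolding cop.simps(2)
    by (simp only: cop_toral insertI2)
      (rule cop_typed_weight_aux(2)[OF _ _ _ _ _ t]; simp add: f0_def P_toral toral_P toral_comm)
qed

text \<open>The cross terms commute because the two weights are inverse to each other. The
  commutator is then Kb \<otimes> h + h \<otimes> K with h the commutator of E and F, and the terms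
  Kb \<otimes> K in it cancel.\<close>

lemma cop_ef:
  assumes ij: "i : I" "j : I"
  shows "ef_rel BB.T (qi i) (i = j) (cop (GE i)) (cop (GF j)) (cop (GK i)) (cop (GKb i))"
proof -
  define c where "c = 1 / (qi i - inverse (qi i))"
  define h where "h = (if i = j then c \<odot> (K i \<oplus> (- 1) \<odot> Kb i) else \<zero>)"
  have [simp]: "h : carrier B" using ij by (simp add: h_def)
  have EFh: "E i \<otimes> F j = F j \<otimes> E i \<oplus> h"
    using EF[OF ij] unfolding h_def c_def .
  have cross: "BB.tn (E i \<otimes> Kb j) (K i \<otimes> F j) = BB.tn (Kb j \<otimes> E i) (F j \<otimes> K i)"
    unfolding KE(2)[OF ij] KF(1)[OF ij(2,1)]
    using ij by (simp add: BB.tn_smult_left BB.tn_smult_right power_int_minus weight_sym[OF ij])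
  let ?X = "BB.tn (F j \<otimes> e0 i) (f0 j \<otimes> E i) \<oplus>\<^bsub>BB.T\<^esub> BB.tn (Kb j) (F j \<otimes> E i) \<oplus>\<^bsub>BB.T\<^esub>
    BB.tn (F j \<otimes> E i) (K i) \<oplus>\<^bsub>BB.T\<^esub> BB.tn (Kb j \<otimes> E i) (F j \<otimes> K i)"
  have l: "cop (GE i) \<otimes>\<^bsub>BB.T\<^esub> cop (GF j) = ?X \<oplus>\<^bsub>BB.T\<^esub> (BB.tn (Kb j) h \<oplus>\<^bsub>BB.T\<^esub> BB.tn h (K i))"
    using ij by (simp add: BB.T.l_distr BB.T.r_distr e0_central e0_toral EFh BB.tn_add_left BB.tn_add_right
        cross BB.T.a_ac)
  have r: "cop (GF j) \<otimes>\<^bsub>BB.T\<^esub> cop (GE i) = ?X"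
    using ij by (simp add: BB.T.l_distr BB.T.r_distr e0_toral BB.T.a_ac)
  have hh: "BB.tn (Kb j) h \<oplus>\<^bsub>BB.T\<^esub> BB.tn h (K i) =
    (if i = j then c \<odot>\<^bsub>BB.T\<^esub> (BB.tn (K i) (K i) \<oplus>\<^bsub>BB.T\<^esub> (- 1) \<odot>\<^bsub>BB.T\<^esub> BB.tn (Kb i) (Kb i)) else \<zero>\<^bsub>BB.T\<^esub>)"
  proof (cases "i = j")
    case True
    let ?k = "BB.tn (K i) (K i)" and ?l = "BB.tn (Kb i) (Kb i)" and ?x = "BB.tn (Kb i) (K i)"
    have "BB.tn (Kb j) h \<oplus>\<^bsub>BB.T\<^esub> BB.tn h (K i) = c \<odot>\<^bsub>BB.T\<^esub> (?x \<oplus>\<^bsub>BB.T\<^esub> (- 1) \<odot>\<^bsub>BB.T\<^esub> ?l) \<oplus>\<^bsub>BB.T\<^esub>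
        c \<odot>\<^bsub>BB.T\<^esub> (?k \<oplus>\<^bsub>BB.T\<^esub> (- 1) \<odot>\<^bsub>BB.T\<^esub> ?x)"
      using ij True by (simp add: h_def BB.tn_add_left BB.tn_add_right BB.tn_smult_left BB.tn_smult_right)
    also have "... = c \<odot>\<^bsub>BB.T\<^esub> ((?k \<oplus>\<^bsub>BB.T\<^esub> (- 1) \<odot>\<^bsub>BB.T\<^esub> ?l) \<oplus>\<^bsub>BB.T\<^esub> (?x \<oplus>\<^bsub>BB.T\<^esub> (- 1) \<odot>\<^bsub>BB.T\<^esub> ?x))"
      using ij by (simp add: BB.T.a_ac BB.T.smult_add_right)
    also have "?x \<oplus>\<^bsub>BB.T\<^esub> (- 1) \<odot>\<^bsub>BB.T\<^esub> ?x = \<zero>\<^bsub>BB.T\<^esub>"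
      using ij by (simp add: BB.T.smult_minus_left BB.T.r_neg)
    finally show ?thesis using ij True by simp
  next
    case False
    \<comment> \<open>Zero is written as a scalar multiple so that linearity of the tensor in each
      leg applies.\<close>
    then have h0: "h = 0 \<odot> E i" using ij by (simp add: h_def)
    show ?thesis
      unfolding h0 using ij False by (simp only: BB.tn_smult_left BB.tn_smult_right f_carrier w_gens_mem) simp
  qed
  show ?thesis
    unfolding ef_rel_def l r hh using ij by (simp add: c_def)
qed

text \<open>The mixed terms vanish by \<open>serre_coproduct\<close>; each remaining half is a Serre
  element in one leg with commuting elements in the other.\<close>

lemma cop_serre_E:
  assumes ij: "i : I" "j : I" and ne: "i ~= j" "a i i = 2"
  shows "BB.T.serre (qi i) (n_ij i j) (cop (GE i)) (cop (GE j)) = \<zero>\<^bsub>BB.T\<^esub>"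
proof -
  have n: "1 - int (n_ij i j) = a i j" using int_n_ij[OF ij ne(1)] by simp
  have "BB.T.serre (qi i) (n_ij i j) (cop (GE i)) (cop (GE j)) =
     BB.T.serre (qi i) (n_ij i j) (BB.tn (e0 i) (E i)) (BB.tn (e0 j) (E j)) \<oplus>\<^bsub>BB.T\<^esub>
     BB.T.serre (qi i) (n_ij i j) (BB.tn (E i) (K i)) (BB.tn (E j) (K j))"
    unfolding cop.simps
  proof (rule BB.T.serre_coproduct, unfold n)
    show "BB.tn (E i) (K i) \<otimes>\<^bsub>BB.T\<^esub> BB.tn (e0 i) (E i) =
        qi i powi 2 \<odot>\<^bsub>BB.T\<^esub> (BB.tn (e0 i) (E i) \<otimes>\<^bsub>BB.T\<^esub> BB.tn (E i) (K i))"
      using ij KE(1)[OF ij(1,1)] ne by (simp add: e0_central BB.tn_smult_right)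
    show "BB.tn (E i) (K i) \<otimes>\<^bsub>BB.T\<^esub> BB.tn (e0 j) (E j) =
        qi i powi a i j \<odot>\<^bsub>BB.T\<^esub> (BB.tn (e0 j) (E j) \<otimes>\<^bsub>BB.T\<^esub> BB.tn (E i) (K i))"
      using ij KE(1)[OF ij(2,1)] by (simp add: e0_central BB.tn_smult_right weight_sym[OF ij])
    show "BB.tn (E j) (K j) \<otimes>\<^bsub>BB.T\<^esub> BB.tn (e0 i) (E i) =
        qi i powi a i j \<odot>\<^bsub>BB.T\<^esub> (BB.tn (e0 i) (E i) \<otimes>\<^bsub>BB.T\<^esub> BB.tn (E j) (K j))"
      using ij KE(1)[OF ij] by (simp add: e0_central BB.tn_smult_right)
  qed (use ij in auto)
  also have "BB.T.serre (qi i) (n_ij i j) (BB.tn (e0 i) (E i)) (BB.tn (e0 j) (E j)) = \<zero>\<^bsub>BB.T\<^esub>"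
    by (rule BB.serre_tensor_right) (use ij ne SE e0_central in auto)
  also have "BB.T.serre (qi i) (n_ij i j) (BB.tn (E i) (K i)) (BB.tn (E j) (K j)) = \<zero>\<^bsub>BB.T\<^esub>"
    by (rule BB.serre_tensor_left) (use ij ne SE KK in auto)
  finally show ?thesis by simp
qed

lemma cop_serre_F:
  assumes ij: "i : I" "j : I" and ne: "i ~= j" "a i i = 2"
  shows "BB.T.serre (qi i) (n_ij i j) (cop (GF i)) (cop (GF j)) = \<zero>\<^bsub>BB.T\<^esub>"
proof -
  have n: "1 - int (n_ij i j) = a i j" using int_n_ij[OF ij ne(1)] by simp
  have "BB.T.serre (qi i) (n_ij i j) (cop (GF i)) (cop (GF j)) =
     BB.T.serre (qi i) (n_ij i j) (BB.tn (F i) (f0 i)) (BB.tn (F j) (f0 j)) \<oplus>\<^bsub>BB.T\<^esub>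
     BB.T.serre (qi i) (n_ij i j) (BB.tn (Kb i) (F i)) (BB.tn (Kb j) (F j))"
    unfolding cop.simps
  proof (rule BB.T.serre_coproduct, unfold n)
    show "BB.tn (Kb i) (F i) \<otimes>\<^bsub>BB.T\<^esub> BB.tn (F i) (f0 i) =
        qi i powi 2 \<odot>\<^bsub>BB.T\<^esub> (BB.tn (F i) (f0 i) \<otimes>\<^bsub>BB.T\<^esub> BB.tn (Kb i) (F i))"
      using ij KF(2)[OF ij(1,1)] ne by (simp add: e0_central BB.tn_smult_left)
    show "BB.tn (Kb i) (F i) \<otimes>\<^bsub>BB.T\<^esub> BB.tn (F j) (f0 j) =
        qi i powi a i j \<odot>\<^bsub>BB.T\<^esub> (BB.tn (F j) (f0 j) \<otimes>\<^bsub>BB.T\<^esub> BB.tn (Kb i) (F i))"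
      using ij KF(2)[OF ij(2,1)] by (simp add: e0_central BB.tn_smult_left weight_sym[OF ij])
    show "BB.tn (Kb j) (F j) \<otimes>\<^bsub>BB.T\<^esub> BB.tn (F i) (f0 i) =
        qi i powi a i j \<odot>\<^bsub>BB.T\<^esub> (BB.tn (F i) (f0 i) \<otimes>\<^bsub>BB.T\<^esub> BB.tn (Kb j) (F j))"
      using ij KF(2)[OF ij] by (simp add: e0_central BB.tn_smult_left)
  qed (use ij in auto)
  also have "BB.T.serre (qi i) (n_ij i j) (BB.tn (F i) (f0 i)) (BB.tn (F j) (f0 j)) = \<zero>\<^bsub>BB.T\<^esub>"
    by (rule BB.serre_tensor_left) (use ij ne SF e0_central in auto)
  also have "BB.T.serre (qi i) (n_ij i j) (BB.tn (Kb i) (F i)) (BB.tn (Kb j) (F j)) = \<zero>\<^bsub>BB.T\<^esub>"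
    by (rule BB.serre_tensor_right) (use ij ne SF KK in auto)
  finally show ?thesis by simp
qed

lemma cop_commute:
  assumes ij: "i : I" "j : I" and a0: "a i j = 0"
  shows "cop (GE i) \<otimes>\<^bsub>BB.T\<^esub> cop (GE j) = cop (GE j) \<otimes>\<^bsub>BB.T\<^esub> cop (GE i)" (is ?t1)
    "cop (GF i) \<otimes>\<^bsub>BB.T\<^esub> cop (GF j) = cop (GF j) \<otimes>\<^bsub>BB.T\<^esub> cop (GF i)"
proof -
  have a0': "a j i = 0" using bc ij a0 by (auto simp: borcherds_cartan_def)
  have [simp]: "K j \<otimes> E i = E i \<otimes> K j" "Kb j \<otimes> F i = F i \<otimes> Kb j" "K i \<otimes> E j = E j \<otimes> K i" "Kb i \<otimes> F j = F j \<otimes> Kb i"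
    using ij KE(1)[OF ij] KF(2)[OF ij] KE(1)[OF ij(2,1)] KF(2)[OF ij(2,1)] a0 a0' by simp_all
  show ?t1
    "cop (GF i) \<otimes>\<^bsub>BB.T\<^esub> cop (GF j) = cop (GF j) \<otimes>\<^bsub>BB.T\<^esub> cop (GF i)"
    using ij by (simp_all add: BB.T.l_distr BB.T.r_distr e0_central(1,2) e0_central(3,4)[of i j] CE[OF ij a0] CF[OF ij a0]
        KK[OF ij] BB.T.a_ac)
qed

lemma w_sat_cop: "w_sat BB.T cop"
  unfolding w_sat_def
proof (intro conjI allI impI ballI)
  show "cop GJ [^]\<^bsub>BB.T\<^esub> m = cop GJ"
    unfolding cop_J_pow J_pow by simp
  show "cop (GK i) \<otimes>\<^bsub>BB.T\<^esub> cop (GKb i) = cop GJ [^]\<^bsub>BB.T\<^esub> (m - 1)" if "i : I" for i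
    unfolding cop_J_pow P_def[symmetric] using that by (simp add: KKb)
  show "cop (GD i) \<otimes>\<^bsub>BB.T\<^esub> cop (GDb i) = cop GJ [^]\<^bsub>BB.T\<^esub> (m - 1)" if "i : I" for i
    unfolding cop_J_pow P_def[symmetric] using that by (simp add: KKb)
  show "cop x \<otimes>\<^bsub>BB.T\<^esub> cop y = cop y \<otimes>\<^bsub>BB.T\<^esub> cop x"
    if "x : insert GJ (w_toral I) & y : insert GJ (w_toral I)" for x y
    using that toral_comm[of x y] by (simp only: cop_toral) (simp del: insert_iff)
  show "cop x \<otimes>\<^bsub>BB.T\<^esub> cop GJ [^]\<^bsub>BB.T\<^esub> (m - 1) = cop x" if "x : w_toral I" for x
    unfolding cop_J_pow P_def[symmetric] cop_toral[OF insertI2[OF that]] using that by (simp add: toral_P)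
  fix i j assume ij: "i : I" "j : I"
  note T = sat[unfolded w_sat_def]
  show "typed_weight BB.T (\<kappa> i) (cop (GK j)) (cop (GKb j)) (cop (GE i)) (qi i powi a i j)"
    by (rule cop_typed_weight(1)) (use ij KKb tw in auto)
  show "typed_weight BB.T (\<kappa>' i) (cop (GK j)) (cop (GKb j)) (cop (GF i)) (qi i powi (- a i j))"
    by (rule cop_typed_weight(2)) (use ij KKb tw in auto)
  show "typed_weight BB.T (\<kappa> i) (cop (GD j)) (cop (GDb j)) (cop (GE i)) (if i = j then q else 1)"
    by (rule cop_typed_weight(1)) (use ij KKb tw(3) dwt_def in auto)
  show "typed_weight BB.T (\<kappa>' i) (cop (GD j)) (cop (GDb j)) (cop (GF i)) (if i = j then inverse q else 1)"
    by (rule cop_typed_weight(2)) (use ij KKb tw(4)[OF ij] dwt_def in "auto split: if_splits")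
next
  fix i j assume "i : I & j : I"
  then show "ef_rel BB.T (qi i) (i = j) (cop (GE i)) (cop (GF j)) (cop (GK i)) (cop (GKb i))"
    by (intro cop_ef) auto
next
  fix i j :: nat and Z :: "nat => wgen"
  assume "i : I & j : I & i ~= j & a i i = 2 & Z : {GE, GF}"
  then show "BB.T.serre (qi i) (n_ij i j) (cop (Z i)) (cop (Z j)) = \<zero>\<^bsub>BB.T\<^esub>"
    using cop_serre_E[of i j] cop_serre_F[of i j] by (elim conjE insertE) (simp_all del: cop.simps)
next
  fix i j :: nat and Z :: "nat => wgen"
  assume "i : I & j : I & a i j = 0 & Z : {GE, GF}"
  then show "cop (Z i) \<otimes>\<^bsub>BB.T\<^esub> cop (Z j) = cop (Z j) \<otimes>\<^bsub>BB.T\<^esub> cop (Z i)"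
    using cop_commute[of i j] by (elim conjE insertE) (simp_all del: cop.simps)
qed

end

section \<open>A family of antipode-like antihomomorphisms of a model\<close>

context w_model
begin

interpretation O: kalg "opposite B"
  by (rule kalg.intro) (rule B.kalgebra_opposite)

text \<open>The values of T on generators, with scalars \<rho>_i on E_i and inverse scalars on F_i.
  \<rho> = 1 gives T; \<rho>_i = q_i^(-a_ii) gives the inverse of T when all types are zero.\<close>

definition tau :: "(nat => 'k) => wgen => 'b" where
  "tau \<rho> g = (case g of GJ => f GJ | GK i => Kb i | GKb i => K i | GD i => f (GDb i) | GDb i => f (GD i)
     | GE i => (- \<rho> i) \<odot> (E i \<otimes> Kb i) | GF i => (- inverse (\<rho> i)) \<odot> (K i \<otimes> F i))"

lemma tau_simps [simp]:
  "tau \<rho> GJ = f GJ" "tau \<rho> (GK i) = Kb i" "tau \<rho> (GKb i) = K i" "tau \<rho> (GD i) = f (GDb i)"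
  "tau \<rho> (GDb i) = f (GD i)" "tau \<rho> (GE i) = (- \<rho> i) \<odot> (E i \<otimes> Kb i)"
  "tau \<rho> (GF i) = (- inverse (\<rho> i)) \<odot> (K i \<otimes> F i)"
  by (simp_all add: tau_def)

lemma tau_toral: "x : insert GJ (w_toral I) ==> EX y:insert GJ (w_toral I). tau \<rho> x = f y"
  "x : w_toral I ==> EX y:w_toral I. tau \<rho> x = f y"
  by (auto simp: w_toral_def)

lemma tau_closed: "tau \<rho> : w_gens I \<rightarrow> carrier B"
  by (auto elim!: w_gens_cases w_toral_cases)

lemma EK_facts:
  assumes "i : I" "j : I"
  shows "Kb j \<otimes> (E i \<otimes> Kb i) = qi i powi (- a i j) \<odot> ((E i \<otimes> Kb i) \<otimes> Kb j)"
    "K j \<otimes> (E i \<otimes> Kb i) = qi i powi a i j \<odot> ((E i \<otimes> Kb i) \<otimes> K j)"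
    "f (GDb j) \<otimes> (E i \<otimes> Kb i) = inverse (dwt i j) \<odot> ((E i \<otimes> Kb i) \<otimes> f (GDb j))"
    "f (GD j) \<otimes> (E i \<otimes> Kb i) = dwt i j \<odot> ((E i \<otimes> Kb i) \<otimes> f (GD j))"
    "(E i \<otimes> Kb i) \<otimes> P = E i \<otimes> Kb i"
  using B.mult_swap3[OF KE(2)[OF assms], of "Kb i"] B.mult_swap3[OF KE(1)[OF assms], of "Kb i"]
    B.mult_swap3[OF DE(1)[OF assms], of "Kb i"] B.mult_swap3[OF DE(2)[OF assms], of "Kb i"]
    toral_comm[of "GKb j" "GKb i"] toral_comm[of "GK j" "GKb i"]
    toral_comm[of "GDb j" "GKb i"] toral_comm[of "GD j" "GKb i"] toral_P[of "GKb i"] assms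
  by (simp_all add: B.m_assoc)

lemma KF_facts:
  assumes "i : I" "j : I"
  shows "Kb j \<otimes> (K i \<otimes> F i) = qi i powi a i j \<odot> ((K i \<otimes> F i) \<otimes> Kb j)" (is ?t1)
    "K j \<otimes> (K i \<otimes> F i) = qi i powi (- a i j) \<odot> ((K i \<otimes> F i) \<otimes> K j)"
    "f (GDb j) \<otimes> (K i \<otimes> F i) = dwt i j \<odot> ((K i \<otimes> F i) \<otimes> f (GDb j))"
    "f (GD j) \<otimes> (K i \<otimes> F i) = inverse (dwt i j) \<odot> ((K i \<otimes> F i) \<otimes> f (GD j))"
    "(K i \<otimes> F i) \<otimes> P = K i \<otimes> F i"
proof -
  have sw: "x \<otimes> (K i \<otimes> F i) = c \<odot> ((K i \<otimes> F i) \<otimes> x)"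
    if "x : carrier B" "x \<otimes> K i = K i \<otimes> x" "x \<otimes> F i = c \<odot> (F i \<otimes> x)" for x c
  proof -
    have "x \<otimes> (K i \<otimes> F i) = K i \<otimes> (x \<otimes> F i)"
      using that(1,2) assms by (simp add: B.m_assoc[symmetric])
    then show ?thesis using that(1,3) assms by (simp add: B.m_assoc)
  qed
  show ?t1
    "K j \<otimes> (K i \<otimes> F i) = qi i powi (- a i j) \<odot> ((K i \<otimes> F i) \<otimes> K j)"
    "f (GDb j) \<otimes> (K i \<otimes> F i) = dwt i j \<odot> ((K i \<otimes> F i) \<otimes> f (GDb j))"
    "f (GD j) \<otimes> (K i \<otimes> F i) = inverse (dwt i j) \<odot> ((K i \<otimes> F i) \<otimes> f (GD j))"
    by (rule sw; use assms KF[OF assms] DF[OF assms] toral_comm in simp)+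
  have "(K i \<otimes> F i) \<otimes> P = (K i \<otimes> P) \<otimes> F i"
    using assms KF(3)[OF assms(1,1)] by (simp add: B.m_assoc)
  then show "(K i \<otimes> F i) \<otimes> P = K i \<otimes> F i" using assms toral_P by simp
qed

text \<open>The images of E_i and F_i are fixed by multiplication with P, so the rules for both
  types hold at once; hence \<open>t\<close> is arbitrary.\<close>

lemma tau_typed_weight:
  assumes [simp]: "u : carrier B" "v : carrier B" "x : carrier B"
    and "u \<otimes> x = inverse c \<odot> (x \<otimes> u)" "v \<otimes> x = c \<odot> (x \<otimes> v)" and "c ~= 0" "u \<otimes> v = P" "v \<otimes> u = P" "x \<otimes> P = x"
    "P \<otimes> x = x \<otimes> P"
  shows "typed_weight (opposite B) t u v (l \<odot> x) c"
proof -
  have e: "c * (l * inverse c) = l" "inverse c * (c * l) = l"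
    using \<open>c ~= 0\<close> by (simp_all add: field_simps)
  show ?thesis
    by (rule O.typed_weightI) (use assms in "simp_all add: mult.commute e")
qed

lemma P_EK: "i : I ==> P \<otimes> (E i \<otimes> Kb i) = (E i \<otimes> Kb i) \<otimes> P"
  "i : I ==> P \<otimes> (K i \<otimes> F i) = (K i \<otimes> F i) \<otimes> P"
proof -
  assume i: "i : I"
  have "P \<otimes> (E i \<otimes> Kb i) = E i \<otimes> (P \<otimes> Kb i)" using i KE(3)[OF i i] by (simp flip: B.m_assoc)
  then show "P \<otimes> (E i \<otimes> Kb i) = (E i \<otimes> Kb i) \<otimes> P" using i P_toral toral_P by (simp add: B.m_assoc)
  have "P \<otimes> (K i \<otimes> F i) = K i \<otimes> F i" using i P_toral by (simp flip: B.m_assoc)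
  then show "P \<otimes> (K i \<otimes> F i) = (K i \<otimes> F i) \<otimes> P" using KF_facts(5)[OF i i] by simp
qed

text \<open>Moving the toral factors to the left brings both products to the form r K_j Kb_i times a
  product of E and F, with the same scalar r = q_i^(a_ii - a_ij). For i = j, r = 1 and the toral
  factor is P, which fixes K_i and Kb_i.\<close>

lemma tau_ef:
  assumes ij: "i : I" "j : I" and l: "\<rho> i ~= 0" "\<rho> j ~= 0"
  shows "ef_rel (opposite B) (qi i) (i = j) (tau \<rho> (GE i)) (tau \<rho> (GF j)) (tau \<rho> (GK i)) (tau \<rho> (GKb i))"
proof -
  define c where "c = 1 / (qi i - inverse (qi i))"
  define h where "h = (if i = j then c \<odot> (K i \<oplus> (- 1) \<odot> Kb i) else \<zero>)"
  have h [simp]: "h : carrier B" using ij by (simp add: h_def)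
  have EFh: "E i \<otimes> F j = F j \<otimes> E i \<oplus> h"
    using EF[OF ij] unfolding h_def c_def .
  define KK where "KK = K j \<otimes> Kb i"
  have [simp]: "KK : carrier B" using ij by (simp add: KK_def)
  define r where "r = qi i powi a i i * qi i powi (- a i j)"
  have EKb: "E i \<otimes> Kb i = qi i powi a i i \<odot> (Kb i \<otimes> E i)"
    using KE(2)[OF ij(1,1)] ij by (simp add: power_int_minus)
  have FKb: "F j \<otimes> Kb i = qi i powi (- a i j) \<odot> (Kb i \<otimes> F j)"
    using KF(2)[OF ij(2,1)] ij by (simp add: power_int_minus weight_sym[OF ij])
  have EK: "E i \<otimes> K j = qi i powi (- a i j) \<odot> (K j \<otimes> E i)"
    using KE(1)[OF ij] ij by (simp add: power_int_minus)
  have 1: "(K j \<otimes> F j) \<otimes> (E i \<otimes> Kb i) = r \<odot> (KK \<otimes> (F j \<otimes> E i))"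
  proof -
    have "(K j \<otimes> F j) \<otimes> (E i \<otimes> Kb i) = qi i powi a i i \<odot> (K j \<otimes> ((F j \<otimes> Kb i) \<otimes> E i))"
      unfolding EKb using ij by (simp add: B.m_assoc)
    also have "... = r \<odot> (KK \<otimes> (F j \<otimes> E i))"
      unfolding FKb r_def KK_def using ij by (simp add: B.m_assoc)
    finally show ?thesis .
  qed
  have 2: "(E i \<otimes> Kb i) \<otimes> (K j \<otimes> F j) = r \<odot> (KK \<otimes> (E i \<otimes> F j))"
  proof -
    have "(E i \<otimes> Kb i) \<otimes> (K j \<otimes> F j) = qi i powi a i i \<odot> (Kb i \<otimes> ((E i \<otimes> K j) \<otimes> F j))"
      unfolding EKb using ij by (simp add: B.m_assoc)
    also have "... = r \<odot> ((Kb i \<otimes> K j) \<otimes> (E i \<otimes> F j))"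
      unfolding EK r_def using ij by (simp add: B.m_assoc)
    finally show ?thesis unfolding KK_def using toral_comm[of "GKb i" "GK j"] ij by simp
  qed
  have KKh: "r \<odot> (KK \<otimes> h) = (if i = j then c \<odot> (K i \<oplus> (- 1) \<odot> Kb i) else \<zero>)"
  proof (cases "i = j")
    case True
    have "r = 1" using True by (simp add: r_def power_int_minus)
    moreover have "KK \<otimes> K i = K i" "KK \<otimes> Kb i = Kb i"
      unfolding KK_def True[symmetric] using ij by (simp_all add: KKb P_toral)
    ultimately show ?thesis using True ij by (simp add: h_def B.r_distr)
  qed (simp add: h_def)
  have lam: "- \<rho> i * - inverse (\<rho> j) = (if i = j then 1 else \<rho> i * inverse (\<rho> j))"
    using l by simp
  let ?L = "\<rho> i * inverse (\<rho> j)"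
  have l1: "tau \<rho> (GE i) \<otimes>\<^bsub>opposite B\<^esub> tau \<rho> (GF j) = (?L * r) \<odot> (KK \<otimes> (F j \<otimes> E i))"
    using ij 1 by (simp add: mult_ac)
  have l2: "tau \<rho> (GF j) \<otimes>\<^bsub>opposite B\<^esub> tau \<rho> (GE i) = (?L * r) \<odot> (KK \<otimes> (F j \<otimes> E i)) \<oplus> ?L \<odot> (r \<odot> (KK \<otimes> h))"
    using ij 2 by (simp add: mult_ac EFh B.r_distr B.smult_add_right)
  have hc: "(if i = j then c \<odot> (K i \<oplus> (- 1) \<odot> Kb i) else \<zero>) : carrier B"
    using ij by simp
  have neg: "c \<odot> (Kb i \<oplus> (- 1) \<odot> K i) = (- 1) \<odot> (c \<odot> (K i \<oplus> (- 1) \<odot> Kb i))"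
    using ij by (simp add: B.smult_add_right B.a_comm)
  have L1: "i = j ==> ?L = 1" using l by simp
  show ?thesis
    unfolding ef_rel_def l1 l2 KKh
  proof (cases "i = j")
    case True
    let ?x = "(?L * r) \<odot> (KK \<otimes> (F j \<otimes> E i))" and ?h = "c \<odot> (K i \<oplus> (- 1) \<odot> Kb i)"
    have [simp]: "?x : carrier B" "?h : carrier B" using ij by auto
    have "?x \<oplus> ?h \<oplus> (- 1) \<odot> ?h = ?x"
      by (simp only: B.a_assoc \<open>?x : carrier B\<close> \<open>?h : carrier B\<close> B.smult_closed)
        (use ij in "simp add: B.smult_minus_left B.r_neg")
    then show "?x = ?x \<oplus> ?L \<odot> (if i = j then ?h else \<zero>) \<oplus>\<^bsub>opposite B\<^esub>
        (if i = j then (1 / (qi i - inverse (qi i))) \<odot>\<^bsub>opposite B\<^esub>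
         (tau \<rho> (GK i) \<oplus>\<^bsub>opposite B\<^esub> (- 1) \<odot>\<^bsub>opposite B\<^esub> tau \<rho> (GKb i)) else \<zero>\<^bsub>opposite B\<^esub>)"
      using True L1 \<open>?h : carrier B\<close> neg by (simp add: c_def)
  qed (use ij in simp)
qed

lemma tau_serre_E:
  assumes ij: "i : I" "j : I" and ne: "i ~= j" "a i i = 2"
  shows "B.serre (qi i) (n_ij i j) (l \<odot> (E i \<otimes> Kb i)) (l' \<odot> (E j \<otimes> Kb j)) = \<zero>"
proof (rule B.serre_twisted)
  show "Kb i \<otimes> E i = qi i powi (- a i i) \<odot> (E i \<otimes> Kb i)" by (rule KE(2)[OF ij(1,1)])
  show "Kb i \<otimes> E j = qi i powi (- a i j) \<odot> (E j \<otimes> Kb i)"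
    using KE(2)[OF ij(2,1)] by (simp add: power_int_minus weight_sym[OF ij])
  show "Kb j \<otimes> E i = qi i powi (- a i j) \<odot> (E i \<otimes> Kb j)" by (rule KE(2)[OF ij])
qed (use ij ne SE KK in auto)

lemma tau_serre_F:
  assumes ij: "i : I" "j : I" and ne: "i ~= j" "a i i = 2"
  shows "B.serre (qi i) (n_ij i j) (l \<odot> (F i \<otimes> K i)) (l' \<odot> (F j \<otimes> K j)) = \<zero>"
proof (rule B.serre_twisted)
  show "K i \<otimes> F i = qi i powi (- a i i) \<odot> (F i \<otimes> K i)" by (rule KF(1)[OF ij(1,1)])
  show "K i \<otimes> F j = qi i powi (- a i j) \<odot> (F j \<otimes> K i)"
    using KF(1)[OF ij(2,1)] by (simp add: power_int_minus weight_sym[OF ij])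
  show "K j \<otimes> F i = qi i powi (- a i j) \<odot> (F i \<otimes> K j)" by (rule KF(1)[OF ij])
qed (use ij ne SF KK in auto)

lemma tau_commute:
  assumes ij: "i : I" "j : I" and a0: "a i j = 0"
  shows "(E i \<otimes> Kb i) \<otimes> (E j \<otimes> Kb j) = (E j \<otimes> Kb j) \<otimes> (E i \<otimes> Kb i)" (is ?t1)
    "(F i \<otimes> K i) \<otimes> (F j \<otimes> K j) = (F j \<otimes> K j) \<otimes> (F i \<otimes> K i)" (is ?t2)
proof -
  have a0': "a j i = 0" using bc ij a0 by (auto simp: borcherds_cartan_def)
  have c: "(x \<otimes> k) \<otimes> (y \<otimes> l) = (y \<otimes> l) \<otimes> (x \<otimes> k)"
    if "x : carrier B" "y : carrier B" "k : carrier B" "l : carrier B"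
      "x \<otimes> y = y \<otimes> x" "k \<otimes> y = y \<otimes> k" "l \<otimes> x = x \<otimes> l" "k \<otimes> l = l \<otimes> k" for x y k l
  proof -
    have "(x \<otimes> k) \<otimes> (y \<otimes> l) = x \<otimes> (k \<otimes> y) \<otimes> l" using that(1-4) by (simp add: B.m_assoc)
    also have "... = (x \<otimes> y) \<otimes> (k \<otimes> l)" unfolding that(6) using that(1-4) by (simp add: B.m_assoc)
    also have "... = y \<otimes> (x \<otimes> l) \<otimes> k" unfolding that(5,8) using that(1-4) by (simp add: B.m_assoc)
    also have "... = (y \<otimes> l) \<otimes> (x \<otimes> k)" unfolding that(7)[symmetric] using that(1-4) by (simp add: B.m_assoc)
    finally show ?thesis .
  qed
  show ?t1
    by (rule c) (use ij CE[OF ij a0] KE(2)[OF ij] KE(2)[OF ij(2,1)] a0 a0' KK in simp_all)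
  show ?t2
    by (rule c) (use ij CF[OF ij a0] KF(1)[OF ij] KF(1)[OF ij(2,1)] a0 a0' KK in simp_all)
qed

lemma KF_swap: "i : I ==> b \<odot> (K i \<otimes> F i) = (b * qi i powi (- a i i)) \<odot> (F i \<otimes> K i)"
  using KF(1)[of i i] by simp

lemma w_sat_tau:
  assumes l: "!!i. i : I ==> \<rho> i ~= 0"
  shows "w_sat (opposite B) (tau \<rho>)"
  unfolding w_sat_def
proof (intro conjI allI impI ballI)
  have pow: "tau \<rho> GJ [^]\<^bsub>opposite B\<^esub> n = f GJ [^] n" for n :: nat by (simp add: B.nat_pow_opposite)
  show "tau \<rho> GJ [^]\<^bsub>opposite B\<^esub> m = tau \<rho> GJ" unfolding pow J_pow by simp
  show "tau \<rho> (GK i) \<otimes>\<^bsub>opposite B\<^esub> tau \<rho> (GKb i) = tau \<rho> GJ [^]\<^bsub>opposite B\<^esub> (m - 1)" if "i : I" for i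
    unfolding pow P_def[symmetric] using that by (simp add: KKb)
  show "tau \<rho> (GD i) \<otimes>\<^bsub>opposite B\<^esub> tau \<rho> (GDb i) = tau \<rho> GJ [^]\<^bsub>opposite B\<^esub> (m - 1)" if "i : I" for i
    unfolding pow P_def[symmetric] using that by (simp add: KKb)
  show "tau \<rho> x \<otimes>\<^bsub>opposite B\<^esub> tau \<rho> y = tau \<rho> y \<otimes>\<^bsub>opposite B\<^esub> tau \<rho> x"
    if "x : insert GJ (w_toral I) & y : insert GJ (w_toral I)" for x y
    using tau_toral(1)[of x \<rho>] tau_toral(1)[of y \<rho>] that toral_comm by (metis opposite_simps(6))
  show "tau \<rho> x \<otimes>\<^bsub>opposite B\<^esub> tau \<rho> GJ [^]\<^bsub>opposite B\<^esub> (m - 1) = tau \<rho> x" if "x : w_toral I" for x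
    unfolding pow P_def[symmetric] using tau_toral(2)[OF that, of \<rho>] P_toral by auto
  fix i j assume ij: "i : I" "j : I"
  note [simp] = KKb[OF ij(2)] P_EK(1)[OF ij(1)] EK_facts(5)[OF ij(1,1)] P_EK(2)[OF ij(1)] KF_facts(5)[OF ij(1,1)]
  show "typed_weight (opposite B) (\<kappa> i) (tau \<rho> (GK j)) (tau \<rho> (GKb j)) (tau \<rho> (GE i)) (qi i powi a i j)"
    unfolding tau_simps by (rule tau_typed_weight) (use ij EK_facts[OF ij] in "simp_all add: power_int_minus")
  show "typed_weight (opposite B) (\<kappa>' i) (tau \<rho> (GK j)) (tau \<rho> (GKb j)) (tau \<rho> (GF i)) (qi i powi (- a i j))"
    unfolding tau_simps by (rule tau_typed_weight) (use ij KF_facts[OF ij] in "simp_all add: power_int_minus")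
  have "typed_weight (opposite B) (\<kappa> i) (tau \<rho> (GD j)) (tau \<rho> (GDb j)) (tau \<rho> (GE i)) (dwt i j)"
    unfolding tau_simps by (rule tau_typed_weight) (use ij EK_facts[OF ij] in simp_all)
  then show "typed_weight (opposite B) (\<kappa> i) (tau \<rho> (GD j)) (tau \<rho> (GDb j)) (tau \<rho> (GE i)) (if i = j then q else 1)"
    by (simp add: dwt_def)
  have "typed_weight (opposite B) (\<kappa>' i) (tau \<rho> (GD j)) (tau \<rho> (GDb j)) (tau \<rho> (GF i)) (inverse (dwt i j))"
    unfolding tau_simps by (rule tau_typed_weight) (use ij KF_facts[OF ij] in simp_all)
  moreover have "inverse (dwt i j) = (if i = j then inverse q else 1)" by (simp add: dwt_def)
  ultimately show "typed_weight (opposite B) (\<kappa>' i) (tau \<rho> (GD j)) (tau \<rho> (GDb j)) (tau \<rho> (GF i)) (if i = j then inverse q else 1)"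
    by simp
next
  fix i j assume "i : I & j : I"
  then show "ef_rel (opposite B) (qi i) (i = j) (tau \<rho> (GE i)) (tau \<rho> (GF j)) (tau \<rho> (GK i)) (tau \<rho> (GKb i))"
    using l by (intro tau_ef) auto
next
  fix i j :: nat and Z :: "nat => wgen"
  assume A: "i : I & j : I & i ~= j & a i i = 2 & Z : {GE, GF}"
  then have ij: "i : I" "j : I" "i ~= j" "a i i = 2" by auto
  have "B.serre (qi i) (n_ij i j) (tau \<rho> (Z i)) (tau \<rho> (Z j)) = \<zero>"
    using A tau_serre_E[OF ij] tau_serre_F[OF ij] ij by (elim conjE insertE) (simp_all add: KF_swap)
  moreover have "Z i : w_gens I" "Z j : w_gens I" using A by auto
  ultimately show "O.serre (qi i) (n_ij i j) (tau \<rho> (Z i)) (tau \<rho> (Z j)) = \<zero>\<^bsub>opposite B\<^esub>"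
    using tau_closed[of \<rho>] by (simp add: B.serre_opposite Pi_iff)
next
  fix i j :: nat and Z :: "nat => wgen"
  assume A: "i : I & j : I & a i j = 0 & Z : {GE, GF}"
  then have ij: "i : I" "j : I" "a i j = 0" by auto
  show "tau \<rho> (Z i) \<otimes>\<^bsub>opposite B\<^esub> tau \<rho> (Z j) = tau \<rho> (Z j) \<otimes>\<^bsub>opposite B\<^esub> tau \<rho> (Z i)"
    using A tau_commute[OF ij] ij by (elim conjE insertE) (simp_all add: KF_swap mult_ac)
qed

end

subsection \<open>The bialgebra \<open>wU\<close>\<close>

lemma kalgebra_extend:
  fixes A :: "('k::field, 'a) module"
  shows "kalgebra A ==> kalgebra (module.extend A (bialgebra.fields D e))"
  by (erule kalgebra_cong) (simp_all add: module.extend_def bialgebra.fields_def)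

lemma extend_simps [simp]:
  fixes A :: "('k::field, 'a) module"
  shows "carrier (module.extend A (bialgebra.fields D e)) = carrier A"
  "\<one>\<^bsub>module.extend A (bialgebra.fields D e)\<^esub> = \<one>\<^bsub>A\<^esub>" "\<zero>\<^bsub>module.extend A (bialgebra.fields D e)\<^esub> = \<zero>\<^bsub>A\<^esub>"
  "add (module.extend A (bialgebra.fields D e)) = add A"
  "monoid.mult (module.extend A (bialgebra.fields D e)) = monoid.mult A"
  "module.smult (module.extend A (bialgebra.fields D e)) = module.smult A"
  "comult (module.extend A (bialgebra.fields D e)) = D" "counit (module.extend A (bialgebra.fields D e)) = e"
  by (simp_all add: module.extend_def bialgebra.fields_def)

text \<open>Both sides of each bialgebra axiom are algebra homomorphisms, so it suffices to compare them
  on the generators of a presented algebra.\<close>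

lemma (in presented) is_bialgebra_extendI:
  fixes D :: "('g list \<Rightarrow>\<^sub>0 'k) set => (('g list \<Rightarrow>\<^sub>0 'k) set \<times> ('g list \<Rightarrow>\<^sub>0 'k) set \<Rightarrow>\<^sub>0 'k) set"
  assumes D: "algebra_hom W (tensor_algebra W W) D" and e: "algebra_hom W base_field e"
    and coassoc: "!!g. g : gs ==>
      tensor_extend (tensor_algebra W (tensor_algebra W W)) (%x1 x2. tensor W (tensor_algebra W W) x1 (D x2)) (D (gen g)) =
      tensor_extend (tensor_algebra W (tensor_algebra W W)) (%x1 x2. kalg.associator W (D x1) x2) (D (gen g))"
    and counit: "!!g. g : gs ==> tensor_extend W (%x1 x2. e x1 \<odot>\<^bsub>W\<^esub> x2) (D (gen g)) = gen g"
      "!!g. g : gs ==> tensor_extend W (%x1 x2. e x2 \<odot>\<^bsub>W\<^esub> x1) (D (gen g)) = gen g"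
  shows "is_bialgebra (module.extend W (bialgebra.fields D e))" (is "is_bialgebra ?H")
proof -
  interpret WW: tens W W ..
  interpret WWW: tens W WW.T ..
  have T1: "tensor_algebra ?H ?H = WW.T" "tensor ?H ?H = WW.tn"
    by (rule tensor_algebra_cong; simp)+
  have T2: "tensor_algebra ?H WW.T = WWW.T" "tensor ?H WW.T = WWW.tn"
    by (rule tensor_algebra_cong; simp)+
  have ext: "tensor_extend ?H = tensor_extend W"
    unfolding tensor_extend_def coset_extend_def finsum_def finprod_def
    by (simp add: fun_eq_iff)
  have id: "algebra_hom W W (%x. x)" by (rule algebra_homI[OF linear_map_id]) auto
  have 1: "tensor_extend WWW.T (%x1 x2. WWW.tn x1 (D x2)) (D x) =
      tensor_extend WWW.T (%x1 x2. tensor_extend WWW.T (%x11 x12. WWW.tn x11 (WW.tn x12 x2)) (D x1)) (D x)"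
    if "x : carrier W" for x
    by (rule presented_hom_eqI[OF WWW.kalgebra_tensor W.comult_right_hom[OF D] W.comult_left_hom[OF D] _ that])
      (use coassoc in "simp add: W.associator_def")
  have 2: "tensor_extend W (%x1 x2. e x1 \<odot>\<^bsub>W\<^esub> x2) (D x) = x" if "x : carrier W" for x
    by (rule presented_hom_eqI[OF W.is_kalgebra W.counit_hom_left(1)[OF D e] id _ that]) (use counit in simp)
  have 3: "tensor_extend W (%x1 x2. e x2 \<odot>\<^bsub>W\<^esub> x1) (D x) = x" if "x : carrier W" for x
    by (rule presented_hom_eqI[OF W.is_kalgebra W.counit_hom_left(2)[OF D e] id _ that]) (use counit in simp)
  have D': "algebra_hom ?H WW.T D" and e': "algebra_hom ?H base_field e"
    using D e by (auto simp: algebra_hom_def linear_map_def ring_hom_def)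
  show ?thesis
    unfolding is_bialgebra_def T1 T2 ext extend_simps
    using kalgebra_extend[OF W.is_kalgebra] D' e' 1 2 3 by (simp add: T1 T2)
qed

context cartan
begin

lemma w_gen_cases:
  assumes "x : w_gens I"
  obtains "x = GJ" | i where "i : I" "x = GE i" | i where "i : I" "x = GF i" | i where "i : I" "x = GK i"
    | i where "i : I" "x = GKb i" | i where "i : I" "x = GD i" | i where "i : I" "x = GDb i"
  using assms by (auto simp: w_gens_def w_toral_def)

interpretation W: presented "w_gens I" wrels
  by (rule presented.intro) (rule wrels_closed)

abbreviation WA where "WA == presented_algebra (w_gens I) wrels"
abbreviation w_mult (infixl "\<cdot>" 70) where "x \<cdot> y == x \<otimes>\<^bsub>WA\<^esub> y"
abbreviation w_smult (infixl "\<bullet>" 75) where "c \<bullet> x == c \<odot>\<^bsub>WA\<^esub> x"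
abbreviation g where "g == presented.gen (w_gens I) wrels"

lemma w_sat_W: "w_sat WA g"
  using w_sat_iff[OF W.W.is_kalgebra W.gen_funcset] W.relation_holds by blast

lemma w_model_W: "w_model I a s q m \<kappa> \<kappa>' WA g"
  by (intro w_model.intro w_model_axioms.intro cartan_axioms W.W.kalg_axioms W.gen_funcset w_sat_W)

interpretation M: w_model I a s q m \<kappa> \<kappa>' WA g by (rule w_model_W)

interpretation WW: tens WA WA ..

lemma w_algebra_eq: "w_algebra I a s q m \<kappa> \<kappa>' = WA"
  by (simp add: w_algebra_def)

lemma w_class_eq: "w : lists (w_gens I) ==> w_class I a s q m \<kappa> \<kappa>' w c = c \<bullet> word_value WA g w"
  unfolding w_class_def by (rule W.cls_single)

lemma w_class_gen: "x : w_gens I ==> w_class I a s q m \<kappa> \<kappa>' [x] 1 = g x"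
  by (simp add: w_class_eq)

lemma w_class_P: "w_class I a s q m \<kappa> \<kappa>' (replicate (m - 1) GJ) 1 = M.P"
proof -
  have "replicate (m - 1) GJ : lists (w_gens I)" by auto
  from w_class_eq[OF this] show ?thesis by (simp add: W.W.word_value_replicate M.P_def)
qed

lemma wP_eq: "wP I a s q m \<kappa> \<kappa>' = M.P"
  unfolding wP_def by (rule w_class_P)

lemma w_comult_gen_eq: "x : w_gens I ==> w_comult_gen I a s q m \<kappa> \<kappa>' x = M.cop x"
proof (cases x)
  case (GE i)
  assume "x : w_gens I"
  then have "i : I" using GE by (auto simp: w_gens_def w_toral_def)
  then show ?thesis
    using w_class_P unfolding GE by (auto simp: w_algebra_eq w_class_gen M.e0_def w_class_eq[of "[]"])
next
  case (GF i)
  assume "x : w_gens I"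
  then have "i : I" using GF by (auto simp: w_gens_def w_toral_def)
  then show ?thesis
    using w_class_P unfolding GF by (auto simp: w_algebra_eq w_class_gen M.f0_def w_class_eq[of "[]"])
qed (simp_all add: w_algebra_eq w_class_gen)

definition \<Delta> where "\<Delta> = generator_extend WW.T (w_comult_gen I a s q m \<kappa> \<kappa>')"
definition eps where "eps = (generator_extend base_field w_counit_gen :: _ => 'k)"
definition th where "th = (generator_extend base_field (%_. 0) :: (wgen list \<Rightarrow>\<^sub>0 'k) set => 'k)"

text \<open>The structure maps are given by functions on the whole type \<open>wgen\<close> that
  match the maps of a model only at indices from \<open>I\<close>; hence \<open>f'\<close> is
  compared with \<open>f\<close> on generators only.\<close>

lemma w_hom:
  fixes B (structure)
  assumes B: "kalgebra B" and f: "f : w_gens I \<rightarrow> carrier B" "w_sat B f"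
    and eq: "!!x. x : w_gens I ==> f' x = f x"
  shows "algebra_hom WA B (generator_extend B f')" "x : w_gens I ==> generator_extend B f' (g x) = f x"
proof -
  interpret B: kalg B by (rule kalg.intro) fact
  have f': "f' : w_gens I \<rightarrow> carrier B" using f eq by auto
  have wv: "word_value B f' w = word_value B f w" if "w : lists (w_gens I)" for w
    using that by (induction w) (auto simp: eq)
  have r: "lin B (word_value B f') r = \<zero>" if r: "r : wrels" for r
  proof -
    have k: "keys r <= lists (w_gens I)" using r wrels_closed by auto
    have "lin B (word_value B f') r = lin B (word_value B f) r"
      by (rule B.lin_cong) (use k wv B.word_value_closed[OF f(1)] in blast)+
    also have "... = \<zero>" using w_sat_iff[OF B f(1)] f(2) r by blast
    finally show ?thesis .
  qed
  show "algebra_hom WA B (generator_extend B f')"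
    by (rule W.generator_extend_hom[OF B f' r])
  show "x : w_gens I ==> generator_extend B f' (g x) = f x"
    using W.generator_extend_gen[OF B f' r] eq by auto
qed

lemmas \<Delta>_hom = w_hom(1)[OF WW.kalgebra_tensor M.cop_closed M.w_sat_cop w_comult_gen_eq, folded \<Delta>_def]
lemmas \<Delta>_gen = w_hom(2)[OF WW.kalgebra_tensor M.cop_closed M.w_sat_cop w_comult_gen_eq, folded \<Delta>_def]

interpretation BF: kalg "base_field :: ('k, 'k) module"
  by (rule kalg.intro) (rule kalgebra_base_field)

lemma w_sat_counit: "w_sat base_field (w_counit_gen :: wgen => 'k)"
proof (rule w_satI_unit[OF kalgebra_base_field])
  show "BF.serre (qi i) (n_ij i j) (w_counit_gen (Z i)) (w_counit_gen (Z j)) = \<zero>\<^bsub>base_field\<^esub>"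
    if "Z : {GE, GF}" for i j Z
    using that BF.qad_zero[of 0 _ "n_ij i j"] by (auto simp: BF.serre_def)
qed (auto simp: ef_rel_def elim!: w_toral_cases)

text \<open>No relator has a constant term, so sending every generator to zero is a model;
  \<open>m \<ge> 2\<close> guarantees this for the relators containing J^(m-1).\<close>

lemma w_sat_zero: "w_sat base_field ((%_. 0) :: wgen => 'k)"
proof -
  have pow: "(0::'k) [^]\<^bsub>base_field\<^esub> n = 0" if "n > 0" for n :: nat
    using that by (cases n) auto
  have s: "BF.serre z n 0 0 = 0" for z n
    using BF.qad_zero[of 0 _ n] by (simp add: BF.serre_def)
  show ?thesis
    unfolding w_sat_def using m_ge_2 by (simp add: pow s typed_weight_def ef_rel_def)
qed

lemma eps_hom: "algebra_hom WA base_field eps"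
  and eps_gen: "x : w_gens I ==> eps (g x) = w_counit_gen x"
  unfolding eps_def by (rule w_hom[OF kalgebra_base_field _ w_sat_counit refl]; simp)+

lemma th_hom: "algebra_hom WA base_field th"
  and th_gen: "x : w_gens I ==> th (g x) = 0"
  unfolding th_def by (rule w_hom[OF kalgebra_base_field _ w_sat_zero refl]; simp)+

lemma hom_pow:
  assumes "kalgebra B" "algebra_hom WA B h" "x : carrier WA"
  shows "h (x [^]\<^bsub>WA\<^esub> n) = h x [^]\<^bsub>B\<^esub> (n::nat)"
proof -
  interpret B: kalg B by (rule kalg.intro) fact
  show ?thesis by (induction n) (use assms in "simp_all add: algebra_homD")
qed

lemma \<Delta>_P: "\<Delta> M.P = WW.tn M.P M.P"
  unfolding M.P_def by (simp add: hom_pow[OF WW.kalgebra_tensor \<Delta>_hom] \<Delta>_gen WW.tn_pow)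

lemma eps_P: "eps M.P = 1"
proof -
  have "(1::'k) [^]\<^bsub>base_field\<^esub> n = 1" for n :: nat by (induction n) auto
  then show ?thesis
    unfolding M.P_def by (simp add: hom_pow[OF kalgebra_base_field eps_hom] eps_gen)
qed

lemma th_P: "th M.P = 0"
proof -
  obtain k where k: "m - 1 = Suc k" using m_ge_2 by (cases m) (auto simp: numeral_2_eq_2 gr0_conv_Suc Suc_le_eq)
  show ?thesis
    unfolding M.P_def k by (simp add: algebra_homD(4)[OF th_hom] th_gen)
qed

lemma \<Delta>_e0: "\<Delta> (M.e0 i) = WW.tn (M.e0 i) (M.e0 i)" "\<Delta> (M.f0 i) = WW.tn (M.f0 i) (M.f0 i)"
  "eps (M.e0 i) = 1" "eps (M.f0 i) = 1"
  using algebra_homD(2)[OF \<Delta>_hom] algebra_homD(2)[OF eps_hom]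
  by (simp_all add: M.e0_def M.f0_def \<Delta>_P eps_P WW.one_T)

definition HW where "HW = module.extend WA (bialgebra.fields \<Delta> eps)"

lemma wU_eq: "wU I a s q m \<kappa> \<kappa>' = HW"
  by (simp add: wU_def HW_def w_algebra_eq \<Delta>_def eps_def)

interpretation WWW: tens WA WW.T ..

lemma is_bialgebra_HW: "is_bialgebra HW"
  unfolding HW_def
proof (rule W.is_bialgebra_extendI[OF \<Delta>_hom eps_hom])
  note D = algebra_homD[OF \<Delta>_hom] and e = algebra_homD[OF eps_hom, simplified]
  have b1: "bilinear_map WA WA WWW.T (%x1 x2. WWW.tn x1 (\<Delta> x2))"
    by (rule bilinear_map_compose[OF WWW.bilinear_tn linear_map_id D(1) linear_map_id])
  have b2: "bilinear_map WA WA WWW.T (%x1 x2. W.W.associator (\<Delta> x1) x2)"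
    by (rule bilinear_map_compose[OF W.W.bilinear_associator D(1) linear_map_id linear_map_id])
  have b3: "bilinear_map WA WA WA (%x1 x2. eps x1 \<bullet> x2)"
    by (auto intro!: bilinear_mapI linear_mapI simp: e W.W.smult_add_left W.W.smult_add_right mult.commute)
  have b4: "bilinear_map WA WA WA (%x1 x2. eps x2 \<bullet> x1)"
    by (auto intro!: bilinear_mapI linear_mapI simp: e W.W.smult_add_left W.W.smult_add_right mult.commute)
  note s1 = WW.tensor_extend_tensor[OF WWW.T.kmod_axioms b1] WW.tensor_extend_add[OF WWW.T.kmod_axioms b1]
  note s2 = WW.tensor_extend_tensor[OF WWW.T.kmod_axioms b2] WW.tensor_extend_add[OF WWW.T.kmod_axioms b2]
  note s3 = WW.tensor_extend_tensor[OF W.W.kmod_axioms b3] WW.tensor_extend_add[OF W.W.kmod_axioms b3]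
  note s4 = WW.tensor_extend_tensor[OF W.W.kmod_axioms b4] WW.tensor_extend_add[OF W.W.kmod_axioms b4]
  fix x assume x: "x : w_gens I"
  show "tensor_extend WWW.T (%x1 x2. WWW.tn x1 (\<Delta> x2)) (\<Delta> (g x)) =
      tensor_extend WWW.T (%x1 x2. W.W.associator (\<Delta> x1) x2) (\<Delta> (g x))"
    by (rule w_gen_cases[OF x]) (simp_all add: \<Delta>_gen s1 s2 \<Delta>_e0 W.W.associator_add WWW.tn_add_right
        WWW.T.a_ac)
  show "tensor_extend WA (%x1 x2. eps x1 \<bullet> x2) (\<Delta> (g x)) = g x"
    by (rule w_gen_cases[OF x]) (simp_all add: \<Delta>_gen s3 eps_gen \<Delta>_e0)
  show "tensor_extend WA (%x1 x2. eps x2 \<bullet> x1) (\<Delta> (g x)) = g x"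
    by (rule w_gen_cases[OF x]) (simp_all add: \<Delta>_gen s4 eps_gen \<Delta>_e0)
qed

text \<open>Defined for all scalars in order to have a candidate for the inverse of T.\<close>

definition Tl :: "(nat => 'k) => (wgen list \<Rightarrow>\<^sub>0 'k) set => (wgen list \<Rightarrow>\<^sub>0 'k) set" where
  "Tl \<rho> = generator_extend (opposite WA) (M.tau \<rho>)"

lemma Tl_hom: "(!!i. i : I ==> \<rho> i ~= 0) ==> algebra_hom WA (opposite WA) (Tl \<rho>)"
  and Tl_gen: "(!!i. i : I ==> \<rho> i ~= 0) ==> x : w_gens I ==> Tl \<rho> (g x) = M.tau \<rho> x"
  unfolding Tl_def by (rule w_hom[OF W.W.kalgebra_opposite _ M.w_sat_tau refl]; simp add: M.tau_closed)+

definition T where "T = wT I a s q m \<kappa> \<kappa>'"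

lemma w_T_gen_eq: "x : w_gens I ==> w_T_gen I a s q m \<kappa> \<kappa>' x = M.tau (%_. 1) x"
  by (erule w_gen_cases) (simp_all add: w_class_gen w_class_eq)

lemma T_hom: "algebra_hom WA (opposite WA) T"
  and T_gen: "x : w_gens I ==> T (g x) = M.tau (%_. 1) x"
  unfolding T_def wT_def w_algebra_eq
  by (rule w_hom[OF W.W.kalgebra_opposite _ M.w_sat_tau w_T_gen_eq]; simp add: M.tau_closed)+

lemma T_P: "T M.P = M.P"
  unfolding M.P_def
  by (simp add: hom_pow[OF W.W.kalgebra_opposite T_hom] T_gen W.W.nat_pow_opposite)

lemma Tl_P: "(!!i. i : I ==> \<rho> i ~= 0) ==> Tl \<rho> M.P = M.P"
  unfolding M.P_def
  by (simp add: hom_pow[OF W.W.kalgebra_opposite Tl_hom] Tl_gen W.W.nat_pow_opposite)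

end

section \<open>Generated subalgebras\<close>

context kalg
begin

lemma subalgebra_iff:
  "(subring C A & (\<forall>c. ALL x:C. c \<odot> x : C)) \<longleftrightarrow> C <= carrier A & \<one> : C &
    (ALL x:C. ALL y:C. x \<oplus> y : C) & (ALL x:C. ALL y:C. x \<otimes> y : C) & (\<forall>c. ALL x:C. c \<odot> x : C)" (is "?l \<longleftrightarrow> ?r")
proof
  assume ?l
  then show ?r using subringE by metis
next
  assume r: ?r
  have "subring C A"
    by (rule subringI) (use r in "auto simp: minus_eq_smult subset_iff")
  then show ?l using r by blast
qed

lemma generated_alt:
  "generated_subalgebra A S = \<Inter>{C. C <= carrier A & \<one> : C & (ALL x:C. ALL y:C. x \<oplus> y : C) &
    (ALL x:C. ALL y:C. x \<otimes> y : C) & (\<forall>c. ALL x:C. c \<odot> x : C) & S <= C}"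
  unfolding generated_subalgebra_def using subalgebra_iff by (metis (no_types, lifting))

lemma generated_minimal:
  assumes "D <= carrier A" "\<one> : D" "!!x y. x : D ==> y : D ==> x \<oplus> y : D"
    "!!x y. x : D ==> y : D ==> x \<otimes> y : D" "!!c x. x : D ==> c \<odot> x : D" "S <= D"
  shows "generated_subalgebra A S <= D"
  unfolding generated_alt using assms by (intro Inter_lower) auto

context
  fixes S assumes S: "S <= carrier A"
begin

lemma generated_closed:
  "generated_subalgebra A S <= carrier A" "\<one> : generated_subalgebra A S" "S <= generated_subalgebra A S"
  "x : generated_subalgebra A S ==> y : generated_subalgebra A S ==> x \<oplus> y : generated_subalgebra A S"
  "x : generated_subalgebra A S ==> y : generated_subalgebra A S ==> x \<otimes> y : generated_subalgebra A S"
  "x : generated_subalgebra A S ==> c \<odot> x : generated_subalgebra A S"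
proof -
  show "generated_subalgebra A S <= carrier A" by (rule generated_minimal) (use S in auto)
qed (auto simp: generated_alt)

text \<open>The product case is restricted to a generator on the left, which is the form needed when
  a coproduct or an antihomomorphism is unfolded.\<close>

lemma generated_induct [consumes 1, case_names one add smult mult]:
  assumes "x : generated_subalgebra A S" and one: "Q \<one>"
    and add: "!!x y. x : generated_subalgebra A S ==> y : generated_subalgebra A S ==> Q x ==> Q y ==> Q (x \<oplus> y)"
    and smult: "!!c x. x : generated_subalgebra A S ==> Q x ==> Q (c \<odot> x)"
    and mult: "!!s y. s : S ==> y : generated_subalgebra A S ==> Q y ==> Q (s \<otimes> y)"
  shows "Q x"
proof -
  let ?G = "generated_subalgebra A S"
  have G: "y : ?G ==> y : carrier A" for y using generated_closed(1) by auto
  \<comment> \<open>Preservation of \<open>Q\<close> under left multiplication is stable under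
    products, whereas \<open>Q\<close> alone need not be. Applying it to the unit recovers
    \<open>Q x\<close>.\<close>
  define D where "D = {x : ?G. ALL y:?G. Q y --> Q (x \<otimes> y)}"
  have "?G <= D"
  proof (rule generated_minimal)
    show "S <= D" using mult generated_closed(3) by (auto simp: D_def)
  next
    fix x y assume "x : D" "y : D"
    then show "x \<oplus> y : D" "x \<otimes> y : D"
      by (auto simp: D_def generated_closed l_distr m_assoc G intro!: add)
  next
    fix c x assume "x : D"
    then show "c \<odot> x : D" by (auto simp: D_def generated_closed G intro!: smult)
  qed (use G generated_closed(2) in "auto simp: D_def")
  then have "Q (x \<otimes> \<one>)" using assms(1) one generated_closed(2) by (auto simp: D_def)
  then show ?thesis using G assms(1) by simp
qed

end

end

text \<open>The elements whose coproduct lies in the image of \<open>emb\<close> form a subalgebra,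
  by \<open>emb_image_closed\<close>.\<close>

lemma (in sub_bialg) comult_image_generated:
  assumes C: "C = generated_subalgebra H N" "N <= carrier H" and u: "u = \<one>"
    and N: "!!x. x : N ==> EX t:carrier (tensor_algebra S S). emb t = comult H x" and x: "x : C"
  shows "EX t:carrier (tensor_algebra S S). emb t = comult H x"
proof -
  note D = algebra_homD[OF comult_hom] and ic = emb_image_closed
  let ?D = "{x : C. EX t:carrier (tensor_algebra S S). emb t = comult H x}"
  have "generated_subalgebra H N <= ?D"
  proof (rule generated_minimal)
    show "?D <= carrier H" using C_carrier by blast
    have "EX t:carrier (tensor_algebra S S). emb t = comult H u"
      using ic(4)[OF u_in u_in] unfolding comult_u .
    then show "\<one> : ?D" using u_in by (simp add: u[symmetric])
    show "N <= ?D" using N generated_closed(3)[OF C(2), folded C(1)] by blast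
    fix x y c assume "x : ?D"
    then have x: "x : C" "EX t:carrier (tensor_algebra S S). emb t = comult H x" by auto
    show "c \<odot> x : ?D" using ic(3)[OF x(2), of c] D(6)[OF C_carrier[OF x(1)], of c] C_smult[OF x(1)] by simp
    assume "y : ?D"
    then have y: "y : C" "EX t:carrier (tensor_algebra S S). emb t = comult H y" by auto
    show "x \<oplus> y : ?D" using ic(1)[OF x(2) y(2)] D(5)[of x y] C_add[OF x(1) y(1)] x(1) y(1) by simp
    show "x \<otimes> y : ?D" using ic(2)[OF x(2) y(2)] D(4)[of x y] C_mult[OF x(1) y(1)] x(1) y(1) by simp
  qed
  then show ?thesis using x C(1) by blast
qed

section \<open>A criterion for weak antipodes\<close>

text \<open>\<open>GT\<close> consists of the group-like generators, \<open>ET\<close> and \<open>FT\<close> of those shaped like \<open>E\<^sub>i\<close> and \<open>F\<^sub>i\<close>.  The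
  identities are checked by induction on products of generators from the left.\<close>

locale weak_hopf_data = bialg H for H :: "('k::field, 'a) bialgebra" (structure) +
  fixes P :: 'a and T :: "'a => 'a" and th :: "'a => 'k" and GT ET FT :: "'a set"
  assumes P_in: "P : GT" and P_central: "!!x. x : carrier H ==> P \<otimes> x = x \<otimes> P" and TP: "T P = P"
    and T_antihom: "algebra_hom H (opposite H) T" and th_hom: "algebra_hom H base_field th"
    and QT: "!!x. x : carrier H ==> (\<one> \<oplus> (- 1) \<odot> P) \<otimes> T x = th x \<odot> (\<one> \<oplus> (- 1) \<odot> P)"
    and GT: "!!x. x : GT ==> x : carrier H" "!!x. x : GT ==> comult H x = tensor H H x x"
      "!!x. x : GT ==> counit H x = 1" "!!x. x : GT ==> x \<otimes> T x = P" "!!x. x : GT ==> T x \<otimes> x = P"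
      "!!x. x : GT ==> x \<otimes> P = x" "!!x. x : GT ==> th x = 0"
    and ET: "!!x. x : ET ==> x : carrier H" "!!x. x : ET ==> counit H x = 0" "!!x. x : ET ==> th x = 0"
      "!!x. x : ET ==> \<exists>e. EX k:GT. (e = \<one> | e = P & x \<otimes> P = x) & T x = (- 1) \<odot> (x \<otimes> T k) &
        comult H x = tensor H H e x \<oplus>\<^bsub>tensor_algebra H H\<^esub> tensor H H x k"
    and FT: "!!x. x : FT ==> x : carrier H" "!!x. x : FT ==> counit H x = 0" "!!x. x : FT ==> th x = 0"
      "!!x. x : FT ==> \<exists>e. EX k:GT. (e = \<one> | e = P & x \<otimes> P = x) & T x = (- 1) \<odot> (T k \<otimes> x) &
        comult H x = tensor H H x e \<oplus>\<^bsub>tensor_algebra H H\<^esub> tensor H H k x"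
    and EF_Q: "!!x y. x : ET ==> y : FT ==>
      (\<one> \<oplus> (- 1) \<odot> P) \<otimes> (x \<otimes> y) = (\<one> \<oplus> (- 1) \<odot> P) \<otimes> (y \<otimes> x)"
    and gen: "carrier H = generated_subalgebra H (GT Un ET Un FT)"
begin

definition Q where "Q = \<one> \<oplus> (- 1) \<odot> P"

lemma P_carrier [simp]: "P : carrier H" by (rule GT(1)[OF P_in])

lemma PP: "P \<otimes> P = P" by (rule GT(6)[OF P_in])

lemma thP: "th P = 0" by (rule GT(7)[OF P_in])

lemma Q_carrier [simp]: "Q : carrier H" by (simp add: Q_def)

lemma Q_central: "x : carrier H ==> Q \<otimes> x = x \<otimes> Q"
  by (simp add: Q_def l_distr r_distr P_central)

lemma Q_swap: "x : carrier H ==> v : carrier H ==> Q \<otimes> (x \<otimes> v) = x \<otimes> (Q \<otimes> v)"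
proof -
  assume c: "x : carrier H" "v : carrier H"
  have "Q \<otimes> (x \<otimes> v) = (Q \<otimes> x) \<otimes> v" using c by (simp add: m_assoc)
  also have "... = x \<otimes> (Q \<otimes> v)" unfolding Q_central[OF c(1)] using c by (simp add: m_assoc)
  finally show ?thesis .
qed

lemma PQ_sum: "x : carrier H ==> P \<otimes> x \<oplus> Q \<otimes> x = x"
proof -
  assume x: "x : carrier H"
  have "P \<otimes> x \<oplus> Q \<otimes> x = x \<oplus> (P \<otimes> x \<oplus> (- 1) \<odot> (P \<otimes> x))"
    using x by (simp add: Q_def l_distr a_ac)
  also have "P \<otimes> x \<oplus> (- 1) \<odot> (P \<otimes> x) = \<zero>" using x by (simp add: smult_minus_left r_neg)
  finally show ?thesis using x by simp
qed

lemma QP: "x : carrier H ==> x \<otimes> P = x ==> Q \<otimes> x = \<zero>"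
proof -
  assume x: "x : carrier H" "x \<otimes> P = x"
  have "Q \<otimes> x = x \<oplus> (- 1) \<odot> x" using x by (simp add: Q_def l_distr P_central)
  then show ?thesis using x by (simp add: smult_minus_left r_neg)
qed

lemmas T_simps = algebra_homD[OF T_antihom, simplified]
lemmas th_simps = algebra_homD[OF th_hom, simplified]

lemma T_linear: "linear_map H H T"
  by (rule linear_mapI) (simp_all add: T_simps)

lemma mult_linear: "a : carrier H ==> b : carrier H ==> linear_map H H (%x. a \<otimes> x \<otimes> b)"
  "a : carrier H ==> linear_map H H (%x. a \<otimes> x)" "a : carrier H ==> linear_map H H (%x. c \<odot> (a \<otimes> x))"
  by (auto intro!: linear_mapI simp: l_distr r_distr smult_add_right mult.commute)

lemma induct [consumes 1, case_names one add smult GT ET FT]: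
  assumes "x : carrier H" and one: "R \<one>"
    and add: "!!x y. x : carrier H ==> y : carrier H ==> R x ==> R y ==> R (x \<oplus> y)"
    and smult: "!!c x. x : carrier H ==> R x ==> R (c \<odot> x)"
    and "!!s y. s : GT ==> y : carrier H ==> R y ==> R (s \<otimes> y)"
    and "!!s y. s : ET ==> y : carrier H ==> R y ==> R (s \<otimes> y)"
    and "!!s y. s : FT ==> y : carrier H ==> R y ==> R (s \<otimes> y)"
  shows "R x"
proof -
  have S: "GT Un ET Un FT <= carrier H" using GT(1) ET(1) FT(1) by auto
  have "x : generated_subalgebra H (GT Un ET Un FT)" using assms(1) gen by simp
  then show ?thesis
    by (induction rule: generated_induct[OF S]) (use assms gen in auto)
qed

text \<open>\<open>V\<close>, \<open>V'\<close>, \<open>L\<close> and \<open>R\<close> on tensors induce the convolutions \<open>id * T\<close>, \<open>T * id\<close>,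
  \<open>id * th\<close> and \<open>th * id\<close>.\<close>

definition V where "V = tensor_extend H (%x y. x \<otimes> T y)"
definition V' where "V' = tensor_extend H (%x y. T x \<otimes> y)"
definition L where "L = tensor_extend H (%x y. th y \<odot> x)"
definition R where "R = tensor_extend H (%x y. th x \<odot> y)"

lemma bV: "bilinear_map H H H (%x y. x \<otimes> T y)" and bV': "bilinear_map H H H (%x y. T x \<otimes> y)"
  using bilinear_mult[OF linear_map_id T_linear] bilinear_mult[OF T_linear linear_map_id] by auto

lemma bL: "bilinear_map H H H (%x y. th y \<odot> x)" and bR: "bilinear_map H H H (%x y. th x \<odot> y)"
  by (auto intro!: bilinear_mapI linear_mapI simp: th_simps smult_add_left smult_add_right mult.commute)

lemmas te_linear = HH.tensor_extend_linear[OF kmod_axioms]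
lemmas te_closed = HH.tensor_extend_closed[OF kmod_axioms]
lemmas te_tensor = HH.tensor_extend_tensor[OF kmod_axioms]
lemmas te_compose = HH.tensor_extend_compose[OF kmod_axioms _ kmod_axioms]
lemmas te_shift = HH.tensor_extend_mult_tensor[OF kmod_axioms]
lemmas te_cong = HH.tensor_extend_cong[OF kmod_axioms]

lemmas V_simps = linear_mapD[OF te_linear[OF bV], folded V_def]
lemmas V'_simps = linear_mapD[OF te_linear[OF bV'], folded V'_def]
lemmas L_simps = linear_mapD[OF te_linear[OF bL], folded L_def]
lemmas R_simps = linear_mapD[OF te_linear[OF bR], folded R_def]

text \<open>The product in the opposite algebra is reversed, so \<open>T (x y) = T y T x\<close>.\<close>

lemma shift:
  assumes [simp]: "a : carrier H" "b : carrier H" and t: "t : carrier HH.T"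
  shows "V (HH.tn a b \<otimes>\<^bsub>HH.T\<^esub> t) = a \<otimes> V t \<otimes> T b" (is ?t4)
    "V' (HH.tn a b \<otimes>\<^bsub>HH.T\<^esub> t) = tensor_extend H (%x y. T x \<otimes> (T a \<otimes> b) \<otimes> y) t" (is ?t1)
    "L (HH.tn a b \<otimes>\<^bsub>HH.T\<^esub> t) = th b \<odot> (a \<otimes> L t)" (is ?t3)
    "R (HH.tn a b \<otimes>\<^bsub>HH.T\<^esub> t) = th a \<odot> (b \<otimes> R t)" (is ?t2)
proof -
  have c: "T a \<otimes> b : carrier H" using T_simps by simp
  have "V (HH.tn a b \<otimes>\<^bsub>HH.T\<^esub> t) = tensor_extend H (%x y. (a \<otimes> x) \<otimes> T (b \<otimes> y)) t"
    unfolding V_def by (rule te_shift[OF bV]) (use t in auto)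
  also have "... = tensor_extend H (%x y. a \<otimes> (x \<otimes> T y) \<otimes> T b) t"
    by (rule te_cong[OF bilinear_map_post[OF bV mult_linear(1)] _ t])
      (simp_all add: T_simps m_assoc)
  also have "... = a \<otimes> V t \<otimes> T b"
    unfolding V_def by (rule te_compose[OF bV mult_linear(1) t, symmetric]) (simp_all add: T_simps)
  finally show ?t4 .
  have b: "bilinear_map H H H (%x y. T x \<otimes> (T a \<otimes> b) \<otimes> y)"
    by (rule bilinear_mult[OF linear_mapI linear_map_id]) (use c in "simp_all add: T_simps l_distr")
  have "V' (HH.tn a b \<otimes>\<^bsub>HH.T\<^esub> t) = tensor_extend H (%x y. T (a \<otimes> x) \<otimes> (b \<otimes> y)) t"
    unfolding V'_def by (rule te_shift[OF bV']) (use t in auto)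
  also have "... = tensor_extend H (%x y. T x \<otimes> (T a \<otimes> b) \<otimes> y) t"
    by (rule te_cong[OF b _ t]) (simp add: T_simps m_assoc)
  finally show ?t1 .
  have "L (HH.tn a b \<otimes>\<^bsub>HH.T\<^esub> t) = tensor_extend H (%x y. th (b \<otimes> y) \<odot> (a \<otimes> x)) t"
    unfolding L_def by (rule te_shift[OF bL]) (use t in auto)
  also have "... = tensor_extend H (%x y. th b \<odot> (a \<otimes> (th y \<odot> x))) t"
    by (rule te_cong[OF bilinear_map_post[OF bL mult_linear(3)] _ t])
      (simp_all add: th_simps)
  also have "... = th b \<odot> (a \<otimes> L t)"
    unfolding L_def by (rule te_compose[OF bL mult_linear(3) t, symmetric]) simp
  finally show ?t3 .
  have "R (HH.tn a b \<otimes>\<^bsub>HH.T\<^esub> t) = tensor_extend H (%x y. th (a \<otimes> x) \<odot> (b \<otimes> y)) t"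
    unfolding R_def by (rule te_shift[OF bR]) (use t in auto)
  also have "... = tensor_extend H (%x y. th a \<odot> (b \<otimes> (th x \<odot> y))) t"
    by (rule te_cong[OF bilinear_map_post[OF bR mult_linear(3)] _ t])
      (simp_all add: th_simps)
  also have "... = th a \<odot> (b \<otimes> R t)"
    unfolding R_def by (rule te_compose[OF bR mult_linear(3) t, symmetric]) simp
  finally show ?t2 .
qed

lemmas GT_facts = GT and ET_facts = ET and FT_facts = FT

abbreviation D where "D == comult H"

lemmas D_simps = algebra_homD[OF comult_hom]

lemma D_one: "D \<one> = HH.tn \<one> \<one>" using D_simps(2) by (simp add: HH.one_T)

definition ET_split where "ET_split s e k \<longleftrightarrow> k : GT & k : carrier H & e : carrier H & (e = \<one> | e = P & s \<otimes> P = s) & T s = (- 1) \<odot> (s \<otimes> T k) & D s = HH.tn e s \<oplus>\<^bsub>HH.T\<^esub> HH.tn s k & T e = e & P \<otimes> e = P & e \<otimes> P = P"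

lemma ETE:
  assumes "s : ET"
  obtains e k where "ET_split s e k"
  unfolding ET_split_def
  using ET(4)[OF assms] GT(1) T_simps(2) TP PP P_carrier one_closed
  by (metis l_one r_one)

lemma ET_splitD:
  assumes "ET_split s e k"
  shows "k : GT" "k : carrier H" "e : carrier H" "e = \<one> | e = P & s \<otimes> P = s"
    "T s = (- 1) \<odot> (s \<otimes> T k)" "D s = HH.tn e s \<oplus>\<^bsub>HH.T\<^esub> HH.tn s k" "T e = e" "P \<otimes> e = P" "e \<otimes> P = P"
  using assms by (simp_all add: ET_split_def)

definition FT_split where "FT_split s e k \<longleftrightarrow> k : GT & k : carrier H & e : carrier H & (e = \<one> | e = P & s \<otimes> P = s) & T s = (- 1) \<odot> (T k \<otimes> s) & D s = HH.tn s e \<oplus>\<^bsub>HH.T\<^esub> HH.tn k s & T e = e & P \<otimes> e = P & e \<otimes> P = P"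

lemma FTE:
  assumes "s : FT"
  obtains e k where "FT_split s e k"
  unfolding FT_split_def
  using FT(4)[OF assms] GT(1) T_simps(2) TP PP P_carrier one_closed
  by (metis l_one r_one)

lemma FT_splitD:
  assumes "FT_split s e k"
  shows "k : GT" "k : carrier H" "e : carrier H" "e = \<one> | e = P & s \<otimes> P = s"
    "T s = (- 1) \<odot> (T k \<otimes> s)" "D s = HH.tn s e \<oplus>\<^bsub>HH.T\<^esub> HH.tn k s" "T e = e" "P \<otimes> e = P" "e \<otimes> P = P"
  using assms by (simp_all add: FT_split_def)

lemma P_move: "x : carrier H ==> v : carrier H ==> t : carrier H ==> P \<otimes> (x \<otimes> v \<otimes> t) = x \<otimes> (P \<otimes> v) \<otimes> t"
proof -
  assume c: "x : carrier H" "v : carrier H" "t : carrier H"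
  have "P \<otimes> (x \<otimes> v \<otimes> t) = (P \<otimes> x) \<otimes> v \<otimes> t" using c by (simp add: m_assoc)
  also have "... = x \<otimes> (P \<otimes> v) \<otimes> t" unfolding P_central[OF c(1)] using c by (simp add: m_assoc)
  finally show ?thesis .
qed

text \<open>In \<open>V (D (s \<otimes> y))\<close> the value for y sits between the legs of s, and
  by induction P turns it into a multiple of P. The outer factors then give s T(s) = P for a
  group-like s and cancel for the other generators.\<close>

lemma P_V: "x : carrier H ==> P \<otimes> V (D x) = counit H x \<odot> P"
proof (induction rule: induct)
  case one
  then show ?case unfolding D_one V_def by (simp add: te_tensor[OF bV] T_simps)
next
  case (add x y)
  then show ?case by (simp add: D_simps V_simps r_distr smult_add_left)
next
  case (smult c x)
  then show ?case by (simp add: D_simps V_simps)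
next
  case (GT s y)
  have [simp]: "s : carrier H" "T s : carrier H" "V (D y) : carrier H" using GT GT(1) T_simps V_simps by (auto intro: GT_facts(1))
  note G = GT_facts[OF GT(1)]
  have "P \<otimes> V (D (s \<otimes> y)) = s \<otimes> (P \<otimes> V (D y)) \<otimes> T s"
    using GT(2) G(2) by (simp add: D_simps shift P_move)
  also have "... = counit H y \<odot> (s \<otimes> P \<otimes> T s)" using GT(3) by simp
  finally show ?case using GT(2) G by simp
next
  case (ET s y)
  obtain e k where ek: "ET_split s e k" by (rule ETE[OF ET(1)])
  note ek' = ET_splitD[OF ek]
  note ek = ek'(1, 2, 3, 5, 6, 8)
  have s: "s : carrier H" "counit H s = 0" using ET_facts[OF ET(1)] by auto
  have c [simp]: "T s : carrier H" "T k : carrier H" "V (D y) : carrier H" using ET s ek T_simps V_simps by auto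
  have "P \<otimes> V (D (s \<otimes> y)) = P \<otimes> (e \<otimes> V (D y) \<otimes> T s) \<oplus> P \<otimes> (s \<otimes> V (D y) \<otimes> T k)"
    using ET(2) s ek by (simp add: D_simps shift HH.T.l_distr V_simps r_distr)
  also have "P \<otimes> (e \<otimes> V (D y) \<otimes> T s) = (P \<otimes> V (D y)) \<otimes> T s"
    using ek(3,6) by (simp add: m_assoc[symmetric])
  also have "P \<otimes> (s \<otimes> V (D y) \<otimes> T k) = s \<otimes> (P \<otimes> V (D y)) \<otimes> T k"
    using s by (simp add: P_move)
  finally have "P \<otimes> V (D (s \<otimes> y)) = counit H y \<odot> (P \<otimes> T s \<oplus> s \<otimes> P \<otimes> T k)"
    using ET(3) s by (simp add: smult_add_right)
  also have "P \<otimes> T s \<oplus> s \<otimes> P \<otimes> T k = \<zero>"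
    using ek s by (simp add: P_central[of s, symmetric] m_assoc smult_minus_left r_minus l_neg)
  finally show ?case using ET(2) s by simp
next
  case (FT s y)
  obtain e k where ek: "FT_split s e k" by (rule FTE[OF FT(1)])
  note ek' = FT_splitD[OF ek]
  note ek = ek'(1, 2, 3, 5, 6, 7, 8)
  have s: "s : carrier H" "counit H s = 0" using FT_facts[OF FT(1)] by auto
  note G = GT_facts[OF ek(1)]
  have c [simp]: "T s : carrier H" "T k : carrier H" "V (D y) : carrier H" using FT s ek T_simps V_simps by auto
  have "P \<otimes> V (D (s \<otimes> y)) = P \<otimes> (s \<otimes> V (D y) \<otimes> e) \<oplus> P \<otimes> (k \<otimes> V (D y) \<otimes> T s)"
    using FT(2) s ek by (simp add: D_simps shift HH.T.l_distr V_simps r_distr)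
  also have "P \<otimes> (s \<otimes> V (D y) \<otimes> e) = s \<otimes> (P \<otimes> V (D y)) \<otimes> e"
    using ek s by (simp add: P_move)
  also have "P \<otimes> (k \<otimes> V (D y) \<otimes> T s) = k \<otimes> (P \<otimes> V (D y)) \<otimes> T s"
    using ek(2) by (simp add: P_move)
  finally have "P \<otimes> V (D (s \<otimes> y)) = counit H y \<odot> (s \<otimes> P \<otimes> e \<oplus> k \<otimes> P \<otimes> T s)"
    using FT(3) s ek by (simp add: smult_add_right)
  also have "k \<otimes> P \<otimes> T s = (- 1) \<odot> (P \<otimes> s)"
    using ek s G by (simp add: m_assoc[symmetric])
  also have "s \<otimes> P \<otimes> e \<oplus> (- 1) \<odot> (P \<otimes> s) = \<zero>"
    using ek s by (simp add: P_central m_assoc smult_minus_left r_neg)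
  finally show ?case using FT(2) s by simp
qed

text \<open>In T * id the legs of a new generator s meet in the middle as T(s_1) s_2, so the
  induction needs a slot \<open>c\<close> between the two legs of what precedes.\<close>

definition M where "M c t = tensor_extend H (%x y. T x \<otimes> c \<otimes> y) t"

lemma bM: "c : carrier H ==> bilinear_map H H H (%x y. T x \<otimes> c \<otimes> y)"
  by (rule bilinear_mult[OF linear_mapI linear_map_id]) (simp_all add: T_simps l_distr)

lemma M_linear: "t : carrier HH.T ==> linear_map H H (%c. M c t)"
  unfolding M_def
  by (rule HH.tensor_extend_param[OF kmod_axioms bM _ kmod_axioms])
    (auto intro!: linear_mapI simp: T_simps l_distr r_distr)

lemma M_one: "t : carrier HH.T ==> M \<one> t = V' t"
  unfolding M_def V'_def by (rule te_cong[OF bV']) (simp_all add: T_simps)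

lemma P_M:
  assumes c: "c : carrier H" and t: "t : carrier HH.T"
  shows "P \<otimes> M c t = M (P \<otimes> c) t"
proof -
  have "P \<otimes> M c t = tensor_extend H (%x y. P \<otimes> (T x \<otimes> c \<otimes> y)) t"
    unfolding M_def by (rule te_compose[OF bM mult_linear(2) t]) (use c in auto)
  also have "... = M (P \<otimes> c) t"
    unfolding M_def by (rule te_cong[OF bM _ t]) (use c in "simp_all add: P_move T_simps")
  finally show ?thesis .
qed

lemma P_M_zero: "c : carrier H ==> t : carrier HH.T ==> P \<otimes> c = \<zero> ==> P \<otimes> M c t = \<zero>"
  using linear_map_zero[OF kmod_axioms kmod_axioms M_linear] by (simp add: P_M)

lemma V'_shift: "a : carrier H ==> b : carrier H ==> t : carrier HH.T ==>
    V' (HH.tn a b \<otimes>\<^bsub>HH.T\<^esub> t) = M (T a \<otimes> b) t"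
  by (simp add: shift M_def)

lemma P_V': "x : carrier H ==> P \<otimes> V' (D x) = counit H x \<odot> P"
proof (induction rule: induct)
  case one
  then show ?case unfolding D_one V'_def by (simp add: te_tensor[OF bV'] T_simps)
next
  case (add x y)
  then show ?case by (simp add: D_simps V'_simps r_distr smult_add_left)
next
  case (smult c x)
  then show ?case by (simp add: D_simps V'_simps)
next
  case (GT s y)
  note G = GT_facts[OF GT(1)]
  have "P \<otimes> V' (D (s \<otimes> y)) = P \<otimes> M P (D y)"
    using GT(2) G by (simp add: D_simps V'_shift)
  also have "... = P \<otimes> M \<one> (D y)"
    using GT(2) by (simp add: P_M PP)
  finally show ?case using GT G by (simp add: M_one)
next
  case (ET s y)
  obtain e k where ek: "ET_split s e k" by (rule ETE[OF ET(1)])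
  note ek' = ET_splitD[OF ek]
  note ek = ek'(1, 2, 3, 5, 6, 7, 8)
  have s: "s : carrier H" "counit H s = 0" using ET_facts[OF ET(1)] by auto
  note G = GT_facts[OF ek(1)]
  have c [simp]: "T s : carrier H" "T k : carrier H" using s ek T_simps by auto
  have "V' (D (s \<otimes> y)) = M (e \<otimes> s) (D y) \<oplus> M (T s \<otimes> k) (D y)"
    using ET(2) s ek(2,3,5,6) by (simp add: D_simps V'_shift HH.T.l_distr V'_simps)
  also have "... = M (e \<otimes> s \<oplus> T s \<otimes> k) (D y)"
    using ET(2) s ek(2,3) linear_mapD(2)[OF M_linear] by simp
  finally have 1: "V' (D (s \<otimes> y)) = M (e \<otimes> s \<oplus> T s \<otimes> k) (D y)" .
  have "T s \<otimes> k = (- 1) \<odot> (P \<otimes> s)" using s ek G by (simp add: m_assoc P_central)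
  then have "P \<otimes> (T s \<otimes> k) = (- 1) \<odot> (P \<otimes> s)" using s PP by (simp add: m_assoc[symmetric])
  moreover have "P \<otimes> (e \<otimes> s) = P \<otimes> s" using s ek by (simp add: m_assoc[symmetric])
  ultimately have "P \<otimes> (e \<otimes> s \<oplus> T s \<otimes> k) = \<zero>"
    using s ek(2,3) by (simp add: r_distr smult_minus_left r_neg)
  then show ?case
    unfolding 1 using ET(2) s ek(2,3) by (simp add: P_M_zero)
next
  case (FT s y)
  obtain e k where ek: "FT_split s e k" by (rule FTE[OF FT(1)])
  note ek' = FT_splitD[OF ek]
  note ek = ek'(1, 2, 3, 5, 6, 9)
  have s: "s : carrier H" "counit H s = 0" using FT_facts[OF FT(1)] by auto
  have c [simp]: "T s : carrier H" "T k : carrier H" using s ek T_simps by auto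
  have "V' (D (s \<otimes> y)) = M (T s \<otimes> e) (D y) \<oplus> M (T k \<otimes> s) (D y)"
    using FT(2) s ek(2,3,5) by (simp add: D_simps V'_shift HH.T.l_distr V'_simps)
  also have "... = M (T s \<otimes> e \<oplus> T k \<otimes> s) (D y)"
    using FT(2) s ek(2,3) linear_mapD(2)[OF M_linear] by simp
  finally have 1: "V' (D (s \<otimes> y)) = M (T s \<otimes> e \<oplus> T k \<otimes> s) (D y)" .
  have "P \<otimes> (T s \<otimes> e) = T s \<otimes> P"
    using ek s by (simp add: P_central m_assoc del: ek(4))
  also have "... = (- 1) \<odot> (P \<otimes> (T k \<otimes> s))"
    using ek s by (simp add: P_central)
  finally have "P \<otimes> (T s \<otimes> e \<oplus> T k \<otimes> s) = \<zero>"
    using s ek(2,3) by (simp add: r_distr smult_minus_left l_neg)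
  then show ?case
    unfolding 1 using FT(2) s ek(2,3) by (simp add: P_M_zero)
qed

lemma Q_zero: "x : carrier H ==> y : carrier H ==> x \<otimes> P = x ==> Q \<otimes> (x \<otimes> y) = \<zero>"
  using QP[of x] by (simp add: m_assoc[symmetric])

lemma L_GT: "s : GT ==> y : carrier H ==> L (D (s \<otimes> y)) = \<zero>"
  using GT[of s] by (simp add: D_simps shift L_simps)

lemma L_ET:
  assumes "s : ET" "y : carrier H"
  shows "L (D (s \<otimes> y)) = \<zero>"
  by (rule ETE[OF assms(1)])
    (use assms(2) ET(1,3)[OF assms(1)] in "simp add: D_simps shift L_simps HH.T.l_distr GT ET_split_def")

lemma R_GT: "s : GT ==> y : carrier H ==> R (D (s \<otimes> y)) = \<zero>"
  using GT[of s] by (simp add: D_simps shift R_simps)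

lemma R_FT:
  assumes "s : FT" "y : carrier H"
  shows "R (D (s \<otimes> y)) = \<zero>"
  by (rule FTE[OF assms(1)])
    (use assms(2) FT(1,3)[OF assms(1)] in "simp add: D_simps shift R_simps HH.T.l_distr GT FT_split_def")

lemma L_FT:
  assumes "s : FT" "y : carrier H"
  shows "(s \<otimes> P = s & L (D (s \<otimes> y)) = \<zero>) | L (D (s \<otimes> y)) = s \<otimes> L (D y)"
proof -
  obtain e k where ek: "FT_split s e k" by (rule FTE[OF assms(1)])
  note ek' = FT_splitD[OF ek]
  note ek = ek'(1, 2, 3, 4, 6)
  have "L (D (s \<otimes> y)) = th e \<odot> (s \<otimes> L (D y))"
    using assms ek FT[of s] by (simp add: D_simps shift L_simps HH.T.l_distr)
  then show ?thesis using ek(4) assms FT(1)[of s] thP th_simps(2) L_simps(1) by auto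
qed

text \<open>Generators in \<open>GT\<close> and \<open>ET\<close> are killed by id * th, so
  \<open>L (D x)\<close> is a combination of products of elements of \<open>FT\<close>. After
  multiplication by Q these commute with \<open>ET\<close> by \<open>EF_Q\<close>.\<close>

lemma L_commute: "x : carrier H ==> s : ET ==> Q \<otimes> (L (D x) \<otimes> s) = Q \<otimes> (s \<otimes> L (D x))"
proof (induction rule: induct)
  case one
  then show ?case unfolding D_one L_def using ET(1) by (simp add: te_tensor[OF bL] th_simps)
next
  case (add x y)
  then show ?case using ET(1) by (simp add: D_simps L_simps l_distr r_distr)
next
  case (smult c x)
  then show ?case using ET(1) by (simp add: D_simps L_simps)
next
  case (GT x y)
  then show ?case using ET(1) by (simp add: L_GT)
next
  case (ET x y)
  then show ?case using ET_facts(1) by (simp add: L_ET)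
next
  case (FT x y)
  have [simp]: "s : carrier H" "x : carrier H" "L (D y) : carrier H"
    using FT ET(1) FT_facts(1) L_simps(1) by auto
  have "Q \<otimes> (x \<otimes> L (D y) \<otimes> s) = x \<otimes> (Q \<otimes> (L (D y) \<otimes> s))"
    by (simp add: m_assoc Q_swap)
  also have "... = x \<otimes> (Q \<otimes> (s \<otimes> L (D y)))" using FT by simp
  also have "... = (Q \<otimes> (x \<otimes> s)) \<otimes> L (D y)" by (simp add: m_assoc Q_swap)
  also have "... = (Q \<otimes> (s \<otimes> x)) \<otimes> L (D y)" by (simp only: EF_Q[folded Q_def, OF \<open>s : ET\<close> \<open>x : FT\<close>])
  finally have "Q \<otimes> (x \<otimes> L (D y) \<otimes> s) = Q \<otimes> (s \<otimes> (x \<otimes> L (D y)))" by (simp add: m_assoc)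
  then show ?case using L_FT[OF FT(1,2)] by auto
qed

text \<open>On \<open>D x\<close> this is the triple convolution id * th * id; \<open>BB\<close> is
  th * id * th.\<close>

definition AA where "AA = tensor_extend H (%x y. L (D x) \<otimes> y)"
definition BB where "BB = tensor_extend H (%x y. th y \<odot> R (D x))"

lemma LD_linear: "linear_map H H (%x. L (D x))" and RD_linear: "linear_map H H (%x. R (D x))"
  by (auto intro!: linear_mapI simp: D_simps L_simps R_simps)

lemma bAA: "bilinear_map H H H (%x y. L (D x) \<otimes> y)"
  by (rule bilinear_mult[OF LD_linear linear_map_id])

lemma bBB: "bilinear_map H H H (%x y. th y \<odot> R (D x))"
  by (rule bilinear_map_compose[OF bL RD_linear linear_map_id linear_map_id])

lemmas AA_simps = linear_mapD[OF te_linear[OF bAA], folded AA_def]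
lemmas BB_simps = linear_mapD[OF te_linear[OF bBB], folded BB_def]

lemma AA_shift:
  assumes "a : carrier H" "b : carrier H" "t : carrier HH.T"
  shows "AA (HH.tn a b \<otimes>\<^bsub>HH.T\<^esub> t) = tensor_extend H (%x y. L (D (a \<otimes> x)) \<otimes> (b \<otimes> y)) t"
  unfolding AA_def by (rule te_shift[OF bAA]) (use assms in auto)

lemma BB_shift:
  assumes "a : carrier H" "b : carrier H" "t : carrier HH.T"
  shows "BB (HH.tn a b \<otimes>\<^bsub>HH.T\<^esub> t) = tensor_extend H (%x y. th (b \<otimes> y) \<odot> R (D (a \<otimes> x))) t"
  unfolding BB_def by (rule te_shift[OF bBB]) (use assms in auto)

lemma te_zero:
  assumes "!!x y. x : carrier H ==> y : carrier H ==> f x y = \<zero>" "t : carrier HH.T"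
  shows "tensor_extend H f t = \<zero>"
proof -
  have b: "bilinear_map H H H (%x y. \<zero>)" by (auto intro!: bilinear_mapI linear_mapI)
  have "tensor_extend H f t = tensor_extend H (%x y. \<zero>) t" by (rule te_cong[OF b _ assms(2)]) (simp add: assms(1))
  also have "... = \<zero>"
    by (rule HH.tensor_extend_unique[OF kmod_axioms b _ _ assms(2)]) (auto intro!: linear_mapI)
  finally show ?thesis .
qed

text \<open>A factor from \<open>GT\<close>, or one of type zero, makes both sides vanish, since Q
  kills elements fixed by P. A remaining factor from \<open>FT\<close> comes out on the left
  directly; one from \<open>ET\<close> appears behind \<open>L (D x)\<close> and is moved forward by
  \<open>L_commute\<close>.\<close>

lemma Q_AA: "x : carrier H ==> Q \<otimes> AA (D x) = Q \<otimes> x"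
proof (induction rule: induct)
  case one
  have "L (HH.tn \<one> \<one>) = \<one>" unfolding L_def by (simp add: te_tensor[OF bL] th_simps)
  then show ?case unfolding D_one AA_def by (simp add: te_tensor[OF bAA] D_one)
next
  case (add x y)
  then show ?case by (simp add: D_simps AA_simps r_distr)
next
  case (smult c x)
  then show ?case by (simp add: D_simps AA_simps)
next
  case (GT s y)
  note G = GT_facts[OF GT(1)]
  have "AA (D (s \<otimes> y)) = \<zero>"
    using GT(1,2) G by (simp add: D_simps AA_shift) (rule te_zero; simp add: L_GT)
  then show ?case using Q_zero GT(2) G by simp
next
  case (ET s y)
  obtain e k where ek: "ET_split s e k" by (rule ETE[OF ET(1)])
  note ek' = ET_splitD[OF ek]
  note ek = ek'(1, 2, 3, 4, 6)
  have s [simp]: "s : carrier H" using ET_facts[OF ET(1)] by auto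
  have d [simp]: "D y : carrier HH.T" using ET by simp
  have "AA (D (s \<otimes> y)) = AA (HH.tn e s \<otimes>\<^bsub>HH.T\<^esub> D y) \<oplus> AA (HH.tn s k \<otimes>\<^bsub>HH.T\<^esub> D y)"
    using ET(2) ek by (simp add: D_simps HH.T.l_distr AA_simps)
  also have "AA (HH.tn s k \<otimes>\<^bsub>HH.T\<^esub> D y) = \<zero>"
    using ek(2) ET(1) by (simp add: AA_shift) (rule te_zero; simp add: L_ET)
  finally have 1: "AA (D (s \<otimes> y)) = AA (HH.tn e s \<otimes>\<^bsub>HH.T\<^esub> D y)" using ek by (simp add: AA_simps)
  show ?case
    using ek(4)
  proof
    assume e: "e = P & s \<otimes> P = s"
    then have "AA (D (s \<otimes> y)) = \<zero>"
      unfolding 1 using P_in by (simp add: AA_shift) (rule te_zero; simp add: L_GT)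
    then show ?thesis using Q_zero ET(2) e by simp
  next
    assume e: "e = \<one>"
    have bs: "bilinear_map H H H (%x y. L (D x) \<otimes> (s \<otimes> y))"
      by (rule bilinear_mult[OF LD_linear mult_linear(2)]) simp
    have "Q \<otimes> AA (D (s \<otimes> y)) = Q \<otimes> tensor_extend H (%x y. L (D x) \<otimes> (s \<otimes> y)) (D y)"
      unfolding 1 e AA_shift[OF one_closed s d]
      by (rule arg_cong[where f = "%z. Q \<otimes> z"], rule te_cong[OF bs _ d]) simp
    also have "... = tensor_extend H (%x y. Q \<otimes> (L (D x) \<otimes> (s \<otimes> y))) (D y)"
      by (rule te_compose[OF bs mult_linear(2) d]) simp
    also have "... = tensor_extend H (%x y. 1 \<odot> ((Q \<otimes> s) \<otimes> (L (D x) \<otimes> y))) (D y)"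
    proof (rule te_cong[OF bilinear_map_post[OF bAA mult_linear(3)] _ d])
      fix x z assume xz: "x : carrier H" "z : carrier H"
      then have l [simp]: "L (D x) : carrier H" by (simp add: L_simps)
      have "Q \<otimes> (L (D x) \<otimes> (s \<otimes> z)) = (Q \<otimes> (L (D x) \<otimes> s)) \<otimes> z" using xz by (simp add: m_assoc)
      also have "... = (Q \<otimes> (s \<otimes> L (D x))) \<otimes> z" using L_commute[OF xz(1) ET(1)] by simp
      finally show "Q \<otimes> (L (D x) \<otimes> (s \<otimes> z)) = 1 \<odot> ((Q \<otimes> s) \<otimes> (L (D x) \<otimes> z))" using xz by (simp add: m_assoc)
    qed simp
    also have "... = 1 \<odot> ((Q \<otimes> s) \<otimes> AA (D y))"
      unfolding AA_def by (rule te_compose[OF bAA mult_linear(3) d, symmetric]) simp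
    also have "... = s \<otimes> (Q \<otimes> AA (D y))" by (simp add: AA_simps Q_central m_assoc)
    also have "... = Q \<otimes> (s \<otimes> y)" using ET(2,3) by (simp add: Q_swap)
    finally show ?thesis .
  qed
next
  case (FT s y)
  obtain e k where ek: "FT_split s e k" by (rule FTE[OF FT(1)])
  note ek' = FT_splitD[OF ek]
  note ek = ek'(1, 2, 3, 4, 6)
  have s [simp]: "s : carrier H" and s0: "th s = 0" using FT_facts[OF FT(1)] by auto
  have d [simp]: "D y : carrier HH.T" using FT by simp
  have "AA (D (s \<otimes> y)) = AA (HH.tn s e \<otimes>\<^bsub>HH.T\<^esub> D y) \<oplus> AA (HH.tn k s \<otimes>\<^bsub>HH.T\<^esub> D y)"
    using FT(2) ek by (simp add: D_simps HH.T.l_distr AA_simps)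
  also have "AA (HH.tn k s \<otimes>\<^bsub>HH.T\<^esub> D y) = \<zero>"
    using ek(1,2) by (simp add: AA_shift) (rule te_zero; simp add: L_GT)
  finally have 1: "AA (D (s \<otimes> y)) = AA (HH.tn s e \<otimes>\<^bsub>HH.T\<^esub> D y)" using ek by (simp add: AA_simps)
  have Ls: "L (D (s \<otimes> x)) = th e \<odot> (s \<otimes> L (D x))" if "x : carrier H" for x
    using that ek s0 by (simp add: D_simps shift L_simps HH.T.l_distr)
  show ?case
    using ek(4)
  proof
    assume e: "e = P & s \<otimes> P = s"
    then have "AA (D (s \<otimes> y)) = \<zero>"
      unfolding 1 by (simp add: AA_shift) (rule te_zero; simp add: Ls thP L_simps)
    then show ?thesis using Q_zero FT(2) e by simp
  next
    assume e: "e = \<one>"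
    have "AA (D (s \<otimes> y)) = tensor_extend H (%x y. 1 \<odot> (s \<otimes> (L (D x) \<otimes> y))) (D y)"
      unfolding 1 e AA_shift[OF s one_closed d]
      by (rule te_cong[OF bilinear_map_post[OF bAA mult_linear(3)] _ d])
        (simp_all add: Ls e th_simps L_simps m_assoc)
    also have "... = 1 \<odot> (s \<otimes> AA (D y))"
      unfolding AA_def by (rule te_compose[OF bAA mult_linear(3) d, symmetric]) simp
    finally have "Q \<otimes> AA (D (s \<otimes> y)) = s \<otimes> (Q \<otimes> AA (D y))"
      by (simp add: AA_simps Q_central m_assoc)
    also have "... = Q \<otimes> (s \<otimes> y)" using FT(2,3) by (simp add: Q_swap)
    finally show ?thesis .
  qed
qed

text \<open>In each summand of the coproduct of a generator some leg is annihilated by th, either in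
  the last factor or inside \<open>R\<close>, so only the constant part survives.\<close>

lemma Q_BB: "x : carrier H ==> BB (D x) = th x \<odot> \<one>"
proof (induction rule: induct)
  case one
  have "R (HH.tn \<one> \<one>) = \<one>" unfolding R_def by (simp add: te_tensor[OF bR] th_simps)
  then show ?case unfolding D_one BB_def by (simp add: te_tensor[OF bBB] D_one th_simps)
next
  case (add x y)
  then show ?case by (simp add: D_simps BB_simps th_simps smult_add_left)
next
  case (smult c x)
  then show ?case by (simp add: D_simps BB_simps th_simps)
next
  case (GT s y)
  note G = GT_facts[OF GT(1)]
  have "BB (D (s \<otimes> y)) = \<zero>"
    using GT(1,2) G by (simp add: D_simps BB_shift) (rule te_zero; simp add: R_GT)
  then show ?case using GT(2) G by (simp add: th_simps)
next
  case (ET s y)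
  obtain e k where ek: "ET_split s e k" by (rule ETE[OF ET(1)])
  note ek' = ET_splitD[OF ek]
  note ek = ek'(1, 2, 3, 6)
  have s [simp]: "s : carrier H" and s0: "th s = 0" using ET_facts[OF ET(1)] by auto
  have d [simp]: "D y : carrier HH.T" using ET by simp
  have "BB (D (s \<otimes> y)) = BB (HH.tn e s \<otimes>\<^bsub>HH.T\<^esub> D y) \<oplus> BB (HH.tn s k \<otimes>\<^bsub>HH.T\<^esub> D y)"
    using ET(2) ek by (simp add: D_simps HH.T.l_distr BB_simps)
  also have "BB (HH.tn e s \<otimes>\<^bsub>HH.T\<^esub> D y) = \<zero>"
    using ek(3) by (simp add: BB_shift) (rule te_zero; use ek(3) in "simp add: th_simps s0 R_simps")
  also have "BB (HH.tn s k \<otimes>\<^bsub>HH.T\<^esub> D y) = \<zero>"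
    using ek(2) GT(7)[OF ek(1)] by (simp add: BB_shift) (rule te_zero; use ek(2) in "simp add: th_simps R_simps")
  finally show ?case using ET(2) s0 by (simp add: th_simps)
next
  case (FT s y)
  obtain e k where ek: "FT_split s e k" by (rule FTE[OF FT(1)])
  note ek' = FT_splitD[OF ek]
  note ek = ek'(1, 2, 3, 6)
  have s [simp]: "s : carrier H" and s0: "th s = 0" using FT_facts[OF FT(1)] by auto
  have d [simp]: "D y : carrier HH.T" using FT by simp
  have "BB (D (s \<otimes> y)) = BB (HH.tn s e \<otimes>\<^bsub>HH.T\<^esub> D y) \<oplus> BB (HH.tn k s \<otimes>\<^bsub>HH.T\<^esub> D y)"
    using FT(2) ek by (simp add: D_simps HH.T.l_distr BB_simps)
  also have "BB (HH.tn s e \<otimes>\<^bsub>HH.T\<^esub> D y) = \<zero>"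
    using ek(3) FT(1) by (simp add: BB_shift) (rule te_zero; simp add: R_FT)
  also have "BB (HH.tn k s \<otimes>\<^bsub>HH.T\<^esub> D y) = \<zero>"
    using ek(1,2) by (simp add: BB_shift) (rule te_zero; simp add: R_GT)
  finally show ?case using FT(2) s0 by (simp add: th_simps)
qed

lemma VD_linear: "linear_map H H (%x. V (D x))" and V'D_linear: "linear_map H H (%x. V' (D x))"
  by (auto intro!: linear_mapI simp: D_simps V_simps V'_simps)

lemma Q_V: "x : carrier H ==> Q \<otimes> V (D x) = Q \<otimes> L (D x)"
proof -
  assume x: "x : carrier H"
  then have d: "D x : carrier HH.T" by simp
  have "Q \<otimes> V (D x) = tensor_extend H (%x y. Q \<otimes> (x \<otimes> T y)) (D x)"
    unfolding V_def by (rule te_compose[OF bV mult_linear(2) d]) simp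
  also have "... = tensor_extend H (%x y. Q \<otimes> (th y \<odot> x)) (D x)"
  proof (rule te_cong[OF bilinear_map_post[OF bL mult_linear(2)] _ d])
    fix x y assume xy: "x : carrier H" "y : carrier H"
    then have [simp]: "T y : carrier H" by (simp add: T_simps)
    have "Q \<otimes> (x \<otimes> T y) = x \<otimes> (Q \<otimes> T y)" using xy by (simp add: Q_swap)
    then show "Q \<otimes> (x \<otimes> T y) = Q \<otimes> (th y \<odot> x)" using xy QT[OF xy(2), folded Q_def] by (simp add: Q_central)
  qed simp
  also have "... = Q \<otimes> L (D x)"
    unfolding L_def by (rule te_compose[OF bL mult_linear(2) d, symmetric]) simp
  finally show ?thesis .
qed

lemma Q_V': "x : carrier H ==> Q \<otimes> V' (D x) = Q \<otimes> R (D x)"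
proof -
  assume x: "x : carrier H"
  then have d: "D x : carrier HH.T" by simp
  have "Q \<otimes> V' (D x) = tensor_extend H (%x y. Q \<otimes> (T x \<otimes> y)) (D x)"
    unfolding V'_def by (rule te_compose[OF bV' mult_linear(2) d]) simp
  also have "... = tensor_extend H (%x y. Q \<otimes> (th x \<odot> y)) (D x)"
  proof (rule te_cong[OF bilinear_map_post[OF bR mult_linear(2)] _ d])
    fix x y assume xy: "x : carrier H" "y : carrier H"
    then have [simp]: "T x : carrier H" by (simp add: T_simps)
    have "Q \<otimes> (T x \<otimes> y) = (Q \<otimes> T x) \<otimes> y" using xy by (simp add: m_assoc)
    then show "Q \<otimes> (T x \<otimes> y) = Q \<otimes> (th x \<odot> y)" using xy QT[OF xy(1), folded Q_def] by simp
  qed simp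
  also have "... = Q \<otimes> R (D x)"
    unfolding R_def by (rule te_compose[OF bR mult_linear(2) d, symmetric]) simp
  finally show ?thesis .
qed

lemma bVV: "bilinear_map H H H (%x y. V (D x) \<otimes> y)"
  by (rule bilinear_mult[OF VD_linear linear_map_id])

lemma bVV': "bilinear_map H H H (%x y. V' (D x) \<otimes> T y)"
  by (rule bilinear_mult[OF V'D_linear T_linear])

text \<open>An element is the sum of its multiples by P and by Q. On the P part id * T is the
  counit, so the counit axiom applies; on the Q part T may be replaced by th, and
  \<open>Q_AA\<close> applies.\<close>

lemma id_T_id:
  assumes x: "x : carrier H"
  shows "tensor_extend H (%x y. V (D x) \<otimes> y) (D x) = x"
proof -
  let ?A = "tensor_extend H (%x y. V (D x) \<otimes> y) (D x)"
  have d: "D x : carrier HH.T" using x by simp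
  have A: "?A : carrier H" by (rule te_closed[OF bVV d])
  have be: "bilinear_map H H H (%x y. counit H x \<odot> y)"
    by (auto intro!: bilinear_mapI linear_mapI simp: smult_add_left smult_add_right mult.commute)
  have "P \<otimes> ?A = tensor_extend H (%x y. P \<otimes> (V (D x) \<otimes> y)) (D x)"
    by (rule te_compose[OF bVV mult_linear(2) d]) simp
  also have "... = tensor_extend H (%x y. P \<otimes> (counit H x \<odot> y)) (D x)"
  proof (rule te_cong[OF bilinear_map_post[OF be mult_linear(2)] _ d])
    fix x y assume xy: "x : carrier H" "y : carrier H"
    then have "P \<otimes> (V (D x) \<otimes> y) = (P \<otimes> V (D x)) \<otimes> y" by (simp add: m_assoc V_simps)
    then show "P \<otimes> (V (D x) \<otimes> y) = P \<otimes> (counit H x \<odot> y)" using xy by (simp add: P_V)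
  qed simp
  also have "... = P \<otimes> tensor_extend H (%x y. counit H x \<odot> y) (D x)"
    by (rule te_compose[OF be mult_linear(2) d, symmetric]) simp
  also have "... = P \<otimes> x" using counit_left[OF x] by simp
  finally have 1: "P \<otimes> ?A = P \<otimes> x" .
  have "Q \<otimes> ?A = tensor_extend H (%x y. Q \<otimes> (V (D x) \<otimes> y)) (D x)"
    by (rule te_compose[OF bVV mult_linear(2) d]) simp
  also have "... = tensor_extend H (%x y. Q \<otimes> (L (D x) \<otimes> y)) (D x)"
  proof (rule te_cong[OF bilinear_map_post[OF bAA mult_linear(2)] _ d])
    fix x y assume xy: "x : carrier H" "y : carrier H"
    then have "Q \<otimes> (V (D x) \<otimes> y) = (Q \<otimes> V (D x)) \<otimes> y" by (simp add: m_assoc V_simps)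
    then show "Q \<otimes> (V (D x) \<otimes> y) = Q \<otimes> (L (D x) \<otimes> y)" using xy by (simp add: Q_V m_assoc L_simps)
  qed simp
  also have "... = Q \<otimes> AA (D x)"
    unfolding AA_def by (rule te_compose[OF bAA mult_linear(2) d, symmetric]) simp
  finally have 2: "Q \<otimes> ?A = Q \<otimes> x" using Q_AA[OF x] by simp
  show ?thesis using PQ_sum[OF A] PQ_sum[OF x] 1 2 by simp
qed

text \<open>The P part follows from T * id being the counit there. On the Q part the convolution
  becomes th * id * th, whose value th(x) Q is again Q T(x).\<close>

lemma T_id_T:
  assumes x: "x : carrier H"
  shows "tensor_extend H (%x y. V' (D x) \<otimes> T y) (D x) = T x"
proof -
  let ?A = "tensor_extend H (%x y. V' (D x) \<otimes> T y) (D x)"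
  have d: "D x : carrier HH.T" using x by simp
  have A: "?A : carrier H" by (rule te_closed[OF bVV' d])
  have Tx: "T x : carrier H" using x T_simps by simp
  have be: "bilinear_map H H H (%x y. counit H x \<odot> y)"
    by (auto intro!: bilinear_mapI linear_mapI simp: smult_add_left smult_add_right mult.commute)
  have PT: "linear_map H H (%x. P \<otimes> T x)"
    using linear_map_comp[OF T_linear mult_linear(2)[of P]] by simp
  have "P \<otimes> ?A = tensor_extend H (%x y. P \<otimes> (V' (D x) \<otimes> T y)) (D x)"
    by (rule te_compose[OF bVV' mult_linear(2) d]) simp
  also have "... = tensor_extend H (%x y. P \<otimes> T (counit H x \<odot> y)) (D x)"
  proof (rule te_cong[OF bilinear_map_post[OF be PT] _ d])
    fix x y assume xy: "x : carrier H" "y : carrier H"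
    then have [simp]: "T y : carrier H" by (simp add: T_simps)
    have "P \<otimes> (V' (D x) \<otimes> T y) = (P \<otimes> V' (D x)) \<otimes> T y" using xy by (simp add: m_assoc V'_simps)
    then show "P \<otimes> (V' (D x) \<otimes> T y) = P \<otimes> T (counit H x \<odot> y)" using xy by (simp add: P_V' T_simps)
  qed
  also have "... = P \<otimes> T (tensor_extend H (%x y. counit H x \<odot> y) (D x))"
    by (rule te_compose[OF be PT d, symmetric])
  also have "... = P \<otimes> T x" using counit_left[OF x] by simp
  finally have 1: "P \<otimes> ?A = P \<otimes> T x" .
  have "Q \<otimes> ?A = tensor_extend H (%x y. Q \<otimes> (V' (D x) \<otimes> T y)) (D x)"
    by (rule te_compose[OF bVV' mult_linear(2) d]) simp
  also have "... = tensor_extend H (%x y. Q \<otimes> (th y \<odot> R (D x))) (D x)"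
  proof (rule te_cong[OF bilinear_map_post[OF bBB mult_linear(2)] _ d])
    fix x y assume xy: "x : carrier H" "y : carrier H"
    then have [simp]: "T y : carrier H" "V' (D x) : carrier H" "R (D x) : carrier H"
      by (simp_all add: T_simps V'_simps R_simps)
    have "Q \<otimes> (V' (D x) \<otimes> T y) = V' (D x) \<otimes> (Q \<otimes> T y)" by (simp add: Q_swap)
    also have "... = th y \<odot> (Q \<otimes> V' (D x))" using QT[OF xy(2), folded Q_def] by (simp add: Q_central)
    finally show "Q \<otimes> (V' (D x) \<otimes> T y) = Q \<otimes> (th y \<odot> R (D x))" using xy by (simp add: Q_V')
  qed simp
  also have "... = Q \<otimes> BB (D x)"
    unfolding BB_def by (rule te_compose[OF bBB mult_linear(2) d, symmetric]) simp
  also have "... = Q \<otimes> T x" using Q_BB[OF x] QT[OF x, folded Q_def] by simp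
  finally have 2: "Q \<otimes> ?A = Q \<otimes> T x" .
  show ?thesis using PQ_sum[OF A] PQ_sum[OF Tx] unfolding 1 2 by (rule subst)
qed

lemma convolution_V: "convolution H id T = (%x. V (D x))" "convolution H T id = (%x. V' (D x))"
  by (simp_all add: fun_eq_iff convolution_def V_def V'_def)

theorem is_weak_hopf: "is_weak_hopf_algebra H T"
  unfolding is_weak_hopf_algebra_def
proof (intro conjI ballI is_bialg T_antihom)
  fix x assume x: "x : carrier H"
  show "convolution H (convolution H id T) id x = x"
    unfolding convolution_V unfolding convolution_def id_def by (rule id_T_id[OF x])
  show "convolution H (convolution H T id) T x = T x"
    unfolding convolution_V unfolding convolution_def by (rule T_id_T[OF x])
qed

lemma convolution_P:
  "x : carrier H ==> P \<otimes> convolution H T id x = counit H x \<odot> P"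
  "x : carrier H ==> P \<otimes> convolution H id T x = counit H x \<odot> P"
  unfolding convolution_V by (rule P_V' P_V; assumption)+

end

section \<open>The weak Hopf algebra \<open>U\<^sup>\<tau>\<close>\<close>

context cartan
begin

interpretation W: presented "w_gens I" wrels
  by (rule presented.intro) (rule wrels_closed)

interpretation M: w_model I a s q m \<kappa> \<kappa>' WA g by (rule w_model_W)

interpretation WW: tens WA WA ..

lemma HW_simps [simp]:
  "carrier HW = carrier WA" "\<one>\<^bsub>HW\<^esub> = \<one>\<^bsub>WA\<^esub>" "\<zero>\<^bsub>HW\<^esub> = \<zero>\<^bsub>WA\<^esub>"
  "x \<oplus>\<^bsub>HW\<^esub> y = x \<oplus>\<^bsub>WA\<^esub> y" "x \<otimes>\<^bsub>HW\<^esub> y = x \<cdot> y" "c \<odot>\<^bsub>HW\<^esub> x = c \<bullet> x"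
  "comult HW = \<Delta>" "counit HW = eps"
  by (simp_all add: HW_def)

lemma HW_tensor: "tensor_algebra HW HW = WW.T" "tensor HW HW = WW.tn"
  by (rule tensor_algebra_cong; simp add: HW_def)+

interpretation HW: bialg HW by (rule bialg.intro) (rule is_bialgebra_HW)

definition ugens where "ugens = w_toral I Un GE ` I Un GF ` I"
definition UC where "UC = generated_subalgebra HW (insert M.P (g ` ugens))"
definition U where "U = sub_bialgebra HW UC \<one>\<^bsub>WA\<^esub>"

lemma ugens_subset: "x : ugens ==> x : w_gens I"
  by (auto simp: ugens_def)

lemma Utau_eq: "Utau I a s q m \<kappa> \<kappa>' = U"
proof -
  have "(%x. w_class I a s q m \<kappa> \<kappa>' [x] 1) ` ugens = g ` ugens"
    by (rule image_cong) (auto simp: w_class_gen dest: ugens_subset)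
  then show ?thesis
    by (simp add: Utau_def wU_eq wP_eq U_def UC_def ugens_def)
qed

lemma ugens_sub: "insert M.P (g ` ugens) <= carrier HW"
  by (auto dest!: ugens_subset)

lemmas UC_closed = HW.generated_closed[OF ugens_sub, folded UC_def, simplified]

lemma UC_carrier: "x : UC ==> x : carrier WA" using UC_closed(1) by auto

lemma UC_induct [consumes 1, case_names one add smult mult]:
  assumes "x : UC" "R \<one>\<^bsub>WA\<^esub>"
    "!!x y. x : UC ==> y : UC ==> R x ==> R y ==> R (x \<oplus>\<^bsub>WA\<^esub> y)"
    "!!c x. x : UC ==> R x ==> R (c \<bullet> x)"
    "!!s y. s : insert M.P (g ` ugens) ==> y : UC ==> R y ==> R (s \<cdot> y)"
  shows "R x"
  using HW.generated_induct[OF ugens_sub, of x R, folded UC_def] assms by simp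

lemma UC_gens [simp]: "M.P : UC" "x : w_toral I ==> g x : UC" "i : I ==> g (GE i) : UC" "i : I ==> g (GF i) : UC"
  "M.e0 i : UC" "M.f0 i : UC"
  using UC_closed(2,3) by (auto simp: ugens_def M.e0_def M.f0_def)

interpretation SU: sub_bialg HW UC "\<one>\<^bsub>WA\<^esub>"
proof (unfold_locales, simp_all only: HW_simps HW_tensor)
  show "UC <= carrier WA" by (rule UC_closed(1))
  show "\<zero>\<^bsub>WA\<^esub> : UC" using UC_closed(6)[OF UC_closed(2), of 0] by simp
  show "\<Delta> \<one>\<^bsub>WA\<^esub> = WW.tn \<one>\<^bsub>WA\<^esub> \<one>\<^bsub>WA\<^esub>" using algebra_homD(2)[OF \<Delta>_hom] by (simp add: WW.one_T)
  show "eps \<one>\<^bsub>WA\<^esub> = 1" using algebra_homD(2)[OF eps_hom] by simp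
qed (use UC_closed UC_carrier in auto)

lemmas sub_bialg_UC = SU.sub_bialg_axioms

lemma SU_S: "sub_bialgebra HW UC \<one>\<^bsub>WA\<^esub> = U"
  by (simp add: U_def)

lemma U_comult_im: "x : UC ==> EX t:carrier (tensor_algebra U U). SU.emb t = comult HW x"
proof (rule SU.comult_image_generated[OF UC_def ugens_sub, unfolded SU_S])
  note ic = SU.emb_image_closed[unfolded SU_S HW_tensor]
  fix y assume "y : insert M.P (g ` ugens)"
  then consider "y = M.P" | x where "x : w_toral I" "y = g x" | i where "i : I" "y = g (GE i)" | i where "i : I" "y = g (GF i)"
    by (auto simp: ugens_def)
  then show "EX t:carrier (tensor_algebra U U). SU.emb t = comult HW y"
  proof cases
    case 1
    then show ?thesis using ic(4)[of M.P M.P] by (simp add: \<Delta>_P)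
  next
    case (2 x)
    then show ?thesis using ic(4)[of "g x" "g x"] by (simp add: \<Delta>_gen M.cop_toral)
  next
    case (3 i)
    have "EX t:carrier (tensor_algebra U U). SU.emb t = M.cop (GE i)"
      unfolding M.cop.simps by (intro ic(1,4)) (use 3 in auto)
    then show ?thesis using 3 by (simp add: \<Delta>_gen del: M.cop.simps)
  next
    case (4 i)
    have "EX t:carrier (tensor_algebra U U). SU.emb t = M.cop (GF i)"
      unfolding M.cop.simps by (intro ic(1,4)) (use 4 in auto)
    then show ?thesis using 4 by (simp add: \<Delta>_gen del: M.cop.simps)
  qed
qed simp_all

lemma is_bialgebra_U: "is_bialgebra U"
  using SU.is_bialgebra_S[unfolded SU_S, OF U_comult_im] .

lemma U_simps [simp]:
  "carrier U = UC" "\<one>\<^bsub>U\<^esub> = \<one>\<^bsub>WA\<^esub>" "\<zero>\<^bsub>U\<^esub> = \<zero>\<^bsub>WA\<^esub>"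
  "x \<oplus>\<^bsub>U\<^esub> y = x \<oplus>\<^bsub>WA\<^esub> y" "x \<otimes>\<^bsub>U\<^esub> y = x \<cdot> y" "c \<odot>\<^bsub>U\<^esub> x = c \<bullet> x" "counit U = eps"
  by (simp_all add: U_def)

lemma comult_U:
  "x : UC ==> t : carrier (tensor_algebra U U) ==> SU.emb t = \<Delta> x ==> comult U x = t"
  using SU.comult_S_eqI[unfolded SU_S, OF U_comult_im] by simp

interpretation U: bialg U by (rule bialg.intro) (rule is_bialgebra_U)

lemma comult_U_tensor:
  assumes "x : UC" "y : UC" "z : UC" "\<Delta> z = WW.tn x y"
  shows "comult U z = tensor U U x y"
  by (rule comult_U) (use assms SU.emb_tensor[unfolded SU_S HW_tensor] in auto)

lemma comult_U_add:
  assumes "x : UC" "y : UC" "x' : UC" "y' : UC" "z : UC" "\<Delta> z = WW.tn x y \<oplus>\<^bsub>WW.T\<^esub> WW.tn x' y'"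
  shows "comult U z = tensor U U x y \<oplus>\<^bsub>tensor_algebra U U\<^esub> tensor U U x' y'"
  by (rule comult_U)
    (use assms SU.emb_tensor[unfolded SU_S HW_tensor] linear_mapD(2)[OF SU.emb_linear[unfolded SU_S HW_tensor]] in auto)

text \<open>Stated for all scalars so that it covers T and its inverse in the type zero
  case.\<close>

lemma tau_UC:
  assumes r: "!!i. i : I ==> \<rho> i ~= 0" and h: "algebra_hom WA (opposite WA) h"
    and hg: "!!x. x : w_gens I ==> h (g x) = M.tau \<rho> x" and hP: "h M.P = M.P" and x: "x : UC"
  shows "h x : UC"
  using x
proof (induction rule: UC_induct)
  case (mult s y)
  note D = algebra_homD[OF h, simplified]
  have "h s : UC"
    using mult(1) by (auto simp: ugens_def hg hP intro!: UC_closed elim!: w_toral_cases)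
  then show ?case using mult ugens_sub by (auto simp: D subset_iff UC_closed UC_carrier)
qed (use algebra_homD[OF h, simplified] in "auto simp: UC_carrier UC_closed")

lemmas T_UC = tau_UC[OF _ T_hom T_gen T_P, simplified]

lemma U_antihom:
  assumes "algebra_hom WA (opposite WA) h" "!!x. x : UC ==> h x : UC"
  shows "algebra_hom U (opposite U) h"
  by (intro algebra_homI linear_mapI) (use assms algebra_homD[OF assms(1)] UC_carrier in auto)

definition QW where "QW = \<one>\<^bsub>WA\<^esub> \<oplus>\<^bsub>WA\<^esub> (- 1) \<bullet> M.P"

lemma QW_zero: "x : carrier WA ==> x \<cdot> M.P = x ==> M.P \<cdot> x = x ==> QW \<cdot> x = \<zero>\<^bsub>WA\<^esub>"
proof -
  assume x: "x : carrier WA" "x \<cdot> M.P = x" "M.P \<cdot> x = x"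
  have "QW \<cdot> x = x \<oplus>\<^bsub>WA\<^esub> (- 1) \<bullet> x" using x by (simp add: QW_def W.W.l_distr)
  then show ?thesis using x by (simp add: W.W.smult_minus_left W.W.r_neg)
qed

lemma QW_closed [simp]: "QW : carrier WA" by (simp add: QW_def)

text \<open>T sends every generator of U to an element with a toral factor; such elements are fixed
  by P and so killed by 1 - P.\<close>

lemma QW_T_gen:
  assumes "x : ugens"
  shows "QW \<cdot> T (g x) = \<zero>\<^bsub>WA\<^esub>"
proof -
  have "T (g x) : carrier WA" "T (g x) \<cdot> M.P = T (g x)" "M.P \<cdot> T (g x) = T (g x)"
    using assms
    by (auto simp: ugens_def T_gen M.EK_facts M.KF_facts M.P_EK M.toral_P M.P_toral elim!: w_toral_cases)
  then show ?thesis by (rule QW_zero)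
qed

lemma P_central_UC: "x : UC ==> M.P \<cdot> x = x \<cdot> M.P"
proof (induction rule: UC_induct)
  case (mult s y)
  have c: "s : carrier WA" "y : carrier WA" using mult ugens_sub UC_carrier by auto
  have s: "M.P \<cdot> s = s \<cdot> M.P" using mult(1) M.P_central ugens_subset by auto
  have "M.P \<cdot> (s \<cdot> y) = s \<cdot> (M.P \<cdot> y)"
    using c s by (simp add: W.W.m_assoc[symmetric])
  then show ?case using mult c by (simp add: W.W.m_assoc)
qed (use UC_carrier in "auto simp: W.W.l_distr W.W.r_distr")

lemma QW_T: "x : UC ==> QW \<cdot> T x = th x \<bullet> QW"
proof (induction rule: UC_induct)
  case one
  then show ?case using algebra_homD(2)[OF T_hom] algebra_homD(2)[OF th_hom] by simp
next
  case (add x y)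
  then show ?case
    using UC_carrier algebra_homD[OF T_hom] algebra_homD[OF th_hom]
    by (simp add: W.W.r_distr W.W.smult_add_left)
next
  case (smult c x)
  then show ?case
    using UC_carrier algebra_homD[OF T_hom] algebra_homD[OF th_hom] by simp
next
  case (mult s y)
  have c: "s : carrier WA" "y : carrier WA" using mult ugens_sub UC_carrier by auto
  have Tc: "T s : carrier WA" "T y : carrier WA" using c algebra_homD(3)[OF T_hom] by auto
  have t: "th s = 0" using mult(1) th_P th_gen ugens_subset by auto
  have Ts: "QW \<cdot> T s = \<zero>\<^bsub>WA\<^esub>"
    using mult(1) QW_T_gen T_P QW_zero[of M.P] by auto
  have "QW \<cdot> T (s \<cdot> y) = (QW \<cdot> T y) \<cdot> T s"
    using c Tc algebra_homD(4)[OF T_hom] by (simp add: W.W.m_assoc)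
  also have "... = th y \<bullet> (QW \<cdot> T s)" using mult(3) Tc by simp
  finally show ?case using Ts t c algebra_homD(4)[OF th_hom] by simp
qed

definition UG where "UG = insert M.P (g ` w_toral I)"

lemma UG_facts:
  assumes "x : UG"
  shows "x : UC" "comult U x = tensor U U x x" "eps x = 1" "x \<cdot> T x = M.P" "T x \<cdot> x = M.P"
    "x \<cdot> M.P = x" "th x = 0"
proof -
  show x: "x : UC" using assms by (auto simp: UG_def)
  have "\<Delta> x = WW.tn x x" using assms by (auto simp: UG_def \<Delta>_P \<Delta>_gen M.cop_toral)
  then show "comult U x = tensor U U x x" using x by (intro comult_U_tensor)
  show "eps x = 1" using assms by (auto simp: UG_def eps_P eps_gen elim!: w_toral_cases)
  show "th x = 0" using assms by (auto simp: UG_def th_P th_gen)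
  show "x \<cdot> M.P = x" using assms by (auto simp: UG_def M.toral_P)
  show "x \<cdot> T x = M.P" "T x \<cdot> x = M.P"
    using assms by (auto simp: UG_def T_P T_gen M.KKb elim!: w_toral_cases)
qed

lemma UC_alt: "UC = generated_subalgebra U (UG Un g ` GE ` I Un g ` GF ` I)"
proof -
  let ?G = "UG Un g ` GE ` I Un g ` GF ` I"
  have G: "?G = insert M.P (g ` ugens)" by (auto simp: UG_def ugens_def)
  have GU: "?G <= carrier U" using UC_closed(3) unfolding G by simp
  note c = U.generated_closed[OF GU, simplified]
  have "UC <= generated_subalgebra U ?G"
    unfolding UC_def
    by (rule HW.generated_minimal) (use c UC_carrier in "auto simp: G[symmetric]")
  then show ?thesis using c(1) by blast
qed

lemma weak_hopf_data_U: "weak_hopf_data U M.P T th UG (g ` GE ` I) (g ` GF ` I)"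
proof (intro weak_hopf_data.intro U.bialg_axioms weak_hopf_data_axioms.intro, simp_all only: U_simps)
  show "M.P : UG" by (simp add: UG_def)
  show "!!x. x : UC ==> M.P \<cdot> x = x \<cdot> M.P" by (rule P_central_UC)
  show "T M.P = M.P" by (rule T_P)
  show "algebra_hom U (opposite U) T" by (rule U_antihom[OF T_hom T_UC])
  show "algebra_hom U base_field th"
    by (intro algebra_homI linear_mapI) (use algebra_homD[OF th_hom] UC_carrier in auto)
  show "!!x. x : UC ==> (\<one>\<^bsub>WA\<^esub> \<oplus>\<^bsub>WA\<^esub> (- 1) \<bullet> M.P) \<cdot> T x = th x \<bullet> (\<one>\<^bsub>WA\<^esub> \<oplus>\<^bsub>WA\<^esub> (- 1) \<bullet> M.P)"
    using QW_T by (simp add: QW_def)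
  show "UC = generated_subalgebra U (UG Un g ` GE ` I Un g ` GF ` I)" by (rule UC_alt)
  fix x assume "x : g ` GE ` I"
  then obtain i where i: "i : I" "x = g (GE i)" by auto
  show "x : UC" "eps x = 0" "th x = 0" using i by (simp_all add: eps_gen th_gen)
  show "\<exists>e. EX k:UG. (e = \<one>\<^bsub>WA\<^esub> | e = M.P & x \<cdot> M.P = x) & T x = (- 1) \<bullet> (x \<cdot> T k) &
      comult U x = tensor U U e x \<oplus>\<^bsub>tensor_algebra U U\<^esub> tensor U U x k"
  proof (intro exI bexI conjI)
    show "comult U x = tensor U U (M.e0 i) x \<oplus>\<^bsub>tensor_algebra U U\<^esub> tensor U U x (g (GK i))"
      by (rule comult_U_add) (use i in "auto simp: \<Delta>_gen")
  qed (use i M.KE(4)[OF i(1,1)] in "auto simp: UG_def T_gen M.e0_def")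
  fix y assume "y : g ` GF ` I"
  then obtain j where j: "j : I" "y = g (GF j)" by auto
  \<comment> \<open>The commutator is zero or a multiple of K_i - Kb_i, and 1 - P kills both K_i and
    Kb_i.\<close>
  show "(\<one>\<^bsub>WA\<^esub> \<oplus>\<^bsub>WA\<^esub> (- 1) \<bullet> M.P) \<cdot> (x \<cdot> y) =
      (\<one>\<^bsub>WA\<^esub> \<oplus>\<^bsub>WA\<^esub> (- 1) \<bullet> M.P) \<cdot> (y \<cdot> x)"
    unfolding QW_def[symmetric] i(2) j(2) M.EF[OF i(1) j(1)]
    using i j QW_zero[of "g (GK j)"] QW_zero[of "g (GKb j)"]
    by (simp add: W.W.r_distr M.toral_P M.P_toral)
next
  fix x assume "x : g ` GF ` I"
  then obtain i where i: "i : I" "x = g (GF i)" by auto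
  show "x : UC" "eps x = 0" "th x = 0" using i by (simp_all add: eps_gen th_gen)
  show "\<exists>e. EX k:UG. (e = \<one>\<^bsub>WA\<^esub> | e = M.P & x \<cdot> M.P = x) & T x = (- 1) \<bullet> (T k \<cdot> x) &
      comult U x = tensor U U x e \<oplus>\<^bsub>tensor_algebra U U\<^esub> tensor U U k x"
  proof (intro exI bexI conjI)
    show "comult U x = tensor U U x (M.f0 i) \<oplus>\<^bsub>tensor_algebra U U\<^esub> tensor U U (g (GKb i)) x"
      by (rule comult_U_add) (use i in "auto simp: \<Delta>_gen")
  qed (use i M.KF(4)[OF i(1,1)] in "auto simp: UG_def T_gen M.f0_def")
qed (use UG_facts in auto)

theorem weak_hopf_U: "is_weak_hopf_algebra U T"
  by (rule weak_hopf_data.is_weak_hopf[OF weak_hopf_data_U])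

theorem not_hopf_U: "\<not> is_hopf_algebra U S"
proof
  assume S: "is_hopf_algebra U S"
  then have lin: "linear_map U U S" and "convolution U S id M.P = \<one>\<^bsub>WA\<^esub>"
    by (simp_all add: is_hopf_algebra_def eps_P)
  moreover have "convolution U S id M.P = S M.P \<cdot> M.P"
    unfolding convolution_def UG_facts(2)[of M.P, unfolded UG_def, simplified]
    using U.HH.tensor_extend_tensor[OF U.kmod_axioms U.bilinear_mult[OF lin linear_map_id], of M.P M.P] by simp
  ultimately have SP: "S M.P \<cdot> M.P = \<one>\<^bsub>WA\<^esub>" by simp
  have c: "S M.P : carrier WA" using linear_mapD(1)[OF lin, of M.P] UC_carrier by simp
  have "th (S M.P \<cdot> M.P) = 0" using c algebra_homD(4)[OF th_hom] th_P by simp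
  then show False using SP algebra_homD(2)[OF th_hom] by simp
qed

text \<open>Type zero gives E_i P = E_i and F_i P = F_i, so K_i E_i Kb_i and K_i F_i Kb_i are
  nonzero multiples of E_i and F_i. T can then be undone on generators by a rescaled
  antihomomorphism of the same shape.\<close>

theorem T_bij_U:
  assumes t0: "!!i. i : I ==> \<kappa> i = 0 & \<kappa>' i = 0"
  shows "bij_betw T UC UC"
proof -
  \<comment> \<open>T(E_i Kb_i) = - K_i E_i Kb_i = - q_i^(a_ii) E_i, so the scalar of the inverse on
    E_i has to be q_i^(-a_ii).\<close>
  define \<rho> where "\<rho> i = qi i powi (- a i i)" for i
  have r: "!!i. i : I ==> \<rho> i ~= 0" by (simp add: \<rho>_def)
  note S = Tl_hom[OF r] Tl_gen[OF r] Tl_P[OF r]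
  have ci: "f (h x) = x"
    if f: "algebra_hom WA (opposite WA) f" and h: "algebra_hom WA (opposite WA) h"
      and g: "!!x. x : w_gens I ==> f (h (g x)) = g x" and x: "x : carrier WA" for f h x
  proof (rule W.presented_hom_eqI[of WA "%x. f (h x)" "%x. x", OF W.W.is_kalgebra _ _ g x])
    show "algebra_hom WA WA (%x. f (h x))"
      by (intro algebra_homI linear_mapI) (use algebra_homD[OF f] algebra_homD[OF h] in auto)
    show "algebra_hom WA WA (%x. x)" by (rule algebra_homI[OF linear_map_id]) auto
  qed
  note t = algebra_homD[OF T_hom, simplified] and l = algebra_homD[OF Tl_hom[OF r], simplified]
  have KEK: "g (GK i) \<cdot> (g (GE i) \<cdot> g (GKb i)) = qi i powi a i i \<bullet> g (GE i)"
    "g (GK i) \<cdot> (g (GF i) \<cdot> g (GKb i)) = qi i powi (- a i i) \<bullet> g (GF i)" if i: "i : I" for i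
    using i W.W.mult_swap3[OF M.KE(1)[OF i i], of "g (GKb i)"] W.W.mult_swap3[OF M.KF(1)[OF i i], of "g (GKb i)"]
      t0[OF i] M.KE(4)[OF i i] M.KF(4)[OF i i] by (simp_all add: M.KKb)
  have inv: "inverse (\<rho> i) = qi i powi a i i" for i by (simp add: \<rho>_def power_int_minus)
  have TT: "T (Tl \<rho> (g x)) = g x" "Tl \<rho> (T (g x)) = g x" if "x : w_gens I" for x
    by (rule w_gen_cases[OF that];
      simp add: S T_gen t l KEK W.W.m_assoc inv; simp add: \<rho>_def power_int_minus)+
  show ?thesis
    by (rule bij_betw_byWitness[where f' = "Tl \<rho>"])
      (use ci[OF T_hom S(1) TT(1)] ci[OF S(1) T_hom TT(2)] UC_carrier T_UC tau_UC[OF r S] in auto)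
qed

end

section \<open>Endomorphism algebras of function modules\<close>

text \<open>Linear maps are normalised to vanish outside the carrier.\<close>

definition endo_algebra :: "('k::field, 'b, 'e) module_scheme => ('k, 'b => 'b) module" where
  "endo_algebra M =
     \<lparr>carrier = {h. linear_map M M h & (\<forall>x. x ~: carrier M --> h x = \<zero>\<^bsub>M\<^esub>)},
      monoid.mult = (%h h' x. h (h' x)),
      one = (%x. if x : carrier M then x else \<zero>\<^bsub>M\<^esub>),
      ring.zero = (%_. \<zero>\<^bsub>M\<^esub>),
      ring.add = (%h h' x. h x \<oplus>\<^bsub>M\<^esub> h' x),
      module.smult = (%c h x. c \<odot>\<^bsub>M\<^esub> h x)\<rparr>"

definition endo :: "('k::field, 'b, 'e) module_scheme => ('b => 'b) => 'b => 'b" where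
  "endo M h = (%x. if x : carrier M then h x else \<zero>\<^bsub>M\<^esub>)"

context kmod
begin

lemma endo_apply [simp]: "x : carrier M ==> endo M h x = h x"
  by (simp add: endo_def)

lemma endo_closed: "linear_map M M h ==> endo M h : carrier (endo_algebra M)"
  by (auto simp: endo_algebra_def endo_def linear_map_def)

lemma endo_eqI:
  assumes "h : carrier (endo_algebra M)" "h' : carrier (endo_algebra M)"
    "!!x. x : carrier M ==> h x = h' x"
  shows "h = h'"
proof
  show "h x = h' x" for x
    using assms by (cases "x : carrier M") (auto simp: endo_algebra_def)
qed

lemma endo_algebra_simps [simp]:
  "(h \<otimes>\<^bsub>endo_algebra M\<^esub> h') x = h (h' x)" "\<zero>\<^bsub>endo_algebra M\<^esub> x = \<zero>"
  "(h \<oplus>\<^bsub>endo_algebra M\<^esub> h') x = h x \<oplus> h' x" "(c \<odot>\<^bsub>endo_algebra M\<^esub> h) x = c \<odot> h x"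
  "x : carrier M ==> \<one>\<^bsub>endo_algebra M\<^esub> x = x"
  by (simp_all add: endo_algebra_def)

lemma endo_linear: "h : carrier (endo_algebra M) ==> linear_map M M h"
  by (simp add: endo_algebra_def)

lemma endo_maps [simp]: "h : carrier (endo_algebra M) ==> x : carrier M ==> h x : carrier M"
  using linear_mapD(1)[OF endo_linear] .

lemma kalgebra_endo: "kalgebra (endo_algebra M)"
proof -
  have z: "h \<zero> = \<zero>" if "linear_map M M h" for h by (rule linear_map_zero[OF kmod_axioms kmod_axioms that])
  have ext: "h x : carrier M" if "linear_map M M h & (\<forall>x. x ~: carrier M --> h x = \<zero>)" for h x
    using linear_mapD(1)[of M M h x] that by (cases "x : carrier M") auto
  note D = linear_mapD[of M M]
  have kmod: "kmod (endo_algebra M)"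
  proof (rule kmodI, goal_cases)
    case (1 h h')
    then show ?case
      by (simp add: endo_algebra_def, intro conjI linear_mapI allI impI)
        (simp_all add: D[of h] D[of h'] smult_add_right a_ac)
  next
    case (6 c h)
    then show ?case
      by (simp add: endo_algebra_def, intro conjI linear_mapI allI impI)
        (simp_all add: D[of h] smult_add_right mult.commute)
  next
    case 2
    show ?case by (simp add: endo_algebra_def) (rule linear_mapI; simp)
  qed (simp_all add: endo_algebra_def ext a_ac smult_add_left smult_add_right)
  show ?thesis
  proof (rule kalgebraI[OF kmod], goal_cases)
    case (1 h h')
    then show ?case
      by (simp add: endo_algebra_def, intro conjI linear_mapI allI impI)
        (simp_all add: D[of h] D[of h'] z)
  next
    case 2
    show ?case by (simp add: endo_algebra_def) (rule linear_mapI; simp)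
  next
    case (4 h)
    then show ?case by (simp add: endo_algebra_def ext)
  next
    case (5 h)
    then show ?case by (auto simp: endo_algebra_def z)
  next
    case (7 h h' h'')
    then show ?case by (simp add: endo_algebra_def D[of h''] ext)
  next
    case (9 c h h')
    then show ?case by (simp add: endo_algebra_def D[of h] ext)
  qed (simp_all add: endo_algebra_def)
qed

end

text \<open>The record type also carries ring fields; \<open>undefined\<close> fills them because
  only the module structure is wanted.\<close>

definition function_module ::
    "('k::field, 'b, 'e) module_scheme => ('x => 'b) set => ('k, 'x => 'b) module" where
  "function_module N C =
     \<lparr>carrier = C, monoid.mult = undefined, one = undefined, ring.zero = (%_. \<zero>\<^bsub>N\<^esub>),
      ring.add = (%f g x. f x \<oplus>\<^bsub>N\<^esub> g x), module.smult = (%c f x. c \<odot>\<^bsub>N\<^esub> f x)\<rparr>"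

lemma function_module_simps [simp]:
  "carrier (function_module N C) = C" "\<zero>\<^bsub>function_module N C\<^esub> = (%_. \<zero>\<^bsub>N\<^esub>)"
  "f \<oplus>\<^bsub>function_module N C\<^esub> g = (%x. f x \<oplus>\<^bsub>N\<^esub> g x)" "c \<odot>\<^bsub>function_module N C\<^esub> f = (%x. c \<odot>\<^bsub>N\<^esub> f x)"
  by (simp_all add: function_module_def)

lemma (in kmod) kmod_function_module:
  assumes "!!f x. f : C ==> f x : carrier M" "(%_. \<zero>) : C"
    "!!f g. f : C ==> g : C ==> (%x. f x \<oplus> g x) : C" "!!c f. f : C ==> (%x. c \<odot> f x) : C"
  shows "kmod (function_module M C)"
  by (rule kmodI) (use assms in "auto simp: fun_eq_iff a_ac smult_add_left smult_add_right")

section \<open>A highest weight representation\<close>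

text \<open>The dual picture of a highest weight module: functions on words, on which \<open>E\<^sub>i\<close> acts by removing the
  letter \<open>i\<close> in front and \<open>F\<^sub>j\<close> by the recursion that the commutation relation with the \<open>E\<^sub>i\<close>
  dictates.  The functions obtained from \<open>hw\<close> by the \<open>F\<^sub>j\<close> form a representation in which
  \<open>J\<close> acts as the identity; the Serre relations hold since their left sides commute with all \<open>F\<^sub>k\<close>,
  respectively \<open>E\<^sub>k\<close>.\<close>

context cartan
begin

text \<open>K_j acts by pointwise multiplication with \<open>kw j\<close>. The highest weight q_j at
  the empty word is chosen so that \<open>cw j []\<close> equals 1.\<close>

primrec kw :: "nat => nat list => 'k" where
  "kw j [] = qi j"
| "kw j (i # w) = qi i powi (- a i j) * kw j w"

primrec dw :: "nat => nat list => 'k" where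
  "dw j [] = 1"
| "dw j (i # w) = (if i = j then inverse q else 1) * dw j w"

text \<open>The value at \<open>w\<close> of the right side of the commutation relation of E_j and
  F_j.\<close>

definition cw :: "nat => nat list => 'k" where
  "cw j w = 1 / (qi j - inverse (qi j)) * (kw j w - inverse (kw j w))"

primrec fw :: "nat => nat list => (nat list => 'k) => 'k" where
  "fw j [] f = 0"
| "fw j (i # w) f = fw j w (%u. f (i # u)) + (if i = j then cw j w * f w else 0)"

definition hw :: "nat list => 'k" where "hw w = (if w = [] then 1 else 0)"

lemma kw_nonzero [simp]: "kw j w ~= 0" and dw_nonzero [simp]: "dw j w ~= 0"
  by (induction w) auto

lemma fw_linear [simp]: "fw j w (%_. 0) = 0" "fw j w (%u. f u + f' u) = fw j w f + fw j w f'"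
  "fw j w (%u. c * f u) = c * fw j w f"
  by (induction w arbitrary: f f') (auto simp: algebra_simps)

text \<open>Any function that is multiplicative in the letters gives a pointwise operator that
  commutes with F_j up to the factor of the letter j. This covers K, D and their inverses
  uniformly.\<close>

lemma fw_weight:
  assumes "!!i w. h (i # w) = u i * h w"
  shows "h w * fw j w f = u j * fw j w (%v. h v * f v)"
proof (induction w arbitrary: f)
  case (Cons i w)
  have "h (i # w) * fw j (i # w) f = u i * (h w * fw j w (%v. f (i # v)) + (if i = j then h w * cw j w * f w else 0))"
    by (simp add: assms algebra_simps)
  also have "... = u j * (fw j w (%v. u i * (h v * f (i # v))) + (if i = j then cw j w * (h w * f w) else 0))"
    unfolding Cons.IH fw_linear(3) by (simp add: algebra_simps)
  also have "(%v. u i * (h v * f (i # v))) = (%v. h (i # v) * f (i # v))"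
    by (simp add: assms mult.assoc)
  finally show ?case by simp
qed simp

inductive_set hwm :: "(nat list => 'k) set" where
  zero: "(%_. 0) : hwm"
| hw: "hw : hwm"
| add: "f : hwm ==> f' : hwm ==> (%w. f w + f' w) : hwm"
| smult: "f : hwm ==> (%w. c * f w) : hwm"
| F: "j : I ==> f : hwm ==> (%w. fw j w f) : hwm"

lemma hwm_weight:
  assumes "!!i w. h (i # w) = u i * h w" and "f : hwm"
  shows "(%w. h w * f w) : hwm"
  using assms(2)
proof induction
  case hw
  have "(%w. h w * hw w) = (%w. h [] * hw w)" by (auto simp: hw_def)
  then show ?case using hwm.smult[OF hwm.hw] by simp
next
  case (F j f)
  show ?case unfolding fw_weight[OF assms(1)] by (intro hwm.smult hwm.F F)
next
  case (add f f')
  then show ?case using hwm.add[OF add.IH] by (simp add: algebra_simps)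
next
  case (smult f c)
  then show ?case using hwm.smult[OF smult.IH, of c] by (simp add: algebra_simps)
qed (simp add: hwm.zero)

lemma kw_weight: "kw j (i # w) = qi i powi (- a i j) * kw j w"
  "inverse (kw j (i # w)) = qi i powi a i j * inverse (kw j w)"
  by (simp_all add: power_int_minus)

lemma dw_weight: "dw j (i # w) = (if i = j then inverse q else 1) * dw j w"
  "inverse (dw j (i # w)) = (if i = j then q else 1) * inverse (dw j w)"
  by simp_all

lemmas hwm_weights =
  hwm_weight[where h = "kw j" for j, OF kw_weight(1)] hwm_weight[where h = "%w. inverse (kw j w)" for j, OF kw_weight(2)]
  hwm_weight[where h = "dw j" for j, OF dw_weight(1)] hwm_weight[where h = "%w. inverse (dw j w)" for j, OF dw_weight(2)]

lemma hwm_cw: "f : hwm ==> (%w. cw j w * f w) : hwm"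
proof -
  assume f: "f : hwm"
  let ?c = "1 / (qi j - inverse (qi j))"
  have "(%w. ?c * (kw j w * f w) + (- ?c) * (inverse (kw j w) * f w)) : hwm"
    by (intro hwm.add hwm.smult hwm_weights f)
  then show ?thesis by (simp add: cw_def algebra_simps)
qed

text \<open>The module is generated from \<open>hw\<close> by the F_j alone; stability under E_i
  comes from moving E_i past F_j, with a correction handled by \<open>hwm_cw\<close>.\<close>

lemma hwm_E: "f : hwm ==> (%w. f (i # w)) : hwm"
proof (induction rule: hwm.induct)
  case (F j f)
  show ?case
    using hwm.add[OF hwm.F[OF F(1) F.IH] hwm_cw[OF F(2)], of j] hwm.F[OF F(1) F.IH] by (cases "i = j") simp_all
qed (simp_all add: hwm.intros hw_def)

definition HM where "HM = function_module base_field hwm"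

interpretation BF: kalg "base_field :: ('k, 'k) module"
  by (rule kalg.intro) (rule kalgebra_base_field)

lemma HM_simps [simp]: "carrier HM = hwm" "\<zero>\<^bsub>HM\<^esub> = (%_. 0)"
  "f \<oplus>\<^bsub>HM\<^esub> f' = (%w. f w + f' w)" "c \<odot>\<^bsub>HM\<^esub> f = (%w. c * f w)"
  by (simp_all add: HM_def)

abbreviation EH where "EH == endo_algebra HM"
abbreviation eh_mult (infixl "\<star>\<^sub>H" 70) where "x \<star>\<^sub>H y == x \<otimes>\<^bsub>EH\<^esub> y"

interpretation HM: kmod HM
  unfolding HM_def by (rule BF.kmod_function_module) (simp_all add: hwm.intros)

interpretation EM: kalg "EH"
  by (rule kalg.intro) (rule HM.kalgebra_endo)

primrec hrep :: "wgen => (nat list => 'k) => (nat list => 'k)" where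
  "hrep GJ = endo HM (%f. f)"
| "hrep (GE i) = endo HM (%f w. f (i # w))"
| "hrep (GF i) = endo HM (%f w. fw i w f)"
| "hrep (GK i) = endo HM (%f w. kw i w * f w)"
| "hrep (GKb i) = endo HM (%f w. inverse (kw i w) * f w)"
| "hrep (GD i) = endo HM (%f w. dw i w * f w)"
| "hrep (GDb i) = endo HM (%f w. inverse (dw i w) * f w)"

lemma hrep_closed: "hrep GJ : carrier (EH)" "hrep (GE i) : carrier (EH)"
  "i : I ==> hrep (GF i) : carrier (EH)"
  "hrep (GK i) : carrier (EH)" "hrep (GKb i) : carrier (EH)"
  "hrep (GD i) : carrier (EH)" "hrep (GDb i) : carrier (EH)"
  unfolding hrep.simps
  by (rule HM.endo_closed, rule linear_mapI; simp add: hwm_E hwm.F hwm_weights distrib_left mult.left_commute)+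

lemma hrep_apply [simp]:
  assumes "f : hwm"
  shows "hrep GJ f = f" "hrep (GE i) f = (%w. f (i # w))" "hrep (GF i) f = (%w. fw i w f)"
    "hrep (GK i) f = (%w. kw i w * f w)" "hrep (GKb i) f = (%w. inverse (kw i w) * f w)"
    "hrep (GD i) f = (%w. dw i w * f w)" "hrep (GDb i) f = (%w. inverse (dw i w) * f w)"
  using assms by simp_all

declare hrep.simps [simp del]

lemmas em_eqI = HM.endo_eqI[unfolded HM_simps]

lemma hrep_weight:
  assumes "i : I"
  shows "hrep (GK j) \<star>\<^sub>H hrep (GE i) = qi i powi a i j \<odot>\<^bsub>EH\<^esub> (hrep (GE i) \<star>\<^sub>H hrep (GK j))" (is ?t6)
    "hrep (GKb j) \<star>\<^sub>H hrep (GE i) = qi i powi (- a i j) \<odot>\<^bsub>EH\<^esub> (hrep (GE i) \<star>\<^sub>H hrep (GKb j))" (is ?t3)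
    "hrep (GD j) \<star>\<^sub>H hrep (GE i) = (if i = j then q else 1) \<odot>\<^bsub>EH\<^esub> (hrep (GE i) \<star>\<^sub>H hrep (GD j))" (is ?t2)
    "hrep (GK j) \<star>\<^sub>H hrep (GF i) = qi i powi (- a i j) \<odot>\<^bsub>EH\<^esub> (hrep (GF i) \<star>\<^sub>H hrep (GK j))" (is ?t4)
    "hrep (GKb j) \<star>\<^sub>H hrep (GF i) = qi i powi a i j \<odot>\<^bsub>EH\<^esub> (hrep (GF i) \<star>\<^sub>H hrep (GKb j))" (is ?t5)
    "hrep (GD j) \<star>\<^sub>H hrep (GF i) = (if i = j then inverse q else 1) \<odot>\<^bsub>EH\<^esub> (hrep (GF i) \<star>\<^sub>H hrep (GD j))" (is ?t1)
proof -
  note c = assms hrep_closed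
  show ?t6
    by (rule em_eqI) (use c in \<open>simp_all add: hwm_E hwm_weights\<close>, simp add: power_int_minus field_simps)
  show ?t3
    by (rule em_eqI) (use c in \<open>simp_all add: hwm_E hwm_weights\<close>, simp add: power_int_minus field_simps)
  show ?t2
    by (rule em_eqI) (use c in "simp_all add: hwm_E hwm_weights mult.assoc[symmetric]")
  show ?t4
    by (rule em_eqI) (use c in "simp_all add: hwm.F hwm_weights fw_weight[OF kw_weight(1)] del: kw.simps")
  show ?t5
    by (rule em_eqI) (use c in \<open>simp_all add: hwm.F hwm_weights fw_weight[where h = "%w. inverse (kw j w)", OF kw_weight(2)] del: kw.simps\<close>)
  show ?t1
    by (rule em_eqI) (use c in "simp_all add: hwm.F hwm_weights fw_weight[OF dw_weight(1)] del: dw.simps")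
qed

lemma hrep_ef:
  assumes "j : I"
  shows "hrep (GE i) \<star>\<^sub>H hrep (GF j) = hrep (GF j) \<star>\<^sub>H hrep (GE i)
     \<oplus>\<^bsub>EH\<^esub> (if i = j then (1 / (qi i - inverse (qi i))) \<odot>\<^bsub>EH\<^esub>
       (hrep (GK i) \<oplus>\<^bsub>EH\<^esub> (- 1) \<odot>\<^bsub>EH\<^esub> hrep (GKb i)) else \<zero>\<^bsub>EH\<^esub>)"
  by (rule em_eqI) (use assms hrep_closed in "simp_all add: hwm_E hwm.F cw_def algebra_simps")

lemma hrep_fe:
  assumes "j : I"
  shows "hrep (GF j) \<star>\<^sub>H hrep (GE i) = hrep (GE i) \<star>\<^sub>H hrep (GF j)
     \<oplus>\<^bsub>EH\<^esub> (if i = j then (1 / (qi i - inverse (qi i))) \<odot>\<^bsub>EH\<^esub>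
       (hrep (GKb i) \<oplus>\<^bsub>EH\<^esub> (- 1) \<odot>\<^bsub>EH\<^esub> hrep (GK i)) else \<zero>\<^bsub>EH\<^esub>)"
  by (rule em_eqI) (use assms hrep_closed in "simp_all add: hwm_E hwm.F cw_def algebra_simps")

text \<open>The module is generated by \<open>hw\<close> under the F_j, so such an operator is
  determined by its value on \<open>hw\<close>.\<close>

lemma commuting_F_zero:
  assumes S: "S : carrier (EH)" "S hw = (%_. 0)"
    and F: "!!j. j : I ==> hrep (GF j) \<star>\<^sub>H S = S \<star>\<^sub>H hrep (GF j)"
  shows "S = \<zero>\<^bsub>EH\<^esub>"
proof (rule em_eqI[OF S(1)])
  fix f assume "f : hwm"
  note lin = linear_mapD[OF HM.endo_linear[OF S(1)], simplified]
  from \<open>f : hwm\<close> have "S f = (%_. 0)"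
  proof induction
    case (F j f)
    have "S (hrep (GF j) f) = hrep (GF j) (S f)" using assms(3)[OF F(1)] HM.endo_algebra_simps(1) by metis
    then show ?case using F by (simp add: hwm.zero)
  next
    case zero
    then show ?case using lin(3)[OF hwm.hw, of 0] by simp
  qed (simp_all add: S lin)
  then show "S f = \<zero>\<^bsub>EH\<^esub> f" by simp
qed simp

text \<open>Dually, the value of a function at a word is the value at the empty word after applying
  the E_i for its letters, so such an operator is determined by evaluation at the empty
  word.\<close>

lemma commuting_E_zero:
  assumes S: "S : carrier (EH)" "!!f. f : hwm ==> S f [] = 0"
    and E: "!!i. hrep (GE i) \<star>\<^sub>H S = S \<star>\<^sub>H hrep (GE i)"
  shows "S = \<zero>\<^bsub>EH\<^esub>"
proof (rule em_eqI[OF S(1)])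
  fix f assume f: "f : hwm"
  have "S f w = 0" for w
    using f
  proof (induction w arbitrary: f)
    case (Cons i w)
    have "hrep (GE i) (S f) = S (hrep (GE i) f)" using E[of i] HM.endo_algebra_simps(1) by metis
    then have "S f (i # w) = S (%u. f (i # u)) w"
      using Cons HM.endo_maps[OF S(1), of f] by (auto simp: fun_eq_iff)
    then show ?case using Cons hwm_E by simp
  qed (simp add: S)
  then show "S f = \<zero>\<^bsub>EH\<^esub> f" by auto
qed simp

lemma qad_hw:
  assumes "x : carrier (EH)" "y : carrier (EH)" "x hw = (%_. 0)" "y hw = (%_. 0)"
  shows "EM.qad x c n y hw = (%_. 0)"
proof (induction n)
  case (Suc n)
  have z: "h (%_. 0) = (%_. 0)" if "h : carrier (EH)" for h
    using linear_map_zero[OF HM.kmod_axioms HM.kmod_axioms HM.endo_linear[OF that]] by simp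
  show ?case using assms Suc z[of x] z[of "EM.qad x c n y"] by simp
qed (use assms in simp)

lemma qad_Nil:
  assumes "x : carrier (EH)" "y : carrier (EH)"
    "!!f. f : hwm ==> x f [] = 0" "!!f. f : hwm ==> y f [] = 0" and "f : hwm"
  shows "EM.qad x c n y f [] = 0"
  using assms(5)
proof (induction n arbitrary: f)
  case (Suc n)
  have "EM.qad x c n y f : hwm" "x f : hwm"
    using HM.endo_maps[of "EM.qad x c n y" f] HM.endo_maps[of x f] assms Suc by auto
  then show ?case using assms Suc by simp
qed (use assms in simp)

text \<open>Two instances are wanted: z = q_i and n = 1 - a_ij when a_ii = 2 (quantum Serre
  relation), and z = n = 1 when a_ij = 0 (plain commutator), where a_ii is unconstrained. The
  disjunction in \<open>com\<close> matters only for k = i and separates these cases.\<close>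

lemma hrep_serre_zero:
  assumes ij: "i : I" "j : I" "i ~= j" and n: "n > 0" and z: "z ~= 0" "z powi (int n - 1) = qi i powi (- a i j)"
    and com: "!!k. k : I ==> k ~= i | (z = qi i & a i i = 2) | n = 1"
  shows "EM.serre z n (hrep (GE i)) (hrep (GE j)) = \<zero>\<^bsub>EH\<^esub>"
    "EM.serre z n (hrep (GF i)) (hrep (GF j)) = \<zero>\<^bsub>EH\<^esub>"
proof -

  have z': "z powi (1 - int n) = qi i powi a i j"
    using arg_cong[OF z(2), of inverse] by (simp flip: power_int_minus)
  have w: "qi j powi a j i = qi i powi a i j" "qi j powi (- a j i) = qi i powi (- a i j)"
    using weight_sym[OF ij(1,2)] by (simp_all add: power_int_minus)
  note c = ij hrep_closed
  \<comment> \<open>For n = 1 the two arguments may be exchanged up to sign, so commutation with the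
    partner of the first argument becomes the easier case
    \<open>serre_commute_second\<close>.\<close>
  have one: "EM.serre z 1 x y = (- 1) \<odot>\<^bsub>EH\<^esub> EM.serre z 1 y x"
    if "x : carrier (EH)" "y : carrier (EH)" for x y
    using that by (simp add: EM.serre_def EM.smult_add_right EM.a_comm)
  have a0: "qi i powi a i j = 1" "qi i powi (- a i j) = 1" if "n = 1"
    using z z' that by simp_all
  let ?SE = "EM.serre z n (hrep (GE i)) (hrep (GE j))" and ?SF = "EM.serre z n (hrep (GF i)) (hrep (GF j))"
  have first_E: "hrep (GF i) \<star>\<^sub>H ?SE = ?SE \<star>\<^sub>H hrep (GF i)"
    using com[OF ij(1)]
  proof (elim disjE)
    assume zi: "z = qi i & a i i = 2"
    show ?thesis
      by (rule EM.serre_commute_first[where k = "hrep (GKb i)" and l = "hrep (GK i)"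
            and ?c0.0 = "1 / (qi i - inverse (qi i))"])
        (use c z z' zi w hrep_fe[OF ij(1), of i] hrep_fe[OF ij(1), of j] hrep_weight[OF ij(1), of i] hrep_weight[OF ij(2), of i]
          in "simp_all")
  next
    assume n1: "n = 1"
    have "hrep (GF i) \<star>\<^sub>H EM.serre z 1 (hrep (GE j)) (hrep (GE i)) =
        EM.serre z 1 (hrep (GE j)) (hrep (GE i)) \<star>\<^sub>H hrep (GF i)"
      by (rule EM.serre_commute_second[where k = "hrep (GKb i)" and l = "hrep (GK i)"
            and ?c0.0 = "1 / (qi i - inverse (qi i))"])
        (use c z z' w a0[OF n1] hrep_fe[OF ij(1), of i] hrep_fe[OF ij(1), of j] hrep_weight[OF ij(2), of i]
          in "simp_all")
    then show ?thesis unfolding n1 one[OF hrep_closed(2)[of i] hrep_closed(2)[of j]] using c by simp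
  qed simp
  have first_F: "hrep (GE i) \<star>\<^sub>H ?SF = ?SF \<star>\<^sub>H hrep (GE i)"
    using com[OF ij(1)]
  proof (elim disjE)
    assume zi: "z = qi i & a i i = 2"
    show ?thesis
      by (rule EM.serre_commute_first[where k = "hrep (GK i)" and l = "hrep (GKb i)"
            and ?c0.0 = "1 / (qi i - inverse (qi i))"])
        (use c z z' zi w hrep_ef[OF ij(1), of i] hrep_ef[OF ij(2), of i] hrep_weight[OF ij(1), of i] hrep_weight[OF ij(2), of i]
          in "simp_all")
  next
    assume n1: "n = 1"
    have "hrep (GE i) \<star>\<^sub>H EM.serre z 1 (hrep (GF j)) (hrep (GF i)) =
        EM.serre z 1 (hrep (GF j)) (hrep (GF i)) \<star>\<^sub>H hrep (GE i)"
      by (rule EM.serre_commute_second[where k = "hrep (GK i)" and l = "hrep (GKb i)"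
            and ?c0.0 = "1 / (qi i - inverse (qi i))"])
        (use c z z' w a0[OF n1] hrep_ef[OF ij(1), of i] hrep_ef[OF ij(2), of i] hrep_weight[OF ij(2), of i]
          in "simp_all")
    then show ?thesis unfolding n1 one[OF hrep_closed(3)[OF ij(1)] hrep_closed(3)[OF ij(2)]] using c by simp
  qed simp
  have second_E: "hrep (GF j) \<star>\<^sub>H ?SE = ?SE \<star>\<^sub>H hrep (GF j)"
    by (rule EM.serre_commute_second[where k = "hrep (GKb j)" and l = "hrep (GK j)"
          and ?c0.0 = "1 / (qi j - inverse (qi j))"])
      (use c z z' n hrep_fe[OF ij(2), of i] hrep_fe[OF ij(2), of j] hrep_weight[OF ij(1), of j]
        in "simp_all")
  have second_F: "hrep (GE j) \<star>\<^sub>H ?SF = ?SF \<star>\<^sub>H hrep (GE j)"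
    by (rule EM.serre_commute_second[where k = "hrep (GK j)" and l = "hrep (GKb j)"
          and ?c0.0 = "1 / (qi j - inverse (qi j))"])
      (use c z z' n hrep_ef[OF ij(1), of j] hrep_ef[OF ij(2), of j] hrep_weight[OF ij(1), of j]
        in "simp_all")
  show "?SE = \<zero>\<^bsub>EH\<^esub>"
  proof (rule commuting_F_zero)
    show "?SE hw = (%_. 0)"
      unfolding EM.serre_def by (rule qad_hw) (use c in "simp_all add: hwm.hw, simp_all add: hw_def")
    show "hrep (GF k) \<star>\<^sub>H ?SE = ?SE \<star>\<^sub>H hrep (GF k)" if k: "k : I" for k
    proof -
      consider "k = i" | "k = j" | "k ~= i" "k ~= j" by blast
      then show ?thesis
      proof cases
        case 3
        show ?thesis
          by (rule EM.serre_commute_trivial)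
            (use c k 3 hrep_fe[OF k, of i] hrep_fe[OF k, of j] in "simp_all")
      qed (use first_E second_E in auto)
    qed
  qed (use c in simp)
  show "?SF = \<zero>\<^bsub>EH\<^esub>"
  proof (rule commuting_E_zero)
    show "?SF f [] = 0" if "f : hwm" for f
      unfolding EM.serre_def by (rule qad_Nil) (use c that in simp_all)
    show "hrep (GE k) \<star>\<^sub>H ?SF = ?SF \<star>\<^sub>H hrep (GE k)" for k
    proof -
      consider "k = i" | "k = j" | "k ~= i" "k ~= j" by blast
      then show ?thesis
      proof cases
        case 3
        show ?thesis
          by (rule EM.serre_commute_trivial)
            (use c 3 hrep_ef[OF ij(1), of k] hrep_ef[OF ij(2), of k] in "simp_all")
      qed (use first_F second_F in auto)
    qed
  qed (use c in simp)
qed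

lemma w_sat_hrep: "w_sat (EH) hrep"
proof (rule w_satI_unit[OF HM.kalgebra_endo])
  show "hrep : w_gens I \<rightarrow> carrier (EH)"
    using hrep_closed by (auto elim!: w_gen_cases)
  show "hrep GJ = \<one>\<^bsub>EH\<^esub>"
    by (rule em_eqI) (use hrep_closed in simp_all)
  show "hrep (GK i) \<star>\<^sub>H hrep (GKb i) = \<one>\<^bsub>EH\<^esub>"
    "hrep (GD i) \<star>\<^sub>H hrep (GDb i) = \<one>\<^bsub>EH\<^esub>" for i
    by (rule em_eqI; use hrep_closed in "simp_all add: hwm_weights mult.assoc[symmetric]")+
  show "hrep x \<star>\<^sub>H hrep y = hrep y \<star>\<^sub>H hrep x"
    if "x : w_toral I" "y : w_toral I" for x y
  proof -
    have "\<exists>h. hrep x : carrier (EH) & (ALL f:hwm. hrep x f = (%w. h w * f w))" if "x : w_toral I" for x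
    proof (rule w_toral_cases[OF that])
      fix i assume "x = GK i"
      then show ?thesis using hrep_closed by (intro exI[of _ "kw i"]) simp
    next
      fix i assume "x = GKb i"
      then show ?thesis using hrep_closed by (intro exI[of _ "%w. inverse (kw i w)"]) simp
    next
      fix i assume "x = GD i"
      then show ?thesis using hrep_closed by (intro exI[of _ "dw i"]) simp
    next
      fix i assume "x = GDb i"
      then show ?thesis using hrep_closed by (intro exI[of _ "%w. inverse (dw i w)"]) simp
    qed
    from this[OF that(1)] this[OF that(2)]
    obtain h h' where h: "hrep x : carrier (EH)" "!!f. f : hwm ==> hrep x f = (%w. h w * f w)"
      "hrep y : carrier (EH)" "!!f. f : hwm ==> hrep y f = (%w. h' w * f w)"
      by blast
    show ?thesis
    proof (rule em_eqI)
      fix f assume f: "f : hwm"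
      have m: "hrep x f : hwm" "hrep y f : hwm" using HM.endo_maps[of "hrep x" f] HM.endo_maps[of "hrep y" f] f h by auto
      show "(hrep x \<star>\<^sub>H hrep y) f = (hrep y \<star>\<^sub>H hrep x) f"
        unfolding HM.endo_algebra_simps(1) h(2)[OF m(2)] h(4)[OF m(1)]
        unfolding h(2)[OF f] h(4)[OF f] by (simp add: mult.left_commute)
    qed (use h in simp_all)
  qed
  show "ef_rel (EH) (qi i) (i = j) (hrep (GE i)) (hrep (GF j)) (hrep (GK i)) (hrep (GKb i))"
    if "i : I" "j : I" for i j
    unfolding ef_rel_def using hrep_ef[OF that(2), of i] by simp
  show "EM.serre (qi i) (n_ij i j) (hrep (Z i)) (hrep (Z j)) = \<zero>\<^bsub>EH\<^esub>"
    if "i : I" "j : I" "i ~= j" "a i i = 2" "Z : {GE, GF}" for i j Z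
  proof -
    have "int (n_ij i j) = 1 - a i j" "n_ij i j > 0" using int_n_ij[OF that(1-3)] a_nonpos[OF that(1-3)] by auto
    then show ?thesis
      using hrep_serre_zero[of i j "n_ij i j" "qi i"] that by auto
  qed
  show "hrep (Z i) \<star>\<^sub>H hrep (Z j) = hrep (Z j) \<star>\<^sub>H hrep (Z i)"
    if "i : I" "j : I" "a i j = 0" "Z : {GE, GF}" for i j Z
  proof (cases "i = j")
    case False
    then have "EM.serre 1 1 (hrep (Z i)) (hrep (Z j)) = \<zero>\<^bsub>EH\<^esub>"
      using hrep_serre_zero[of i j 1 1] that by auto
    then show ?thesis
      using that hrep_closed EM.diff_zero_iff by (auto simp: EM.serre_def)
  qed simp
qed (use hrep_weight in auto)

interpretation W: presented "w_gens I" wrels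
  by (rule presented.intro) (rule wrels_closed)

interpretation M: w_model I a s q m \<kappa> \<kappa>' WA g by (rule w_model_W)

interpretation WW: tens WA WA ..

definition hact where "hact = generator_extend (EH) hrep"

lemma hact_hom: "algebra_hom WA (EH) hact"
  and hact_gen: "x : w_gens I ==> hact (g x) = hrep x"
proof -
  have "hrep : w_gens I \<rightarrow> carrier (EH)"
    using hrep_closed by (auto elim!: w_gen_cases)
  note h = w_hom[OF HM.kalgebra_endo this w_sat_hrep refl, folded hact_def]
  show "algebra_hom WA (EH) hact" "x : w_gens I ==> hact (g x) = hrep x"
    by (fact h)+
qed

lemma hact_P: "hact M.P = \<one>\<^bsub>EH\<^esub>"
proof -
  have "hrep GJ = \<one>\<^bsub>EH\<^esub>"
    by (rule em_eqI) (use hrep_closed in simp_all)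
  then show ?thesis
    unfolding M.P_def by (simp add: hom_pow[OF HM.kalgebra_endo hact_hom] hact_gen)
qed

lemma hact_e0: "hact (M.e0 i) = \<one>\<^bsub>EH\<^esub>"
  using hact_P algebra_homD(2)[OF hact_hom] by (simp add: M.e0_def)

lemma noncommutative_U: "noncommutative U"
proof -
  obtain i where one: "i : I" using I_nonempty by blast
  let ?E = "g (GE i)" and ?F = "g (GF i)"
  \<comment> \<open>E_i kills \<open>hw\<close>, and on F_i \<open>hw\<close> it gives
    \<open>cw i [] = 1\<close> at the empty word.\<close>
  have 1: "hact (?E \<cdot> ?F) hw [] = 1" "hact (?F \<cdot> ?E) hw [] = 0"
    using qi_diff[OF one] one
    by (simp_all add: algebra_homD(4)[OF hact_hom] hact_gen hwm.intros hwm_E cw_def) (simp add: hw_def)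
  then have "?E \<otimes>\<^bsub>U\<^esub> ?F ~= ?F \<otimes>\<^bsub>U\<^esub> ?E" by auto
  then show ?thesis
    unfolding noncommutative_def using one UC_gens by (intro bexI[of _ ?E] bexI[of _ ?F]) auto
qed

lemma noncocommutative_U: "noncocommutative U"
proof -
  interpret U: bialg U by (rule bialg.intro) (rule is_bialgebra_U)
  obtain i where i: "i : I" using I_nonempty by blast
  let ?E = "g (GE i)" and ?K = "g (GK i)" and ?F = "g (GF i)" and ?e = "M.e0 i"
  have mem [simp]: "?E : UC" "?K : UC" "?e : UC" using i UC_gens by auto
  have \<Delta>: "comult U ?E = tensor U U ?e ?E \<oplus>\<^bsub>tensor_algebra U U\<^esub> tensor U U ?E ?K"
    by (rule comult_U_add) (use i in "auto simp: \<Delta>_gen")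
  \<comment> \<open>A functional on the tensor square that tells the two legs apart: on the
    coproduct of E_i only E_i \<otimes> K_i contributes, with value q_i; after the flip only E_i
    \<otimes> e contributes, with value 1. Here q_i is different from 1.\<close>
  define b where "b x y = hact x (hrep (GF i) hw) [] * hact y hw []" for x y
  have lin: "linear_map U base_field (%x. hact x f [])" for f
    by (rule linear_mapI) (use algebra_homD[OF hact_hom] UC_carrier in auto)
  have b: "bilinear_map U U base_field b"
    unfolding b_def by (intro bilinear_mapI linear_mapI) (use linear_mapD[OF lin] in "auto simp: algebra_simps")
  have flip: "bilinear_map U U (tensor_algebra U U) (%x y. tensor U U y x)"
    using U.HH.bilinear_tn by (auto simp: bilinear_map_def)
  note te = U.HH.tensor_extend_tensor U.HH.tensor_extend_add
  note s1 = te[OF BF.kmod_axioms b, simplified] and s2 = te[OF U.HH.T.kmod_axioms flip, simplified]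
  have v: "hact ?E (hrep (GF i) hw) [] = 1" "hact ?K (hrep (GF i) hw) [] = 0" "hact ?e (hrep (GF i) hw) [] = 0"
    "hact ?E hw [] = 0" "hact ?K hw [] = qi i" "hact ?e hw [] = 1"
    using qi_diff[OF i] i
    by (simp_all add: hact_gen hact_e0 hwm.intros hwm_E cw_def) (simp_all add: hw_def)
  have "tensor_extend base_field b (comult U ?E) = qi i"
    unfolding \<Delta> by (simp add: s1 b_def v)
  moreover have "tensor_extend base_field b
      (tensor_extend (tensor_algebra U U) (%x y. tensor U U y x) (comult U ?E)) = 1"
    unfolding \<Delta> by (simp add: s1 s2 b_def v)
  ultimately show ?thesis
    unfolding noncocommutative_def using q_cond i by (intro bexI[of _ ?E]) auto
qed

end

section \<open>The usual quantum algebra\<close>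

lemma (in kalg) twisted_commutator:
  assumes [simp]: "u : carrier A" "v : carrier A" "k : carrier A" "l : carrier A" "h : carrier A"
    and lu: "l \<otimes> u = b \<odot> (u \<otimes> l)" and lv: "l \<otimes> v = d \<odot> (v \<otimes> l)" and ku: "k \<otimes> u = d \<odot> (u \<otimes> k)"
    and kl: "k \<otimes> l = l \<otimes> k" and uv: "u \<otimes> v = v \<otimes> u \<oplus> h"
  shows "(l \<otimes> u) \<otimes> (v \<otimes> k) = (v \<otimes> k) \<otimes> (l \<otimes> u) \<oplus> (b * d) \<odot> (h \<otimes> (l \<otimes> k))"
proof -
  have "(l \<otimes> u) \<otimes> (v \<otimes> k) = b \<odot> (u \<otimes> (l \<otimes> v) \<otimes> k)" unfolding lu by (simp add: m_assoc)
  also have "... = (b * d) \<odot> ((u \<otimes> v) \<otimes> (l \<otimes> k))" unfolding lv by (simp add: m_assoc)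
  finally have 1: "(l \<otimes> u) \<otimes> (v \<otimes> k) = (b * d) \<odot> ((u \<otimes> v) \<otimes> (l \<otimes> k))" .
  have "(v \<otimes> k) \<otimes> (l \<otimes> u) = b \<odot> (v \<otimes> (k \<otimes> u) \<otimes> l)" unfolding lu by (simp add: m_assoc)
  also have "... = (b * d) \<odot> ((v \<otimes> u) \<otimes> (l \<otimes> k))" unfolding ku kl[symmetric] by (simp add: m_assoc)
  finally show ?thesis unfolding 1 uv by (simp add: l_distr smult_add_right)
qed

text \<open>The translation between the presentations exchanges E and F and inverts k, so the
  commutator changes sign twice. The two versions serve the two directions of the
  translation.\<close>

lemma (in kalg) ef_rel_twisted:
  assumes c: "u : carrier A" "v : carrier A" "k : carrier A" "l : carrier A" "k0 : carrier A" "l0 : carrier A"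
    and t: "l \<otimes> u = b \<odot> (u \<otimes> l)" "l \<otimes> v = d \<odot> (v \<otimes> l)" "k \<otimes> u = d \<odot> (u \<otimes> k)" "k \<otimes> l = l \<otimes> k"
    and p: "p ==> b * d = 1" "p ==> l \<otimes> k = \<one>"
  shows "ef_rel A z p v u k0 l0 ==> ef_rel A z p (l \<otimes> u) (v \<otimes> k) l0 k0"
    "ef_rel A z p u v k0 l0 ==> ef_rel A z p (v \<otimes> k) (l \<otimes> u) l0 k0"
proof -
  define h where "h = (if p then (1 / (z - inverse z)) \<odot> (k0 \<oplus> (- 1) \<odot> l0) else \<zero>)"
  define h' where "h' = (if p then (1 / (z - inverse z)) \<odot> (l0 \<oplus> (- 1) \<odot> k0) else \<zero>)"
  have [simp]: "h : carrier A" "h' : carrier A" using c by (simp_all add: h_def h'_def)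
  have hh: "h \<oplus> h' = \<zero>"
  proof -
    have "h' = (- 1) \<odot> h" using c by (simp add: h_def h'_def smult_add_right a_comm)
    then show ?thesis by (simp add: smult_minus_left r_neg)
  qed
  have hm: "(b * d) \<odot> (h \<otimes> (l \<otimes> k)) = h" "(b * d) \<odot> (h' \<otimes> (l \<otimes> k)) = h'"
    using p c by (auto simp: h_def h'_def)
  have mv: "x = y \<oplus> h ==> y = x \<oplus> h'" if "x : carrier A" "y : carrier A" for x y
    using that hh by (simp add: a_assoc)
  {
    assume "ef_rel A z p v u k0 l0"
    then have "v \<otimes> u = u \<otimes> v \<oplus> h" by (simp add: ef_rel_def h_def)
    then have "u \<otimes> v = v \<otimes> u \<oplus> h'" by (rule mv[rotated 2]) (use c in auto)
    from twisted_commutator[OF c(1-4) _ t this] show "ef_rel A z p (l \<otimes> u) (v \<otimes> k) l0 k0"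
      unfolding ef_rel_def h'_def[symmetric] hm by simp
  next
    assume "ef_rel A z p u v k0 l0"
    then have "u \<otimes> v = v \<otimes> u \<oplus> h" by (simp add: ef_rel_def h_def)
    from twisted_commutator[OF c(1-4) _ t this]
    have "(l \<otimes> u) \<otimes> (v \<otimes> k) = (v \<otimes> k) \<otimes> (l \<otimes> u) \<oplus> h" unfolding hm by simp
    then have "(v \<otimes> k) \<otimes> (l \<otimes> u) = (l \<otimes> u) \<otimes> (v \<otimes> k) \<oplus> h'" by (rule mv[rotated 2]) (use c in auto)
    then show "ef_rel A z p (v \<otimes> k) (l \<otimes> u) l0 k0"
      unfolding ef_rel_def h'_def[symmetric] .
  }
qed

lemma simple_root_superset:
  assumes "finite S" "keys h <= S"
  shows "simple_root a i h = (\<Sum>x\<in>S. lookup h x * (case x of CH j => a j i | CD j => if i = j then 1 else 0))"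
  unfolding simple_root_def
  by (rule sum.mono_neutral_left) (use assms in "auto simp: in_keys_iff")

lemma simple_root_add [simp]: "simple_root a i (h + h') = simple_root a i h + simple_root a i h'"
proof -
  let ?S = "keys h Un keys h'"
  have "keys (h + h') <= ?S" by (rule Poly_Mapping.keys_add)
  then show ?thesis
    using simple_root_superset[of ?S _ a i] by (simp add: lookup_add distrib_right sum.distrib)
qed

lemma simple_root_zero [simp]: "simple_root a i 0 = 0"
  by (simp add: simple_root_def)

lemma simple_root_minus [simp]: "simple_root a i (- h) = - simple_root a i h"
  using simple_root_add[of a i h "- h"] by simp

lemma simple_root_single [simp]:
  "simple_root a i (single (CH j) n) = n * a j i"
  "simple_root a i (single (CD j) n) = (if i = j then n else 0)"
  by (simp_all add: simple_root_def)

section \<open>The relations of U_q, and models of wU obtained from models of U_q\<close>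

context cartan
begin

abbreviation lat where "lat == coweight_lattice I"
abbreviation qrels where "qrels == q_rels I a s q"
abbreviation \<alpha> where "\<alpha> == simple_root a"
abbreviation kH where "kH i == single (CH i) (int (s i))"
abbreviation dH where "dH i == single (CD i) (1 :: int)"

lemma lat_iff: "h : lat \<longleftrightarrow> keys h <= CH ` I Un CD ` I"
  by (simp add: coweight_lattice_def free_Abelian_group_def)

lemma lat_closed [simp, intro]: "0 : lat" "h : lat ==> h' : lat ==> h + h' : lat" "h : lat ==> - h : lat"
  "i : I ==> single (CH i) n : lat" "i : I ==> single (CD i) n : lat"
  using Poly_Mapping.keys_add[of h h'] by (auto simp: lat_iff)

lemma lat_diff [simp, intro]: "h : lat ==> h' : lat ==> h - h' : lat"
  using lat_closed(2)[of h "- h'"] lat_closed(3)[of h'] by simp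

lemma q_k_eq: "q_k s i = QH (kH i)" "q_k_inv s i = QH (- kH i)"
  by (simp_all add: q_k_def q_k_inv_def flip: single_uminus)

lemma q_gens_mem [simp]: "i : I ==> QE i : q_gens I" "i : I ==> QF i : q_gens I"
  "h : lat ==> QH h : q_gens I"
  by (auto simp: q_gens_def)

lemma q_gen_cases:
  assumes "x : q_gens I"
  obtains i where "i : I" "x = QE i" | i where "i : I" "x = QF i" | h where "h : lat" "x = QH h"
  using assms by (auto simp: q_gens_def)

definition q_sat where
  "q_sat B f \<longleftrightarrow>
    f (QH 0) = \<one>\<^bsub>B\<^esub> &
    (\<forall>h h'. h : lat & h' : lat --> f (QH h) \<otimes>\<^bsub>B\<^esub> f (QH h') = f (QH (h + h'))) &
    (\<forall>h i. h : lat & i : I --> f (QH h) \<otimes>\<^bsub>B\<^esub> f (QE i) \<otimes>\<^bsub>B\<^esub> f (QH (- h)) = q powi \<alpha> i h \<odot>\<^bsub>B\<^esub> f (QE i)) &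
    (\<forall>h i. h : lat & i : I --> f (QH h) \<otimes>\<^bsub>B\<^esub> f (QF i) \<otimes>\<^bsub>B\<^esub> f (QH (- h)) = q powi (- \<alpha> i h) \<odot>\<^bsub>B\<^esub> f (QF i)) &
    (\<forall>i j. i : I & j : I --> ef_rel B (qi i) (i = j) (f (QE i)) (f (QF j)) (f (q_k s i)) (f (q_k_inv s i))) &
    (\<forall>i j Z. i : I & j : I & i ~= j & a i i = 2 & Z : {QE, QF} -->
      kalg.serre B (qi i) (n_ij i j) (f (Z i)) (f (Z j)) = \<zero>\<^bsub>B\<^esub>) &
    (\<forall>i j Z. i : I & j : I & a i j = 0 & Z : {QE, QF} -->
      f (Z i) \<otimes>\<^bsub>B\<^esub> f (Z j) = f (Z j) \<otimes>\<^bsub>B\<^esub> f (Z i))"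

lemma q_sat_iff:
  assumes "kalgebra B" "f : q_gens I \<rightarrow> carrier B"
  shows "(ALL r:qrels. lin B (word_value B f) r = \<zero>\<^bsub>B\<^esub>) \<longleftrightarrow> q_sat B f"
proof -
  interpret R: rel_eval B "q_gens I" f
    by (intro rel_eval.intro kalg.intro assms rel_eval_axioms.intro)
  show ?thesis
    unfolding q_rels_def q_sat_def ball_Un ball_setcompr1 ball_setcompr2 ball_setcompr3 conj_assoc
  proof (intro arg_cong2[where f = "(&)"], goal_cases)
    case 1
    have "lin B R.ev (single [QH 0] 1 - single [] 1) = \<zero>\<^bsub>B\<^esub> \<longleftrightarrow> f (QH 0) = \<one>\<^bsub>B\<^esub>"
      by (subst R.eval_binomial) auto
    then show ?case by simp
  next
    case 2
    show ?case by (intro iff_allI imp_cong refl, subst R.eval_binomial) auto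
  next
    case 3
    show ?case by (intro iff_allI imp_cong refl, subst R.eval_conjugation) auto
  next
    case 4
    show ?case by (intro iff_allI imp_cong refl, subst R.eval_conjugation) auto
  next
    case 5
    show ?case by (intro iff_allI imp_cong refl, subst R.eval_ef) (auto simp: q_k_eq)
  next
    case 6
    show ?case by (intro iff_allI imp_cong refl, subst R.eval_serre) auto
  next
    case 7
    show ?case by (intro iff_allI imp_cong refl, subst R.eval_commutator) auto
  qed
qed

lemma qrels_closed: "qrels <= carrier (free_algebra (q_gens I))"
proof -
  have c: "keys (commutator_rel x y :: _ \<Rightarrow>\<^sub>0 'k) <= lists (q_gens I)"
    if "x : q_gens I" "y : q_gens I" for x y
    unfolding commutator_rel_def by (rule keys_diff_subset) (use that in auto)
  have z: "keys (serre_rel (d :: 'k) n x y) <= lists (q_gens I)"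
    if "x : q_gens I" "y : q_gens I" for d n x y
    unfolding serre_rel_def by (rule keys_sum_subset) (use that in auto)
  have w: "keys (conjugation_rel u x v (d :: 'k)) <= lists (q_gens I)"
    if "u : q_gens I" "v : q_gens I" "x : q_gens I" for u v x d
    unfolding conjugation_rel_def by (rule keys_diff_subset) (use that in auto)
  have "ALL r:qrels. keys r <= lists (q_gens I)"
    unfolding q_rels_def ball_Un ball_setcompr1 ball_setcompr2 ball_setcompr3 conj_assoc
  proof (intro conjI, goal_cases)
    case 3
    show ?case by (intro allI impI w) auto
  next
    case 4
    show ?case by (intro allI impI w) auto
  next
    case 5
    show ?case
      by (intro allI impI keys_diff_subset c) (auto simp: q_k_eq split: if_splits dest!: subsetD[OF keys_diff])
  next
    case 6
    show ?case by (intro allI impI z) auto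
  next
    case 7
    show ?case by (intro allI impI c) auto
  qed (auto dest!: subsetD[OF keys_diff] split: if_splits)
  then show ?thesis by auto
qed

text \<open>The assignment \<open>K\<^sub>i \<mapsto> k\<^sub>i\<^sup>-\<^sup>1\<close>, \<open>E\<^sub>i \<mapsto> k\<^sub>i\<^sup>-\<^sup>1 f\<^sub>i\<close>, \<open>F\<^sub>i \<mapsto> e\<^sub>i k\<^sub>i\<close> translates between the two presentations;
  it matches the two comultiplications and antipodes.\<close>

fun w_of_q :: "('k, 'b, 'e) module_scheme => (qgen => 'b) => wgen => 'b" where
  "w_of_q B f GJ = \<one>\<^bsub>B\<^esub>"
| "w_of_q B f (GE i) = f (QH (- kH i)) \<otimes>\<^bsub>B\<^esub> f (QF i)"
| "w_of_q B f (GF i) = f (QE i) \<otimes>\<^bsub>B\<^esub> f (QH (kH i))"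
| "w_of_q B f (GK i) = f (QH (- kH i))"
| "w_of_q B f (GKb i) = f (QH (kH i))"
| "w_of_q B f (GD i) = f (QH (- dH i))"
| "w_of_q B f (GDb i) = f (QH (dH i))"

lemma q_weight:
  fixes B (structure)
  assumes B: "kalgebra B" and f: "f : q_gens I \<rightarrow> carrier B" and sat: "q_sat B f" and h: "h : lat" "i : I"
  shows "f (QH h) \<otimes> f (QE i) = q powi \<alpha> i h \<odot> (f (QE i) \<otimes> f (QH h))" (is ?t2)
    "f (QH h) \<otimes> f (QF i) = q powi (- \<alpha> i h) \<odot> (f (QF i) \<otimes> f (QH h))" (is ?t1)
proof -
  interpret B: kalg B by (rule kalg.intro) fact
  have [simp]: "x : q_gens I ==> f x : carrier B" for x using f by auto
  have inv: "f (QH (- h)) \<otimes> f (QH h) = \<one>"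
    using sat[unfolded q_sat_def, THEN conjunct2, THEN conjunct1, rule_format, of "- h" h]
      sat[unfolded q_sat_def, THEN conjunct1] h by simp
  have S: "f (QH h) \<otimes> f (QE i) \<otimes> f (QH (- h)) = q powi \<alpha> i h \<odot> f (QE i)"
    "f (QH h) \<otimes> f (QF i) \<otimes> f (QH (- h)) = q powi (- \<alpha> i h) \<odot> f (QF i)"
    using sat[unfolded q_sat_def] h by blast+
  have c: "f (QH h) \<otimes> x = c \<odot> (x \<otimes> f (QH h))"
    if x: "x : carrier B" and e: "f (QH h) \<otimes> x \<otimes> f (QH (- h)) = c \<odot> x" for x c
  proof -
    have "c \<odot> (x \<otimes> f (QH h)) = f (QH h) \<otimes> x \<otimes> f (QH (- h)) \<otimes> f (QH h)"
      using x h by (simp add: e)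
    also have "... = f (QH h) \<otimes> x" using x h inv by (simp add: B.m_assoc)
    finally show ?thesis ..
  qed
  show ?t2
    by (rule c) (use h S in simp_all)
  show ?t1
    by (rule c) (use h S in simp_all)
qed

lemma kH_weight: "i : I ==> j : I ==> q powi (int (s j) * a j i) = qi i powi a i j"
  "i : I ==> j : I ==> q powi (- (int (s j) * a j i)) = qi i powi (- a i j)"
  using weight_sym[of i j] by (simp_all add: qi_powi power_int_minus)

lemma w_of_q_closed:
  "kalgebra B ==> f : q_gens I \<rightarrow> carrier B ==> w_of_q B f : w_gens I \<rightarrow> carrier B"
proof
  fix x assume "kalgebra B" "f : q_gens I \<rightarrow> carrier B" and x: "x : w_gens I"
  then interpret B: kalg B by (intro kalg.intro)
  have "y : q_gens I ==> f y : carrier B" for y using \<open>f : q_gens I \<rightarrow> carrier B\<close> by auto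
  then show "w_of_q B f x : carrier B" by - (rule w_gen_cases[OF x]; simp)
qed

lemma w_of_q_weight:
  fixes B (structure)
  assumes B: "kalgebra B" and f: "f : q_gens I \<rightarrow> carrier B" and sat: "q_sat B f" and h: "h : lat" "i : I"
  shows "f (QH h) \<otimes> w_of_q B f (GE i) = q powi (- \<alpha> i h) \<odot> (w_of_q B f (GE i) \<otimes> f (QH h))" (is ?t1)
    "f (QH h) \<otimes> w_of_q B f (GF i) = q powi \<alpha> i h \<odot> (w_of_q B f (GF i) \<otimes> f (QH h))" (is ?t2)
proof -
  interpret B: kalg B by (rule kalg.intro) fact
  have [simp]: "x : q_gens I ==> f x : carrier B" for x using f by auto
  have Hc: "f (QH h) \<otimes> f (QH h') = f (QH h') \<otimes> f (QH h)" if "h' : lat" for h'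
    using sat[unfolded q_sat_def, THEN conjunct2, THEN conjunct1] h that by (simp add: add.commute)
  note wt = q_weight[OF B f sat]
  have "f (QH h) \<otimes> w_of_q B f (GE i) = f (QH (- kH i)) \<otimes> (f (QH h) \<otimes> f (QF i))"
    using h Hc[of "- kH i"] by (simp flip: B.m_assoc)
  then show ?t1
    unfolding wt(2)[OF h] using h by (simp add: B.m_assoc)
  have "f (QH h) \<otimes> w_of_q B f (GF i) = (f (QH h) \<otimes> f (QE i)) \<otimes> f (QH (kH i))"
    using h by (simp add: B.m_assoc)
  then show ?t2
    unfolding wt(1)[OF h] using h Hc[of "kH i"] by (simp add: B.m_assoc)
qed

lemma w_sat_w_of_q:
  fixes B (structure)
  assumes B: "kalgebra B" and f: "f : q_gens I \<rightarrow> carrier B" and sat: "q_sat B f"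
  shows "w_sat B (w_of_q B f)"
proof -
  interpret B: kalg B by (rule kalg.intro) fact
  have fc [simp]: "x : q_gens I ==> f x : carrier B" for x using f by auto
  note S = sat[unfolded q_sat_def]
  have HH: "f (QH h) \<otimes> f (QH h') = f (QH (h + h'))" if "h : lat" "h' : lat" for h h' using S that by blast
  have H0: "f (QH 0) = \<one>" using S by blast
  have Hc: "f (QH h) \<otimes> f (QH h') = f (QH h') \<otimes> f (QH h)" if "h : lat" "h' : lat" for h h'
    using HH that by (simp add: add.commute)
  note wt = q_weight[OF B f sat]
  note FE = w_of_q_weight[OF B f sat]
  have sw: "w_of_q B f (GE i) = qi i powi a i i \<odot> (f (QF i) \<otimes> f (QH (- kH i)))" if "i : I" for i
    using wt(2)[of "- kH i" i] that by (simp add: kH_weight)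
  have com: "f (Z i) \<otimes> f (Z j) = f (Z j) \<otimes> f (Z i)"
    if "i : I" "j : I" "a i j = 0" "Z : {QE, QF}" for i j Z using S that by blast
  have ser: "B.serre (qi i) (n_ij i j) (f (Z i)) (f (Z j)) = \<zero>"
    if "i : I" "j : I" "i ~= j" "a i i = 2" "Z : {QE, QF}" for i j Z using S that by blast
  show ?thesis
  proof (rule w_satI_unit[OF B w_of_q_closed[OF B f]])
    fix x y assume xy: "x : w_toral I" "y : w_toral I"
    have "EX h:lat. w_of_q B f x = f (QH h)" if "x : w_toral I" for x
      by (rule w_toral_cases[OF that]) auto
    from this[OF xy(1)] this[OF xy(2)]
    show "w_of_q B f x \<otimes> w_of_q B f y = w_of_q B f y \<otimes> w_of_q B f x"
      using Hc by auto
  next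
    fix i j assume ij: "i : I" "j : I"
    show "w_of_q B f (GK j) \<otimes> w_of_q B f (GE i) = qi i powi a i j \<odot> (w_of_q B f (GE i) \<otimes> w_of_q B f (GK j))"
      "w_of_q B f (GK j) \<otimes> w_of_q B f (GF i) = qi i powi (- a i j) \<odot> (w_of_q B f (GF i) \<otimes> w_of_q B f (GK j))"
      using FE[of "- kH j" i] ij by (simp_all add: kH_weight)
    show "w_of_q B f (GD j) \<otimes> w_of_q B f (GE i) = (if i = j then q else 1) \<odot> (w_of_q B f (GE i) \<otimes> w_of_q B f (GD j))"
      "w_of_q B f (GD j) \<otimes> w_of_q B f (GF i) = (if i = j then inverse q else 1) \<odot> (w_of_q B f (GF i) \<otimes> w_of_q B f (GD j))"
      using FE[of "- dH j" i] ij by (simp_all add: power_int_minus)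
    \<comment> \<open>The image of E_i involves f_i and that of F_j involves e_j, so the relation
      for the pair (j, i) is the one needed.\<close>
    have "ef_rel B (qi j) (j = i) (f (QE j)) (f (QF i)) (f (QH (kH j))) (f (QH (- kH j)))"
      using S ij unfolding q_k_eq by blast
    then have "ef_rel B (qi j) (j = i) (w_of_q B f (GE i)) (w_of_q B f (GF j)) (f (QH (- kH j))) (f (QH (kH j)))"
      unfolding w_of_q.simps
      by (intro B.ef_rel_twisted(1)[where b = "qi i powi a i i" and d = "qi i powi (- a i j)"])
        (use ij wt(2)[of "- kH i" i] wt(1)[of "- kH i" j] wt(2)[of "kH j" i] Hc HH H0 weight_sym[OF ij]
          in "auto simp: kH_weight power_int_minus")
    then show "ef_rel B (qi i) (i = j) (w_of_q B f (GE i)) (w_of_q B f (GF j)) (w_of_q B f (GK i)) (w_of_q B f (GKb i))"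
      by (cases "i = j") (simp_all add: ef_rel_def)
  next
    fix i j :: nat and Z :: "nat => wgen"
    assume ij: "i : I" "j : I" "i ~= j" "a i i = 2" and Z: "Z : {GE, GF}"
    have e: "B.serre (qi i) (n_ij i j) (l \<odot> (f (QE i) \<otimes> f (QH (kH i)))) (l' \<odot> (f (QE j) \<otimes> f (QH (kH j)))) = \<zero>" for l l'
      by (rule B.serre_twisted[where b = "qi i powi a i i" and e = "qi i powi a i j"])
        (use ij wt(1)[of "kH i"] wt(1)[of "kH j" i] Hc ser[of i j QE] weight_sym[OF ij(1,2)] in "auto simp: kH_weight")
    have f: "B.serre (qi i) (n_ij i j) (l \<odot> (f (QF i) \<otimes> f (QH (- kH i)))) (l' \<odot> (f (QF j) \<otimes> f (QH (- kH j)))) = \<zero>" for l l'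
      by (rule B.serre_twisted[where b = "qi i powi a i i" and e = "qi i powi a i j"])
        (use ij wt(2)[of "- kH i"] wt(2)[of "- kH j" i] Hc ser[of i j QF] weight_sym[OF ij(1,2)] in "auto simp: kH_weight")
    have "B.serre (qi i) (n_ij i j) (w_of_q B f (GE i)) (w_of_q B f (GE j)) = \<zero>"
      unfolding sw[OF ij(1)] sw[OF ij(2)] by (rule f)
    moreover have "B.serre (qi i) (n_ij i j) (w_of_q B f (GF i)) (w_of_q B f (GF j)) = \<zero>"
      using e[of 1 1] ij by simp
    ultimately show "B.serre (qi i) (n_ij i j) (w_of_q B f (Z i)) (w_of_q B f (Z j)) = \<zero>"
      using Z by (elim insertE) (simp_all del: w_of_q.simps)
  next
    fix i j :: nat and Z :: "nat => wgen"
    assume ij: "i : I" "j : I" "a i j = 0" and Z: "Z : {GE, GF}"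
    have c: "(k \<otimes> x) \<otimes> (l \<otimes> y) = (l \<otimes> y) \<otimes> (k \<otimes> x)"
      if [simp]: "x : carrier B" "y : carrier B" "k : carrier B" "l : carrier B"
        and xy: "x \<otimes> y = y \<otimes> x" and ky: "k \<otimes> y = y \<otimes> k" and lx: "l \<otimes> x = x \<otimes> l"
        and kl: "k \<otimes> l = l \<otimes> k" for x y k l
    proof -
      have "(k \<otimes> x) \<otimes> (l \<otimes> y) = k \<otimes> (l \<otimes> x) \<otimes> y" unfolding lx by (simp add: B.m_assoc)
      also have "... = (k \<otimes> l) \<otimes> (x \<otimes> y)" by (simp add: B.m_assoc)
      also have "... = l \<otimes> (k \<otimes> y) \<otimes> x" unfolding kl xy by (simp add: B.m_assoc)
      also have "... = (l \<otimes> y) \<otimes> (k \<otimes> x)" unfolding ky by (simp add: B.m_assoc)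
      finally show ?thesis .
    qed
    have a0: "a j i = 0" using bc ij by (auto simp: borcherds_cartan_def)
    have sE: "w_of_q B f (GF i) = qi i powi (- a i i) \<odot> (f (QH (kH i)) \<otimes> f (QE i))" if "i : I" for i
      using wt(1)[of "kH i" i] that by (simp add: kH_weight power_int_minus)
    have e: "f (QH (kH i)) \<otimes> f (QE i) \<otimes> (f (QH (kH j)) \<otimes> f (QE j)) =
        f (QH (kH j)) \<otimes> f (QE j) \<otimes> (f (QH (kH i)) \<otimes> f (QE i))"
      by (rule c) (use ij a0 wt(1)[of "kH i" j] wt(1)[of "kH j" i] com[of i j QE] Hc in auto)
    have f: "w_of_q B f (GE i) \<otimes> w_of_q B f (GE j) = w_of_q B f (GE j) \<otimes> w_of_q B f (GE i)"
      unfolding w_of_q.simps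
      by (rule c) (use ij a0 wt(2)[of "- kH i" j] wt(2)[of "- kH j" i] com[of i j QF] Hc in auto)
    have "w_of_q B f (GF i) \<otimes> w_of_q B f (GF j) = w_of_q B f (GF j) \<otimes> w_of_q B f (GF i)"
      unfolding sE[OF ij(1)] sE[OF ij(2)] using ij e by (simp add: mult.commute)
    then show "w_of_q B f (Z i) \<otimes> w_of_q B f (Z j) = w_of_q B f (Z j) \<otimes> w_of_q B f (Z i)"
      using Z f by (elim insertE) (simp_all del: w_of_q.simps)
  qed (use HH H0 in auto)
qed

end

context cartan
begin

text \<open>The reverse translation. A model of wU with J = 1 supplies only the toral elements
  attached to s_i h_i and d_i, so a compatible \<eta> on the full lattice is required in addition.
  Coproduct, counit and antipode of U_q, and the faithful module below, are all obtained from this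
  lemma.\<close>

lemma q_satI:
  fixes B (structure)
  assumes B: "kalgebra B" and hc: "h : w_gens I \<rightarrow> carrier B" and hs: "w_sat B h" and hJ: "h GJ = \<one>"
    and \<eta>: "!!x. x : lat ==> \<eta> x : carrier B" "\<eta> 0 = \<one>"
      "!!x y. x : lat ==> y : lat ==> \<eta> x \<otimes> \<eta> y = \<eta> (x + y)"
      "!!x i. x : lat ==> i : I ==> \<eta> x \<otimes> h (GE i) = q powi (- \<alpha> i x) \<odot> (h (GE i) \<otimes> \<eta> x)"
      "!!x i. x : lat ==> i : I ==> \<eta> x \<otimes> h (GF i) = q powi \<alpha> i x \<odot> (h (GF i) \<otimes> \<eta> x)"
      "!!i. i : I ==> \<eta> (kH i) = h (GKb i)"
    and f: "!!i. i : I ==> f (QE i) = h (GF i) \<otimes> h (GK i)"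
      "!!i. i : I ==> f (QF i) = h (GKb i) \<otimes> h (GE i)" "!!x. x : lat ==> f (QH x) = \<eta> x"
  shows "q_sat B f"
proof -
  interpret M: w_model I a s q m \<kappa> \<kappa>' B h
    by (intro w_model.intro w_model_axioms.intro cartan_axioms kalg.intro B hc hs)
  have P: "M.P = \<one>" by (simp add: M.P_def hJ)
  have [simp]: "x : lat ==> \<eta> x : carrier B" for x by (rule \<eta>)
  have \<eta>c: "\<eta> x \<otimes> \<eta> y = \<eta> y \<otimes> \<eta> x" if "x : lat" "y : lat" for x y
    using \<eta>(3) that by (simp add: add.commute)
  have K: "\<eta> (- kH i) = M.K i" if "i : I" for i
  proof -
    have "\<eta> (- kH i) = \<eta> (- kH i) \<otimes> (M.Kb i \<otimes> M.K i)"
      using that by (simp add: M.KKb P)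
    also have "... = (\<eta> (- kH i) \<otimes> \<eta> (kH i)) \<otimes> M.K i"
      using that \<eta>(6) by (simp add: M.B.m_assoc)
    also have "... = M.K i" using that \<eta>(2) \<eta>(3)[of "- kH i" "kH i"] by simp
    finally show ?thesis .
  qed
  have cj: "\<eta> x \<otimes> y \<otimes> \<eta> (- x) = c \<odot> y"
    if "x : lat" "y : carrier B" "\<eta> x \<otimes> y = c \<odot> (y \<otimes> \<eta> x)" for x y c
    using that \<eta>(2) \<eta>(3)[of x "- x"] by (simp add: M.B.m_assoc)
  have wt: "\<eta> x \<otimes> f (QE i) = q powi \<alpha> i x \<odot> (f (QE i) \<otimes> \<eta> x)"
    "\<eta> x \<otimes> f (QF i) = q powi (- \<alpha> i x) \<odot> (f (QF i) \<otimes> \<eta> x)"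
    if x: "x : lat" "i : I" for x i
  proof -
    have "\<eta> x \<otimes> f (QE i) = (\<eta> x \<otimes> M.F i) \<otimes> M.K i" using x f by (simp add: M.B.m_assoc)
    then show "\<eta> x \<otimes> f (QE i) = q powi \<alpha> i x \<odot> (f (QE i) \<otimes> \<eta> x)"
      unfolding \<eta>(5)[OF x] using x f \<eta>c[of x "- kH i"] K by (simp add: M.B.m_assoc)
    have "\<eta> x \<otimes> f (QF i) = M.Kb i \<otimes> (\<eta> x \<otimes> M.E i)"
      using x f \<eta>c[of x "kH i"] \<eta>(6) by (simp flip: M.B.m_assoc)
    then show "\<eta> x \<otimes> f (QF i) = q powi (- \<alpha> i x) \<odot> (f (QF i) \<otimes> \<eta> x)"
      unfolding \<eta>(4)[OF x] using x f by (simp add: M.B.m_assoc)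
  qed
  have Fswap: "f (QF i) = qi i powi (- a i i) \<odot> (M.E i \<otimes> M.Kb i)" if "i : I" for i
    using f(2)[OF that] M.KE(2)[OF that that] by simp
  show ?thesis
    unfolding q_sat_def
  proof (intro conjI allI impI)
    show "f (QH 0) = \<one>" using f \<eta> by simp
    show "f (QH x) \<otimes> f (QH y) = f (QH (x + y))" if "x : lat & y : lat" for x y using f \<eta> that by simp
    show "f (QH x) \<otimes> f (QE i) \<otimes> f (QH (- x)) = q powi \<alpha> i x \<odot> f (QE i)" if "x : lat & i : I" for x i
      using cj[of x "f (QE i)"] wt[of x i] f that by simp
    show "f (QH x) \<otimes> f (QF i) \<otimes> f (QH (- x)) = q powi (- \<alpha> i x) \<odot> f (QF i)" if "x : lat & i : I" for x i
      using cj[of x "f (QF i)"] wt[of x i] f that by simp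
  next
    fix i j assume "i : I & j : I"
    then have ij: "i : I" "j : I" by auto
    have "ef_rel B (qi j) (j = i) (M.E j) (M.F i) (M.K j) (M.Kb j)"
      using hs ij unfolding w_sat_def by blast
    then have "ef_rel B (qi j) (j = i) (M.F i \<otimes> M.K i) (M.Kb j \<otimes> M.E j) (M.Kb j) (M.K j)"
      by (rule M.B.ef_rel_twisted(2)[rotated -1, where b = "qi j powi (- a j j)" and d = "qi i powi a i j"])
        (use ij M.KE(2)[OF ij(2,2)] M.KF(2)[OF ij] M.KE(1)[OF ij(2,1)] weight_sym[OF ij] M.KK M.KKb P
          in "auto simp: power_int_minus")
    then show "ef_rel B (qi i) (i = j) (f (QE i)) (f (QF j)) (f (q_k s i)) (f (q_k_inv s i))"
      using ij f K \<eta>(6) by (cases "i = j") (simp_all add: ef_rel_def q_k_eq)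
  next
    fix i j :: nat and Z :: "nat => qgen"
    assume A: "i : I & j : I & i ~= j & a i i = 2 & Z : {QE, QF}"
    then have ij: "i : I" "j : I" "i ~= j" "a i i = 2" by auto
    have "M.B.serre (qi i) (n_ij i j) (f (QE i)) (f (QE j)) = \<zero>"
      using M.tau_serre_F[OF ij, of 1 1] ij by (simp add: f)
    moreover have "M.B.serre (qi i) (n_ij i j) (f (QF i)) (f (QF j)) = \<zero>"
      unfolding Fswap[OF ij(1)] Fswap[OF ij(2)] by (rule M.tau_serre_E[OF ij])
    ultimately show "M.B.serre (qi i) (n_ij i j) (f (Z i)) (f (Z j)) = \<zero>" using A by auto
  next
    fix i j :: nat and Z :: "nat => qgen"
    assume A: "i : I & j : I & a i j = 0 & Z : {QE, QF}"
    then have ij: "i : I" "j : I" "a i j = 0" by auto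
    have "f (QE i) \<otimes> f (QE j) = f (QE j) \<otimes> f (QE i)"
      using M.tau_commute(2)[OF ij] ij by (simp add: f)
    moreover have "f (QF i) \<otimes> f (QF j) = f (QF j) \<otimes> f (QF i)"
      unfolding Fswap[OF ij(1)] Fswap[OF ij(2)] using M.tau_commute(1)[OF ij] ij by (simp add: mult.commute)
    ultimately show "f (Z i) \<otimes> f (Z j) = f (Z j) \<otimes> f (Z i)" using A by auto
  qed
qed

section \<open>The structure maps of U_q, inherited from its model of the weak relations\<close>

interpretation Q: presented "q_gens I" qrels
  by (rule presented.intro) (rule qrels_closed)

abbreviation WQ where "WQ == presented_algebra (q_gens I) qrels"
abbreviation q_mult (infixl "\<star>" 70) where "x \<star> y == x \<otimes>\<^bsub>WQ\<^esub> y"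
abbreviation gq where "gq == presented.gen (q_gens I) qrels"

lemma q_sat_W: "q_sat WQ gq"
  using q_sat_iff[OF Q.W.is_kalgebra Q.gen_funcset] Q.relation_holds by blast

lemma q_hom:
  assumes B: "kalgebra B" and f: "f : q_gens I \<rightarrow> carrier B" "q_sat B f"
  shows "algebra_hom WQ B (generator_extend B f)" "x : q_gens I ==> generator_extend B f (gq x) = f x"
proof -
  have r: "lin B (word_value B f) r = \<zero>\<^bsub>B\<^esub>" if r: "r : qrels" for r
    using q_sat_iff[OF B f(1)] f(2) r by blast
  show "algebra_hom WQ B (generator_extend B f)"
    by (rule Q.generator_extend_hom[OF B f(1) r])
  show "x : q_gens I ==> generator_extend B f (gq x) = f x"
    by (rule Q.generator_extend_gen[OF B f(1) r])
qed

definition hq where "hq = w_of_q WQ gq"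

lemma hq_simps [simp]:
  "hq GJ = \<one>\<^bsub>WQ\<^esub>" "hq (GE i) = gq (QH (- kH i)) \<star> gq (QF i)"
  "hq (GF i) = gq (QE i) \<star> gq (QH (kH i))" "hq (GK i) = gq (QH (- kH i))" "hq (GKb i) = gq (QH (kH i))"
  "hq (GD i) = gq (QH (- dH i))" "hq (GDb i) = gq (QH (dH i))"
  by (simp_all add: hq_def)

lemma w_sat_hq: "w_sat WQ hq"
  unfolding hq_def by (rule w_sat_w_of_q[OF Q.W.is_kalgebra Q.gen_funcset q_sat_W])

lemma hq_closed: "hq : w_gens I \<rightarrow> carrier WQ"
  unfolding hq_def by (rule w_of_q_closed[OF Q.W.is_kalgebra Q.gen_funcset])

lemma w_model_hq: "w_model I a s q m \<kappa> \<kappa>' WQ hq"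
  by (intro w_model.intro w_model_axioms.intro cartan_axioms Q.W.kalg_axioms hq_closed w_sat_hq)

interpretation N: w_model I a s q m \<kappa> \<kappa>' WQ hq by (rule w_model_hq)

interpretation QQ: tens WQ WQ ..

lemma N_P: "N.P = \<one>\<^bsub>WQ\<^esub>" "N.e0 i = \<one>\<^bsub>WQ\<^esub>" "N.f0 i = \<one>\<^bsub>WQ\<^esub>"
  by (simp_all add: N.e0_def N.f0_def N.P_def)

lemma q_class_eq: "w : lists (q_gens I) ==> q_class I a s q w c = c \<odot>\<^bsub>WQ\<^esub> word_value WQ gq w"
  unfolding q_class_def by (rule Q.cls_single)

lemma q_class_gen: "x : q_gens I ==> q_class I a s q [x] 1 = gq x" "q_class I a s q [] 1 = \<one>\<^bsub>WQ\<^esub>"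
  by (simp_all add: q_class_eq)

lemma q_algebra_eq: "q_algebra I a s q = WQ"
  by (simp add: q_algebra_def)

lemma gq_H: "gq (QH 0) = \<one>\<^bsub>WQ\<^esub>" "x : lat ==> y : lat ==> gq (QH x) \<star> gq (QH y) = gq (QH (x + y))"
  using q_sat_W[unfolded q_sat_def, THEN conjunct1]
    q_sat_W[unfolded q_sat_def, THEN conjunct2, THEN conjunct1] by auto

lemma gq_HH: "x : lat ==> gq (QH x) \<star> gq (QH (- x)) = \<one>\<^bsub>WQ\<^esub>" "x : lat ==> gq (QH (- x)) \<star> gq (QH x) = \<one>\<^bsub>WQ\<^esub>"
  by (simp_all add: gq_H)

lemmas hq_weight = w_of_q_weight[OF Q.W.is_kalgebra Q.gen_funcset q_sat_W, folded hq_def]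

lemma q_comult_gen_simps:
  "i : I ==> q_comult_gen I a s q (QE i) =
    QQ.tn (gq (QE i)) (gq (QH (- kH i))) \<oplus>\<^bsub>QQ.T\<^esub> QQ.tn \<one>\<^bsub>WQ\<^esub> (gq (QE i))"
  "i : I ==> q_comult_gen I a s q (QF i) =
    QQ.tn (gq (QH (kH i))) (gq (QF i)) \<oplus>\<^bsub>QQ.T\<^esub> QQ.tn (gq (QF i)) \<one>\<^bsub>WQ\<^esub>"
  "h : lat ==> q_comult_gen I a s q (QH h) = QQ.tn (gq (QH h)) (gq (QH h))"
  by (simp_all add: q_algebra_eq q_class_gen q_k_eq)

text \<open>U_q \<otimes> U_q carries the model \<open>N.cop\<close>, for which the weak relations
  are already known; multiplying its values by toral elements gives the prescribed coproducts of e_i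
  and f_i.\<close>

lemma q_sat_comult:
  "q_comult_gen I a s q : q_gens I \<rightarrow> carrier QQ.T" "q_sat QQ.T (q_comult_gen I a s q)"
proof -
  show "q_comult_gen I a s q : q_gens I \<rightarrow> carrier QQ.T"
    by (auto elim!: q_gen_cases simp: q_comult_gen_simps simp del: q_comult_gen.simps)
  show "q_sat QQ.T (q_comult_gen I a s q)"
  proof (rule q_satI[OF QQ.kalgebra_tensor N.cop_closed N.w_sat_cop, where \<eta> = "%x. QQ.tn (gq (QH x)) (gq (QH x))"])
    fix x i assume x: "x : lat" "i : I"
    note [simp] = q_comult_gen_simps
    show "QQ.tn (gq (QH x)) (gq (QH x)) \<otimes>\<^bsub>QQ.T\<^esub> N.cop (GE i) =
        q powi (- \<alpha> i x) \<odot>\<^bsub>QQ.T\<^esub> (N.cop (GE i) \<otimes>\<^bsub>QQ.T\<^esub> QQ.tn (gq (QH x)) (gq (QH x)))"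
      using x hq_weight(1)[OF x] unfolding N.cop.simps N_P
      by (simp del: hq_simps(2) add: QQ.T.l_distr QQ.T.r_distr QQ.tn_smult_left QQ.tn_smult_right QQ.T.smult_add_right gq_H add.commute)
    show "QQ.tn (gq (QH x)) (gq (QH x)) \<otimes>\<^bsub>QQ.T\<^esub> N.cop (GF i) =
        q powi \<alpha> i x \<odot>\<^bsub>QQ.T\<^esub> (N.cop (GF i) \<otimes>\<^bsub>QQ.T\<^esub> QQ.tn (gq (QH x)) (gq (QH x)))"
      using x hq_weight(2)[OF x] unfolding N.cop.simps N_P
      by (simp del: hq_simps(3) add: QQ.T.l_distr QQ.T.r_distr QQ.tn_smult_left QQ.tn_smult_right QQ.T.smult_add_right gq_H add.commute)
  next
    fix i assume i: "i : I"
    show "q_comult_gen I a s q (QE i) = N.cop (GF i) \<otimes>\<^bsub>QQ.T\<^esub> N.cop (GK i)"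
      using i unfolding q_comult_gen_simps(1)[OF i] N.cop.simps N_P
      by (simp add: QQ.T.l_distr Q.W.m_assoc gq_HH)
    show "q_comult_gen I a s q (QF i) = N.cop (GKb i) \<otimes>\<^bsub>QQ.T\<^esub> N.cop (GE i)"
      using i unfolding q_comult_gen_simps(2)[OF i] N.cop.simps N_P
      by (simp add: QQ.T.r_distr gq_HH flip: Q.W.m_assoc)
  qed (simp_all add: q_comult_gen_simps gq_H QQ.one_T del: q_comult_gen.simps)
qed

definition \<Delta>q where "\<Delta>q = generator_extend QQ.T (q_comult_gen I a s q)"
definition epsq where "epsq = (generator_extend base_field q_counit_gen :: _ => 'k)"

lemmas \<Delta>q_hom = q_hom(1)[OF QQ.kalgebra_tensor q_sat_comult, folded \<Delta>q_def]
lemmas \<Delta>q_gen = q_hom(2)[OF QQ.kalgebra_tensor q_sat_comult, folded \<Delta>q_def]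

lemma epsq_hom: "algebra_hom WQ base_field epsq"
  and epsq_gen: "x : q_gens I ==> epsq (gq x) = q_counit_gen x"
proof -
  have "q_sat base_field (q_counit_gen :: qgen => 'k)"
    by (rule q_satI[OF kalgebra_base_field _ w_sat_counit, where \<eta> = "%_. 1"]) simp_all
  then show "algebra_hom WQ base_field epsq" "x : q_gens I ==> epsq (gq x) = q_counit_gen x"
    unfolding epsq_def using q_hom[OF kalgebra_base_field, of q_counit_gen] by auto
qed

definition Sq where "Sq = qS I a s q"

lemma q_S_gen_simps:
  "i : I ==> q_S_gen I a s q (QE i) = (- 1) \<odot>\<^bsub>WQ\<^esub> (gq (QE i) \<star> gq (QH (kH i)))"
  "i : I ==> q_S_gen I a s q (QF i) = (- 1) \<odot>\<^bsub>WQ\<^esub> (gq (QH (- kH i)) \<star> gq (QF i))"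
  "h : lat ==> q_S_gen I a s q (QH h) = gq (QH (- h))"
  by (simp_all add: q_class_gen q_class_eq q_k_eq)

lemma q_S_closed: "q_S_gen I a s q : q_gens I \<rightarrow> carrier (opposite WQ)"
  by (auto elim!: q_gen_cases simp: q_S_gen_simps simp del: q_S_gen.simps)

text \<open>As for the coproduct, but starting from the model \<open>N.tau\<close> with all scalars
  1 in the opposite algebra.\<close>

lemma q_sat_S: "q_sat (opposite WQ) (q_S_gen I a s q)"
proof (rule q_satI[OF Q.W.kalgebra_opposite, where \<eta> = "%x. gq (QH (- x))" and h = "N.tau (%_. 1)"])
  show "w_sat (opposite WQ) (N.tau (%_. 1))" by (rule N.w_sat_tau) simp
  show "N.tau (%_. 1) : w_gens I \<rightarrow> carrier (opposite WQ)" using N.tau_closed by simp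
  fix x i assume x: "x : lat" "i : I"
  note w = hq_weight[OF lat_closed(3)[OF x(1)] x(2)]
  have E: "hq (GE i) \<star> gq (QH (- x)) = q powi (- \<alpha> i x) \<odot>\<^bsub>WQ\<^esub> (gq (QH (- x)) \<star> hq (GE i))"
    "hq (GF i) \<star> gq (QH (- x)) = q powi \<alpha> i x \<odot>\<^bsub>WQ\<^esub> (gq (QH (- x)) \<star> hq (GF i))"
    unfolding w using x by (simp_all add: power_int_minus del: hq_simps(2,3))
  have H: "gq (QH (kH i)) \<star> gq (QH (- x)) = gq (QH (- x)) \<star> gq (QH (kH i))"
    "gq (QH (- kH i)) \<star> gq (QH (- x)) = gq (QH (- x)) \<star> gq (QH (- kH i))"
    using x by (simp_all add: gq_H add.commute)
  have c: "hq (GE i) : carrier WQ" "hq (GF i) : carrier WQ" using x by auto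
  have 1: "(hq (GE i) \<star> gq (QH (kH i))) \<star> gq (QH (- x)) =
      q powi (- \<alpha> i x) \<odot>\<^bsub>WQ\<^esub> (gq (QH (- x)) \<star> (hq (GE i) \<star> gq (QH (kH i))))"
  proof -
    have "(hq (GE i) \<star> gq (QH (kH i))) \<star> gq (QH (- x)) = (hq (GE i) \<star> gq (QH (- x))) \<star> gq (QH (kH i))"
      using x c H by (simp add: Q.W.m_assoc del: hq_simps(2,3))
    then show ?thesis unfolding E using x c by (simp add: Q.W.m_assoc del: hq_simps(2,3))
  qed
  have 2: "(gq (QH (- kH i)) \<star> hq (GF i)) \<star> gq (QH (- x)) =
      q powi \<alpha> i x \<odot>\<^bsub>WQ\<^esub> (gq (QH (- x)) \<star> (gq (QH (- kH i)) \<star> hq (GF i)))"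
  proof -
    have "(gq (QH (- kH i)) \<star> hq (GF i)) \<star> gq (QH (- x)) = gq (QH (- kH i)) \<star> (hq (GF i) \<star> gq (QH (- x)))"
      using x c by (simp add: Q.W.m_assoc del: hq_simps(2,3))
    also have "... = q powi \<alpha> i x \<odot>\<^bsub>WQ\<^esub> ((gq (QH (- kH i)) \<star> gq (QH (- x))) \<star> hq (GF i))"
      unfolding E using x c by (simp add: Q.W.m_assoc del: hq_simps(2,3))
    finally show ?thesis unfolding H using x c by (simp add: Q.W.m_assoc del: hq_simps(2,3))
  qed
  show "gq (QH (- x)) \<otimes>\<^bsub>opposite WQ\<^esub> N.tau (%_. 1) (GE i) =
      q powi (- \<alpha> i x) \<odot>\<^bsub>opposite WQ\<^esub> (N.tau (%_. 1) (GE i) \<otimes>\<^bsub>opposite WQ\<^esub> gq (QH (- x)))"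
    using x c 1 by (simp del: hq_simps(2,3) add: mult.commute)
  show "gq (QH (- x)) \<otimes>\<^bsub>opposite WQ\<^esub> N.tau (%_. 1) (GF i) =
      q powi \<alpha> i x \<odot>\<^bsub>opposite WQ\<^esub> (N.tau (%_. 1) (GF i) \<otimes>\<^bsub>opposite WQ\<^esub> gq (QH (- x)))"
    using x c 2 by (simp del: hq_simps(2,3) add: mult.commute)
next
  fix i assume i: "i : I"
  show "q_S_gen I a s q (QE i) = N.tau (%_. 1) (GF i) \<otimes>\<^bsub>opposite WQ\<^esub> N.tau (%_. 1) (GK i)"
    using i unfolding q_S_gen_simps(1)[OF i] by (simp add: gq_HH flip: Q.W.m_assoc)
  show "q_S_gen I a s q (QF i) = N.tau (%_. 1) (GKb i) \<otimes>\<^bsub>opposite WQ\<^esub> N.tau (%_. 1) (GE i)"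
    using i unfolding q_S_gen_simps(2)[OF i] by (simp add: gq_HH Q.W.m_assoc)
qed (auto simp: q_S_gen_simps gq_H add.commute simp del: q_S_gen.simps)

lemma Sq_hom: "algebra_hom WQ (opposite WQ) Sq"
  and Sq_gen: "x : q_gens I ==> Sq (gq x) = q_S_gen I a s q x"
  unfolding Sq_def qS_def q_algebra_eq
  using q_hom[OF Q.W.kalgebra_opposite q_S_closed q_sat_S] by auto

definition HQ where "HQ = module.extend WQ (bialgebra.fields \<Delta>q epsq)"

lemma Uq_eq: "Uq I a s q = HQ"
  by (simp add: Uq_def HQ_def q_algebra_eq \<Delta>q_def epsq_def)

interpretation QQQ: tens WQ QQ.T ..

lemma \<Delta>q_gens:
  "i : I ==> \<Delta>q (gq (QE i)) = QQ.tn (gq (QE i)) (gq (QH (- kH i))) \<oplus>\<^bsub>QQ.T\<^esub> QQ.tn \<one>\<^bsub>WQ\<^esub> (gq (QE i))"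
  "i : I ==> \<Delta>q (gq (QF i)) = QQ.tn (gq (QH (kH i))) (gq (QF i)) \<oplus>\<^bsub>QQ.T\<^esub> QQ.tn (gq (QF i)) \<one>\<^bsub>WQ\<^esub>"
  "h : lat ==> \<Delta>q (gq (QH h)) = QQ.tn (gq (QH h)) (gq (QH h))" "\<Delta>q \<one>\<^bsub>WQ\<^esub> = QQ.tn \<one>\<^bsub>WQ\<^esub> \<one>\<^bsub>WQ\<^esub>"
  "epsq \<one>\<^bsub>WQ\<^esub> = 1"
  using algebra_homD(2)[OF \<Delta>q_hom] algebra_homD(2)[OF epsq_hom]
  by (simp_all add: \<Delta>q_gen q_comult_gen_simps QQ.one_T del: q_comult_gen.simps)

lemma is_bialgebra_HQ: "is_bialgebra HQ"
  unfolding HQ_def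
proof (rule Q.is_bialgebra_extendI[OF \<Delta>q_hom epsq_hom])
  note D = algebra_homD[OF \<Delta>q_hom] and e = algebra_homD[OF epsq_hom, simplified]
  have b1: "bilinear_map WQ WQ QQQ.T (%x1 x2. QQQ.tn x1 (\<Delta>q x2))"
    by (rule bilinear_map_compose[OF QQQ.bilinear_tn linear_map_id D(1) linear_map_id])
  have b2: "bilinear_map WQ WQ QQQ.T (%x1 x2. Q.W.associator (\<Delta>q x1) x2)"
    by (rule bilinear_map_compose[OF Q.W.bilinear_associator D(1) linear_map_id linear_map_id])
  have b3: "bilinear_map WQ WQ WQ (%x1 x2. epsq x1 \<odot>\<^bsub>WQ\<^esub> x2)"
    by (auto intro!: bilinear_mapI linear_mapI simp: e Q.W.smult_add_left Q.W.smult_add_right mult.commute)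
  have b4: "bilinear_map WQ WQ WQ (%x1 x2. epsq x2 \<odot>\<^bsub>WQ\<^esub> x1)"
    by (auto intro!: bilinear_mapI linear_mapI simp: e Q.W.smult_add_left Q.W.smult_add_right mult.commute)
  note s1 = QQ.tensor_extend_tensor[OF QQQ.T.kmod_axioms b1] QQ.tensor_extend_add[OF QQQ.T.kmod_axioms b1]
  note s2 = QQ.tensor_extend_tensor[OF QQQ.T.kmod_axioms b2] QQ.tensor_extend_add[OF QQQ.T.kmod_axioms b2]
  note s3 = QQ.tensor_extend_tensor[OF Q.W.kmod_axioms b3] QQ.tensor_extend_add[OF Q.W.kmod_axioms b3]
  note s4 = QQ.tensor_extend_tensor[OF Q.W.kmod_axioms b4] QQ.tensor_extend_add[OF Q.W.kmod_axioms b4]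
  fix x assume x: "x : q_gens I"
  show "tensor_extend QQQ.T (%x1 x2. QQQ.tn x1 (\<Delta>q x2)) (\<Delta>q (gq x)) =
      tensor_extend QQQ.T (%x1 x2. Q.W.associator (\<Delta>q x1) x2) (\<Delta>q (gq x))"
    by (rule q_gen_cases[OF x]) (simp_all add: \<Delta>q_gens s1 s2 Q.W.associator_add QQQ.tn_add_right QQQ.T.a_ac)
  show "tensor_extend WQ (%x1 x2. epsq x1 \<odot>\<^bsub>WQ\<^esub> x2) (\<Delta>q (gq x)) = gq x"
    by (rule q_gen_cases[OF x]) (simp_all add: \<Delta>q_gens s3 epsq_gen)
  show "tensor_extend WQ (%x1 x2. epsq x2 \<odot>\<^bsub>WQ\<^esub> x1) (\<Delta>q (gq x)) = gq x"
    by (rule q_gen_cases[OF x]) (simp_all add: \<Delta>q_gens s4 epsq_gen)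
qed

end

section \<open>Transport of Hopf algebra structures\<close>

text \<open>Surjectivity lets every element, and the linearity of S', be lifted to \<open>H\<close>,
  while convolutions are carried along by the compatibility with coproducts. Applied to the map onto
  \<open>Uq'\<close>, this yields the antipode axioms there without a separate verification.\<close>

lemma is_hopf_algebra_transport:
  assumes H: "is_hopf_algebra H S" and H': "is_bialgebra H'" and \<phi>: "algebra_hom H H' \<phi>"
    and surj: "\<phi> ` carrier H = carrier H'"
    and \<Delta>: "!!x. x : carrier H ==>
      tensor_extend (tensor_algebra H' H') (%x1 x2. tensor H' H' (\<phi> x1) (\<phi> x2)) (comult H x) = comult H' (\<phi> x)"
    and eps: "!!x. x : carrier H ==> counit H' (\<phi> x) = counit H x"
    and S: "!!x. x : carrier H ==> \<phi> (S x) = S' (\<phi> x)"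
  shows "is_hopf_algebra H' S'"
proof -
  interpret H: bialg H by (rule bialg.intro) (use H in "simp add: is_hopf_algebra_def")
  interpret H': bialg H' by (rule bialg.intro) (rule H')
  note p = algebra_homD[OF \<phi>]
  have ex: "EX x:carrier H. y = \<phi> x" if "y : carrier H'" for y
    using that[folded surj] by (simp only: image_iff)
  have lS: "linear_map H H S" using H by (simp add: is_hopf_algebra_def)
  note s = linear_mapD[OF lS]
  have S'c: "S' y : carrier H'" if "y : carrier H'" for y
  proof -
    from ex[OF that] obtain x where x: "x : carrier H" "y = \<phi> x" ..
    show ?thesis using p(3)[OF s(1)[OF x(1)]] S[OF x(1)] x(2) by simp
  qed
  have lS': "linear_map H' H' S'"
  proof (rule linear_mapI)
    fix y y' c assume y: "y : carrier H'"
    from ex[OF this] obtain x where x: "x : carrier H" "y = \<phi> x" ..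
    show "S' y : carrier H'" by (rule S'c[OF y])
    show "S' (c \<odot>\<^bsub>H'\<^esub> y) = c \<odot>\<^bsub>H'\<^esub> S' y"
      using x s p S[of x] S[of "c \<odot>\<^bsub>H\<^esub> x"] by simp
    assume "y' : carrier H'"
    from ex[OF this] obtain x' where x': "x' : carrier H" "y' = \<phi> x'" ..
    show "S' (y \<oplus>\<^bsub>H'\<^esub> y') = S' y \<oplus>\<^bsub>H'\<^esub> S' y'"
      using x x' s p S[of x] S[of x'] S[of "x \<oplus>\<^bsub>H\<^esub> x'"] by simp
  qed
  have id: "linear_map H' H' id" and id0: "linear_map H H id" by (auto intro: linear_mapI)
  have conv: "convolution H' f' k' (\<phi> x) = \<phi> (convolution H f k x)"
    if x: "x : carrier H" and f: "linear_map H H f" "linear_map H H k" "linear_map H' H' f'" "linear_map H' H' k'"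
      and c: "!!x. x : carrier H ==> \<phi> (f x) = f' (\<phi> x)" "!!x. x : carrier H ==> \<phi> (k x) = k' (\<phi> x)" for x f k f' k'
  proof -
    have d: "comult H x : carrier H.HH.T" using x by simp
    have b: "bilinear_map H H H'.HH.T (%x1 x2. H'.HH.tn (\<phi> x1) (\<phi> x2))"
      by (rule bilinear_map_compose[OF H'.HH.bilinear_tn p(1) p(1) linear_map_id])
    note b' = H'.bilinear_mult[OF f(3,4)]
    have b'': "bilinear_map H H H' (%x1 x2. f' (\<phi> x1) \<otimes>\<^bsub>H'\<^esub> k' (\<phi> x2))"
      by (rule bilinear_map_compose[OF b' p(1) p(1) linear_map_id])
    have "convolution H' f' k' (\<phi> x) = tensor_extend H' (%x1 x2. f' x1 \<otimes>\<^bsub>H'\<^esub> k' x2)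
        (tensor_extend H'.HH.T (%x1 x2. H'.HH.tn (\<phi> x1) (\<phi> x2)) (comult H x))"
      unfolding convolution_def \<Delta>[OF x, symmetric] ..
    also have "... = tensor_extend H' (%x1 x2. tensor_extend H' (%x1 x2. f' x1 \<otimes>\<^bsub>H'\<^esub> k' x2) (H'.HH.tn (\<phi> x1) (\<phi> x2))) (comult H x)"
      by (rule H.HH.tensor_extend_compose[OF H'.HH.T.kmod_axioms b H'.kmod_axioms H'.HH.tensor_extend_linear[OF H'.kmod_axioms b'] d])
    also have "... = tensor_extend H' (%x1 x2. f' (\<phi> x1) \<otimes>\<^bsub>H'\<^esub> k' (\<phi> x2)) (comult H x)"
      by (rule H.HH.tensor_extend_cong[OF H'.kmod_axioms b'' _ d])
        (simp add: H'.HH.tensor_extend_tensor[OF H'.kmod_axioms b'] p)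
    also have "... = tensor_extend H' (%x1 x2. \<phi> (f x1 \<otimes>\<^bsub>H\<^esub> k x2)) (comult H x)"
      by (rule H.HH.tensor_extend_cong[OF H'.kmod_axioms b'' _ d, symmetric])
        (use linear_mapD(1)[OF f(1)] linear_mapD(1)[OF f(2)] p(4) c in simp)
    also have "... = \<phi> (convolution H f k x)"
      unfolding convolution_def
      by (rule H.HH.tensor_extend_compose[OF H.kmod_axioms H.bilinear_mult[OF f(1,2)] H'.kmod_axioms p(1) d, symmetric])
    finally show ?thesis .
  qed
  have "convolution H' S' id y = counit H' y \<odot>\<^bsub>H'\<^esub> \<one>\<^bsub>H'\<^esub> & convolution H' id S' y = counit H' y \<odot>\<^bsub>H'\<^esub> \<one>\<^bsub>H'\<^esub>"
    if "y : carrier H'" for y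
  proof -
    from ex[OF that] obtain x where x: "x : carrier H" "y = \<phi> x" ..
    have "convolution H S id x = counit H x \<odot>\<^bsub>H\<^esub> \<one>\<^bsub>H\<^esub>" "convolution H id S x = counit H x \<odot>\<^bsub>H\<^esub> \<one>\<^bsub>H\<^esub>"
      using H x by (simp_all add: is_hopf_algebra_def)
    moreover have "convolution H' S' id y = \<phi> (convolution H S id x)" "convolution H' id S' y = \<phi> (convolution H id S x)"
      unfolding x(2) by (rule conv; use x lS id0 lS' id S in simp)+
    ultimately show ?thesis using x eps p by simp
  qed
  then show ?thesis using H' lS' by (simp add: is_hopf_algebra_def)
qed

section \<open>The Hopf algebras \<open>U\<^sup>\<tau> J\<^sup>m\<^sup>-\<^sup>1\<close> and \<open>U'\<^sub>q\<close>\<close>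

context cartan
begin

interpretation W: presented "w_gens I" wrels
  by (rule presented.intro) (rule wrels_closed)

interpretation M: w_model I a s q m \<kappa> \<kappa>' WA g by (rule w_model_W)

interpretation WW: tens WA WA ..

interpretation U: bialg U by (rule bialg.intro) (rule is_bialgebra_U)

definition PC where "PC = (%x. x \<cdot> M.P) ` UC"
definition UP where "UP = sub_bialgebra U PC M.P"

lemma UtauP_eq: "UtauP I a s q m \<kappa> \<kappa>' = UP"
  by (simp add: UtauP_def Utau_eq wP_eq UP_def PC_def)

lemma PC_iff: "x : PC \<longleftrightarrow> x : UC & x \<cdot> M.P = x"
proof -
  have "y \<cdot> M.P \<cdot> M.P = y \<cdot> M.P" if "y : UC" for y
    using that UC_carrier by (simp add: W.W.m_assoc)
  then show ?thesis
    unfolding PC_def using UC_closed(5)[OF _ UC_gens(1)] by (auto simp: image_iff)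
qed

lemma PC_P: "x : PC ==> x \<cdot> M.P = x" "x : PC ==> M.P \<cdot> x = x"
  using PC_iff P_central_UC by auto

lemma PC_UC: "x : PC ==> x : UC" "x : PC ==> x : carrier WA"
  using PC_iff UC_carrier by auto

lemma UP_facts: "M.P : UG" "comult U M.P = tensor U U M.P M.P"
  using UG_facts(2)[of M.P] by (auto simp: UG_def)

interpretation SP: sub_bialg U PC "M.P"
proof (unfold_locales, simp_all only: U_simps)
  show "PC <= UC" using PC_UC by auto
  show "\<zero>\<^bsub>WA\<^esub> : PC" unfolding PC_iff using UC_closed(6)[OF UC_closed(2), of 0] by simp
  show "M.P : PC" unfolding PC_iff by simp
  show "x \<oplus>\<^bsub>WA\<^esub> y : PC" "x \<cdot> y : PC" if "x : PC" "y : PC" for x y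
    using that UC_closed UC_carrier unfolding PC_iff by (simp_all add: W.W.l_distr W.W.m_assoc)
  show "c \<bullet> x : PC" if "x : PC" for c x
    using that UC_closed UC_carrier unfolding PC_iff by simp
qed (use PC_P UP_facts eps_P in auto)

lemma SP_S: "sub_bialgebra U PC M.P = UP"
  by (simp add: UP_def)

text \<open>Since x = x P and P is group-like, \<Delta>(x) = \<Delta>(x) (P \<otimes> P), and right
  multiplication by P \<otimes> P maps U \<otimes> U into the image of the corner.\<close>

lemma UP_comult_im: "x : PC ==> EX t:carrier (tensor_algebra UP UP). SP.emb t = comult U x"
proof -
  assume x: "x : PC"
  note ic = SP.emb_image_closed[unfolded SP_S]
  have "EX t':carrier (tensor_algebra UP UP). SP.emb t' = t \<otimes>\<^bsub>U.HH.T\<^esub> U.HH.tn M.P M.P" if "t : carrier U.HH.T" for t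
    using that
  proof (induction rule: U.HH.tensor_induct)
    case (tensor y z)
    then have "y \<cdot> M.P : PC" "z \<cdot> M.P : PC" by (auto simp: PC_def)
    from ic(4)[OF this] show ?case using tensor by simp
  next
    case (add t t')
    then show ?case using ic(1)[OF add(3,4)] by (simp add: U.HH.T.l_distr)
  qed
  from this[of "comult U x"]
  have "EX t':carrier (tensor_algebra UP UP). SP.emb t' = comult U x \<otimes>\<^bsub>U.HH.T\<^esub> comult U M.P"
    using x PC_UC UP_facts by simp
  moreover have "comult U (x \<otimes>\<^bsub>U\<^esub> M.P) = comult U x \<otimes>\<^bsub>U.HH.T\<^esub> comult U M.P"
    by (rule algebra_homD(4)[OF U.comult_hom]) (use x PC_UC in simp_all)
  ultimately show ?thesis using PC_P(1)[OF x] by simp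
qed

lemma is_bialgebra_UP: "is_bialgebra UP"
  using SP.is_bialgebra_S[unfolded SP_S, OF UP_comult_im] .

interpretation UP: bialg UP by (rule bialg.intro) (rule is_bialgebra_UP)

lemma UP_simps [simp]:
  "carrier UP = PC" "\<one>\<^bsub>UP\<^esub> = M.P" "\<zero>\<^bsub>UP\<^esub> = \<zero>\<^bsub>WA\<^esub>"
  "x \<oplus>\<^bsub>UP\<^esub> y = x \<oplus>\<^bsub>WA\<^esub> y" "x \<otimes>\<^bsub>UP\<^esub> y = x \<cdot> y" "c \<odot>\<^bsub>UP\<^esub> x = c \<bullet> x" "counit UP = eps"
  by (simp_all add: UP_def)

lemma T_PC: "x : PC ==> T x : PC"
proof -
  assume x: "x : PC"
  have "T (x \<cdot> M.P) = M.P \<cdot> T x"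
    using algebra_homD(4)[OF T_hom, of x M.P] x PC_UC T_P by simp
  then show ?thesis
    using PC_P(1)[OF x] P_central_UC[of "T x"] T_UC[of x] PC_UC(1)[OF x] by (simp add: PC_iff)
qed

text \<open>Convolutions on the corner agree with those on U, and P acts as the identity there, so
  antipode identities that hold after multiplication by P become exact.\<close>

lemma is_hopf_UP: "is_hopf_algebra UP T"
proof -
  interpret WH: weak_hopf_data U M.P T th UG "g ` GE ` I" "g ` GF ` I" by (rule weak_hopf_data_U)
  have lin: "linear_map UP UP T"
    by (rule linear_mapI) (use T_PC algebra_homD[OF T_hom] PC_UC in simp_all)
  have id: "linear_map UP UP id" "linear_map U U id" by (auto intro: linear_mapI)
  have conv: "convolution UP f k x = eps x \<bullet> M.P"
    if x: "x : PC" and f: "linear_map UP UP f" "linear_map UP UP k" "linear_map U U f" "linear_map U U k"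
      and P: "M.P \<cdot> convolution U f k x = eps x \<bullet> M.P" for f k x
  proof -
    have "convolution UP f k x = convolution U f k x"
      by (rule SP.convolution_S[unfolded SP_S, OF UP_comult_im f(3,4)])
        (use x linear_mapD(1)[OF f(1)] linear_mapD(1)[OF f(2)] in auto)
    moreover have "convolution UP f k x : PC"
      unfolding convolution_def
      using UP.HH.tensor_extend_closed[OF UP.kmod_axioms UP.bilinear_mult[OF f(1,2)], of "comult UP x"] x by simp
    ultimately show ?thesis using P PC_P(2) by metis
  qed
  show ?thesis
    unfolding is_hopf_algebra_def
    using is_bialgebra_UP lin conv[OF _ lin id(1) WH.T_linear id(2)] conv[OF _ id(1) lin id(2) WH.T_linear]
      WH.convolution_P PC_UC(1) by simp
qed

interpretation Q: presented "q_gens I" qrels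
  by (rule presented.intro) (rule qrels_closed)

interpretation N: w_model I a s q m \<kappa> \<kappa>' WQ hq by (rule w_model_hq)

interpretation QQ: tens WQ WQ ..

interpretation HQ: bialg HQ by (rule bialg.intro) (rule is_bialgebra_HQ)

lemma HQ_simps [simp]:
  "carrier HQ = carrier WQ" "\<one>\<^bsub>HQ\<^esub> = \<one>\<^bsub>WQ\<^esub>" "\<zero>\<^bsub>HQ\<^esub> = \<zero>\<^bsub>WQ\<^esub>"
  "x \<oplus>\<^bsub>HQ\<^esub> y = x \<oplus>\<^bsub>WQ\<^esub> y" "x \<otimes>\<^bsub>HQ\<^esub> y = x \<star> y" "c \<odot>\<^bsub>HQ\<^esub> x = c \<odot>\<^bsub>WQ\<^esub> x"
  "comult HQ = \<Delta>q" "counit HQ = epsq"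
  by (simp_all add: HQ_def)

lemma HQ_tensor: "tensor_algebra HQ HQ = QQ.T" "tensor HQ HQ = QQ.tn"
  by (rule tensor_algebra_cong; simp add: HQ_def)+

section \<open>The subalgebra \<open>Uq'\<close> as a bialgebra\<close>

abbreviation slat where "slat == scaled_coweight_lattice I s"

definition vgens where "vgens = QE ` I Un QF ` I Un QH ` slat"
definition VC where "VC = generated_subalgebra HQ (gq ` vgens)"
definition V where "V = sub_bialgebra HQ VC \<one>\<^bsub>WQ\<^esub>"

lemma slat_lat: "h : slat ==> h : lat" by (simp add: scaled_coweight_lattice_def)

lemma slat_closed [simp]: "h : slat ==> - h : slat" "i : I ==> kH i : slat" "i : I ==> dH i : slat"
  "h : slat ==> h' : slat ==> h + h' : slat" "0 : slat"
  by (auto simp: scaled_coweight_lattice_def lookup_single lookup_add when_def)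

lemma vgens_subset: "x : vgens ==> x : q_gens I"
  using slat_lat by (auto simp: vgens_def)

lemma Uq'_eq: "Uq' I a s q = V"
proof -
  have "(%x. q_class I a s q [x] 1) ` vgens = gq ` vgens"
    by (rule image_cong) (auto simp: q_class_gen dest: vgens_subset)
  then show ?thesis
    by (simp add: Uq'_def Uq_eq V_def VC_def vgens_def)
qed

lemma vgens_sub: "gq ` vgens <= carrier HQ"
  by (auto dest!: vgens_subset)

lemmas VC_closed = HQ.generated_closed[OF vgens_sub, folded VC_def, simplified]

lemma VC_carrier: "x : VC ==> x : carrier WQ" using VC_closed(1) by auto

lemma VC_gens [simp]: "i : I ==> gq (QE i) : VC" "i : I ==> gq (QF i) : VC" "h : slat ==> gq (QH h) : VC"
  using VC_closed(3) by (auto simp: vgens_def)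

interpretation SV: sub_bialg HQ VC "\<one>\<^bsub>WQ\<^esub>"
proof (unfold_locales, simp_all only: HQ_simps HQ_tensor)
  show "VC <= carrier WQ" by (rule VC_closed(1))
  show "\<zero>\<^bsub>WQ\<^esub> : VC" using VC_closed(6)[OF VC_closed(2), of 0] by simp
qed (use VC_closed VC_carrier \<Delta>q_gens in auto)

lemma SV_S: "sub_bialgebra HQ VC \<one>\<^bsub>WQ\<^esub> = V"
  by (simp add: V_def)

lemma V_comult_im: "x : VC ==> EX t:carrier (tensor_algebra V V). SV.emb t = comult HQ x"
proof (rule SV.comult_image_generated[OF VC_def vgens_sub, unfolded SV_S])
  note ic = SV.emb_image_closed[unfolded SV_S HQ_tensor]
  fix y assume "y : gq ` vgens"
  then consider h where "h : slat" "y = gq (QH h)" | i where "i : I" "y = gq (QE i)" | i where "i : I" "y = gq (QF i)"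
    by (auto simp: vgens_def)
  then have "EX t:carrier (tensor_algebra V V). SV.emb t = \<Delta>q y"
  proof cases
    case (1 h)
    show ?thesis
      unfolding 1(2) \<Delta>q_gens(3)[OF slat_lat[OF 1(1)]] by (intro ic(4)) (use 1 in auto)
  next
    case (2 i)
    show ?thesis
      unfolding 2(2) \<Delta>q_gens(1)[OF 2(1)] by (intro ic(1,4)) (use 2 VC_closed(2) in auto)
  next
    case (3 i)
    show ?thesis
      unfolding 3(2) \<Delta>q_gens(2)[OF 3(1)] by (intro ic(1,4)) (use 3 VC_closed(2) in auto)
  qed
  then show "EX t:carrier (tensor_algebra V V). SV.emb t = comult HQ y" by simp
qed simp_all

lemma is_bialgebra_V: "is_bialgebra V"
  using SV.is_bialgebra_S[unfolded SV_S, OF V_comult_im] .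

lemma V_simps [simp]:
  "carrier V = VC" "\<one>\<^bsub>V\<^esub> = \<one>\<^bsub>WQ\<^esub>" "\<zero>\<^bsub>V\<^esub> = \<zero>\<^bsub>WQ\<^esub>"
  "x \<oplus>\<^bsub>V\<^esub> y = x \<oplus>\<^bsub>WQ\<^esub> y" "x \<otimes>\<^bsub>V\<^esub> y = x \<star> y" "c \<odot>\<^bsub>V\<^esub> x = c \<odot>\<^bsub>WQ\<^esub> x" "counit V = epsq"
  by (simp_all add: V_def)

section \<open>The homomorphism from wU to U_q and its compatibility with the Hopf
  structures\<close>

definition Phi where "Phi = generator_extend WQ hq"

lemmas Phi_hom = w_hom(1)[OF Q.W.is_kalgebra hq_closed w_sat_hq refl, folded Phi_def]
lemmas Phi_gen = w_hom(2)[OF Q.W.is_kalgebra hq_closed w_sat_hq refl, folded Phi_def]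
lemmas Phi_simps = algebra_homD[OF Phi_hom]

lemma Phi_P: "Phi M.P = \<one>\<^bsub>WQ\<^esub>" "Phi (M.e0 i) = \<one>\<^bsub>WQ\<^esub>" "Phi (M.f0 i) = \<one>\<^bsub>WQ\<^esub>"
proof -
  show "Phi M.P = \<one>\<^bsub>WQ\<^esub>"
    unfolding M.P_def by (simp add: hom_pow[OF Q.W.is_kalgebra Phi_hom] Phi_gen)
  then show "Phi (M.e0 i) = \<one>\<^bsub>WQ\<^esub>" "Phi (M.f0 i) = \<one>\<^bsub>WQ\<^esub>"
    using Phi_simps(2) by (simp_all add: M.e0_def M.f0_def)
qed

lemma bilinear_Phi: "bilinear_map WA WA QQ.T (%x1 x2. QQ.tn (Phi x1) (Phi x2))"
  by (rule bilinear_map_compose[OF QQ.bilinear_tn Phi_simps(1) Phi_simps(1) linear_map_id])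

lemma Phi_comult:
  assumes "x : carrier WA"
  shows "tensor_extend QQ.T (%x1 x2. QQ.tn (Phi x1) (Phi x2)) (\<Delta> x) = \<Delta>q (Phi x)"
proof (rule W.presented_hom_eqI[OF QQ.kalgebra_tensor _ algebra_hom_comp[OF Phi_hom \<Delta>q_hom] _ assms])
  show "algebra_hom WA QQ.T (%x. tensor_extend QQ.T (%x1 x2. QQ.tn (Phi x1) (Phi x2)) (\<Delta> x))"
    by (rule algebra_hom_comp[OF \<Delta>_hom WW.tensor_extend_hom[OF QQ.T.kmod_axioms bilinear_Phi QQ.kalgebra_tensor refl]])
      (simp_all add: Phi_simps QQ.one_T)
  fix x assume x: "x : w_gens I"
  note te = WW.tensor_extend_tensor[OF QQ.T.kmod_axioms bilinear_Phi] WW.tensor_extend_add[OF QQ.T.kmod_axioms bilinear_Phi]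
  note d = algebra_homD(4)[OF \<Delta>q_hom]
  show "tensor_extend QQ.T (%x1 x2. QQ.tn (Phi x1) (Phi x2)) (\<Delta> (g x)) = \<Delta>q (Phi (g x))"
    by (rule w_gen_cases[OF x])
      (simp_all add: \<Delta>_gen te Phi_gen Phi_P \<Delta>q_gens d QQ.T.l_distr QQ.T.r_distr gq_HH)
qed

lemma Phi_counit: "x : carrier WA ==> epsq (Phi x) = eps x"
proof (rule W.presented_hom_eqI[OF kalgebra_base_field algebra_hom_comp[OF Phi_hom epsq_hom] eps_hom])
  fix x assume x: "x : w_gens I"
  note e = algebra_homD(4)[OF epsq_hom]
  show "epsq (Phi (g x)) = eps (g x)"
    by (rule w_gen_cases[OF x]) (simp_all add: Phi_gen eps_gen epsq_gen e \<Delta>q_gens)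
qed

lemma Phi_T: "x : carrier WA ==> Phi (T x) = Sq (Phi x)"
proof (rule W.presented_hom_eqI[OF Q.W.kalgebra_opposite _ algebra_hom_comp[OF Phi_hom Sq_hom]])
  have "algebra_hom (opposite WA) (opposite WQ) Phi"
    by (intro algebra_homI linear_mapI) (simp_all add: Phi_simps)
  then show "algebra_hom WA (opposite WQ) (%x. Phi (T x))" by (rule algebra_hom_comp[OF T_hom])
  fix x assume x: "x : w_gens I"
  note S = algebra_homD[OF Sq_hom, simplified]
  show "Phi (T (g x)) = Sq (Phi (g x))"
    by (rule w_gen_cases[OF x])
      (simp_all add: T_gen Phi_gen Phi_simps Sq_gen S q_S_gen_simps Q.W.m_assoc del: q_S_gen.simps)
qed

lemma Phi_VC: "x : UC ==> Phi x : VC"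
proof (induction rule: UC_induct)
  case (mult s y)
  have c: "s : carrier WA" "y : carrier WA" using mult ugens_sub UC_carrier by auto
  have "Phi s : VC"
    using mult(1) by (auto simp: ugens_def Phi_P Phi_gen intro!: VC_closed elim!: w_toral_cases)
  then show ?case using mult c by (simp add: Phi_simps VC_closed)
qed (use UC_carrier VC_closed in "auto simp: Phi_simps")

definition scl :: "(coweight => int => int) => (coweight \<Rightarrow>\<^sub>0 int) => (coweight \<Rightarrow>\<^sub>0 int)" where
  "scl f v = (\<Sum>k\<in>keys v. single k (f k (lookup v k)))"

lemma lookup_scl: "f k 0 = 0 ==> lookup (scl f v) k = f k (lookup v k)"
  unfolding scl_def lookup_sum lookup_single
  by (cases "k : keys v") (auto simp: when_def in_keys_iff sum.delta)

text \<open>Rescaling h_i to s_i h_i identifies the full lattice with the scaled one. Induction and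
  the universal property for free abelian groups thereby apply to the latter.\<close>

definition mul_s where "mul_s = scl (%k c. case k of CH i => int (s i) * c | CD i => c)"
definition div_s where "div_s = scl (%k c. case k of CH i => c div int (s i) | CD i => c)"

lemma lookup_mul_s: "lookup (mul_s v) k = (case k of CH i => int (s i) * lookup v k | CD i => lookup v k)"
  and lookup_div_s: "lookup (div_s v) k = (case k of CH i => lookup v k div int (s i) | CD i => lookup v k)"
  unfolding mul_s_def div_s_def by (subst lookup_scl; simp split: coweight.splits)+

lemma mul_s_simps: "mul_s (x - y) = mul_s x - mul_s y" "mul_s 0 = 0"
  "mul_s (frag_of (CH i)) = kH i" "mul_s (frag_of (CD i)) = dH i"
  by (rule poly_mapping_eqI;
      simp add: lookup_mul_s lookup_minus lookup_single when_def algebra_simps split: coweight.splits)+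

lemma div_s_lat: "h : lat ==> keys (div_s h) <= CH ` I Un CD ` I"
proof
  fix k assume h: "h : lat" and "k : keys (div_s h)"
  then have "lookup h k ~= 0"
    by (auto simp: in_keys_iff lookup_div_s split: coweight.splits)
  then show "k : CH ` I Un CD ` I" using h unfolding lat_iff by (auto simp: in_keys_iff)
qed

lemma mul_div_s: "h : slat ==> mul_s (div_s h) = h"
proof (rule poly_mapping_eqI)
  fix k assume h: "h : slat"
  show "lookup (mul_s (div_s h)) k = lookup h k"
  proof (cases k)
    case (CH i)
    have "int (s i) dvd lookup h (CH i)"
    proof (cases "i : I")
      case False
      then have "lookup h (CH i) = 0"
        using slat_lat[OF h] unfolding lat_iff by (auto simp: in_keys_iff subset_iff)
      then show ?thesis by simp
    qed (use h in "simp add: scaled_coweight_lattice_def")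
    then show ?thesis using CH by (simp add: lookup_mul_s lookup_div_s)
  qed (simp add: lookup_mul_s lookup_div_s)
qed

text \<open>The toral part is generated by the images of K_i, D_i and their weak inverses. The
  elements e_i and f_i are the images of F_i K_i and Kb_i E_i, and P may be inserted freely because
  its image is 1.\<close>

lemma Phi_surj: "Phi ` PC = VC"
proof
  show "Phi ` PC <= VC" using Phi_VC PC_UC by auto
  have im: "Phi ` PC = Phi ` UC"
    unfolding PC_def using UC_carrier by (force simp: Phi_simps Phi_P image_image)
  let ?D = "Phi ` UC"
  \<comment> \<open>The induction rule builds differences, so y and - y are treated
    together.\<close>
  have H: "keys y <= CH ` I Un CD ` I ==>
      mul_s y : lat & gq (QH (mul_s y)) : ?D & gq (QH (- mul_s y)) : ?D" for y
  proof (induction y rule: frag_induction)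
    case zero
    have "\<one>\<^bsub>WQ\<^esub> : ?D" using UC_closed(2) Phi_simps(2) by (metis imageI)
    then show ?case by (simp add: mul_s_simps gq_H)
  next
    case (one k)
    have "gq (QH (kH i)) : ?D & gq (QH (- kH i)) : ?D & gq (QH (dH i)) : ?D & gq (QH (- dH i)) : ?D"
      if "i : I" for i
      using that imageI[OF UC_gens(2)[of "GK i"], of Phi] imageI[OF UC_gens(2)[of "GKb i"], of Phi]
        imageI[OF UC_gens(2)[of "GD i"], of Phi] imageI[OF UC_gens(2)[of "GDb i"], of Phi] by (simp add: Phi_gen)
    then show ?case using one by (auto simp: mul_s_simps)
  next
    case (diff x y)
    have mult: "u \<star> v : ?D" if "u : ?D" "v : ?D" for u v
      using that UC_closed(5) UC_carrier Phi_simps(4) by (auto simp: image_iff) metis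
    have "gq (QH (mul_s (x - y))) = gq (QH (mul_s x)) \<star> gq (QH (- mul_s y))"
      "gq (QH (- mul_s (x - y))) = gq (QH (mul_s y)) \<star> gq (QH (- mul_s x))"
      using diff by (simp_all add: gq_H mul_s_simps)
    then show ?case using diff mult by (simp add: mul_s_simps)
  qed
  have "VC <= ?D"
    unfolding VC_def
  proof (rule HQ.generated_minimal)
    show "?D <= carrier HQ" using Phi_simps(3) UC_carrier by auto
    show "\<one>\<^bsub>HQ\<^esub> : ?D" using UC_closed(2) Phi_simps(2) by (metis imageI HQ_simps(2))
    fix x y c assume "x : ?D"
    then obtain x' where x': "x' : UC" "x = Phi x'" by auto
    show "c \<odot>\<^bsub>HQ\<^esub> x : ?D" using x' imageI[OF UC_closed(6)[OF x'(1)], of Phi c] UC_carrier by (simp add: Phi_simps)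
    assume "y : ?D"
    then obtain y' where y': "y' : UC" "y = Phi y'" by auto
    show "x \<oplus>\<^bsub>HQ\<^esub> y : ?D" "x \<otimes>\<^bsub>HQ\<^esub> y : ?D"
      using x' y' imageI[OF UC_closed(4)[OF x'(1) y'(1)], of Phi] imageI[OF UC_closed(5)[OF x'(1) y'(1)], of Phi] UC_carrier
      by (simp_all add: Phi_simps)
  next
    show "gq ` vgens <= ?D"
    proof
      fix y assume "y : gq ` vgens"
      then consider h where "h : slat" "y = gq (QH h)" | i where "i : I" "y = gq (QE i)" | i where "i : I" "y = gq (QF i)"
        by (auto simp: vgens_def)
      then show "y : ?D"
      proof cases
        case (1 h)
        then show ?thesis using H[OF div_s_lat[OF slat_lat]] mul_div_s by force
      next
        case (2 i)
        have "Phi (g (GF i) \<cdot> g (GK i)) = y" using 2 by (simp add: Phi_simps Phi_gen gq_HH Q.W.m_assoc)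
        moreover have "g (GF i) \<cdot> g (GK i) : UC" using 2 UC_closed(5) by simp
        ultimately show ?thesis by blast
      next
        case (3 i)
        have "Phi (g (GKb i) \<cdot> g (GE i)) = y" using 3 by (simp add: Phi_simps Phi_gen gq_HH flip: Q.W.m_assoc)
        moreover have "g (GKb i) \<cdot> g (GE i) : UC" using 3 UC_closed(5) by simp
        ultimately show ?thesis by blast
      qed
    qed
  qed
  then show "VC <= Phi ` PC" using im by simp
qed

interpretation HW: bialg HW by (rule bialg.intro) (rule is_bialgebra_HW)

interpretation SU: sub_bialg HW UC "\<one>\<^bsub>WA\<^esub>" by (rule sub_bialg_UC)

interpretation V: bialg V by (rule bialg.intro) (rule is_bialgebra_V)

text \<open>The comparison takes place in U_q \<otimes> U_q, into which the tensor square of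
  \<open>Uq'\<close> embeds. There the coproducts of the corner and of U are both that of wU, for
  which \<open>Phi_comult\<close> holds.\<close>

lemma Phi_comult_UP:
  assumes x: "x : PC"
  shows "tensor_extend (tensor_algebra V V) (%x1 x2. tensor V V (Phi x1) (Phi x2)) (comult UP x) = comult V (Phi x)"
    (is "?L = _")
proof -
  have xU: "x : UC" "x : carrier WA" using x PC_UC by auto
  have Phix: "Phi x : VC" by (rule Phi_VC[OF xU(1)])
  note te = SU.tensor_extend_emb[unfolded SU_S] SP.tensor_extend_emb[unfolded SP_S]
  have U: "SU.emb (comult U x) = \<Delta> x"
    by (rule SU.comult_S(2)[unfolded SU_S HW_simps, OF U_comult_im[unfolded HW_simps]]) (use xU in auto)
  have P: "SP.emb (comult UP x) = comult U x"
    by (rule SP.comult_S(2)[unfolded SP_S, OF UP_comult_im]) (use x in auto)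
  have V: "SV.emb (comult V (Phi x)) = \<Delta>q (Phi x)" "comult V (Phi x) : carrier V.HH.T"
    by (rule SV.comult_S[unfolded SV_S HQ_simps, OF V_comult_im[unfolded HQ_simps]]; use Phix in auto)+
  have l: "linear_map UP V Phi"
    by (rule linear_mapI) (use Phi_VC PC_UC Phi_simps in simp_all)
  have bW: "bilinear_map HW HW QQ.T (%x1 x2. QQ.tn (Phi x1) (Phi x2))"
    using bilinear_Phi by (simp add: bilinear_map_def linear_map_def)
  have bU: "bilinear_map U U QQ.T (%x1 x2. QQ.tn (Phi x1) (Phi x2))"
    using SU.bilinear_restrict[OF bW] unfolding SU_S .
  have bP: "bilinear_map UP UP QQ.T (%x1 x2. QQ.tn (Phi x1) (Phi x2))"
    using SP.bilinear_restrict[OF bU] unfolding SP_S .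
  have b: "bilinear_map UP UP V.HH.T (%x1 x2. V.HH.tn (Phi x1) (Phi x2))"
    by (rule bilinear_map_compose[OF V.HH.bilinear_tn l l linear_map_id])
  have d: "comult UP x : carrier UP.HH.T" and dU: "comult U x : carrier U.HH.T" using x xU by simp_all
  have "SV.emb ?L = tensor_extend QQ.T (%x1 x2. SV.emb (V.HH.tn (Phi x1) (Phi x2))) (comult UP x)"
    by (rule UP.HH.tensor_extend_compose[OF V.HH.T.kmod_axioms b QQ.T.kmod_axioms SV.emb_linear[unfolded SV_S HQ_tensor] d])
  also have "... = tensor_extend QQ.T (%x1 x2. QQ.tn (Phi x1) (Phi x2)) (comult UP x)"
    by (rule UP.HH.tensor_extend_cong[OF QQ.T.kmod_axioms bP _ d])
      (use SV.emb_tensor[unfolded SV_S HQ_tensor] Phi_VC PC_UC in simp)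
  also have "... = tensor_extend QQ.T (%x1 x2. QQ.tn (Phi x1) (Phi x2)) (comult U x)"
    using te(2)[OF QQ.T.kmod_axioms bU d] P by simp
  also have "... = tensor_extend QQ.T (%x1 x2. QQ.tn (Phi x1) (Phi x2)) (\<Delta> x)"
    using te(1)[OF QQ.T.kmod_axioms bW dU] U by simp
  also have "... = SV.emb (comult V (Phi x))"
    using Phi_comult[OF xU(2)] V by simp
  finally have "SV.emb ?L = SV.emb (comult V (Phi x))" .
  then show ?thesis
    by (rule SV.emb_inj[unfolded SV_S, rotated 2])
      (use UP.HH.tensor_extend_closed[OF V.HH.T.kmod_axioms b d] V in auto)
qed

lemma Phi_hom_UP: "algebra_hom UP V Phi"
  by (intro algebra_homI linear_mapI) (use Phi_VC PC_UC Phi_simps Phi_P in simp_all)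

theorem is_hopf_V: "is_hopf_algebra V Sq"
  by (rule is_hopf_algebra_transport[OF is_hopf_UP is_bialgebra_V Phi_hom_UP _ Phi_comult_UP])
    (use Phi_surj Phi_counit Phi_T PC_UC in simp_all)

theorem hopf_isomorphic_UP_V:
  assumes inj: "inj_on Phi PC"
  shows "hopf_isomorphic UP T V Sq"
  unfolding hopf_isomorphic_def
  using is_hopf_UP is_hopf_V Phi_hom_UP Phi_comult_UP Phi_surj Phi_counit Phi_T PC_UC inj
  by (intro conjI exI[of _ Phi]) (simp_all add: bij_betw_def)

section \<open>Faithfulness\<close>

text \<open>The algebra \<open>U\<^sub>q\<close> acts on functions \<open>u\<close> from the lattice to \<open>wU J\<^sup>m\<^sup>-\<^sup>1\<close>: the element \<open>q\<^sup>h\<close> by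
  translation, and \<open>E\<^sub>i\<close>, \<open>F\<^sub>i\<close> pointwise by left multiplication, twisted by the weights.  Translations
  by \<open>s\<^sub>i h\<^sub>i\<close> and \<open>d\<^sub>i\<close> are required to coincide with the multiplications by \<open>Kb\<^sub>i\<close> and \<open>Db\<^sub>i\<close>.
  At the origin, the action of the image of \<open>x \<in> U\<^sup>\<tau>\<close> is multiplication by \<open>x\<close>.\<close>

definition fm :: "((coweight \<Rightarrow>\<^sub>0 int) => (wgen list \<Rightarrow>\<^sub>0 'k) set) set" where
  "fm = {u. (\<forall>v. u v : carrier WA & M.P \<cdot> u v = u v) &
    (ALL i:I. \<forall>v. u (v + kH i) = M.Kb i \<cdot> u v & u (v + dH i) = g (GDb i) \<cdot> u v)}"

lemma fmD:
  assumes "u : fm"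
  shows "u v : carrier WA" "M.P \<cdot> u v = u v" "i : I ==> u (v + kH i) = M.Kb i \<cdot> u v"
    "i : I ==> u (v + dH i) = g (GDb i) \<cdot> u v"
  using assms by (simp_all add: fm_def)

lemma fmI:
  assumes "!!v. u v : carrier WA" "!!v. M.P \<cdot> u v = u v" "!!i v. i : I ==> u (v + kH i) = M.Kb i \<cdot> u v"
    "!!i v. i : I ==> u (v + dH i) = g (GDb i) \<cdot> u v"
  shows "u : fm"
  using assms by (simp add: fm_def)

definition FM where "FM = function_module WA fm"

lemma FM_simps [simp]: "carrier FM = fm" "\<zero>\<^bsub>FM\<^esub> = (%_. \<zero>\<^bsub>WA\<^esub>)"
  "u \<oplus>\<^bsub>FM\<^esub> u' = (%v. u v \<oplus>\<^bsub>WA\<^esub> u' v)" "c \<odot>\<^bsub>FM\<^esub> u = (%v. c \<bullet> u v)"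
  by (simp_all add: FM_def)

lemma fm_closed:
  "(%_. \<zero>\<^bsub>WA\<^esub>) : fm" "u : fm ==> u' : fm ==> (%v. u v \<oplus>\<^bsub>WA\<^esub> u' v) : fm"
  "u : fm ==> (%v. c \<bullet> u v) : fm" "u : fm ==> (%v. u (v + x)) : fm"
proof -
  show "(%_. \<zero>\<^bsub>WA\<^esub>) : fm" by (rule fmI) simp_all
  assume u: "u : fm"
  note [simp] = fmD[OF u]
  show "(%v. c \<bullet> u v) : fm" by (rule fmI) simp_all
  show "(%v. u (v + x)) : fm"
  proof (rule fmI)
    show "u (v + kH i + x) = M.Kb i \<cdot> u (v + x)" if "i : I" for i v
      using fmD(3)[OF u that, of "v + x"] by (simp add: ac_simps)
    show "u (v + dH i + x) = g (GDb i) \<cdot> u (v + x)" if "i : I" for i v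
      using fmD(4)[OF u that, of "v + x"] by (simp add: ac_simps)
  qed simp_all
  assume u': "u' : fm"
  note [simp] = fmD[OF u']
  show "(%v. u v \<oplus>\<^bsub>WA\<^esub> u' v) : fm" by (rule fmI) (simp_all add: W.W.r_distr)
qed

abbreviation EF where "EF == endo_algebra FM"

interpretation FM: kmod FM
  unfolding FM_def by (rule W.W.kmod_function_module) (simp_all add: fm_closed fmD)

interpretation EM: kalg "EF"
  by (rule kalg.intro) (rule FM.kalgebra_endo)

lemmas fe_eqI = FM.endo_eqI[unfolded FM_simps]

text \<open>Translation by x changes these values by the factor q^(-\<alpha>_i(x)), respectively
  q^(\<alpha>_i(x)), which is the weight with which q^x has to pass E_i, respectively F_i.\<close>

fun fwt :: "wgen => (coweight \<Rightarrow>\<^sub>0 int) => 'k" where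
  "fwt (GE i) v = q powi (- \<alpha> i v)"
| "fwt (GF i) v = q powi \<alpha> i v"
| "fwt _ v = 1"

text \<open>A representation of U_q needs a model in which J acts as the identity; on values fixed
  by P this is achieved by letting P act in place of J.\<close>

definition gJ where "gJ x = (if x = GJ then M.P else g x)"

lemma gJ_simps [simp]: "gJ GJ = M.P" "x ~= GJ ==> gJ x = g x" "x : w_gens I ==> gJ x : carrier WA"
  by (auto simp: gJ_def)

definition frep where "frep x = endo FM (%u v. fwt x v \<bullet> (gJ x \<cdot> u v))"

lemma frep_apply: "u : fm ==> frep x u v = fwt x v \<bullet> (gJ x \<cdot> u v)"
  by (simp add: frep_def)

text \<open>The conditions on \<open>c\<close> say that the change of the scalar under translation
  compensates for the commutation of y with Kb_j and Db_j; equivariance is then preserved.\<close>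

lemma fm_op:
  assumes u: "u : fm" and [simp]: "y : carrier WA" and P: "M.P \<cdot> y = y \<cdot> M.P"
    and K: "!!j v. j : I ==> c (v + kH j) \<bullet> (y \<cdot> M.Kb j) = c v \<bullet> (M.Kb j \<cdot> y)"
    and D: "!!j v. j : I ==> c (v + dH j) \<bullet> (y \<cdot> g (GDb j)) = c v \<bullet> (g (GDb j) \<cdot> y)"
  shows "(%v. c v \<bullet> (y \<cdot> u v)) : fm"
proof (rule fmI)
  note [simp] = fmD(1)[OF u]
  fix v
  have "M.P \<cdot> (y \<cdot> u v) = y \<cdot> u v"
    using P fmD(2)[OF u] by (simp add: W.W.m_assoc flip: W.W.m_assoc[of M.P y])
  then show "M.P \<cdot> (c v \<bullet> (y \<cdot> u v)) = c v \<bullet> (y \<cdot> u v)" by simp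
  fix j assume j: "j : I"
  have "c (v + kH j) \<bullet> (y \<cdot> u (v + kH j)) = (c (v + kH j) \<bullet> (y \<cdot> M.Kb j)) \<cdot> u v"
    using j by (simp add: fmD(3)[OF u] W.W.m_assoc)
  then show "c (v + kH j) \<bullet> (y \<cdot> u (v + kH j)) = M.Kb j \<cdot> (c v \<bullet> (y \<cdot> u v))"
    unfolding K[OF j] using j by (simp add: W.W.m_assoc)
  have "c (v + dH j) \<bullet> (y \<cdot> u (v + dH j)) = (c (v + dH j) \<bullet> (y \<cdot> g (GDb j))) \<cdot> u v"
    using j by (simp add: fmD(4)[OF u] W.W.m_assoc)
  then show "c (v + dH j) \<bullet> (y \<cdot> u (v + dH j)) = g (GDb j) \<cdot> (c v \<bullet> (y \<cdot> u v))"
    unfolding D[OF j] using j by (simp add: W.W.m_assoc)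
qed (use fmD(1)[OF u] in simp)

lemma frep_maps:
  assumes "x : w_gens I" "u : fm"
  shows "(%v. fwt x v \<bullet> (gJ x \<cdot> u v)) : fm"
proof -
  have t: "(%v. 1 \<bullet> (y \<cdot> u v)) : fm"
    if "y : carrier WA" "!!z. z : w_toral I ==> y \<cdot> g z = g z \<cdot> y" "M.P \<cdot> y = y \<cdot> M.P" for y
    by (rule fm_op) (use that assms in auto)
  have tor: "(%v. fwt x v \<bullet> (gJ x \<cdot> u v)) : fm" if x: "x : w_toral I"
  proof -
    have "fwt x v = 1" "gJ x = g x" for v using x by (auto elim!: w_toral_cases)
    then show ?thesis using t[of "g x"] x M.toral_comm[of x] M.P_toral_comm by simp
  qed
  show ?thesis
  proof (rule w_gens_cases[OF assms(1)])
    assume "x = GJ"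
    then show ?thesis using t[of M.P] M.P_toral_comm by simp
  next
    fix i assume i: "i : I" "x = GE i"
    have "(%v. q powi (- \<alpha> i v) \<bullet> (g (GE i) \<cdot> u v)) : fm"
      by (rule fm_op[OF assms(2)])
        (use i M.KE[OF i(1)] M.DE[OF i(1)] in "auto simp: kH_weight M.dwt_def power_int_add power_int_minus mult.commute power_int_diff divide_inverse")
    then show ?thesis using i by simp
  next
    fix i assume i: "i : I" "x = GF i"
    have "(%v. q powi \<alpha> i v \<bullet> (g (GF i) \<cdot> u v)) : fm"
      by (rule fm_op[OF assms(2)])
        (use i M.KF[OF i(1)] M.DF[OF i(1)] in "auto simp: kH_weight M.dwt_def power_int_add power_int_minus mult.commute")
    then show ?thesis using i by simp
  qed (rule tor)
qed

lemma frep_closed: "x : w_gens I ==> frep x : carrier (EF)"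
  unfolding frep_def
  by (rule FM.endo_closed, rule linear_mapI)
    (simp_all add: frep_maps fmD W.W.r_distr W.W.smult_add_right mult.commute)

lemma frep_fm: "x : w_gens I ==> u : fm ==> frep x u : fm"
  using FM.endo_maps[OF frep_closed, of x u] by simp

lemma frep_apply2: "x : w_gens I ==> y : w_gens I ==> u : fm ==>
  frep x (frep y u) v = (fwt x v * fwt y v) \<bullet> ((gJ x \<cdot> gJ y) \<cdot> u v)"
  by (simp add: frep_apply frep_fm fmD W.W.m_assoc)

text \<open>The operators act at each lattice point separately. At a point v the iterated
  q-commutator is left multiplication by the one formed from the rescaled elements.\<close>

lemma frep_serre:
  assumes xy: "x : w_gens I" "y : w_gens I" and S: "W.W.serre z n (gJ x) (gJ y) = \<zero>\<^bsub>WA\<^esub>"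
  shows "EM.serre z n (frep x) (frep y) = \<zero>\<^bsub>EF\<^esub>"
proof (rule fe_eqI)
  fix u assume u: "u : fm"
  have q: "EM.qad (frep x) d n (frep y) u v =
      W.W.qad (fwt x v \<bullet> gJ x) d n (fwt y v \<bullet> gJ y) \<cdot> u v" if "u : fm" for d n u v
    using that
  proof (induction n arbitrary: u)
    case 0
    then show ?case using xy by (simp add: frep_apply fmD)
  next
    case (Suc n)
    let ?q = "W.W.qad (fwt x v \<bullet> gJ x) d n (fwt y v \<bullet> gJ y)"
    have c: "EM.qad (frep x) d n (frep y) u : fm" "?q : carrier WA"
      using FM.endo_maps[of "EM.qad (frep x) d n (frep y)" u] xy frep_closed Suc by auto
    have "EM.qad (frep x) d (Suc n) (frep y) u v =
        frep x (EM.qad (frep x) d n (frep y) u) v \<oplus>\<^bsub>WA\<^esub> (- d n) \<bullet> EM.qad (frep x) d n (frep y) (frep x u) v"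
      by simp
    also have "... =
        fwt x v \<bullet> (gJ x \<cdot> (?q \<cdot> u v)) \<oplus>\<^bsub>WA\<^esub> (- d n) \<bullet> (?q \<cdot> (fwt x v \<bullet> (gJ x \<cdot> u v)))"
      unfolding frep_apply[OF c(1)] Suc.IH[OF Suc.prems] Suc.IH[OF frep_fm[OF xy(1) Suc.prems]]
        frep_apply[OF Suc.prems] ..
    finally show ?case using c xy fmD(1)[OF Suc.prems] by (simp add: W.W.l_distr W.W.m_assoc)
  qed
  \<comment> \<open>Rescaling is the case of \<open>serre_twisted\<close> in which both twisting
    elements are the unit.\<close>
  have "W.W.serre z n (fwt x v \<bullet> gJ x) (fwt y v \<bullet> gJ y) = \<zero>\<^bsub>WA\<^esub>" for v
    using W.W.serre_twisted[of "gJ x" "gJ y" "\<one>\<^bsub>WA\<^esub>" "\<one>\<^bsub>WA\<^esub>" 1 1 z n "fwt x v" "fwt y v"] S xy by simp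
  then show "EM.serre z n (frep x) (frep y) u = \<zero>\<^bsub>EF\<^esub> u"
    unfolding EM.serre_def W.W.serre_def using q[OF u] fmD(1)[OF u] by (auto simp: fun_eq_iff)
qed (use xy frep_closed in simp_all)

lemma w_sat_frep: "w_sat (EF) frep"
proof (rule w_satI_unit[OF FM.kalgebra_endo])
  show "frep : w_gens I \<rightarrow> carrier (EF)" using frep_closed by auto
  show "frep GJ = \<one>\<^bsub>EF\<^esub>"
    by (rule fe_eqI) (simp_all add: frep_closed frep_apply fmD fun_eq_iff)
  show "frep (GK i) \<otimes>\<^bsub>EF\<^esub> frep (GKb i) = \<one>\<^bsub>EF\<^esub>"
    "frep (GD i) \<otimes>\<^bsub>EF\<^esub> frep (GDb i) = \<one>\<^bsub>EF\<^esub>" if "i : I" for i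
    by (rule fe_eqI; use that in "simp add: frep_closed frep_apply2 M.KKb fmD fun_eq_iff")+
  show "frep x \<otimes>\<^bsub>EF\<^esub> frep y = frep y \<otimes>\<^bsub>EF\<^esub> frep x"
    if "x : w_toral I" "y : w_toral I" for x y
  proof -
    have "gJ x \<cdot> gJ y = gJ y \<cdot> gJ x"
      using M.toral_comm[of x y] that by (auto simp: gJ_def w_toral_def)
    then show ?thesis
      by (intro fe_eqI) (use that in "simp_all add: frep_closed frep_apply2 fun_eq_iff mult.commute")
  qed
next
  fix i j assume ij: "i : I" "j : I"
  show "frep (GK j) \<otimes>\<^bsub>EF\<^esub> frep (GE i) = qi i powi a i j \<odot>\<^bsub>EF\<^esub> (frep (GE i) \<otimes>\<^bsub>EF\<^esub> frep (GK j))"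
    by (rule fe_eqI) (use ij M.KE(1)[OF ij] in "simp_all add: frep_closed frep_apply2 fmD fun_eq_iff mult.commute")
  show "frep (GK j) \<otimes>\<^bsub>EF\<^esub> frep (GF i) = qi i powi (- a i j) \<odot>\<^bsub>EF\<^esub> (frep (GF i) \<otimes>\<^bsub>EF\<^esub> frep (GK j))"
    by (rule fe_eqI) (use ij M.KF(1)[OF ij] in "simp_all add: frep_closed frep_apply2 fmD fun_eq_iff mult.commute")
  have "frep (GD j) \<otimes>\<^bsub>EF\<^esub> frep (GE i) = M.dwt i j \<odot>\<^bsub>EF\<^esub> (frep (GE i) \<otimes>\<^bsub>EF\<^esub> frep (GD j))"
    by (rule fe_eqI) (use ij M.DE(1)[OF ij] in "simp_all add: frep_closed frep_apply2 fmD fun_eq_iff mult.commute")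
  then show "frep (GD j) \<otimes>\<^bsub>EF\<^esub> frep (GE i) = (if i = j then q else 1) \<odot>\<^bsub>EF\<^esub> (frep (GE i) \<otimes>\<^bsub>EF\<^esub> frep (GD j))"
    by (simp add: M.dwt_def)
  have "frep (GD j) \<otimes>\<^bsub>EF\<^esub> frep (GF i) = inverse (M.dwt i j) \<odot>\<^bsub>EF\<^esub> (frep (GF i) \<otimes>\<^bsub>EF\<^esub> frep (GD j))"
    by (rule fe_eqI) (use ij M.DF(1)[OF ij] in "simp_all add: frep_closed frep_apply2 fmD fun_eq_iff mult.commute")
  moreover have "inverse (M.dwt i j) = (if i = j then inverse q else 1)" by (simp add: M.dwt_def)
  ultimately show "frep (GD j) \<otimes>\<^bsub>EF\<^esub> frep (GF i) = (if i = j then inverse q else 1) \<odot>\<^bsub>EF\<^esub> (frep (GF i) \<otimes>\<^bsub>EF\<^esub> frep (GD j))"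
    by simp
  show "ef_rel (EF) (qi i) (i = j) (frep (GE i)) (frep (GF j)) (frep (GK i)) (frep (GKb i))"
    unfolding ef_rel_def
  proof (rule fe_eqI)
    fix u assume u: "u : fm"
    let ?h = "if i = j then (1 / (qi i - inverse (qi i))) \<bullet> (M.K i \<oplus>\<^bsub>WA\<^esub> (- 1) \<bullet> M.Kb i) else \<zero>\<^bsub>WA\<^esub>"
    have c: "?h : carrier WA" using ij by simp
    have "frep (GE i) (frep (GF j) u) v = frep (GF j) (frep (GE i) u) v \<oplus>\<^bsub>WA\<^esub>
        (q powi (- \<alpha> i v) * q powi \<alpha> j v) \<bullet> (?h \<cdot> u v)" for v
      using M.EF[OF ij] c fmD(1)[OF u] ij u
      by (simp add: frep_apply2 W.W.l_distr[OF _ c] W.W.smult_add_right mult.commute del: W.W.smult_mult_left)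
    \<comment> \<open>The two weights are inverse to each other for i = j, and the correction is
      zero otherwise.\<close>
    moreover have "(q powi (- \<alpha> i v) * q powi \<alpha> j v) \<bullet> (?h \<cdot> u v) = ?h \<cdot> u v" for v
      using fmD(1)[OF u] ij by (cases "i = j") (simp_all add: power_int_minus)
    ultimately show "(frep (GE i) \<otimes>\<^bsub>EF\<^esub> frep (GF j)) u = (frep (GF j) \<otimes>\<^bsub>EF\<^esub> frep (GE i) \<oplus>\<^bsub>EF\<^esub>
       (if i = j then 1 / (qi i - inverse (qi i)) \<odot>\<^bsub>EF\<^esub> (frep (GK i) \<oplus>\<^bsub>EF\<^esub> - 1 \<odot>\<^bsub>EF\<^esub> frep (GKb i))
        else \<zero>\<^bsub>EF\<^esub>)) u"
      using ij u fmD(1)[OF u] by (simp add: fun_eq_iff frep_apply W.W.l_distr W.W.smult_add_right)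
  qed (use ij frep_closed in auto)
next
  fix i j :: nat and Z :: "nat => wgen"
  assume A: "i : I" "j : I" "i ~= j" "a i i = 2" "Z : {GE, GF}"
  then show "EM.serre (qi i) (n_ij i j) (frep (Z i)) (frep (Z j)) = \<zero>\<^bsub>EF\<^esub>"
    using M.SE[OF A(1-4)] M.SF[OF A(1-4)] by (intro frep_serre) auto
next
  fix i j :: nat and Z :: "nat => wgen"
  assume A: "i : I" "j : I" "a i j = 0" "Z : {GE, GF}"
  have "gJ (Z i) \<cdot> gJ (Z j) = gJ (Z j) \<cdot> gJ (Z i)" "Z i : w_gens I" "Z j : w_gens I"
    using A M.CE[OF A(1-3)] M.CF[OF A(1-3)] by auto
  then show "frep (Z i) \<otimes>\<^bsub>EF\<^esub> frep (Z j) = frep (Z j) \<otimes>\<^bsub>EF\<^esub> frep (Z i)"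
    by (intro fe_eqI) (simp_all add: frep_closed frep_apply2 fun_eq_iff mult.commute)
qed

definition shift where "shift x = endo FM (%u v. u (v + x))"

lemma shift_apply: "u : fm ==> shift x u v = u (v + x)"
  by (simp add: shift_def)

lemma shift_closed: "shift x : carrier (EF)"
  unfolding shift_def by (rule FM.endo_closed, rule linear_mapI) (simp_all add: fm_closed)

lemma shift_fm: "u : fm ==> shift x u : fm"
  using FM.endo_maps[OF shift_closed, of u x] by simp

text \<open>The equivariance conditions in \<open>fm\<close> give the two positive translations; the
  negative ones follow by multiplying with the weak inverse, because values are fixed by P.\<close>

lemma shift_toral:
  assumes "i : I"
  shows "shift (kH i) = frep (GKb i)" "shift (dH i) = frep (GDb i)" "shift (- kH i) = frep (GK i)" "shift (- dH i) = frep (GD i)"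
proof -
  have inv: "u (v - x) = y \<cdot> u v"
    if "u : fm" "!!v. u (v + x) = y' \<cdot> u v" "y : carrier WA" "y' : carrier WA" "y \<cdot> y' = M.P" for u v x y y'
  proof -
    have "y \<cdot> u v = y \<cdot> (y' \<cdot> u (v - x))" using that(2)[of "v - x"] by simp
    also have "... = u (v - x)" using that fmD[OF that(1)] by (simp flip: W.W.m_assoc)
    finally show ?thesis ..
  qed
  show "shift (kH i) = frep (GKb i)" "shift (dH i) = frep (GDb i)"
    by (rule fe_eqI; use assms in "simp add: shift_closed frep_closed shift_apply frep_apply fmD fun_eq_iff")+
  show "shift (- kH i) = frep (GK i)"
    by (rule fe_eqI)
      (use assms inv[of _ "kH i" "M.Kb i" "M.K i"] fmD(3) M.KKb in "simp_all add: shift_closed frep_closed shift_apply frep_apply fmD(1) fun_eq_iff")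
  show "shift (- dH i) = frep (GD i)"
    by (rule fe_eqI)
      (use assms inv[of _ "dH i" "g (GDb i)" "g (GD i)"] fmD(4) M.KKb in "simp_all add: shift_closed frep_closed shift_apply frep_apply fmD(1) fun_eq_iff")
qed

fun qrep where
  "qrep (QE i) = frep (GF i) \<otimes>\<^bsub>EF\<^esub> frep (GK i)"
| "qrep (QF i) = frep (GKb i) \<otimes>\<^bsub>EF\<^esub> frep (GE i)"
| "qrep (QH x) = shift x"

lemma q_sat_qrep: "q_sat (EF) qrep"
proof (rule q_satI[OF FM.kalgebra_endo _ w_sat_frep, where \<eta> = shift])
  show "frep : w_gens I \<rightarrow> carrier (EF)" using frep_closed by auto
  show "frep GJ = \<one>\<^bsub>EF\<^esub>"
    by (rule fe_eqI) (simp_all add: frep_closed frep_apply fmD fun_eq_iff)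
  show "shift x : carrier (EF)" for x by (rule shift_closed)
  show "shift 0 = \<one>\<^bsub>EF\<^esub>"
    by (rule fe_eqI) (simp_all add: shift_closed shift_apply fun_eq_iff)
  show "shift x \<otimes>\<^bsub>EF\<^esub> shift y = shift (x + y)" for x y
    by (rule fe_eqI) (simp_all add: shift_closed shift_apply shift_fm fun_eq_iff ac_simps)
  show "shift x \<otimes>\<^bsub>EF\<^esub> frep (GE i) = q powi (- \<alpha> i x) \<odot>\<^bsub>EF\<^esub> (frep (GE i) \<otimes>\<^bsub>EF\<^esub> shift x)"
    "shift x \<otimes>\<^bsub>EF\<^esub> frep (GF i) = q powi \<alpha> i x \<odot>\<^bsub>EF\<^esub> (frep (GF i) \<otimes>\<^bsub>EF\<^esub> shift x)"
    if "i : I" for x i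
    by (rule fe_eqI; use that in "simp add: shift_closed frep_closed shift_apply shift_fm frep_apply frep_fm fmD fun_eq_iff
      power_int_add power_int_minus power_int_diff divide_inverse mult.commute")+
qed (simp_all add: shift_toral)

definition qact where "qact = generator_extend (EF) qrep"

lemma qrep_closed: "qrep : q_gens I \<rightarrow> carrier (EF)"
  using frep_closed shift_closed by (auto elim!: q_gen_cases)

lemmas qact_hom = q_hom(1)[OF FM.kalgebra_endo qrep_closed q_sat_qrep, folded qact_def]
lemmas qact_gen = q_hom(2)[OF FM.kalgebra_endo qrep_closed q_sat_qrep, folded qact_def]

lemma qact_Phi_gen:
  assumes "x : ugens"
  shows "qact (Phi (g x)) = frep x"
proof -
  have inv: "frep (GK i) \<otimes>\<^bsub>EF\<^esub> frep (GKb i) = \<one>\<^bsub>EF\<^esub>" if "i : I" for i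
    by (rule fe_eqI; use that in "simp add: frep_closed frep_apply2 M.KKb fmD fun_eq_iff")
  note h = algebra_homD(4)[OF qact_hom] frep_closed shift_toral
  have "Phi (g x) = hq x" using ugens_subset[OF assms] by (rule Phi_gen)
  moreover have "qact (hq x) = frep x"
  proof -
    consider i where "i : I" "x = GE i" | i where "i : I" "x = GF i" | "x : w_toral I"
      using assms by (auto simp: ugens_def)
    then show ?thesis
    proof cases
      case (1 i)
      then show ?thesis using inv[of i] by (simp add: h qact_gen flip: EM.m_assoc)
    next
      case (2 i)
      then show ?thesis using inv[of i] by (simp add: h qact_gen EM.m_assoc)
    next
      case 3
      then show ?thesis by (auto simp: h qact_gen elim!: w_toral_cases)
    qed
  qed
  ultimately show ?thesis by simp
qed

lemma qact_origin:
  assumes "x : UC" "u : fm"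
  shows "qact (Phi x) u 0 = x \<cdot> u 0"
  using assms(1)
proof (induction rule: UC_induct)
  note h = algebra_homD[OF qact_hom] and c = fmD[OF assms(2)]
  case one
  then show ?case using assms(2) c Phi_simps(2) h(2) by simp
next
  note h = algebra_homD[OF qact_hom] and c = fmD[OF assms(2)]
  case (add x y)
  then show ?case using c UC_carrier by (simp add: Phi_simps h W.W.l_distr)
next
  note h = algebra_homD[OF qact_hom] and c = fmD[OF assms(2)]
  case (smult r x)
  then show ?case using c UC_carrier by (simp add: Phi_simps h)
next
  note h = algebra_homD[OF qact_hom] and c = fmD[OF assms(2)]
  case (mult t y)
  have ty: "t : carrier WA" "y : carrier WA" using mult ugens_sub UC_carrier by auto
  have e: "qact (Phi y) : carrier (EF)" using ty h(3) Phi_simps(3) by simp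
  have um: "qact (Phi y) u : fm" using FM.endo_maps[OF e, of u] assms(2) by simp
  have "qact (Phi t) (qact (Phi y) u) 0 = t \<cdot> qact (Phi y) u 0"
  proof (cases "t = M.P")
    case True
    then show ?thesis using um fmD(2)[OF um] by (simp add: Phi_P h(2))
  next
    case False
    then obtain x where x: "x : ugens" "t = g x" using mult(1) by auto
    \<comment> \<open>At the origin all weights are trivial, so the action there is plain
      multiplication.\<close>
    have "fwt x 0 = 1" "x ~= GJ" using x(1) by (auto simp: ugens_def elim!: w_toral_cases)
    then show ?thesis unfolding x(2) qact_Phi_gen[OF x(1)] frep_apply[OF um]
      using fmD(1)[OF um] ugens_subset[OF x(1)] by simp
  qed
  then show ?case using mult ty c by (simp add: Phi_simps h W.W.m_assoc)
qed

text \<open>Toral monomials times P: an abelian group with identity P inside an algebra whose own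
  unit is different. It serves as the target for the universal property of the free abelian
  group.\<close>

inductive_set TC where
  one: "M.P : TC"
| mult: "x : w_toral I ==> t : TC ==> g x \<cdot> t : TC"

lemma TC_carrier: "t : TC ==> t : carrier WA" and TC_P: "t : TC ==> M.P \<cdot> t = t"
proof -
  have "t : carrier WA & M.P \<cdot> t = t" if "t : TC" for t
    using that by induction (auto simp: M.P_toral simp flip: W.W.m_assoc)
  then show "t : TC ==> t : carrier WA" "t : TC ==> M.P \<cdot> t = t" by auto
qed

lemma TC_commute:
  assumes "t : TC" "y : carrier WA" "M.P \<cdot> y = y \<cdot> M.P" "!!x. x : w_toral I ==> g x \<cdot> y = y \<cdot> g x"
  shows "t \<cdot> y = y \<cdot> t"
  using assms(1)
proof induction
  case (mult x t)
  have "(g x \<cdot> t) \<cdot> y = (g x \<cdot> y) \<cdot> t" using mult TC_carrier assms(2) by (simp add: W.W.m_assoc)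
  then show ?case unfolding assms(4)[OF mult(1)] using mult TC_carrier assms(2) by (simp add: W.W.m_assoc)
qed (rule assms(3))

lemma TC_toral: "t : TC ==> x : w_toral I ==> t \<cdot> g x = g x \<cdot> t"
  by (rule TC_commute) (auto simp: M.toral_comm M.P_toral_comm)

lemma TC_comm: "t : TC ==> t' : TC ==> t \<cdot> t' = t' \<cdot> t"
proof (rule TC_commute)
  assume "t' : TC"
  then show "M.P \<cdot> t' = t' \<cdot> M.P"
    using TC_commute[of t' M.P] M.P_toral_comm by simp
qed (auto simp: TC_carrier TC_toral)

lemma TC_mult: "t : TC ==> t' : TC ==> t \<cdot> t' : TC"
proof (induction rule: TC.induct)
  case (mult x t)
  then show ?case using TC.mult[of x "t \<cdot> t'"] TC_carrier by (simp add: W.W.m_assoc)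
qed (simp add: TC_P)

lemma TC_inverse: "t : TC ==> EX t':TC. t' \<cdot> t = M.P"
proof (induction rule: TC.induct)
  case (mult x t)
  then obtain t' where t': "t' : TC" "t' \<cdot> t = M.P" by blast
  have "EX y:w_toral I. g y \<cdot> g x = M.P"
  proof (rule w_toral_cases[OF mult(1)])
    fix i assume i: "i : I"
    show ?thesis if "x = GK i" using i that by (intro bexI[of _ "GKb i"]) (simp_all add: M.KKb)
    show ?thesis if "x = GKb i" using i that by (intro bexI[of _ "GK i"]) (simp_all add: M.KKb)
    show ?thesis if "x = GD i" using i that by (intro bexI[of _ "GDb i"]) (simp_all add: M.KKb)
    show ?thesis if "x = GDb i" using i that by (intro bexI[of _ "GD i"]) (simp_all add: M.KKb)
  qed
  then obtain y where y: "y : w_toral I" "g y \<cdot> g x = M.P" by blast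
  have "(g y \<cdot> t') \<cdot> (g x \<cdot> t) = g y \<cdot> (t' \<cdot> g x) \<cdot> t"
    using mult y t' TC_carrier by (simp add: W.W.m_assoc)
  also have "... = (g y \<cdot> g x) \<cdot> (t' \<cdot> t)"
    unfolding TC_toral[OF t'(1) mult(1)]
    using mult(1) y(1) TC_carrier[OF t'(1)] TC_carrier[OF mult(2)] by (simp add: W.W.m_assoc)
  also have "... = M.P" unfolding y(2) t'(2) by simp
  finally show ?case using TC.mult[OF y(1) t'(1)] by blast
qed (auto intro!: bexI[of _ "M.P"] TC.one)

text \<open>On the scaled lattice, equivariance and the value P at the origin force the character
  sending s_i h_i to Kb_i and d_i to Db_i. It exists because the lattice is free and the toral
  monomials form an abelian group.\<close>

lemma fm_unit: "EX u:fm. u 0 = M.P"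
proof -
  define G where "G = \<lparr>carrier = TC, monoid.mult = (\<cdot>), one = M.P\<rparr>"
  have G: "comm_group G"
  proof (rule comm_groupI, goal_cases)
    case (4 x y)
    then show ?case using TC_comm[of x y] by (simp add: G_def)
  next
    case (6 x)
    then show ?case using TC_inverse[of x] by (simp add: G_def)
  qed (simp_all add: G_def TC_mult TC.one TC_P TC_carrier W.W.m_assoc)
  define \<chi> where "\<chi> k = (case k of CH i => M.Kb i | CD i => g (GDb i))" for k
  have tor: "g x : TC" if "x : w_toral I" for x
    using TC.mult[OF that TC.one] that by (simp add: M.toral_P)
  have "\<chi> ` (CH ` I Un CD ` I) <= carrier G" using tor by (auto simp: \<chi>_def G_def)
  then obtain h where h: "h : hom (free_Abelian_group (CH ` I Un CD ` I)) G"
    "!!x. x : CH ` I Un CD ` I ==> h (frag_of x) = \<chi> x"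
    using comm_group.free_Abelian_group_universal[OF G] by metis
  have h_closed: "h x : TC" if "keys x <= CH ` I Un CD ` I" for x
    using hom_in_carrier[OF h(1)] that by (simp add: G_def)
  have h_add: "h (x + y) = h x \<cdot> h y"
    if "keys x <= CH ` I Un CD ` I" "keys y <= CH ` I Un CD ` I" for x y
    using hom_mult[OF h(1), of x y] that by (simp add: G_def)
  have "h 0 = \<one>\<^bsub>G\<^esub>"
    using hom_one[OF h(1)] G by (simp add: comm_group.axioms)
  then have h0: "h 0 = M.P" by (simp add: G_def)
  \<comment> \<open>Extension by zero respects equivariance: translations by \<open>kH i\<close> and
    \<open>dH i\<close> preserve the scaled lattice and its complement.\<close>
  define u where "u v = (if v : slat then h (div_s v) else \<zero>\<^bsub>WA\<^esub>)" for v
  have div_add: "div_s (v + kH i) = div_s v + frag_of (CH i)" "div_s (v + dH i) = div_s v + frag_of (CD i)" if "i : I" for v i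
    using s_pos[OF that]
    by (auto intro!: poly_mapping_eqI simp: lookup_div_s lookup_add lookup_single when_def split: coweight.splits)
  have slat_add: "v + x : slat \<longleftrightarrow> v : slat" if "x : slat" for v x
    using slat_closed(4)[of v x] slat_closed(4)[of "v + x" "- x"] slat_closed(1)[OF that] that by auto
  have step: "u (v + x) = g y \<cdot> u v"
    if "x : slat" "y : w_toral I" "div_s (v + x) = div_s v + frag_of k" "k : CH ` I Un CD ` I" "\<chi> k = g y" for v x y k
  proof (cases "v : slat")
    case True
    have k: "keys (div_s v) <= CH ` I Un CD ` I" by (rule div_s_lat[OF slat_lat[OF True]])
    have "u (v + x) = h (div_s v) \<cdot> g y"
      using that True slat_add[OF that(1)] h_add[OF k, of "frag_of k"] h(2)[OF that(4)] by (simp add: u_def)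
    then show ?thesis using TC_toral[OF h_closed[OF k] that(2)] True by (simp add: u_def)
  qed (use that slat_add in "simp add: u_def")
  have div0: "div_s 0 = 0" by (rule poly_mapping_eqI) (simp add: lookup_div_s split: coweight.splits)
  have "u : fm"
  proof (rule fmI)
    fix v
    have t: "h (div_s v) : TC" if "v : slat" by (rule h_closed[OF div_s_lat[OF slat_lat[OF that]]])
    show "u v : carrier WA" "M.P \<cdot> u v = u v" using t TC_carrier TC_P by (simp_all add: u_def)
    fix i assume i: "i : I"
    show "u (v + kH i) = M.Kb i \<cdot> u v"
      by (rule step[OF _ _ div_add(1)[OF i]]) (use i in "auto simp: \<chi>_def")
    show "u (v + dH i) = g (GDb i) \<cdot> u v"
      by (rule step[OF _ _ div_add(2)[OF i]]) (use i in "auto simp: \<chi>_def")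
  qed
  moreover have "u 0 = M.P" by (simp add: u_def div0 h0)
  ultimately show ?thesis by blast
qed

text \<open>Acting on a function with value P at the origin recovers x P = x from the image of
  x.\<close>

lemma Phi_inj: "inj_on Phi PC"
proof (rule inj_onI)
  fix x y assume xy: "x : PC" "y : PC" "Phi x = Phi y"
  obtain u where u: "u : fm" "u 0 = M.P" using fm_unit by blast
  have "x = qact (Phi x) u 0"
    unfolding qact_origin[OF PC_UC(1)[OF xy(1)] u(1)] u(2) by (rule PC_P(1)[OF xy(1), symmetric])
  also have "... = y"
    unfolding xy(3) qact_origin[OF PC_UC(1)[OF xy(2)] u(1)] u(2) by (rule PC_P(1)[OF xy(2)])
  finally show "x = y" .
qed

end

theorem mainTheorem4:
  fixes I :: "nat set" and a :: "nat \<Rightarrow> nat \<Rightarrow> int" and s :: "nat \<Rightarrow> nat"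
    and q :: "'k::field_char_0" and m :: nat and \<kappa> \<kappa>' :: "nat \<Rightarrow> nat"
  assumes "(\<exists>n\<ge>1. I = {1..n}) \<or> I = {1..}"
    and "borcherds_cartan I a"
    and "symmetrizes I a s"
    and "\<forall>i\<in>I. q ^ s i \<notin> {0, 1, -1}"
    and "m \<ge> 2"
    and "\<forall>i\<in>I. \<kappa> i \<in> {0, 1} \<and> \<kappa>' i \<in> {0, 1}"
  shows "let U = Utau I a s q m \<kappa> \<kappa>'; T = wT I a s q m \<kappa> \<kappa>' in
    is_weak_hopf_algebra U T \<and>
    ((\<forall>i\<in>I. \<kappa> i = 0 \<and> \<kappa>' i = 0) \<longrightarrow> bij_betw T (carrier U) (carrier U)) \<and>
    noncommutative U \<and>
    noncocommutative U \<and>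
    \<not> (\<exists>S. is_hopf_algebra U S) \<and>
    hopf_isomorphic (UtauP I a s q m \<kappa> \<kappa>') T (Uq' I a s q) (qS I a s q)"
proof -
  interpret cartan I a s q m \<kappa> \<kappa>'
    by (rule cartan.intro) (use assms in auto)
  show ?thesis
    unfolding Let_def Utau_eq UtauP_eq Uq'_eq T_def[symmetric] Sq_def[symmetric]
    using weak_hopf_U T_bij_U noncommutative_U noncocommutative_U not_hopf_U hopf_isomorphic_UP_V[OF Phi_inj]
    by simp
qed

end
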